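(* Let $P(D)=\sum_{|\alpha|\le m}c_\alpha D^\alpha$ be a partial differential operator on $\mathbb{R}^n$ of order $m$ with coefficients $c_\alpha\in\widetilde{\mathbb{C}}$ such that $\widetilde{P}(\xi_0)$ is invertible in $\widetilde{\mathbb{R}}$ for some $\xi_0\in\mathbb{R}^n$. Then $P(D)$ has a fundamental solution $E\in\mathcal{L}_{\rm b}(\mathcal{G}_c(\mathbb{R}^n),\widetilde{\mathbb{C}})$. More precisely, for every $c>0$ and every representative $(P_\varepsilon)_\varepsilon$ of $P$ there exists a fundamental solution $E$ of $P(D)$ given by a net of distributions $(E_\varepsilon)_\varepsilon$ such that $E_\varepsilon/\cosh(c|x|)\in B_{\infty,\widetilde{P_\varepsilon}}(\mathbb{R}^n)$ and, for all $\varepsilon$, $$\Big\Vert \frac{E_\varepsilon}{\cosh(c|x|)}\Big\Vert_{\infty,\widetilde{P_\varepsilon}}\le C_0,$$ where the constant $C_0$ depends only on $n$, $m$ and $c$.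
   Context: All nets are indexed by $\varepsilon\in(0,1]$; $O(\cdot)$ is as $\varepsilon\to0$. $\widetilde{\mathbb{C}}$ (resp. $\widetilde{\mathbb{R}}$) is the ring of complex (resp. real) nets $(r_\varepsilon)_\varepsilon$ that are moderate ($\exists N\in\mathbb{N}$: $|r_\varepsilon|=O(\varepsilon^{-N})$) modulo negligible nets ($\forall q\in\mathbb{N}$: $|r_\varepsilon|=O(\varepsilon^{q})$). $\mathcal{G}(\Omega)$ ($\Omega\subseteq\mathbb{R}^n$ open) is the Colombeau algebra: nets $(u_\varepsilon)_\varepsilon$ in $C^\infty(\Omega)$ such that $\forall K\Subset\Omega\,\forall\alpha\,\exists N$: $\sup_K|\partial^\alpha u_\varepsilon|=O(\varepsilon^{-N})$, modulo nets with $\forall K\,\forall\alpha\,\forall q$: $\sup_K|\partial^\alpha u_\varepsilon|=O(\varepsilon^q)$. $\mathcal{G}_c(\Omega)$ is the subalgebra of elements with compact support; their representatives are always chosen with supports in one compact set independent of $\varepsilon$. Topology: for $K\Subset\Omega$, $\mathcal{G}_K(\Omega)=\{u\in\mathcal{G}_c(\Omega):\mathrm{supp}\,u\subseteq K\}$ carries the ultra-pseudo-seminorms $e^{-\mathrm{v}_{K,j}(u)}$, $\mathrm{v}_{K,j}(u)=\sup\{b\in\mathbb{R}:\sup_{x\in K',|\alpha|\le j}|\partial^\alpha u_\varepsilon(x)|=O(\varepsilon^b)\}$, with $K'\Subset\Omega$ a compact neighbourhood of $K$ (choice irrelevant); $\mathcal{G}_c(\Omega)$ is the strict inductive limit of the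 $\mathcal{G}_{K}(\Omega)$; $\widetilde{\mathbb{C}}$ carries $|r|_{\rm e}=e^{-\mathrm{v}(r)}$, $\mathrm{v}(r)=\sup\{b:|r_\varepsilon|=O(\varepsilon^b)\}$. $\mathcal{L}(\mathcal{G}_c(\Omega),\widetilde{\mathbb{C}})$ is the set of continuous $\widetilde{\mathbb{C}}$-linear functionals. Such a $T$ is basic, $T\in\mathcal{L}_{\rm b}(\mathcal{G}_c(\Omega),\widetilde{\mathbb{C}})$, if there is a net $(T_\varepsilon)_\varepsilon$ in $\mathcal{D}'(\Omega)$ such that $\forall K\Subset\Omega\ \exists j,N\in\mathbb{N},c>0,\eta\in(0,1]$ with $|T_\varepsilon(f)|\le c\,\varepsilon^{-N}\sup_{x\in K,|\alpha|\le j}|\partial^\alpha f(x)|$ for all $f\in C^\infty_K(\Omega)$, $\varepsilon\in(0,\eta]$, and $T(u)=[(T_\varepsilon(u_\varepsilon))_\varepsilon]$ for all $u\in\mathcal{G}_c(\Omega)$; one says $T$ is given (defined) by $(T_\varepsilon)_\varepsilon$. $\iota_d:\mathcal{D}'(\Omega)\to\mathcal{L}(\mathcal{G}_c(\Omega),\widetilde{\mathbb{C}})$, $\iota_d(w)(u)=[(w(u_\varepsilon))_\varepsilon]$. $D^\alpha=(-i)^{|\alpha|}\partial^\alpha$; $P(D)T(u)=T({}^tP(D)u)$ with ${}^tP(D)=\sum(-1)^{|\alpha|}c_\alpha D^\alpha$. A fundamental solution of $P(D)$ is $E\in\mathcal{L}(\mathcal{G}_c(\mathbb{R}^n),\widetilde{\mathbb{C}})$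 with $P(D)E=\iota_d(\delta)$. A representative of $P$ is a net of polynomials $P_\varepsilon(\xi)=\sum_{|\alpha|\le m}c_{\alpha,\varepsilon}\xi^\alpha$ with $(c_{\alpha,\varepsilon})_\varepsilon$ representatives of $c_\alpha$. $\widetilde{P_\varepsilon}(\xi)=\big(\sum_{|\alpha|\le m}|\partial^\alpha P_\varepsilon(\xi)|^2\big)^{1/2}$ and $\widetilde{P}(\xi)=[(\widetilde{P_\varepsilon}(\xi))_\varepsilon]\in\widetilde{\mathbb{R}}$. For a tempered weight function $k$ (positive on $\mathbb{R}^n$ with $k(\xi+\eta)\le(1+C|\xi|)^Nk(\eta)$ for some $C>0$, $N\in\mathbb{N}$ and all $\xi,\eta$) and $p\in[1,\infty]$, $B_{p,k}(\mathbb{R}^n)$ is the set of $w\in\mathscr{S}'(\mathbb{R}^n)$ such that $\widehat{w}$ is a function and $\Vert w\Vert_{p,k}=(2\pi)^{-n}\Vert k\widehat{w}\Vert_{L^p}<\infty$. *)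

theory Defs
  imports
    "HOL-Analysis.Analysis"
    "HOL-Library.Landau_Symbols"
    "HOL-Probability.Essential_Supremum"
begin

section \<open>Generalized numbers\<close>

text \<open>A net indexed by \<open>\<epsilon> \<in> (0,1]\<close> is a function on \<^typ>\<open>real\<close>; its values outside
  \<open>(0,1]\<close> never matter.\<close>

abbreviation O_eps :: "real \<Rightarrow> (real \<Rightarrow> real) \<Rightarrow> bool" where
  "O_eps b f \<equiv> f \<in> O[at_right 0](\<lambda>\<epsilon>. \<epsilon> powr b)"

definition moderate :: "(real \<Rightarrow> 'k::real_normed_field) \<Rightarrow> bool" where
  "moderate r \<longleftrightarrow> (\<exists>N::nat. O_eps (- real N) (\<lambda>\<epsilon>. norm (r \<epsilon>)))"

definition negl :: "(real \<Rightarrow> 'k::real_normed_field) \<Rightarrow> bool" where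
  "negl r \<longleftrightarrow> (\<forall>q::nat. O_eps (real q) (\<lambda>\<epsilon>. norm (r \<epsilon>)))"

lemma O_eps_mono:
  assumes "O_eps b f" "a \<le> b"
  shows "O_eps a f"
proof -
  have "eventually (\<lambda>\<epsilon>::real. \<epsilon> \<in> {0<..<1}) (at_right 0)"
    by (rule eventually_at_right_real) simp
  then have "eventually (\<lambda>\<epsilon>::real. norm (\<epsilon> powr b) \<le> 1 * norm (\<epsilon> powr a)) (at_right 0)"
    by eventually_elim (use \<open>a \<le> b\<close> in \<open>auto intro!: powr_mono'\<close>)
  then have "(\<lambda>\<epsilon>::real. \<epsilon> powr b) \<in> O[at_right 0](\<lambda>\<epsilon>. \<epsilon> powr a)"
    by (rule bigoI)
  with assms(1) show ?thesis by (rule landau_o.big.trans)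
qed

lemma O_eps_le:
  assumes "O_eps b g" "eventually (\<lambda>\<epsilon>. \<bar>f \<epsilon>\<bar> \<le> g \<epsilon>) (at_right 0)"
  shows "O_eps b f"
proof -
  have "f \<in> O[at_right 0](g)"
    by (rule bigoI[where c = 1]) (use assms(2) in \<open>auto elim!: eventually_mono\<close>)
  then show ?thesis using assms(1) by (rule landau_o.big.trans)
qed

lemma O_eps_add: "O_eps b f \<Longrightarrow> O_eps b g \<Longrightarrow> O_eps b (\<lambda>\<epsilon>. f \<epsilon> + g \<epsilon>)"
  by (rule sum_in_bigo)

lemma O_eps_mult:
  assumes "O_eps a f" "O_eps b g"
  shows "O_eps (a + b) (\<lambda>\<epsilon>. f \<epsilon> * g \<epsilon>)"
  using landau_o.big.mult[OF assms] by (simp add: powr_add)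

lemma O_eps_0 [simp]: "O_eps b (\<lambda>_. 0)"
  by simp

lemma O_eps_const: "O_eps 0 (\<lambda>_. c)"
proof (rule bigoI)
  show "\<forall>\<^sub>F \<epsilon> in at_right 0. norm c \<le> norm c * norm (\<epsilon> powr 0 :: real)"
    by (rule eventually_at_rightI[of 0 1]) auto
qed

lemma O_eps_sum: "(\<And>i. i \<in> I \<Longrightarrow> O_eps b (f i)) \<Longrightarrow> O_eps b (\<lambda>\<epsilon>. \<Sum>i\<in>I. f i \<epsilon>)"
  by (rule big_sum_in_bigo)

lemma eventually_unit: "eventually (\<lambda>\<epsilon>::real. \<epsilon> \<in> {0<..1}) (at_right 0)"
  by (rule eventually_at_rightI[of 0 1]) auto

lemma negl_imp_moderate: "negl r \<Longrightarrow> moderate r"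
  unfolding negl_def moderate_def by (metis of_nat_0 neg_0_equal_iff_equal)

lemma negl_zero [simp]: "negl (\<lambda>_. 0)"
  by (simp add: negl_def)

lemma moderate_const [simp]: "moderate (\<lambda>_. c)"
  unfolding moderate_def by (rule exI[of _ 0]) (simp only: of_nat_0 minus_zero O_eps_const)

lemma negl_add:
  assumes "negl r" "negl s" shows "negl (\<lambda>\<epsilon>. r \<epsilon> + s \<epsilon>)"
  unfolding negl_def
proof
  fix q :: nat
  have "O_eps q (\<lambda>\<epsilon>. norm (r \<epsilon>) + norm (s \<epsilon>))"
    using assms by (intro O_eps_add) (auto simp: negl_def)
  then show "O_eps q (\<lambda>\<epsilon>. norm (r \<epsilon> + s \<epsilon>))"
    by (rule O_eps_le) (simp add: norm_triangle_ineq always_eventually)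
qed

lemma negl_minus [simp]: "negl (\<lambda>\<epsilon>. - r \<epsilon>) \<longleftrightarrow> negl r"
  by (simp add: negl_def)

lemma moderate_minus [simp]: "moderate (\<lambda>\<epsilon>. - r \<epsilon>) \<longleftrightarrow> moderate r"
  by (simp add: moderate_def)

lemma moderate_add:
  assumes "moderate r" "moderate s" shows "moderate (\<lambda>\<epsilon>. r \<epsilon> + s \<epsilon>)"
proof -
  obtain M N where MN: "O_eps (- real M) (\<lambda>\<epsilon>. norm (r \<epsilon>))" "O_eps (- real N) (\<lambda>\<epsilon>. norm (s \<epsilon>))"
    using assms by (auto simp: moderate_def)
  have "O_eps (- real (M + N)) (\<lambda>\<epsilon>. norm (r \<epsilon>) + norm (s \<epsilon>))"
    by (intro O_eps_add O_eps_mono[OF MN(1)] O_eps_mono[OF MN(2)]) auto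
  then have "O_eps (- real (M + N)) (\<lambda>\<epsilon>. norm (r \<epsilon> + s \<epsilon>))"
    by (rule O_eps_le) (simp add: norm_triangle_ineq always_eventually)
  then show ?thesis unfolding moderate_def by blast
qed

lemma moderate_mult:
  assumes "moderate r" "moderate s" shows "moderate (\<lambda>\<epsilon>. r \<epsilon> * s \<epsilon>)"
proof -
  obtain M N where MN: "O_eps (- real M) (\<lambda>\<epsilon>. norm (r \<epsilon>))" "O_eps (- real N) (\<lambda>\<epsilon>. norm (s \<epsilon>))"
    using assms by (auto simp: moderate_def)
  have "O_eps (- real (M + N)) (\<lambda>\<epsilon>. norm (r \<epsilon> * s \<epsilon>))"
    using O_eps_mult[OF MN] by (simp add: norm_mult algebra_simps)
  then show ?thesis unfolding moderate_def by blast
qed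

lemma negl_mult:
  assumes "negl r" "moderate s" shows "negl (\<lambda>\<epsilon>. r \<epsilon> * s \<epsilon>)"
  unfolding negl_def
proof
  fix q :: nat
  obtain N where N: "O_eps (- real N) (\<lambda>\<epsilon>. norm (s \<epsilon>))"
    using assms by (auto simp: moderate_def)
  have "O_eps (real (q + N)) (\<lambda>\<epsilon>. norm (r \<epsilon>))"
    using assms(1) unfolding negl_def by blast
  from O_eps_mult[OF this N] show "O_eps q (\<lambda>\<epsilon>. norm (r \<epsilon> * s \<epsilon>))"
    by (simp add: norm_mult algebra_simps)
qed

lemma not_negl_1: "\<not> negl (\<lambda>_. 1 :: 'k::real_normed_field)"
proof
  assume "negl (\<lambda>_. 1 :: 'k)"
  then have "O_eps (real 1) (\<lambda>_. norm (1::'k))" unfolding negl_def by blast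
  then have "O_eps 1 (\<lambda>_. 1)" by simp
  then obtain c where c: "c > 0" "eventually (\<lambda>\<epsilon>::real. norm (1::real) \<le> c * norm (\<epsilon> powr 1)) (at_right 0)"
    by (elim landau_o.bigE)
  have "eventually (\<lambda>\<epsilon>::real. \<epsilon> \<in> {0<..<1/c}) (at_right 0)"
    by (rule eventually_at_right_real) (use c in simp)
  with c(2) have "eventually (\<lambda>\<epsilon>::real. False) (at_right 0)"
    by eventually_elim (use c in \<open>auto simp: field_simps\<close>)
  then show False by simp
qed

definition gen_eq :: "(real \<Rightarrow> 'k::real_normed_field) \<Rightarrow> (real \<Rightarrow> 'k) \<Rightarrow> bool" where
  "gen_eq r s \<longleftrightarrow> moderate r \<and> moderate s \<and> negl (\<lambda>\<epsilon>. r \<epsilon> - s \<epsilon>)"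

text \<open>\<open>complex gen\<close> and \<open>real gen\<close> are the rings of generalized complex and real numbers.\<close>

quotient_type (overloaded) 'k gen = "real \<Rightarrow> 'k::real_normed_field" / partial: gen_eq
proof (rule part_equivpI)
  show "\<exists>x::real \<Rightarrow> 'k. gen_eq x x"
    by (rule exI[of _ "\<lambda>_. 0"]) (simp add: gen_eq_def)
  show "symp (gen_eq :: (real \<Rightarrow> 'k) \<Rightarrow> _)"
    by (rule sympI) (auto simp: gen_eq_def dest: negl_minus[THEN iffD2])
  show "transp (gen_eq :: (real \<Rightarrow> 'k) \<Rightarrow> _)"
    by (rule transpI) (auto simp: gen_eq_def dest: negl_add)
qed

instantiation gen :: (real_normed_field) comm_ring_1
begin

lift_definition zero_gen :: "'a gen" is "\<lambda>_. 0" by (simp add: gen_eq_def)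
lift_definition one_gen :: "'a gen" is "\<lambda>_. 1" by (simp add: gen_eq_def)
lift_definition plus_gen :: "'a gen \<Rightarrow> 'a gen \<Rightarrow> 'a gen" is "\<lambda>r s \<epsilon>. r \<epsilon> + s \<epsilon>"
  unfolding gen_eq_def
  by (auto intro: moderate_add) (drule (1) negl_add, simp add: algebra_simps)
lift_definition uminus_gen :: "'a gen \<Rightarrow> 'a gen" is "\<lambda>r \<epsilon>. - r \<epsilon>"
  unfolding gen_eq_def by (auto dest: negl_minus[THEN iffD2])
lift_definition minus_gen :: "'a gen \<Rightarrow> 'a gen \<Rightarrow> 'a gen" is "\<lambda>r s \<epsilon>. r \<epsilon> - s \<epsilon>"
proof -
  fix r r' s s' :: "real \<Rightarrow> 'a"
  assume "gen_eq r r'" "gen_eq s s'"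
  then show "gen_eq (\<lambda>\<epsilon>. r \<epsilon> - s \<epsilon>) (\<lambda>\<epsilon>. r' \<epsilon> - s' \<epsilon>)"
    using moderate_add[of r "\<lambda>\<epsilon>. - s \<epsilon>"] moderate_add[of r' "\<lambda>\<epsilon>. - s' \<epsilon>"]
      negl_add[of "\<lambda>\<epsilon>. r \<epsilon> - r' \<epsilon>" "\<lambda>\<epsilon>. - (s \<epsilon> - s' \<epsilon>)"] negl_minus[of "\<lambda>\<epsilon>. s \<epsilon> - s' \<epsilon>"]
    by (simp add: gen_eq_def algebra_simps)
qed
lift_definition times_gen :: "'a gen \<Rightarrow> 'a gen \<Rightarrow> 'a gen" is "\<lambda>r s \<epsilon>. r \<epsilon> * s \<epsilon>"
proof -
  fix r r' s s' :: "real \<Rightarrow> 'a"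
  assume *: "gen_eq r r'" "gen_eq s s'"
  have "negl (\<lambda>\<epsilon>. (r \<epsilon> - r' \<epsilon>) * s \<epsilon> + (s \<epsilon> - s' \<epsilon>) * r' \<epsilon>)"
    using * by (intro negl_add negl_mult) (auto simp: gen_eq_def)
  also have "(\<lambda>\<epsilon>. (r \<epsilon> - r' \<epsilon>) * s \<epsilon> + (s \<epsilon> - s' \<epsilon>) * r' \<epsilon>) = (\<lambda>\<epsilon>. r \<epsilon> * s \<epsilon> - r' \<epsilon> * s' \<epsilon>)"
    by (auto simp: algebra_simps)
  finally show "gen_eq (\<lambda>\<epsilon>. r \<epsilon> * s \<epsilon>) (\<lambda>\<epsilon>. r' \<epsilon> * s' \<epsilon>)"
    using * by (auto simp: gen_eq_def intro: moderate_mult)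
qed

instance
proof
  fix a b c :: "'a gen"
  show "a * b * c = a * (b * c)"
    by transfer (simp add: gen_eq_def moderate_mult mult.assoc)
  show "a * b = b * a"
    by transfer (simp add: gen_eq_def moderate_mult mult.commute)
  show "1 * a = a" by transfer (simp add: gen_eq_def)
  show "a + b + c = a + (b + c)"
    by transfer (simp add: gen_eq_def moderate_add add.assoc)
  show "a + b = b + a"
    by transfer (simp add: gen_eq_def moderate_add add.commute)
  show "0 + a = a" by transfer (simp add: gen_eq_def)
  show "- a + a = 0" by transfer (simp add: gen_eq_def)
  show "a - b = a + - b"
    by transfer (use moderate_add moderate_minus in \<open>fastforce simp: gen_eq_def\<close>)
  show "(a + b) * c = a * c + b * c"
    by transfer (simp add: gen_eq_def moderate_add moderate_mult distrib_right)
  show "(0::'a gen) \<noteq> 1"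
    by transfer (simp add: gen_eq_def not_negl_1 negl_minus[of "\<lambda>_. 1", simplified])
qed

end

lift_definition gen_const :: "'k::real_normed_field \<Rightarrow> 'k gen" is "\<lambda>c _. c"
  by (simp add: gen_eq_def)

definition is_rep :: "(real \<Rightarrow> 'k::real_normed_field) \<Rightarrow> 'k gen \<Rightarrow> bool" where
  "is_rep r a \<longleftrightarrow> moderate r \<and> abs_gen r = a"

text \<open>The order of growth of a net is an extended real: it is \<open>\<infinity>\<close> exactly for negligible
  nets, for which \<open>e\<^sup>-\<^sup>v = 0\<close>.\<close>

definition valuation :: "(real \<Rightarrow> real) \<Rightarrow> ereal" where
  "valuation f = Sup (ereal ` {b. O_eps b f})"

definition exp_neg :: "ereal \<Rightarrow> real" where
  "exp_neg v = (if v = \<infinity> then 0 else exp (- real_of_ereal v))"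

lemma valuation_cong_negl:
  assumes "\<And>q::nat. O_eps (real q) (\<lambda>\<epsilon>. h \<epsilon>)"
    and "eventually (\<lambda>\<epsilon>. \<bar>f \<epsilon>\<bar> \<le> g \<epsilon> + h \<epsilon>) (at_right 0)"
    and "eventually (\<lambda>\<epsilon>. \<bar>g \<epsilon>\<bar> \<le> f \<epsilon> + h \<epsilon>) (at_right 0)"
  shows "valuation f = valuation g"
proof -
  have h: "O_eps b h" for b
    using assms(1)[of "nat \<lceil>b\<rceil>"] by (rule O_eps_mono) linarith
  have "O_eps b f \<longleftrightarrow> O_eps b g" for b
    using O_eps_le[OF O_eps_add[OF _ h] assms(2)] O_eps_le[OF O_eps_add[OF _ h] assms(3)]
    by blast
  then show ?thesis by (simp add: valuation_def)
qed

lift_definition gen_val :: "'k::real_normed_field gen \<Rightarrow> ereal" is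
  "\<lambda>r. valuation (\<lambda>\<epsilon>. norm (r \<epsilon>))"
proof -
  fix r s :: "real \<Rightarrow> 'k"
  assume "gen_eq r s"
  then have n: "O_eps (real q) (\<lambda>\<epsilon>. norm (r \<epsilon> - s \<epsilon>))" for q
    by (simp add: gen_eq_def negl_def)
  show "valuation (\<lambda>\<epsilon>. norm (r \<epsilon>)) = valuation (\<lambda>\<epsilon>. norm (s \<epsilon>))"
  proof (rule valuation_cong_negl[OF n])
    show "\<forall>\<^sub>F \<epsilon> in at_right 0. \<bar>norm (r \<epsilon>)\<bar> \<le> norm (s \<epsilon>) + norm (r \<epsilon> - s \<epsilon>)"
      by (intro always_eventually allI) (simp add: norm_triangle_sub)
    show "\<forall>\<^sub>F \<epsilon> in at_right 0. \<bar>norm (s \<epsilon>)\<bar> \<le> norm (r \<epsilon>) + norm (r \<epsilon> - s \<epsilon>)"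
      by (intro always_eventually allI) (metis abs_norm_cancel norm_triangle_sub norm_minus_commute)
  qed
qed

definition gen_norm :: "'k::real_normed_field gen \<Rightarrow> real" where
  "gen_norm r = exp_neg (gen_val r)"

definition gen_topology :: "'k::real_normed_field gen topology" where
  "gen_topology = Metric_space.mtopology UNIV (\<lambda>r s. gen_norm (r - s))"


lemma O_eps_less_valuation:
  assumes "ereal b < valuation f" shows "O_eps b f"
  using assms unfolding valuation_def less_Sup_iff by (auto intro: O_eps_mono)

lemma valuation_ge: "O_eps b f \<Longrightarrow> ereal b \<le> valuation f"
  unfolding valuation_def by (auto intro: Sup_upper)

lemma gen_val_minus: "gen_val (- r) = gen_val r"
  by transfer simp

lemma gen_val_neq_MInf: "gen_val r \<noteq> - \<infinity>"
  by transfer (auto simp: gen_eq_def moderate_def dest!: valuation_ge)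

lemma gen_val_add: "min (gen_val r) (gen_val s) \<le> gen_val (r + s)"
proof (transfer, rule dense_le)
  fix r s :: "real \<Rightarrow> 'a" and y
  assume y: "y < min (valuation (\<lambda>\<epsilon>. norm (r \<epsilon>))) (valuation (\<lambda>\<epsilon>. norm (s \<epsilon>)))"
  show "y \<le> valuation (\<lambda>\<epsilon>. norm (r \<epsilon> + s \<epsilon>))"
  proof (cases y)
    case (real b)
    then have "O_eps b (\<lambda>\<epsilon>. norm (r \<epsilon>) + norm (s \<epsilon>))"
      using y by (intro O_eps_add O_eps_less_valuation) auto
    then have "O_eps b (\<lambda>\<epsilon>. norm (r \<epsilon> + s \<epsilon>))"
      by (rule O_eps_le) (simp add: norm_triangle_ineq always_eventually)
    then show ?thesis using real by (simp add: valuation_ge)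
  qed (use y in auto)
qed

lemma gen_val_eq_PInf: "gen_val r = \<infinity> \<longleftrightarrow> r = 0"
proof (transfer, goal_cases)
  case (1 r)
  have "valuation (\<lambda>\<epsilon>. norm (r \<epsilon>)) = \<infinity> \<Longrightarrow> negl r"
    unfolding negl_def by (auto intro: O_eps_less_valuation)
  moreover have "valuation (\<lambda>\<epsilon>. norm (r \<epsilon>)) = \<infinity>" if "negl r"
  proof (rule ereal_top)
    fix B :: real
    have "ereal B \<le> ereal (real (nat \<lceil>B\<rceil>))" by simp linarith
    also have "\<dots> \<le> valuation (\<lambda>\<epsilon>. norm (r \<epsilon>))"
      using that unfolding negl_def by (blast intro: valuation_ge)
    finally show "ereal B \<le> valuation (\<lambda>\<epsilon>. norm (r \<epsilon>))" .
  qed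
  ultimately show ?case using 1 by (auto simp: gen_eq_def)
qed


lemma exp_neg_antimono:
  assumes "v \<le> w" "v \<noteq> - \<infinity>" shows "exp_neg w \<le> exp_neg v"
  using assms by (cases v; cases w) (auto simp: exp_neg_def)

lemma gen_norm_add: "gen_norm (r + s) \<le> max (gen_norm r) (gen_norm s)"
  using exp_neg_antimono[OF gen_val_add[of r s]] gen_val_neq_MInf[of r] gen_val_neq_MInf[of s]
  unfolding gen_norm_def by (cases "gen_val r \<le> gen_val s") (auto simp: min_def max_def)

text \<open>The topology just defined really is the one of the ultrametric \<open>|r - s|\<^sub>e\<close>.\<close>

lemma Metric_space_gen: "Metric_space UNIV (\<lambda>r s :: 'k::real_normed_field gen. gen_norm (r - s))"
proof
  fix x y z :: "'k gen"
  show "0 \<le> gen_norm (x - y)" for x y :: "'k gen" by (simp add: gen_norm_def exp_neg_def)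
  show "gen_norm (x - y) = gen_norm (y - x)" for x y :: "'k gen"
    using gen_val_minus[of "x - y"] by (simp add: gen_norm_def)
  show "gen_norm (x - y) = 0 \<longleftrightarrow> x = y" for x y :: "'k gen"
    by (simp add: gen_norm_def exp_neg_def gen_val_eq_PInf)
  have "gen_norm (x - z) \<le> max (gen_norm (x - y)) (gen_norm (y - z))"
    using gen_norm_add[of "x - y" "y - z"] by simp
  also have "\<dots> \<le> gen_norm (x - y) + gen_norm (y - z)"
    by (simp add: gen_norm_def exp_neg_def)
  finally show "gen_norm (x - z) \<le> gen_norm (x - y) + gen_norm (y - z)" .
qed


section \<open>Smooth functions and partial derivatives\<close>

type_synonym 'n cfun = "real^'n \<Rightarrow> complex"

definition dpart :: "'n::finite \<Rightarrow> 'n cfun \<Rightarrow> 'n cfun" where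
  "dpart i f = (\<lambda>x. vector_derivative (\<lambda>t. f (x + t *\<^sub>R axis i 1)) (at 0))"

definition smooth :: "'n::finite cfun \<Rightarrow> bool" where
  "smooth f \<longleftrightarrow> (\<forall>is. continuous_on UNIV (foldr dpart is f) \<and>
     (\<forall>i x. (\<lambda>t::real. foldr dpart is f (x + t *\<^sub>R axis i 1)) differentiable (at 0)))"

definition mi_deg :: "('n::finite \<Rightarrow> nat) \<Rightarrow> nat" where
  "mi_deg \<alpha> = (\<Sum>i\<in>UNIV. \<alpha> i)"

text \<open>\<open>\<partial>\<^sup>\<alpha>\<close>: differentiate \<open>\<alpha> i\<close> times in direction \<open>i\<close>, in some order. On smooth functions the
  order is irrelevant, see \<open>pd_foldr\<close> below.\<close>

definition pd :: "('n::finite \<Rightarrow> nat) \<Rightarrow> 'n cfun \<Rightarrow> 'n cfun" where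
  "pd \<alpha> f = foldr dpart (SOME is. count_list is = \<alpha>) f"

lemma smooth_imp:
  assumes "smooth f"
  shows "continuous_on UNIV f" "(\<lambda>t::real. f (x + t *\<^sub>R axis i 1)) differentiable (at 0)"
  using assms[unfolded smooth_def, rule_format, of "[]"] by auto

lemma smooth_foldr: "smooth f \<Longrightarrow> smooth (foldr dpart is f)"
  unfolding smooth_def foldr_append[symmetric, THEN fun_cong, unfolded comp_def]
  by (metis foldr_append comp_apply)

lemma smooth_dpart: "smooth f \<Longrightarrow> smooth (dpart i f)"
  using smooth_foldr[of f "[i]"] by simp

lemma smooth_pd: "smooth f \<Longrightarrow> smooth (pd \<alpha> f)"
  unfolding pd_def by (rule smooth_foldr)

lemma dpart_has_vector_derivative:
  assumes "smooth f"
  shows "((\<lambda>t. f (x + t *\<^sub>R axis i 1)) has_vector_derivative dpart i f (x + s *\<^sub>R axis i 1)) (at s)"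
proof -
  have "((\<lambda>t. f (x + s *\<^sub>R axis i 1 + t *\<^sub>R axis i 1)) has_vector_derivative
      dpart i f (x + s *\<^sub>R axis i 1)) (at (s - s))"
    using smooth_imp(2)[OF assms, of "x + s *\<^sub>R axis i 1" i]
    unfolding dpart_def by (simp add: vector_derivative_works)
  then have "((\<lambda>t. f (x + s *\<^sub>R axis i 1 + t *\<^sub>R axis i 1)) \<circ> (\<lambda>t. t - s) has_vector_derivative
      1 *\<^sub>R dpart i f (x + s *\<^sub>R axis i 1)) (at s)"
    by (intro vector_diff_chain_at) (auto intro!: derivative_eq_intros)
  then show ?thesis
    by (simp add: comp_def algebra_simps flip: scaleR_add_left)
qed

lemma dpart_add:
  assumes "smooth f" "smooth g"
  shows "dpart i (\<lambda>x. f x + g x) = (\<lambda>x. dpart i f x + dpart i g x)"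
proof
  fix x
  show "dpart i (\<lambda>x. f x + g x) x = dpart i f x + dpart i g x"
    using smooth_imp(2)[OF assms(1), of x i] smooth_imp(2)[OF assms(2), of x i]
    unfolding dpart_def by (intro vector_derivative_at derivative_intros) (simp_all add: vector_derivative_works)
qed

lemma dpart_cmult:
  assumes "smooth f"
  shows "dpart i (\<lambda>x. c * f x) = (\<lambda>x. c * dpart i f x)"
proof
  fix x
  show "dpart i (\<lambda>x. c * f x) x = c * dpart i f x"
    using smooth_imp(2)[OF assms(1), of x i]
    unfolding dpart_def
    by (intro vector_derivative_at has_vector_derivative_mult_right) (simp_all add: vector_derivative_works)
qed

lemma foldr_dpart_add:
  assumes "smooth f" "smooth g"
  shows "foldr dpart is (\<lambda>x. f x + g x) = (\<lambda>x. foldr dpart is f x + foldr dpart is g x)"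
  by (induction "is") (simp_all add: dpart_add smooth_foldr assms)

lemma foldr_dpart_cmult:
  assumes "smooth f"
  shows "foldr dpart is (\<lambda>x. c * f x) = (\<lambda>x. c * foldr dpart is f x)"
  by (induction "is") (simp_all add: dpart_cmult smooth_foldr assms)

lemma smooth_add:
  assumes "smooth f" "smooth g" shows "smooth (\<lambda>x. f x + g x)"
  using assms unfolding smooth_def foldr_dpart_add[OF assms]
  by (auto intro!: continuous_intros derivative_intros)

lemma smooth_cmult:
  assumes "smooth f" shows "smooth (\<lambda>x. c * f x)"
  using assms unfolding smooth_def foldr_dpart_cmult[OF assms]
  by (auto intro!: continuous_intros derivative_intros)

lemma smooth_0 [simp]: "smooth (\<lambda>_. 0)"
proof -
  have "foldr dpart is (\<lambda>_. 0) = (\<lambda>_. 0 :: complex)" for "is" :: "'a list"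
    by (induction "is") (auto simp: dpart_def)
  then show ?thesis by (simp add: smooth_def)
qed

lemma pd_add: "smooth f \<Longrightarrow> smooth g \<Longrightarrow> pd \<alpha> (\<lambda>x. f x + g x) = (\<lambda>x. pd \<alpha> f x + pd \<alpha> g x)"
  unfolding pd_def by (rule foldr_dpart_add)

lemma pd_cmult: "smooth f \<Longrightarrow> pd \<alpha> (\<lambda>x. c * f x) = (\<lambda>x. c * pd \<alpha> f x)"
  unfolding pd_def by (rule foldr_dpart_cmult)

lemma smooth_minus: "smooth f \<Longrightarrow> smooth (\<lambda>x. - f x)"
  using smooth_cmult[of f "-1"] by simp

lemma pd_minus: "smooth f \<Longrightarrow> pd \<alpha> (\<lambda>x. - f x) = (\<lambda>x. - pd \<alpha> f x)"
  using pd_cmult[of f \<alpha> "-1"] by simp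

lemma smooth_diff: "smooth f \<Longrightarrow> smooth g \<Longrightarrow> smooth (\<lambda>x. f x - g x)"
  using smooth_add[of f "\<lambda>x. - g x"] smooth_minus[of g] by simp

lemma pd_diff: "smooth f \<Longrightarrow> smooth g \<Longrightarrow> pd \<alpha> (\<lambda>x. f x - g x) = (\<lambda>x. pd \<alpha> f x - pd \<alpha> g x)"
  using pd_add[of f "\<lambda>x. - g x" \<alpha>] smooth_minus[of g] by (simp add: pd_minus)

lemma pd_0 [simp]: "pd \<alpha> (\<lambda>_. 0) = (\<lambda>_. 0)"
  using pd_cmult[of "\<lambda>_. 0" \<alpha> 0] by simp

lemma ex_count_list: "\<exists>is. count_list is = (\<alpha> :: 'n::finite \<Rightarrow> nat)"
proof -
  have "\<exists>is. \<forall>x. count_list is x = (if x \<in> A then \<alpha> x else 0)" if "finite A" for A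
    using that
  proof (induction A rule: finite_induct)
    case empty
    show ?case by (rule exI[of _ "[]"]) simp
  next
    case (insert a A)
    then obtain "is" where "is": "\<forall>x. count_list is x = (if x \<in> A then \<alpha> x else 0)" by blast
    have "count_list (replicate k a) x = (if x = a then k else 0)" for k x
      by (induction k) auto
    then show ?case using insert(2) "is"
      by (intro exI[of _ "replicate (\<alpha> a) a @ is"]) auto
  qed
  from this[of UNIV] show ?thesis by auto
qed

lemma dpart_swap_aux:
  fixes g :: "real \<Rightarrow> real \<Rightarrow> real"
  assumes 1: "\<And>s t. ((\<lambda>s. g s t) has_real_derivative g1 s t) (at s)"
    and 12: "\<And>s t. ((\<lambda>t. g1 s t) has_real_derivative g12 s t) (at t)"
    and h: "0 < h"
  shows "\<exists>s\<in>{0..h}. \<exists>t\<in>{0..h}. g h h - g h 0 - g 0 h + g 0 0 = h * h * g12 s t"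
proof -
  have "\<exists>z. 0 < z \<and> z < h \<and> (g h h - g h 0) - (g 0 h - g 0 0) = (h - 0) * (g1 z h - g1 z 0)"
    by (rule MVT2[of 0 h "\<lambda>s. g s h - g s 0" "\<lambda>s. g1 s h - g1 s 0"])
       (use h 1 in \<open>auto intro!: derivative_intros\<close>)
  then obtain z where z: "0 < z" "z < h" "(g h h - g h 0) - (g 0 h - g 0 0) = h * (g1 z h - g1 z 0)"
    by auto
  have "\<exists>y. 0 < y \<and> y < h \<and> g1 z h - g1 z 0 = (h - 0) * g12 z y"
    by (rule MVT2) (use h 12 in auto)
  then obtain y where "0 < y" "y < h" "g1 z h - g1 z 0 = h * g12 z y" by auto
  with z show ?thesis
    by (intro bexI[of _ z] bexI[of _ y]) (auto simp: algebra_simps)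
qed

lemma dpart_swap_part:
  fixes f :: "'n::finite cfun" and R :: "complex \<Rightarrow> real"
  assumes f: "smooth f" and R: "bounded_linear R"
  shows "R (dpart i (dpart j f) x) = R (dpart j (dpart i f) x)"
proof -
  define p where "p s t = x + s *\<^sub>R axis i 1 + t *\<^sub>R axis j 1" for s t
  have D1: "((\<lambda>s. R (k (p s t))) has_real_derivative R (dpart i k (p s t))) (at s)"
    if "smooth k" for k s t
  proof -
    have "((\<lambda>s. k ((x + t *\<^sub>R axis j 1) + s *\<^sub>R axis i 1)) has_vector_derivative
        dpart i k ((x + t *\<^sub>R axis j 1) + s *\<^sub>R axis i 1)) (at s)"
      by (rule dpart_has_vector_derivative[OF that])
    from bounded_linear.has_vector_derivative[OF R this] show ?thesis
      by (simp add: has_real_derivative_iff_has_vector_derivative p_def algebra_simps)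
  qed
  have D2: "((\<lambda>t. R (k (p s t))) has_real_derivative R (dpart j k (p s t))) (at t)"
    if "smooth k" for k s t
  proof -
    have "((\<lambda>t. k ((x + s *\<^sub>R axis i 1) + t *\<^sub>R axis j 1)) has_vector_derivative
        dpart j k ((x + s *\<^sub>R axis i 1) + t *\<^sub>R axis j 1)) (at t)"
      by (rule dpart_has_vector_derivative[OF that])
    from bounded_linear.has_vector_derivative[OF R this] show ?thesis
      by (simp add: has_real_derivative_iff_has_vector_derivative p_def algebra_simps)
  qed
  define F where "F z = R (dpart j (dpart i f) z)" for z
  define G where "G z = R (dpart i (dpart j f) z)" for z
  have cont: "isCont F x" "isCont G x"
  proof -
    have c: "isCont (dpart k (dpart l f)) x" for k l
      using smooth_imp(1)[OF smooth_dpart[OF smooth_dpart[OF f]]]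
      by (simp add: continuous_on_eq_continuous_at)
    show "isCont F x"
      unfolding F_def by (rule bounded_linear.isCont[OF R c[of j i]])
    show "isCont G x"
      unfolding G_def by (rule bounded_linear.isCont[OF R c[of i j]])
  qed
  have eq: "\<exists>a b. dist a x \<le> 2 * h \<and> dist b x \<le> 2 * h \<and> F a = G b" if h: "h > 0" for h
  proof -
    have ex1: "\<exists>s\<in>{0..h}. \<exists>t\<in>{0..h}.
        R (f (p h h)) - R (f (p h 0)) - R (f (p 0 h)) + R (f (p 0 0)) = h * h * F (p s t)"
      unfolding F_def by (rule dpart_swap_aux[OF D1[OF f] D2[OF smooth_dpart[OF f]] h])
    from ex1 obtain s t where st: "s \<in> {0..h}" "t \<in> {0..h}"
      "R (f (p h h)) - R (f (p h 0)) - R (f (p 0 h)) + R (f (p 0 0)) = h * h * F (p s t)"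
      by blast
    have ex2: "\<exists>t\<in>{0..h}. \<exists>s\<in>{0..h}.
        R (f (p h h)) - R (f (p 0 h)) - R (f (p h 0)) + R (f (p 0 0)) = h * h * G (p s t)"
      unfolding G_def
      by (rule dpart_swap_aux[of "\<lambda>t s. R (f (p s t))" "\<lambda>t s. R (dpart j f (p s t))"
            "\<lambda>t s. R (dpart i (dpart j f) (p s t))",
            OF D2[OF f] D1[OF smooth_dpart[OF f]] h])
    from ex2 obtain s' t' where st': "s' \<in> {0..h}" "t' \<in> {0..h}"
      "R (f (p h h)) - R (f (p 0 h)) - R (f (p h 0)) + R (f (p 0 0)) = h * h * G (p t' s')"
      by blast
    have FG: "F (p s t) = G (p t' s')"
    proof -
      have "h * h * F (p s t) = R (f (p h h)) - R (f (p h 0)) - R (f (p 0 h)) + R (f (p 0 0))"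
        by (rule st(3)[symmetric])
      also have "\<dots> = R (f (p h h)) - R (f (p 0 h)) - R (f (p h 0)) + R (f (p 0 0))"
        by (simp only: diff_right_commute)
      also have "\<dots> = h * h * G (p t' s')" by (rule st'(3))
      finally show ?thesis using h by (simp only: mult_cancel_left mult_eq_0_iff) simp
    qed
    have d: "dist (p u v) x \<le> 2 * h" if "u \<in> {0..h}" "v \<in> {0..h}" for u v
    proof -
      have "dist (p u v) x \<le> norm (u *\<^sub>R axis i 1 :: real^'n) + norm (v *\<^sub>R axis j 1 :: real^'n)"
        unfolding p_def dist_norm
        using norm_triangle_ineq[of "u *\<^sub>R axis i 1 :: real^'n" "v *\<^sub>R axis j 1"]
        by (simp add: add.assoc del: norm_scaleR)
      also have "\<dots> \<le> 2 * h" using that by simp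
      finally show ?thesis .
    qed
    show ?thesis
      using d[OF st(1,2)] d[OF st'(2,1)] FG by (intro exI conjI)
  qed
  have "F x = G x"
  proof (rule ccontr)
    assume "F x \<noteq> G x"
    define e where "e = \<bar>F x - G x\<bar> / 2"
    have e: "e > 0" using \<open>F x \<noteq> G x\<close> by (simp add: e_def)
    obtain d1 where d1: "d1 > 0" "\<And>y. dist y x < d1 \<Longrightarrow> dist (F y) (F x) < e"
      using cont(1) e unfolding continuous_at_eps_delta by blast
    obtain d2 where d2: "d2 > 0" "\<And>y. dist y x < d2 \<Longrightarrow> dist (G y) (G x) < e"
      using cont(2) e unfolding continuous_at_eps_delta by blast
    have "0 < min d1 d2 / 4" using d1(1) d2(1) by simp
    from eq[OF this] obtain a b where ab: "dist a x \<le> 2 * (min d1 d2 / 4)"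
      "dist b x \<le> 2 * (min d1 d2 / 4)" "F a = G b"
      by blast
    have "dist (F a) (F x) < e"
      by (rule d1(2)) (use ab(1) d1(1) d2(1) in linarith)
    moreover have "dist (G b) (G x) < e"
      by (rule d2(2)) (use ab(2) d1(1) d2(1) in linarith)
    moreover have "dist (F x) (G x) \<le> dist (F a) (F x) + dist (G b) (G x)"
      using dist_triangle3[of "F x" "G x" "F a"] ab(3) by simp
    ultimately show False unfolding e_def by (simp add: dist_real_def)
  qed
  then show ?thesis by (simp add: F_def G_def)
qed

lemma dpart_swap: "smooth f \<Longrightarrow> dpart i (dpart j f) = dpart j (dpart i f)"
  using dpart_swap_part[OF _ bounded_linear_Re, of f i j] dpart_swap_part[OF _ bounded_linear_Im, of f i j]
  by (auto simp: fun_eq_iff complex_eq_iff)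

lemma foldr_dpart_remove1:
  assumes "smooth f"
  shows "a \<in> set js \<Longrightarrow> foldr dpart js f = dpart a (foldr dpart (remove1 a js) f)"
  by (induction js) (auto simp: dpart_swap[OF smooth_foldr[OF assms]])

lemma foldr_dpart_perm:
  assumes "smooth f"
  shows "count_list is = count_list js \<Longrightarrow> foldr dpart is f = foldr dpart js f"
proof (induction "is" arbitrary: js)
  case Nil
  then have "js = []" by (cases js) (auto simp: fun_eq_iff split: if_splits)
  then show ?case by simp
next
  case (Cons a "is")
  have a: "a \<in> set js"
  proof (rule ccontr)
    assume "a \<notin> set js"
    then have "count_list js a = 0" by simp
    then show False using fun_cong[OF Cons.prems, of a] by simp
  qed
  have r: "count_list js x = (if x = a then 1 else 0) + count_list (remove1 a js) x" for x
    using a by (induction js) auto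
  have "count_list is x = count_list (remove1 a js) x" for x
    using r[of x] fun_cong[OF Cons.prems, of x] by (simp split: if_splits)
  then have "foldr dpart is f = foldr dpart (remove1 a js) f"
    using Cons.IH by blast
  then show ?case using foldr_dpart_remove1[OF assms a] by simp
qed

lemma pd_foldr: "smooth f \<Longrightarrow> foldr dpart is f = pd (count_list is) f"
  unfolding pd_def
  by (rule foldr_dpart_perm, assumption) (rule someI[of "\<lambda>js. count_list js = count_list is" "is", symmetric], simp)

lemma pd_pd:
  assumes "smooth f"
  shows "pd \<alpha> (pd \<beta> f) = pd (\<lambda>i. \<alpha> i + \<beta> i) f"
proof -
  obtain "is" where i: "count_list is = \<alpha>" using ex_count_list[of \<alpha>] by blast
  obtain js where j: "count_list js = \<beta>" using ex_count_list[of \<beta>] by blast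
  have "pd \<alpha> (pd \<beta> f) = foldr dpart (is @ js) f"
    using pd_foldr[OF smooth_pd[OF assms], of "is" \<beta>] pd_foldr[OF assms, of js] i j by simp
  also have "\<dots> = pd (count_list (is @ js)) f" by (rule pd_foldr[OF assms])
  also have "count_list (is @ js) = (\<lambda>i. \<alpha> i + \<beta> i)" using i j by auto
  finally show ?thesis .
qed

lemma finite_mi: "finite {\<alpha> :: 'n::finite \<Rightarrow> nat. mi_deg \<alpha> \<le> j}"
proof (rule finite_subset)
  show "{\<alpha> :: 'n \<Rightarrow> nat. mi_deg \<alpha> \<le> j} \<subseteq> PiE UNIV (\<lambda>_. {..j})"
    unfolding mi_deg_def by (auto intro: order_trans[OF member_le_sum[of _ UNIV]])
qed (auto intro: finite_PiE)

text \<open>Inserting \<open>0\<close> only matters for \<open>K = \<emptyset>\<close>, where the supremum is to be \<open>0\<close>.\<close>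

definition sup_on :: "(real^'n) set \<Rightarrow> 'n::finite cfun \<Rightarrow> real" where
  "sup_on K f = Sup (insert 0 ((\<lambda>x. norm (f x)) ` K))"

definition seminorm_C :: "(real^'n) set \<Rightarrow> nat \<Rightarrow> 'n::finite cfun \<Rightarrow> real" where
  "seminorm_C K j f = Sup (insert 0 {norm (pd \<alpha> f x) |x \<alpha>. x \<in> K \<and> mi_deg \<alpha> \<le> j})"

lemma bdd_sup_on:
  assumes "compact K" "smooth f"
  shows "bdd_above (insert 0 ((\<lambda>x. norm (f x)) ` K))"
proof -
  have "compact ((\<lambda>x. norm (f x)) ` K)"
    using assms smooth_imp(1)[OF assms(2)]
    by (intro compact_continuous_image continuous_intros) (auto intro: continuous_on_subset)
  then show ?thesis by (simp add: bounded_imp_bdd_above compact_imp_bounded)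
qed

lemma sup_on_upper: "compact K \<Longrightarrow> smooth f \<Longrightarrow> x \<in> K \<Longrightarrow> norm (f x) \<le> sup_on K f"
  unfolding sup_on_def by (rule cSup_upper) (simp, rule bdd_sup_on)

lemma sup_on_nonneg: "compact K \<Longrightarrow> smooth f \<Longrightarrow> 0 \<le> sup_on K f"
  unfolding sup_on_def by (rule cSup_upper) (simp, rule bdd_sup_on)

lemma sup_on_least: "0 \<le> c \<Longrightarrow> (\<And>x. x \<in> K \<Longrightarrow> norm (f x) \<le> c) \<Longrightarrow> sup_on K f \<le> c"
  unfolding sup_on_def by (rule cSup_least) auto

lemma sup_on_0 [simp]: "sup_on K (\<lambda>_. 0) = 0"
proof -
  have "insert 0 ((\<lambda>x. norm (0::complex)) ` K) = {0}" by auto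
  then show ?thesis unfolding sup_on_def by (simp only: cSup_singleton)
qed

lemma sup_on_minus [simp]: "sup_on K (\<lambda>x. - f x) = sup_on K f"
  unfolding sup_on_def by simp

lemma sup_on_add:
  assumes "compact K" "smooth f" "smooth g"
  shows "sup_on K (\<lambda>x. f x + g x) \<le> sup_on K f + sup_on K g"
  using assms sup_on_upper[of K] sup_on_nonneg[of K]
  by (intro sup_on_least) (auto intro!: norm_triangle_mono add_nonneg_nonneg)

lemma sup_on_cmult:
  assumes "compact K" "smooth f"
  shows "sup_on K (\<lambda>x. c * f x) \<le> norm c * sup_on K f"
  using assms sup_on_upper[of K f] sup_on_nonneg[of K f]
  by (intro sup_on_least) (auto simp: norm_mult intro!: mult_left_mono)

lemma bdd_seminorm_C:
  assumes "compact K" "smooth f"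
  shows "bdd_above (insert 0 {norm (pd \<alpha> f x) |x \<alpha>. x \<in> K \<and> mi_deg \<alpha> \<le> j})"
proof -
  have "{norm (pd \<alpha> f x) |x \<alpha>. x \<in> K \<and> mi_deg \<alpha> \<le> j} =
      (\<Union>\<alpha>\<in>{\<alpha>. mi_deg \<alpha> \<le> j}. (\<lambda>x. norm (pd \<alpha> f x)) ` K)" by auto
  moreover have "bdd_above \<dots>"
    using bdd_sup_on[OF assms(1) smooth_pd[OF assms(2)]]
    by (simp add: bdd_above_UN[OF finite_mi])
  ultimately show ?thesis by simp
qed

lemma seminorm_C_upper:
  "compact K \<Longrightarrow> smooth f \<Longrightarrow> x \<in> K \<Longrightarrow> mi_deg \<alpha> \<le> j \<Longrightarrow> norm (pd \<alpha> f x) \<le> seminorm_C K j f"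
  unfolding seminorm_C_def by (rule cSup_upper) (blast, rule bdd_seminorm_C)

lemma seminorm_C_nonneg: "compact K \<Longrightarrow> smooth f \<Longrightarrow> 0 \<le> seminorm_C K j f"
  unfolding seminorm_C_def by (rule cSup_upper) (blast, rule bdd_seminorm_C)

lemma seminorm_C_least:
  "0 \<le> c \<Longrightarrow> (\<And>x \<alpha>. x \<in> K \<Longrightarrow> mi_deg \<alpha> \<le> j \<Longrightarrow> norm (pd \<alpha> f x) \<le> c) \<Longrightarrow> seminorm_C K j f \<le> c"
  unfolding seminorm_C_def by (rule cSup_least) auto

lemma seminorm_C_add:
  assumes "compact K" "smooth f" "smooth g"
  shows "seminorm_C K j (\<lambda>x. f x + g x) \<le> seminorm_C K j f + seminorm_C K j g"
  using assms seminorm_C_upper[of K] seminorm_C_nonneg[of K]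
  by (intro seminorm_C_least) (auto simp: pd_add intro!: norm_triangle_mono add_nonneg_nonneg)

lemma seminorm_C_minus: "smooth f \<Longrightarrow> seminorm_C K j (\<lambda>x. - f x) = seminorm_C K j f"
  unfolding seminorm_C_def by (simp add: pd_minus)

lemma seminorm_C_le_sum:
  assumes "compact K" "smooth f"
  shows "seminorm_C K j f \<le> (\<Sum>\<alpha> | mi_deg \<alpha> \<le> j. sup_on K (pd \<alpha> f))"
proof (rule seminorm_C_least)
  have nn: "0 \<le> sup_on K (pd \<alpha> f)" for \<alpha> using assms by (intro sup_on_nonneg smooth_pd)
  then show "0 \<le> (\<Sum>\<alpha> | mi_deg \<alpha> \<le> j. sup_on K (pd \<alpha> f))" by (simp add: sum_nonneg)
  fix x :: "real^'a" and \<alpha> :: "'a \<Rightarrow> nat"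
  assume "x \<in> K" "mi_deg \<alpha> \<le> j"
  then have "norm (pd \<alpha> f x) \<le> sup_on K (pd \<alpha> f)" using assms by (intro sup_on_upper smooth_pd)
  also have "\<dots> \<le> (\<Sum>\<alpha> | mi_deg \<alpha> \<le> j. sup_on K (pd \<alpha> f))"
    using \<open>mi_deg \<alpha> \<le> j\<close> nn by (intro member_le_sum) (auto intro: finite_mi)
  finally show "norm (pd \<alpha> f x) \<le> (\<Sum>\<alpha> | mi_deg \<alpha> \<le> j. sup_on K (pd \<alpha> f))" .
qed


section \<open>The Colombeau algebra of the whole space\<close>

definition net_smooth :: "(real \<Rightarrow> 'n::finite cfun) \<Rightarrow> bool" where
  "net_smooth u \<longleftrightarrow> (\<forall>\<epsilon>\<in>{0<..1}. smooth (u \<epsilon>))"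

definition net_moderate :: "(real \<Rightarrow> 'n::finite cfun) \<Rightarrow> bool" where
  "net_moderate u \<longleftrightarrow> net_smooth u \<and>
     (\<forall>K \<alpha>. compact K \<longrightarrow> (\<exists>N::nat. O_eps (- real N) (\<lambda>\<epsilon>. sup_on K (pd \<alpha> (u \<epsilon>)))))"

definition net_negl_on :: "(real^'n) set \<Rightarrow> (real \<Rightarrow> 'n::finite cfun) \<Rightarrow> bool" where
  "net_negl_on V u \<longleftrightarrow>
     (\<forall>K \<alpha>. compact K \<longrightarrow> K \<subseteq> V \<longrightarrow> (\<forall>q::nat. O_eps (real q) (\<lambda>\<epsilon>. sup_on K (pd \<alpha> (u \<epsilon>)))))"

definition colombeau_eq :: "(real \<Rightarrow> 'n::finite cfun) \<Rightarrow> (real \<Rightarrow> 'n cfun) \<Rightarrow> bool" where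
  "colombeau_eq u v \<longleftrightarrow>
     net_moderate u \<and> net_moderate v \<and> net_negl_on UNIV (\<lambda>\<epsilon> x. u \<epsilon> x - v \<epsilon> x)"

lemma net_smoothD: "net_smooth u \<Longrightarrow> \<epsilon> \<in> {0<..1} \<Longrightarrow> smooth (u \<epsilon>)"
  by (simp add: net_smooth_def)

lemma net_moderate_smooth: "net_moderate u \<Longrightarrow> net_smooth u"
  by (simp add: net_moderate_def)

lemma O_eps_sup_add:
  assumes "compact K" "net_smooth u" "net_smooth v"
    and "O_eps b (\<lambda>\<epsilon>. sup_on K (pd \<alpha> (u \<epsilon>)))" "O_eps b (\<lambda>\<epsilon>. sup_on K (pd \<alpha> (v \<epsilon>)))"
  shows "O_eps b (\<lambda>\<epsilon>. sup_on K (pd \<alpha> (\<lambda>x. u \<epsilon> x + v \<epsilon> x)))"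
proof (rule O_eps_le[OF O_eps_add[OF assms(4,5)]])
  show "\<forall>\<^sub>F \<epsilon> in at_right 0. \<bar>sup_on K (pd \<alpha> (\<lambda>x. u \<epsilon> x + v \<epsilon> x))\<bar>
      \<le> sup_on K (pd \<alpha> (u \<epsilon>)) + sup_on K (pd \<alpha> (v \<epsilon>))"
    using eventually_unit
  proof eventually_elim
    case (elim \<epsilon>)
    note s = net_smoothD[OF assms(2) elim] net_smoothD[OF assms(3) elim]
    have "0 \<le> sup_on K (pd \<alpha> (\<lambda>x. u \<epsilon> x + v \<epsilon> x))"
      by (intro sup_on_nonneg smooth_pd smooth_add s assms)
    moreover have "sup_on K (pd \<alpha> (\<lambda>x. u \<epsilon> x + v \<epsilon> x)) \<le> sup_on K (pd \<alpha> (u \<epsilon>)) + sup_on K (pd \<alpha> (v \<epsilon>))"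
      unfolding pd_add[OF s] by (intro sup_on_add smooth_pd s assms)
    ultimately show ?case by simp
  qed
qed

lemma O_eps_sup_cmult:
  assumes "compact K" "net_smooth u"
    and "O_eps a (\<lambda>\<epsilon>. norm (r \<epsilon>))" "O_eps b (\<lambda>\<epsilon>. sup_on K (pd \<alpha> (u \<epsilon>)))"
  shows "O_eps (a + b) (\<lambda>\<epsilon>. sup_on K (pd \<alpha> (\<lambda>x. r \<epsilon> * u \<epsilon> x)))"
proof (rule O_eps_le[OF O_eps_mult[OF assms(3,4)]])
  show "\<forall>\<^sub>F \<epsilon> in at_right 0. \<bar>sup_on K (pd \<alpha> (\<lambda>x. r \<epsilon> * u \<epsilon> x))\<bar>
      \<le> norm (r \<epsilon>) * sup_on K (pd \<alpha> (u \<epsilon>))"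
    using eventually_unit
  proof eventually_elim
    case (elim \<epsilon>)
    note s = net_smoothD[OF assms(2) elim]
    have "0 \<le> sup_on K (pd \<alpha> (\<lambda>x. r \<epsilon> * u \<epsilon> x))"
      by (intro sup_on_nonneg smooth_pd smooth_cmult s assms)
    moreover have "sup_on K (pd \<alpha> (\<lambda>x. r \<epsilon> * u \<epsilon> x)) \<le> norm (r \<epsilon>) * sup_on K (pd \<alpha> (u \<epsilon>))"
      unfolding pd_cmult[OF s] by (intro sup_on_cmult smooth_pd s assms)
    ultimately show ?case by simp
  qed
qed

lemma O_eps_cong_unit:
  assumes "\<And>\<epsilon>. \<epsilon> \<in> {0<..1} \<Longrightarrow> f \<epsilon> = g \<epsilon>"
  shows "O_eps b f \<longleftrightarrow> O_eps b g"
  by (rule landau_o.big.in_cong) (use eventually_unit assms in \<open>auto elim: eventually_mono\<close>)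

lemma net_smooth_add: "net_smooth u \<Longrightarrow> net_smooth v \<Longrightarrow> net_smooth (\<lambda>\<epsilon> x. u \<epsilon> x + v \<epsilon> x)"
  by (simp add: net_smooth_def smooth_add)

lemma net_smooth_minus: "net_smooth u \<Longrightarrow> net_smooth (\<lambda>\<epsilon> x. - u \<epsilon> x)"
  by (simp add: net_smooth_def smooth_minus)

lemma net_smooth_diff: "net_smooth u \<Longrightarrow> net_smooth v \<Longrightarrow> net_smooth (\<lambda>\<epsilon> x. u \<epsilon> x - v \<epsilon> x)"
  by (simp add: net_smooth_def smooth_diff)

lemma net_smooth_cmult: "net_smooth u \<Longrightarrow> net_smooth (\<lambda>\<epsilon> x. r \<epsilon> * u \<epsilon> x)"
  by (simp add: net_smooth_def smooth_cmult)

lemma net_negl_add: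
  "net_smooth u \<Longrightarrow> net_smooth v \<Longrightarrow> net_negl_on V u \<Longrightarrow> net_negl_on V v \<Longrightarrow>
    net_negl_on V (\<lambda>\<epsilon> x. u \<epsilon> x + v \<epsilon> x)"
  unfolding net_negl_on_def by (auto intro: O_eps_sup_add)

lemma O_eps_sup_minus:
  "net_smooth u \<Longrightarrow> O_eps b (\<lambda>\<epsilon>. sup_on K (pd \<alpha> (\<lambda>x. - u \<epsilon> x))) \<longleftrightarrow> O_eps b (\<lambda>\<epsilon>. sup_on K (pd \<alpha> (u \<epsilon>)))"
  by (rule O_eps_cong_unit) (simp add: net_smoothD pd_minus)

lemma net_negl_minus: "net_smooth u \<Longrightarrow> net_negl_on V u \<Longrightarrow> net_negl_on V (\<lambda>\<epsilon> x. - u \<epsilon> x)"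
  unfolding net_negl_on_def by (simp add: O_eps_sup_minus)

lemma net_moderate_minus: "net_moderate u \<Longrightarrow> net_moderate (\<lambda>\<epsilon> x. - u \<epsilon> x)"
  unfolding net_moderate_def by (simp add: O_eps_sup_minus net_smooth_minus)

lemma net_moderate_add:
  assumes "net_moderate u" "net_moderate v"
  shows "net_moderate (\<lambda>\<epsilon> x. u \<epsilon> x + v \<epsilon> x)"
  unfolding net_moderate_def
proof (intro conjI allI impI)
  have s: "net_smooth u" "net_smooth v" using assms by (auto simp: net_moderate_def)
  then show "net_smooth (\<lambda>\<epsilon> x. u \<epsilon> x + v \<epsilon> x)" by (rule net_smooth_add)
  fix K :: "(real^'a) set" and \<alpha> assume K: "compact K"
  obtain M N where MN: "O_eps (- real M) (\<lambda>\<epsilon>. sup_on K (pd \<alpha> (u \<epsilon>)))" "O_eps (- real N) (\<lambda>\<epsilon>. sup_on K (pd \<alpha> (v \<epsilon>)))"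
    using assms K unfolding net_moderate_def by metis
  have "O_eps (- real (M + N)) (\<lambda>\<epsilon>. sup_on K (pd \<alpha> (\<lambda>x. u \<epsilon> x + v \<epsilon> x)))"
    by (intro O_eps_sup_add K s O_eps_mono[OF MN(1)] O_eps_mono[OF MN(2)]) auto
  then show "\<exists>N::nat. O_eps (- real N) (\<lambda>\<epsilon>. sup_on K (pd \<alpha> (\<lambda>x. u \<epsilon> x + v \<epsilon> x)))" by blast
qed

lemma net_moderate_diff: "net_moderate u \<Longrightarrow> net_moderate v \<Longrightarrow> net_moderate (\<lambda>\<epsilon> x. u \<epsilon> x - v \<epsilon> x)"
  using net_moderate_add[of u "\<lambda>\<epsilon> x. - v \<epsilon> x"] net_moderate_minus[of v] by simp

lemma net_moderate_cmult:
  assumes "moderate r" "net_moderate u"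
  shows "net_moderate (\<lambda>\<epsilon> x. r \<epsilon> * u \<epsilon> x)"
  unfolding net_moderate_def
proof (intro conjI allI impI)
  have s: "net_smooth u" using assms by (auto simp: net_moderate_def)
  then show "net_smooth (\<lambda>\<epsilon> x. r \<epsilon> * u \<epsilon> x)" by (rule net_smooth_cmult)
  fix K :: "(real^'a) set" and \<alpha> assume K: "compact K"
  obtain M N where MN: "O_eps (- real M) (\<lambda>\<epsilon>. norm (r \<epsilon>))" "O_eps (- real N) (\<lambda>\<epsilon>. sup_on K (pd \<alpha> (u \<epsilon>)))"
    using assms K unfolding net_moderate_def moderate_def by metis
  from O_eps_sup_cmult[OF K s MN]
  have "O_eps (- real (M + N)) (\<lambda>\<epsilon>. sup_on K (pd \<alpha> (\<lambda>x. r \<epsilon> * u \<epsilon> x)))"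
    by (simp add: algebra_simps)
  then show "\<exists>N::nat. O_eps (- real N) (\<lambda>\<epsilon>. sup_on K (pd \<alpha> (\<lambda>x. r \<epsilon> * u \<epsilon> x)))" by blast
qed

lemma net_negl_cmult1:
  assumes "negl r" "net_moderate u"
  shows "net_negl_on V (\<lambda>\<epsilon> x. r \<epsilon> * u \<epsilon> x)"
  unfolding net_negl_on_def
proof (intro allI impI)
  have s: "net_smooth u" using assms by (auto simp: net_moderate_def)
  fix K :: "(real^'a) set" and \<alpha> and q :: nat assume K: "compact K"
  obtain N where N: "O_eps (- real N) (\<lambda>\<epsilon>. sup_on K (pd \<alpha> (u \<epsilon>)))"
    using assms K unfolding net_moderate_def by metis
  have "O_eps (real (q + N)) (\<lambda>\<epsilon>. norm (r \<epsilon>))" using assms(1) unfolding negl_def by blast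
  from O_eps_sup_cmult[OF K s this N]
  show "O_eps (real q) (\<lambda>\<epsilon>. sup_on K (pd \<alpha> (\<lambda>x. r \<epsilon> * u \<epsilon> x)))"
    by (simp add: algebra_simps)
qed

lemma net_negl_cmult2:
  assumes "moderate r" "net_smooth u" "net_negl_on V u"
  shows "net_negl_on V (\<lambda>\<epsilon> x. r \<epsilon> * u \<epsilon> x)"
  unfolding net_negl_on_def
proof (intro allI impI)
  fix K :: "(real^'a) set" and \<alpha> and q :: nat assume K: "compact K" "K \<subseteq> V"
  obtain N where N: "O_eps (- real N) (\<lambda>\<epsilon>. norm (r \<epsilon>))"
    using assms K unfolding moderate_def by metis
  have "O_eps (real (q + N)) (\<lambda>\<epsilon>. sup_on K (pd \<alpha> (u \<epsilon>)))"
    using assms(3) K unfolding net_negl_on_def by blast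
  from O_eps_sup_cmult[OF K(1) assms(2) N this]
  show "O_eps (real q) (\<lambda>\<epsilon>. sup_on K (pd \<alpha> (\<lambda>x. r \<epsilon> * u \<epsilon> x)))"
    by (simp add: algebra_simps)
qed

lemma net_moderate_0 [simp]: "net_moderate (\<lambda>_ _. 0)"
  by (auto simp: net_moderate_def net_smooth_def)

lemma net_negl_0 [simp]: "net_negl_on V (\<lambda>_ _. 0)"
  by (simp add: net_negl_on_def)

lemma net_moderate_pd:
  assumes "net_moderate u" shows "net_moderate (\<lambda>\<epsilon>. pd \<alpha> (u \<epsilon>))"
  unfolding net_moderate_def
proof (intro conjI allI impI)
  have s: "net_smooth u" using assms by (auto simp: net_moderate_def)
  then show "net_smooth (\<lambda>\<epsilon>. pd \<alpha> (u \<epsilon>))" by (simp add: net_smooth_def smooth_pd)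
  fix K :: "(real^'a) set" and \<beta> assume K: "compact K"
  obtain N where N: "O_eps (- real N) (\<lambda>\<epsilon>. sup_on K (pd (\<lambda>i. \<beta> i + \<alpha> i) (u \<epsilon>)))"
    using assms K unfolding net_moderate_def by metis
  have "O_eps (- real N) (\<lambda>\<epsilon>. sup_on K (pd \<beta> (pd \<alpha> (u \<epsilon>))))"
    using N by (subst O_eps_cong_unit) (auto simp: pd_pd net_smoothD[OF s])
  then show "\<exists>N::nat. O_eps (- real N) (\<lambda>\<epsilon>. sup_on K (pd \<beta> (pd \<alpha> (u \<epsilon>))))" by blast
qed

lemma net_negl_pd:
  assumes "net_smooth u" "net_negl_on V u" shows "net_negl_on V (\<lambda>\<epsilon>. pd \<alpha> (u \<epsilon>))"
  unfolding net_negl_on_def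
proof (intro allI impI)
  fix K :: "(real^'a) set" and \<beta> and q :: nat assume K: "compact K" "K \<subseteq> V"
  have "O_eps q (\<lambda>\<epsilon>. sup_on K (pd (\<lambda>i. \<beta> i + \<alpha> i) (u \<epsilon>)))"
    using assms K unfolding net_negl_on_def by blast
  then show "O_eps q (\<lambda>\<epsilon>. sup_on K (pd \<beta> (pd \<alpha> (u \<epsilon>))))"
    by (subst O_eps_cong_unit) (auto simp: pd_pd net_smoothD[OF assms(1)])
qed

lemma net_negl_cong_unit:
  assumes "\<And>\<epsilon>. \<epsilon> \<in> {0<..1} \<Longrightarrow> u \<epsilon> = v \<epsilon>"
  shows "net_negl_on V u \<longleftrightarrow> net_negl_on V v"
proof -
  have "O_eps b (\<lambda>\<epsilon>. sup_on K (pd \<alpha> (u \<epsilon>))) \<longleftrightarrow> O_eps b (\<lambda>\<epsilon>. sup_on K (pd \<alpha> (v \<epsilon>)))" for b K \<alpha>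
    by (rule O_eps_cong_unit) (simp add: assms)
  then show ?thesis by (simp add: net_negl_on_def)
qed

lemma colombeau_eq_sym:
  assumes "colombeau_eq u v" shows "colombeau_eq v u"
proof -
  have "net_negl_on UNIV (\<lambda>\<epsilon> x. - (u \<epsilon> x - v \<epsilon> x))"
    using assms unfolding colombeau_eq_def
    by (intro net_negl_minus net_smooth_diff net_moderate_smooth) auto
  with assms show ?thesis by (simp add: colombeau_eq_def)
qed

quotient_type 'n colombeau = "real \<Rightarrow> 'n::finite cfun" / partial: colombeau_eq
proof (rule part_equivpI)
  show "\<exists>x::real \<Rightarrow> 'n cfun. colombeau_eq x x"
    by (rule exI[of _ "\<lambda>_ _. 0"]) (simp add: colombeau_eq_def)
  show "symp (colombeau_eq :: (real \<Rightarrow> 'n cfun) \<Rightarrow> _)"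
    by (rule sympI) (rule colombeau_eq_sym)
  show "transp (colombeau_eq :: (real \<Rightarrow> 'n cfun) \<Rightarrow> _)"
  proof (rule transpI)
    fix u v w :: "real \<Rightarrow> 'n cfun" assume *: "colombeau_eq u v" "colombeau_eq v w"
    then have "net_negl_on UNIV (\<lambda>\<epsilon> x. (u \<epsilon> x - v \<epsilon> x) + (v \<epsilon> x - w \<epsilon> x))"
      unfolding colombeau_eq_def by (intro net_negl_add net_smooth_diff net_moderate_smooth) auto
    with * show "colombeau_eq u w" by (simp add: colombeau_eq_def)
  qed
qed

instantiation colombeau :: (finite) ab_group_add
begin

lift_definition zero_colombeau :: "'a colombeau" is "\<lambda>_ _. 0" by (simp add: colombeau_eq_def)
lift_definition plus_colombeau :: "'a colombeau \<Rightarrow> 'a colombeau \<Rightarrow> 'a colombeau"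
  is "\<lambda>u v \<epsilon> x. u \<epsilon> x + v \<epsilon> x"
proof -
  fix u u' v v' :: "real \<Rightarrow> 'a cfun"
  assume *: "colombeau_eq u u'" "colombeau_eq v v'"
  then have "net_negl_on UNIV (\<lambda>\<epsilon> x. (u \<epsilon> x - u' \<epsilon> x) + (v \<epsilon> x - v' \<epsilon> x))"
    unfolding colombeau_eq_def by (intro net_negl_add net_smooth_diff net_moderate_smooth) auto
  with * show "colombeau_eq (\<lambda>\<epsilon> x. u \<epsilon> x + v \<epsilon> x) (\<lambda>\<epsilon> x. u' \<epsilon> x + v' \<epsilon> x)"
    by (simp add: colombeau_eq_def net_moderate_add algebra_simps)
qed
lift_definition uminus_colombeau :: "'a colombeau \<Rightarrow> 'a colombeau" is "\<lambda>u \<epsilon> x. - u \<epsilon> x"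
proof -
  fix u v :: "real \<Rightarrow> 'a cfun" assume *: "colombeau_eq u v"
  then have "net_negl_on UNIV (\<lambda>\<epsilon> x. - (u \<epsilon> x - v \<epsilon> x))"
    unfolding colombeau_eq_def by (intro net_negl_minus net_smooth_diff net_moderate_smooth) auto
  with * show "colombeau_eq (\<lambda>\<epsilon> x. - u \<epsilon> x) (\<lambda>\<epsilon> x. - v \<epsilon> x)"
    by (simp add: colombeau_eq_def net_moderate_minus)
qed
definition minus_colombeau :: "'a colombeau \<Rightarrow> 'a colombeau \<Rightarrow> 'a colombeau"
  where "minus_colombeau u v = u + - v"

instance
proof
  fix a b c :: "'a colombeau"
  show "a + b + c = a + (b + c)"
    by transfer (simp add: colombeau_eq_def net_moderate_add add.assoc)
  show "a + b = b + a"
    by transfer (simp add: colombeau_eq_def net_moderate_add add.commute)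
  show "0 + a = a" by transfer (simp add: colombeau_eq_def)
  show "- a + a = 0" by transfer (simp add: colombeau_eq_def)
  show "a - b = a + - b" by (rule minus_colombeau_def)
qed

end

lift_definition gscale :: "complex gen \<Rightarrow> 'n::finite colombeau \<Rightarrow> 'n colombeau" (infixr "*\<^sub>G" 75)
  is "\<lambda>r u \<epsilon> x. r \<epsilon> * u \<epsilon> x"
proof -
  fix r r' :: "real \<Rightarrow> complex" and u u' :: "real \<Rightarrow> 'n cfun"
  assume *: "gen_eq r r'" "colombeau_eq u u'"
  then have "net_negl_on UNIV (\<lambda>\<epsilon> x. (r \<epsilon> - r' \<epsilon>) * u \<epsilon> x + r' \<epsilon> * (u \<epsilon> x - u' \<epsilon> x))"
    unfolding colombeau_eq_def gen_eq_def
    by (intro net_negl_add net_smooth_diff net_smooth_cmult net_moderate_smooth net_negl_cmult1 net_negl_cmult2) auto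
  with * show "colombeau_eq (\<lambda>\<epsilon> x. r \<epsilon> * u \<epsilon> x) (\<lambda>\<epsilon> x. r' \<epsilon> * u' \<epsilon> x)"
    by (simp add: colombeau_eq_def gen_eq_def net_moderate_cmult algebra_simps)
qed

lift_definition gpd :: "('n::finite \<Rightarrow> nat) \<Rightarrow> 'n colombeau \<Rightarrow> 'n colombeau"
  is "\<lambda>\<alpha> u \<epsilon>. pd \<alpha> (u \<epsilon>)"
proof -
  fix \<alpha> and u v :: "real \<Rightarrow> 'n cfun"
  assume *: "colombeau_eq u v"
  then have s: "net_smooth u" "net_smooth v"
    by (auto simp: colombeau_eq_def net_moderate_smooth)
  have "net_negl_on UNIV (\<lambda>\<epsilon>. pd \<alpha> (\<lambda>x. u \<epsilon> x - v \<epsilon> x))"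
    using * s by (intro net_negl_pd net_smooth_diff) (auto simp: colombeau_eq_def)
  then have "net_negl_on UNIV (\<lambda>\<epsilon> x. pd \<alpha> (u \<epsilon>) x - pd \<alpha> (v \<epsilon>) x)"
    by (subst net_negl_cong_unit) (auto simp: pd_diff net_smoothD[OF s(1)] net_smoothD[OF s(2)])
  with * show "colombeau_eq (\<lambda>\<epsilon>. pd \<alpha> (u \<epsilon>)) (\<lambda>\<epsilon>. pd \<alpha> (v \<epsilon>))"
    by (simp add: colombeau_eq_def net_moderate_pd)
qed

definition is_crep :: "(real \<Rightarrow> 'n::finite cfun) \<Rightarrow> 'n colombeau \<Rightarrow> bool" where
  "is_crep u_net u \<longleftrightarrow> net_moderate u_net \<and> abs_colombeau u_net = u"

text \<open>\<open>vanishes_on V u\<close>: the restriction of \<open>u\<close> to the open set \<open>V\<close> is zero.\<close>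

lift_definition vanishes_on :: "(real^'n) set \<Rightarrow> 'n::finite colombeau \<Rightarrow> bool" is net_negl_on
proof -
  fix V :: "(real^'n) set" and u v :: "real \<Rightarrow> 'n cfun"
  have *: "net_negl_on V v" if e: "colombeau_eq u v" and n: "net_negl_on V u" for u v
  proof -
    have s: "net_smooth u" "net_smooth v" and "net_negl_on V (\<lambda>\<epsilon> x. u \<epsilon> x - v \<epsilon> x)"
      using e by (auto simp: colombeau_eq_def net_moderate_smooth net_negl_on_def)
    then have "net_negl_on V (\<lambda>\<epsilon> x. u \<epsilon> x + - (u \<epsilon> x - v \<epsilon> x))"
      using n by (intro net_negl_add net_negl_minus net_smooth_minus net_smooth_diff)
    then show ?thesis by simp
  qed
  assume "colombeau_eq u v"
  moreover from this have "colombeau_eq v u"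
    by (rule colombeau_eq_sym)
  ultimately show "net_negl_on V u = net_negl_on V v"
    using * by blast
qed

definition gsupp :: "'n::finite colombeau \<Rightarrow> (real^'n) set" where
  "gsupp u = - \<Union>{V. open V \<and> vanishes_on V u}"

definition Gc :: "'n::finite colombeau set" where
  "Gc = {u. compact (gsupp u)}"

definition Gc_on :: "(real^'n) set \<Rightarrow> 'n::finite colombeau set" where
  "Gc_on K = {u \<in> Gc. gsupp u \<subseteq> K}"

text \<open>A representative of \<open>u \<in> \<G>\<^sub>c\<close> whose supports lie in one compact set.\<close>

definition is_crep_c :: "(real \<Rightarrow> 'n::finite cfun) \<Rightarrow> 'n colombeau \<Rightarrow> bool" where
  "is_crep_c u_net u \<longleftrightarrow> is_crep u_net u \<and>
     (\<exists>K. compact K \<and> (\<forall>\<epsilon>\<in>{0<..1}. \<forall>x. x \<notin> K \<longrightarrow> u_net \<epsilon> x = 0))"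

section \<open>Topology and continuous functionals\<close>

text \<open>The valuation \<open>v\<^sub>K\<^sub>,\<^sub>j\<close> uses the closed \<open>1\<close>-neighbourhood of \<open>K\<close> as the compact
  neighbourhood of \<open>K\<close>, and an arbitrary representative (see \<open>valuation_seminorm_C_cong\<close>).\<close>

definition nbhd1 :: "(real^'n::finite) set \<Rightarrow> (real^'n) set" where
  "nbhd1 K = {x. \<exists>y\<in>K. dist x y \<le> 1}"

definition val_C :: "(real^'n) set \<Rightarrow> nat \<Rightarrow> 'n::finite colombeau \<Rightarrow> ereal" where
  "val_C K j u = valuation (\<lambda>\<epsilon>. seminorm_C (nbhd1 K) j (rep_colombeau u \<epsilon>))"

definition ultra_seminorm :: "(real^'n) set \<Rightarrow> nat \<Rightarrow> 'n::finite colombeau \<Rightarrow> real" where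
  "ultra_seminorm K j u = exp_neg (val_C K j u)"

lemma valuation_seminorm_C_cong:
  assumes "colombeau_eq u v" "compact L"
  shows "valuation (\<lambda>\<epsilon>. seminorm_C L j (u \<epsilon>)) = valuation (\<lambda>\<epsilon>. seminorm_C L j (v \<epsilon>))"
proof -
  have s: "net_smooth u" "net_smooth v"
    using assms by (auto simp: colombeau_eq_def net_moderate_smooth)
  define w where "w = (\<lambda>\<epsilon> x. u \<epsilon> x - v \<epsilon> x)"
  have w: "net_smooth w" unfolding w_def by (rule net_smooth_diff[OF s])
  have n: "net_negl_on UNIV w" using assms by (simp add: colombeau_eq_def w_def)
  have O: "O_eps (real q) (\<lambda>\<epsilon>. seminorm_C L j (w \<epsilon>))" for q
  proof (rule O_eps_le)
    show "O_eps (real q) (\<lambda>\<epsilon>. \<Sum>\<alpha> | mi_deg \<alpha> \<le> j. sup_on L (pd \<alpha> (w \<epsilon>)))"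
      using n assms(2) by (intro O_eps_sum) (auto simp: net_negl_on_def)
    show "\<forall>\<^sub>F \<epsilon> in at_right 0. \<bar>seminorm_C L j (w \<epsilon>)\<bar> \<le> (\<Sum>\<alpha> | mi_deg \<alpha> \<le> j. sup_on L (pd \<alpha> (w \<epsilon>)))"
      using eventually_unit
    proof eventually_elim
      case (elim \<epsilon>)
      show ?case
        using seminorm_C_le_sum[OF assms(2) net_smoothD[OF w elim], of j]
          seminorm_C_nonneg[OF assms(2) net_smoothD[OF w elim], of j]
        by linarith
    qed
  qed
  show ?thesis
  proof (rule valuation_cong_negl[OF O])
    show "\<forall>\<^sub>F \<epsilon> in at_right 0. \<bar>seminorm_C L j (u \<epsilon>)\<bar> \<le> seminorm_C L j (v \<epsilon>) + seminorm_C L j (w \<epsilon>)"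
      using eventually_unit
    proof eventually_elim
      case (elim \<epsilon>)
      have "(\<lambda>x. v \<epsilon> x + w \<epsilon> x) = u \<epsilon>" by (simp add: w_def)
      then show ?case
        using seminorm_C_add[OF assms(2) net_smoothD[OF s(2) elim] net_smoothD[OF w elim], of j]
          seminorm_C_nonneg[OF assms(2) net_smoothD[OF s(1) elim], of j]
        by simp
    qed
    show "\<forall>\<^sub>F \<epsilon> in at_right 0. \<bar>seminorm_C L j (v \<epsilon>)\<bar> \<le> seminorm_C L j (u \<epsilon>) + seminorm_C L j (w \<epsilon>)"
      using eventually_unit
    proof eventually_elim
      case (elim \<epsilon>)
      have "(\<lambda>x. u \<epsilon> x + - w \<epsilon> x) = v \<epsilon>" by (simp add: w_def)
      then show ?case
        using seminorm_C_add[OF assms(2) net_smoothD[OF s(1) elim] smooth_minus[OF net_smoothD[OF w elim]], of j]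
          seminorm_C_nonneg[OF assms(2) net_smoothD[OF s(2) elim], of j]
          seminorm_C_minus[OF net_smoothD[OF w elim], of L j]
        by simp
    qed
  qed
qed

text \<open>The strict inductive limit is taken among locally convex topological modules over the
  generalized complex numbers: a base of neighbourhoods of \<open>0\<close> is given by the absolutely convex
  sets (closed under addition and under scalars of norm \<open>\<le> 1\<close>) whose trace on every
  \<open>Gc_on K\<close> is a neighbourhood of \<open>0\<close> there. Such sets are automatically absorbent.\<close>

definition Gc_nbhd0 :: "'n::finite colombeau set \<Rightarrow> bool" where
  "Gc_nbhd0 U \<longleftrightarrow> U \<subseteq> Gc \<and>
     (\<forall>u\<in>U. \<forall>v\<in>U. u + v \<in> U) \<and>
     (\<forall>r. \<forall>u\<in>U. gen_norm r \<le> 1 \<longrightarrow> r *\<^sub>G u \<in> U) \<and>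
     (\<forall>K. compact K \<longrightarrow> (\<exists>J \<delta>. finite J \<and> \<delta> > 0 \<and>
        {u \<in> Gc_on K. \<forall>j\<in>J. ultra_seminorm K j u < \<delta>} \<subseteq> U))"

definition Gc_open :: "'n::finite colombeau set \<Rightarrow> bool" where
  "Gc_open W \<longleftrightarrow> W \<subseteq> Gc \<and> (\<forall>u\<in>W. \<exists>U. Gc_nbhd0 U \<and> (+) u ` U \<subseteq> W)"

lemma Gc_nbhd0_D:
  assumes "Gc_nbhd0 U"
  shows "U \<subseteq> Gc" "u \<in> U \<Longrightarrow> v \<in> U \<Longrightarrow> u + v \<in> U"
    "gen_norm r \<le> 1 \<Longrightarrow> u \<in> U \<Longrightarrow> r *\<^sub>G u \<in> U"
    "compact K \<Longrightarrow> \<exists>J \<delta>. finite J \<and> \<delta> > 0 \<and>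
        {u \<in> Gc_on K. \<forall>j\<in>J. ultra_seminorm K j u < \<delta>} \<subseteq> U"
  using assms by (simp_all add: Gc_nbhd0_def)

lemma Gc_nbhd0_Int:
  assumes "Gc_nbhd0 U" "Gc_nbhd0 V" shows "Gc_nbhd0 (U \<inter> V)"
  unfolding Gc_nbhd0_def
proof (intro conjI)
  show "U \<inter> V \<subseteq> Gc" using Gc_nbhd0_D(1)[OF assms(1)] by blast
  show "\<forall>u\<in>U \<inter> V. \<forall>v\<in>U \<inter> V. u + v \<in> U \<inter> V"
    by (intro ballI IntI Gc_nbhd0_D(2)[OF assms(1)] Gc_nbhd0_D(2)[OF assms(2)]) simp_all
  show "\<forall>r. \<forall>u\<in>U \<inter> V. gen_norm r \<le> 1 \<longrightarrow> r *\<^sub>G u \<in> U \<inter> V"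
    by (intro allI ballI impI IntI Gc_nbhd0_D(3)[OF assms(1)] Gc_nbhd0_D(3)[OF assms(2)]) simp_all
  show "\<forall>K. compact K \<longrightarrow> (\<exists>J \<delta>. finite J \<and> \<delta> > 0 \<and>
        {u \<in> Gc_on K. \<forall>j\<in>J. ultra_seminorm K j u < \<delta>} \<subseteq> U \<inter> V)"
  proof (intro allI impI)
    fix K :: "(real^'a) set" assume K: "compact K"
    from Gc_nbhd0_D(4)[OF assms(1) K] obtain I d where
      1: "finite I" "d > 0" "{u \<in> Gc_on K. \<forall>j\<in>I. ultra_seminorm K j u < d} \<subseteq> U"
      by (elim exE conjE)
    from Gc_nbhd0_D(4)[OF assms(2) K] obtain J e where
      2: "finite J" "e > 0" "{u \<in> Gc_on K. \<forall>j\<in>J. ultra_seminorm K j u < e} \<subseteq> V"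
      by (elim exE conjE)
    have "{u \<in> Gc_on K. \<forall>j\<in>I \<union> J. ultra_seminorm K j u < min d e} \<subseteq> U \<inter> V"
      using 1(3) 2(3) by auto
    moreover have "finite (I \<union> J)" "min d e > 0" using 1 2 by simp_all
    ultimately show "\<exists>J \<delta>. finite J \<and> \<delta> > 0 \<and>
        {u \<in> Gc_on K. \<forall>j\<in>J. ultra_seminorm K j u < \<delta>} \<subseteq> U \<inter> V"
      by (intro exI conjI)
  qed
qed

lemma istopology_Gc_open: "istopology Gc_open"
  unfolding istopology_def
proof (intro conjI allI impI)
  fix S T :: "'a colombeau set" assume *: "Gc_open S" "Gc_open T"
  show "Gc_open (S \<inter> T)"
    unfolding Gc_open_def
  proof (intro conjI ballI)
    show "S \<inter> T \<subseteq> Gc" using * by (auto simp: Gc_open_def)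
    fix u assume "u \<in> S \<inter> T"
    then obtain U V where "Gc_nbhd0 U" "Gc_nbhd0 V" "(+) u ` U \<subseteq> S" "(+) u ` V \<subseteq> T"
      using * unfolding Gc_open_def by blast
    then show "\<exists>U. Gc_nbhd0 U \<and> (+) u ` U \<subseteq> S \<inter> T"
      by (intro exI[of _ "U \<inter> V"]) (auto simp: Gc_nbhd0_Int)
  qed
next
  fix \<K> :: "'a colombeau set set" assume *: "\<forall>K\<in>\<K>. Gc_open K"
  show "Gc_open (\<Union>\<K>)"
    unfolding Gc_open_def
  proof (intro conjI ballI)
    show "\<Union>\<K> \<subseteq> Gc" using * by (auto simp: Gc_open_def)
    fix u assume "u \<in> \<Union>\<K>"
    then obtain W where "W \<in> \<K>" "u \<in> W" by blast
    with * obtain U where "Gc_nbhd0 U" "(+) u ` U \<subseteq> W" unfolding Gc_open_def by blast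
    with \<open>W \<in> \<K>\<close> show "\<exists>U. Gc_nbhd0 U \<and> (+) u ` U \<subseteq> \<Union>\<K>" by blast
  qed
qed

definition Gc_topology :: "'n::finite colombeau topology" where
  "Gc_topology = topology Gc_open"

text \<open>Functionals on \<open>Gc\<close> are functions on the whole algebra, whose values outside \<open>Gc\<close> are
  irrelevant.\<close>

definition LGc :: "('n::finite colombeau \<Rightarrow> complex gen) set" where
  "LGc = {T. (\<forall>u\<in>Gc. \<forall>v\<in>Gc. T (u + v) = T u + T v) \<and>
             (\<forall>r. \<forall>u\<in>Gc. T (r *\<^sub>G u) = r * T u) \<and>
             continuous_map Gc_topology gen_topology T}"

section \<open>Distributions and basic functionals\<close>

definition test_on :: "(real^'n) set \<Rightarrow> 'n::finite cfun set" where
  "test_on K = {f. smooth f \<and> (\<forall>x. x \<notin> K \<longrightarrow> f x = 0)}"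

definition test_funs :: "'n::finite cfun set" where
  "test_funs = (\<Union>K\<in>Collect compact. test_on K)"

definition linear_on_funs :: "'n::finite cfun set \<Rightarrow> ('n cfun \<Rightarrow> complex) \<Rightarrow> bool" where
  "linear_on_funs S w \<longleftrightarrow> (\<forall>f\<in>S. \<forall>g\<in>S. w (\<lambda>x. f x + g x) = w f + w g) \<and>
     (\<forall>a. \<forall>f\<in>S. w (\<lambda>x. a * f x) = a * w f)"

definition distribution :: "('n::finite cfun \<Rightarrow> complex) \<Rightarrow> bool" where
  "distribution w \<longleftrightarrow> linear_on_funs test_funs w \<and>
     (\<forall>K. compact K \<longrightarrow> (\<exists>C j. \<forall>f\<in>test_on K. norm (w f) \<le> C * seminorm_C K j f))"

definition dirac :: "'n::finite cfun \<Rightarrow> complex" where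
  "dirac f = f 0"

definition basic_net :: "(real \<Rightarrow> 'n::finite cfun \<Rightarrow> complex) \<Rightarrow> bool" where
  "basic_net T_net \<longleftrightarrow> (\<forall>\<epsilon>\<in>{0<..1}. distribution (T_net \<epsilon>)) \<and>
     (\<forall>K. compact K \<longrightarrow> (\<exists>(j::nat) (N::nat) c \<eta>. c > 0 \<and> \<eta> \<in> {0<..1} \<and>
        (\<forall>f\<in>test_on K. \<forall>\<epsilon>\<in>{0<..\<eta>}.
           norm (T_net \<epsilon> f) \<le> c * \<epsilon> powr (- real N) * seminorm_C K j f)))"

definition given_by ::
    "('n::finite colombeau \<Rightarrow> complex gen) \<Rightarrow> (real \<Rightarrow> 'n cfun \<Rightarrow> complex) \<Rightarrow> bool" where
  "given_by T T_net \<longleftrightarrow> basic_net T_net \<and>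
     (\<forall>u\<in>Gc. \<forall>u_net. is_crep_c u_net u \<longrightarrow> is_rep (\<lambda>\<epsilon>. T_net \<epsilon> (u_net \<epsilon>)) (T u))"

definition LGc_basic :: "('n::finite colombeau \<Rightarrow> complex gen) set" where
  "LGc_basic = {T \<in> LGc. \<exists>T_net. given_by T T_net}"

definition iota_d :: "('n::finite cfun \<Rightarrow> complex) \<Rightarrow> 'n colombeau \<Rightarrow> complex gen" where
  "iota_d w u = abs_gen (\<lambda>\<epsilon>. w ((SOME u_net. is_crep_c u_net u) \<epsilon>))"

section \<open>Differential operators with generalized constant coefficients\<close>

text \<open>An operator \<open>P(D)\<close> is given by \<open>m\<close> and a family of coefficients, of which only those with
  \<open>mi_deg \<alpha> \<le> m\<close> matter. Recall \<open>D\<^sup>\<alpha> = (-\<i>)\<^bsup>|\<alpha>|\<^esup> \<partial>\<^sup>\<alpha>\<close>.\<close>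

definition gD :: "('n::finite \<Rightarrow> nat) \<Rightarrow> 'n colombeau \<Rightarrow> 'n colombeau" where
  "gD \<alpha> u = gen_const ((- \<i>) ^ mi_deg \<alpha>) *\<^sub>G gpd \<alpha> u"

definition transpose_op ::
    "nat \<Rightarrow> (('n::finite \<Rightarrow> nat) \<Rightarrow> complex gen) \<Rightarrow> 'n colombeau \<Rightarrow> 'n colombeau" where
  "transpose_op m c u = (\<Sum>\<alpha> | mi_deg \<alpha> \<le> m. ((- 1) ^ mi_deg \<alpha> * c \<alpha>) *\<^sub>G gD \<alpha> u)"

definition apply_op :: "nat \<Rightarrow> (('n::finite \<Rightarrow> nat) \<Rightarrow> complex gen) \<Rightarrow>
    ('n colombeau \<Rightarrow> complex gen) \<Rightarrow> ('n colombeau \<Rightarrow> complex gen)" where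
  "apply_op m c T = (\<lambda>u. T (transpose_op m c u))"

definition fundamental_solution ::
    "nat \<Rightarrow> (('n::finite \<Rightarrow> nat) \<Rightarrow> complex gen) \<Rightarrow> ('n colombeau \<Rightarrow> complex gen) \<Rightarrow> bool" where
  "fundamental_solution m c E \<longleftrightarrow> E \<in> LGc \<and> (\<forall>u\<in>Gc. apply_op m c E u = iota_d dirac u)"

definition symbol :: "nat \<Rightarrow> (('n::finite \<Rightarrow> nat) \<Rightarrow> complex) \<Rightarrow> 'n cfun" where
  "symbol m p \<xi> = (\<Sum>\<alpha> | mi_deg \<alpha> \<le> m. p \<alpha> * of_real (\<Prod>i\<in>UNIV. (\<xi> $ i) ^ \<alpha> i))"

definition tilde :: "nat \<Rightarrow> (('n::finite \<Rightarrow> nat) \<Rightarrow> complex) \<Rightarrow> real^'n \<Rightarrow> real" where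
  "tilde m p \<xi> = sqrt (\<Sum>\<alpha> | mi_deg \<alpha> \<le> m. (norm (pd \<alpha> (symbol m p) \<xi>))\<^sup>2)"

definition poly_rep :: "nat \<Rightarrow> (real \<Rightarrow> ('n::finite \<Rightarrow> nat) \<Rightarrow> complex) \<Rightarrow>
    (('n \<Rightarrow> nat) \<Rightarrow> complex gen) \<Rightarrow> bool" where
  "poly_rep m p c \<longleftrightarrow> (\<forall>\<alpha>. mi_deg \<alpha> \<le> m \<longrightarrow> is_rep (\<lambda>\<epsilon>. p \<epsilon> \<alpha>) (c \<alpha>))"

definition gtilde :: "nat \<Rightarrow> (('n::finite \<Rightarrow> nat) \<Rightarrow> complex gen) \<Rightarrow> real^'n \<Rightarrow> real gen" where
  "gtilde m c \<xi> = abs_gen (\<lambda>\<epsilon>. tilde m (\<lambda>\<alpha>. rep_gen (c \<alpha>) \<epsilon>) \<xi>)"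

section \<open>Tempered distributions and the spaces \<open>B\<^sub>p\<^sub>,\<^sub>k\<close>\<close>

definition seminorm_S :: "nat \<Rightarrow> 'n::finite cfun \<Rightarrow> real" where
  "seminorm_S N f = Sup {(1 + norm x) ^ N * norm (pd \<alpha> f x) |x \<alpha>. mi_deg \<alpha> \<le> N}"

definition schwartz :: "'n::finite cfun set" where
  "schwartz = {f. smooth f \<and>
     (\<forall>N. bdd_above {(1 + norm x) ^ N * norm (pd \<alpha> f x) |x \<alpha>. mi_deg \<alpha> \<le> N})}"

definition tempered :: "('n::finite cfun \<Rightarrow> complex) \<Rightarrow> bool" where
  "tempered w \<longleftrightarrow> linear_on_funs schwartz w \<and>
     (\<exists>C N. \<forall>f\<in>schwartz. norm (w f) \<le> C * seminorm_S N f)"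

definition fourier :: "'n::finite cfun \<Rightarrow> 'n cfun" where
  "fourier f \<xi> = (LINT x|lborel. exp (- \<i> * of_real (x \<bullet> \<xi>)) * f x)"

text \<open>\<open>is_fourier_fun w g\<close>: the Fourier transform \<open>f \<mapsto> w (fourier f)\<close> of the tempered
  distribution \<open>w\<close> is the locally integrable function \<open>g\<close>. It suffices to compare the two
  distributions on test functions. The function \<open>g\<close> is unique up to null sets.\<close>

definition is_fourier_fun :: "('n::finite cfun \<Rightarrow> complex) \<Rightarrow> 'n cfun \<Rightarrow> bool" where
  "is_fourier_fun w g \<longleftrightarrow> g \<in> borel_measurable lebesgue \<and>
     (\<forall>K. compact K \<longrightarrow> set_integrable lebesgue K g) \<and>
     (\<forall>f\<in>test_funs. w (fourier f) = (LINT \<xi>|lebesgue. g \<xi> * f \<xi>))"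

definition Lp_norm :: "ennreal \<Rightarrow> 'n::finite cfun \<Rightarrow> ennreal" where
  "Lp_norm p g =
     (if p = \<infinity> then esssup lebesgue (\<lambda>x. ennreal (norm (g x)))
      else let I = (\<integral>\<^sup>+x. ennreal (norm (g x) powr enn2real p) \<partial>lebesgue)
           in if I = \<infinity> then \<infinity> else ennreal (enn2real I powr (1 / enn2real p)))"

definition B_norm :: "ennreal \<Rightarrow> (real^'n \<Rightarrow> real) \<Rightarrow> ('n::finite cfun \<Rightarrow> complex) \<Rightarrow> ennreal" where
  "B_norm p k w = ennreal ((2 * pi) powr (- real CARD('n))) *
     Lp_norm p (\<lambda>\<xi>. of_real (k \<xi>) * (SOME g. is_fourier_fun w g) \<xi>)"

text \<open>These spaces are of interest for tempered weight functions \<open>k\<close>, but the definition makes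
  sense for arbitrary \<open>k\<close>. This matters because a net \<open>(P\<^sub>\<epsilon>)\<close> representing a nonzero
  generalized polynomial may have \<open>P\<^sub>\<epsilon> = 0\<close> (hence \<open>tilde\<close> identically \<open>0\<close>) for \<open>\<epsilon>\<close> away
  from \<open>0\<close>; whenever \<open>P\<^sub>\<epsilon> \<noteq> 0\<close>, its \<open>tilde\<close> is a tempered weight function.\<close>

definition B_space :: "ennreal \<Rightarrow> (real^'n \<Rightarrow> real) \<Rightarrow> ('n::finite cfun \<Rightarrow> complex) set" where
  "B_space p k = {w. tempered w \<and> (\<exists>g. is_fourier_fun w g) \<and> B_norm p k w < \<infinity>}"

definition mult_dist ::
    "(real^'n \<Rightarrow> real) \<Rightarrow> ('n::finite cfun \<Rightarrow> complex) \<Rightarrow> ('n cfun \<Rightarrow> complex)" where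
  "mult_dist a w = (\<lambda>f. w (\<lambda>x. of_real (a x) * f x))"

text \<open>A distribution (functional on test functions) is identified with the tempered distribution
  (functional on Schwartz functions) extending it; by density there is at most one.\<close>

definition extends_dist :: "('n::finite cfun \<Rightarrow> complex) \<Rightarrow> ('n cfun \<Rightarrow> complex) \<Rightarrow> bool" where
  "extends_dist w v \<longleftrightarrow> (\<forall>f\<in>test_funs. w f = v f)"

end

theory Submission
  imports
    Defs
    "HOL-Complex_Analysis.Complex_Analysis"
    "HOL-Probability.Probability"
    "HOL-Computational_Algebra.Fundamental_Theorem_Algebra"
begin

text \<open>For a single polynomial \<open>P \<noteq> 0\<close> a fundamental solution is
  \<open>E(u) = (2 \<pi>)\<^sup>-\<^sup>n \<integral> \<integral>\<^sub>0\<^sup>1 F(\<zeta>) / P(\<zeta>) dt d\<xi>\<close> with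
  \<open>F(\<zeta>) = \<integral> exp(\<i> x\<zeta>) u(x) dx\<close> and \<open>\<zeta> = \<xi> + exp(2 \<pi> \<i> t) v(\<xi>)\<close>: replacing \<open>u\<close> by \<open>\<^sup>tP(D)u\<close> cancels
  \<open>P(\<zeta>)\<close>, and the mean value property followed by Fourier inversion yields \<open>u(0)\<close>. The shift
  \<open>v(\<xi>)\<close> is chosen from a finite set of small vectors, depending only on \<open>n\<close>, \<open>m\<close> and a radius, such
  that \<open>|P(\<zeta>)| \<ge> c tilde(\<xi>)\<close> on the whole circle: interpolation on a grid supplies a
  direction in which \<open>P\<close> is large somewhere, and among \<open>m + 1\<close> radii one avoids the at most \<open>m\<close> roots of
  the restriction of \<open>P\<close> to that complex line. The function \<open>1 / cosh(a|x|)\<close> extends holomorphically to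
  a neighbourhood of \<open>\<real>\<^sup>n\<close>, and shifting contours shows that its Fourier--Laplace transform decays fast; as
  \<open>tilde\<close> varies slowly, the Fourier transform of \<open>E / cosh(a|x|)\<close> is bounded by a constant multiple of
  \<open>1 / tilde\<close>. All constants depend on \<open>n\<close>, \<open>m\<close>, \<open>a\<close> only, so the construction applies to each \<open>P\<^sub>\<epsilon>\<close>,
  and invertibility of the generalized weight at one point provides moderateness in \<open>\<epsilon>\<close>. Where
  \<open>P\<^sub>\<epsilon> = 0\<close> the net is set to \<open>0\<close>.\<close>

section \<open>Smooth functions and cutoffs\<close>

text \<open>The obstacle is uniformity in \<epsilon>: leading coefficients of P_\<epsilon> may tend
  to 0, so neither a fixed noncharacteristic direction nor division by the principal part gives
  constants independent of \<epsilon>. The weight \<open>tilde\<close> counts all derivatives and is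
  immune to this, at the price of a shift that depends on P and on \<xi>. Taking it from a finite
  set fixed by n, m and a makes the choice measurable and the constants common to all P. The radius
  a/2 spends half of the decay of 1/cosh(a|x|) on the growth of exp(i x \<zeta>); the other half
  keeps the integrals convergent. E is built from complex frequencies and may grow exponentially,
  hence the division by cosh. In the recurring exponent m + 2n, m powers pay for the variation of
  \<open>tilde\<close> and 2n for integrability. In the bound for the Fourier transform of
  E/cosh(a|x|), weights at \<xi> and \<eta> are only compared with each other, so the size of P
  cancels. In the bound for E on test functions a factor 1/\<open>tilde\<close>(0) remains; this is
  where invertibility enters, carried from \<xi>_0 to 0 by slow variation.\<close>

lemma smooth_coinduct:
  assumes "f \<in> C"
    and cont: "\<And>f. f \<in> C \<Longrightarrow> continuous_on UNIV f"
    and deriv: "\<And>f i. f \<in> C \<Longrightarrow>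
      \<exists>g\<in>C. \<forall>x. ((\<lambda>t. f (x + t *\<^sub>R axis i 1)) has_vector_derivative g x) (at 0)"
  shows "smooth f"
proof -
  \<comment> \<open>Iterated partial derivatives never leave a class closed under single ones. Each
    closure property below therefore only needs a suitable class and one differentiation rule, with
    no induction over words of derivatives.\<close>
  have "foldr dpart is f \<in> C" for "is"
  proof (induction "is")
    case (Cons i js)
    then obtain g where g: "g \<in> C"
      "\<And>x. ((\<lambda>t. foldr dpart js f (x + t *\<^sub>R axis i 1)) has_vector_derivative g x) (at 0)"
      using deriv by blast
    have "dpart i (foldr dpart js f) = g"
      by (auto simp: dpart_def fun_eq_iff intro!: vector_derivative_at g)
    with g show ?case by simp
  qed (use assms in simp)
  then show ?thesis
    unfolding smooth_def using cont deriv differentiableI_vector by blast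
qed

lemma dpart_eqI:
  assumes "\<And>x. ((\<lambda>t. f (x + t *\<^sub>R axis i 1)) has_vector_derivative g x) (at 0)"
  shows "dpart i f = g"
  by (auto simp: dpart_def fun_eq_iff intro!: vector_derivative_at assms)

lemma dpart_has_vector_derivative0:
  "smooth f \<Longrightarrow> ((\<lambda>t. f (x + t *\<^sub>R axis i 1)) has_vector_derivative dpart i f x) (at 0)"
  using dpart_has_vector_derivative[of f x i 0] by simp

text \<open>The product rule leads from one product to a sum of two, so finite sums of products are
  the class that \<open>smooth_coinduct\<close> asks for.\<close>

inductive_set product_sums :: "'n::finite cfun set" where
  base: "smooth f \<Longrightarrow> smooth g \<Longrightarrow> (\<lambda>x. f x * g x) \<in> product_sums"
| add: "u \<in> product_sums \<Longrightarrow> v \<in> product_sums \<Longrightarrow> (\<lambda>x. u x + v x) \<in> product_sums"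

lemma smooth_mult:
  assumes "smooth f" "smooth g" shows "smooth (\<lambda>x. f x * g x)"
proof (rule smooth_coinduct)
  show "(\<lambda>x. f x * g x) \<in> product_sums" by (intro product_sums.base assms)
  fix h :: "'a cfun" assume "h \<in> product_sums"
  then show "continuous_on UNIV h"
    by induction (auto intro!: continuous_intros dest: smooth_imp(1))
next
  fix h :: "'a cfun" and i assume "h \<in> product_sums"
  then show "\<exists>g\<in>product_sums. \<forall>x. ((\<lambda>t. h (x + t *\<^sub>R axis i 1)) has_vector_derivative g x) (at 0)"
  proof induction
    case (base f g)
    show ?case
    proof (intro bexI allI)
      show "(\<lambda>x. f x * dpart i g x + dpart i f x * g x) \<in> product_sums"
        by (intro product_sums.intros smooth_dpart base)
      fix x
      show "((\<lambda>t. f (x + t *\<^sub>R axis i 1) * g (x + t *\<^sub>R axis i 1)) has_vector_derivative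
          f x * dpart i g x + dpart i f x * g x) (at 0)"
        using has_vector_derivative_mult[OF dpart_has_vector_derivative0[OF base(1)] dpart_has_vector_derivative0[OF base(2)], of x i x i]
        by simp
    qed
  next
    case (add u v)
    then obtain g1 g2 where "g1 \<in> product_sums" "g2 \<in> product_sums"
      "\<forall>x. ((\<lambda>t. u (x + t *\<^sub>R axis i 1)) has_vector_derivative g1 x) (at 0)"
      "\<forall>x. ((\<lambda>t. v (x + t *\<^sub>R axis i 1)) has_vector_derivative g2 x) (at 0)" by blast
    then show ?case
      by (intro bexI[of _ "\<lambda>x. g1 x + g2 x"] allI product_sums.add)
         (auto intro!: has_vector_derivative_add)
  qed
qed

lemma dpart_mult:
  assumes "smooth f" "smooth g"
  shows "dpart i (\<lambda>x. f x * g x) = (\<lambda>x. f x * dpart i g x + dpart i f x * g x)"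
proof (rule dpart_eqI)
  fix x
  show "((\<lambda>t. f (x + t *\<^sub>R axis i 1) * g (x + t *\<^sub>R axis i 1)) has_vector_derivative
      f x * dpart i g x + dpart i f x * g x) (at 0)"
    using has_vector_derivative_mult[OF dpart_has_vector_derivative0[OF assms(1)] dpart_has_vector_derivative0[OF assms(2)], of x i x i]
    by simp
qed

lemma smooth_const [simp]: "smooth (\<lambda>_::real^'n::finite. c)"
proof (rule smooth_coinduct)
  show "(\<lambda>_. c) \<in> range (\<lambda>c (_::real^'n). c)" by simp
qed (auto intro!: exI[of _ 0])

lemma axis_nth_of_real: "axis i (1::real) $ j = (if i = j then 1 else 0)"
  by (auto simp: axis_def)

lemma coord_has_vector_derivative:
  "((\<lambda>t. complex_of_real ((x + t *\<^sub>R axis i 1) $ j)) has_vector_derivative (if i = j then 1 else 0)) (at s)"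
proof -
  have "((\<lambda>t. (x + t *\<^sub>R axis i 1) $ j) has_real_derivative (if i = j then 1 else 0)) (at s)"
    by (cases "i = j") (auto simp: axis_nth_of_real intro!: derivative_eq_intros)
  from has_vector_derivative_of_real[OF this] show ?thesis by (auto split: if_splits)
qed

lemma smooth_coord: "smooth (\<lambda>x::real^'n::finite. complex_of_real (x $ j))"
proof (rule smooth_coinduct)
  let ?C = "insert (\<lambda>x::real^'n. complex_of_real (x $ j)) {f. smooth f}"
  show "(\<lambda>x. complex_of_real (x $ j)) \<in> ?C" by simp
  show "continuous_on UNIV f" if "f \<in> ?C" for f
    using that by (auto intro!: continuous_intros dest: smooth_imp(1))
  fix f i assume "f \<in> ?C"
  then show "\<exists>g\<in>?C. \<forall>x. ((\<lambda>t. f (x + t *\<^sub>R axis i 1)) has_vector_derivative g x) (at 0)"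
  proof
    assume "f = (\<lambda>x. complex_of_real (x $ j))"
    then show ?thesis
      using coord_has_vector_derivative[of _ i j 0]
      by (intro bexI[of _ "\<lambda>_. if i = j then 1 else 0"]) auto
  next
    assume "f \<in> {f. smooth f}"
    then have "smooth f" by simp
    then show ?thesis
      by (intro bexI[of _ "dpart i f"] allI dpart_has_vector_derivative0) (auto intro: smooth_dpart)
  qed
qed

lemma smooth_sum: "(\<And>i. i \<in> I \<Longrightarrow> smooth (f i)) \<Longrightarrow> smooth (\<lambda>x. \<Sum>i\<in>I. f i x)"
  by (induction I rule: infinite_finite_induct) (auto intro: smooth_add)

lemma smooth_prod: "(\<And>i. i \<in> I \<Longrightarrow> smooth (f i)) \<Longrightarrow> smooth (\<lambda>x. \<Prod>i\<in>I. f i x)"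
  by (induction I rule: infinite_finite_induct) (auto intro: smooth_mult)

lemma smooth_power: "smooth f \<Longrightarrow> smooth (\<lambda>x. f x ^ k)"
  by (induction k) (auto intro: smooth_mult)

lemma pd_sum:
  assumes "\<And>i. i \<in> I \<Longrightarrow> smooth (f i)"
  shows "pd \<alpha> (\<lambda>x. \<Sum>i\<in>I. f i x) = (\<lambda>x. \<Sum>i\<in>I. pd \<alpha> (f i) x)"
  using assms by (induction I rule: infinite_finite_induct) (simp_all add: pd_add smooth_sum)

section \<open>Smooth functions of one real variable and a smooth step\<close>

coinductive smooth_real :: "(real \<Rightarrow> real) \<Rightarrow> bool" where
  "(\<And>t. (f has_real_derivative g t) (at t)) \<Longrightarrow> smooth_real g \<Longrightarrow> smooth_real f"

lemma smooth_real_deriv: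
  "smooth_real f \<Longrightarrow> \<exists>g. smooth_real g \<and> (\<forall>t. (f has_real_derivative g t) (at t))"
  by (erule smooth_real.cases) metis

lemma smooth_realI:
  assumes "f \<in> C"
    and "\<And>f. f \<in> C \<Longrightarrow> \<exists>g\<in>C. \<forall>t. (f has_real_derivative g t) (at t)"
  shows "smooth_real f"
  using assms(1)
proof (coinduction arbitrary: f)
  case smooth_real
  then show ?case using assms(2) by metis
qed

inductive_set real_product_sums :: "(real \<Rightarrow> real) set" where
  base: "smooth_real f \<Longrightarrow> smooth_real g \<Longrightarrow> (\<lambda>x. f x * g x) \<in> real_product_sums"
| add: "u \<in> real_product_sums \<Longrightarrow> v \<in> real_product_sums \<Longrightarrow> (\<lambda>x. u x + v x) \<in> real_product_sums"

lemma smooth_real_mult: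
  assumes "smooth_real f" "smooth_real g" shows "smooth_real (\<lambda>x. f x * g x)"
proof (rule smooth_realI)
  show "(\<lambda>x. f x * g x) \<in> real_product_sums" by (intro real_product_sums.base assms)
  fix h :: "real \<Rightarrow> real" assume "h \<in> real_product_sums"
  then show "\<exists>g\<in>real_product_sums. \<forall>t. (h has_real_derivative g t) (at t)"
  proof induction
    case (base f g)
    obtain f' where "smooth_real f'" "\<And>t. (f has_real_derivative f' t) (at t)"
      using smooth_real_deriv[OF base(1)] by auto
    moreover obtain g' where "smooth_real g'" "\<And>t. (g has_real_derivative g' t) (at t)"
      using smooth_real_deriv[OF base(2)] by auto
    ultimately show ?case using base
      by (intro bexI[of _ "\<lambda>x. f' x * g x + g' x * f x"] allI real_product_sums.intros DERIV_mult)
  next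
    case (add u v)
    then obtain u' v' where "u' \<in> real_product_sums" "\<And>t. (u has_real_derivative u' t) (at t)"
      "v' \<in> real_product_sums" "\<And>t. (v has_real_derivative v' t) (at t)" by auto
    then show ?case by (intro bexI[of _ "\<lambda>x. u' x + v' x"] allI real_product_sums.add DERIV_add)
  qed
qed

lemma smooth_real_add:
  assumes "smooth_real f" "smooth_real g" shows "smooth_real (\<lambda>x. f x + g x)"
proof (rule smooth_realI)
  let ?C = "{(\<lambda>x. f x + g x) | f g. smooth_real f \<and> smooth_real g}"
  show "(\<lambda>x. f x + g x) \<in> ?C" using assms by blast
  fix h assume "h \<in> ?C"
  then obtain f g where h: "h = (\<lambda>x. f x + g x)" "smooth_real f" "smooth_real g" by blast
  obtain f' where "smooth_real f'" "\<And>t. (f has_real_derivative f' t) (at t)"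
    using smooth_real_deriv[OF h(2)] by auto
  moreover obtain g' where "smooth_real g'" "\<And>t. (g has_real_derivative g' t) (at t)"
    using smooth_real_deriv[OF h(3)] by auto
  ultimately show "\<exists>g\<in>?C. \<forall>t. (h has_real_derivative g t) (at t)"
    unfolding h(1) by (intro bexI[of _ "\<lambda>x. f' x + g' x"] allI DERIV_add) auto
qed

lemma smooth_real_affine:
  assumes "smooth_real f" shows "smooth_real (\<lambda>x. f (a * x + b))"
proof (rule smooth_realI)
  let ?C = "{(\<lambda>x. c * f (a * x + b)) | f c. smooth_real f}"
  show "(\<lambda>x. f (a * x + b)) \<in> ?C" using assms by (auto intro!: exI[of _ f] exI[of _ 1])
  fix h assume "h \<in> ?C"
  then obtain f c where h: "h = (\<lambda>x. c * f (a * x + b))" "smooth_real f" by blast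
  obtain f' where f': "smooth_real f'" "\<And>t. (f has_real_derivative f' t) (at t)"
    using smooth_real_deriv[OF h(2)] by auto
  have "((\<lambda>x. f (a * x + b)) has_real_derivative f' (a * t + b) * a) (at t)" for t
    by (rule DERIV_chain2[OF f'(2)]) (auto intro!: derivative_eq_intros)
  from DERIV_cmult[OF this]
  have "((\<lambda>x. c * f (a * x + b)) has_real_derivative (c * a) * f' (a * t + b)) (at t)" for t
    by (simp only: mult.assoc mult.commute[of _ a] mult.left_commute[of a])
  then show "\<exists>g\<in>?C. \<forall>t. (h has_real_derivative g t) (at t)"
    unfolding h(1) using f'(1) by (intro bexI[of _ "\<lambda>x. (c * a) * f' (a * x + b)"] allI) auto
qed

lemma smooth_real_const: "smooth_real (\<lambda>_. c)"
  by (rule smooth_realI[where C = "range (\<lambda>c t. c)"]) (auto intro!: exI[of _ 0])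

lemma smooth_real_divide:
  assumes "smooth_real f" "smooth_real g" "\<And>x. g x \<noteq> 0"
  shows "smooth_real (\<lambda>x. f x / g x)"
proof (rule smooth_realI)
  \<comment> \<open>The exponent k is part of the class because the quotient rule maps f / g^k to
    (f' g - k f g') / g^(k+1): the numerator stays smooth and only the power of g grows.\<close>
  let ?C = "{(\<lambda>x. f x / g x ^ k) | f k. smooth_real f}"
  show "(\<lambda>x. f x / g x) \<in> ?C" using assms by (auto intro!: exI[of _ f] exI[of _ 1])
  fix h assume "h \<in> ?C"
  then obtain f k where h: "h = (\<lambda>x. f x / g x ^ k)" "smooth_real f" by blast
  obtain f' where f': "smooth_real f'" "\<And>t. (f has_real_derivative f' t) (at t)"
    using smooth_real_deriv[OF h(2)] by auto
  obtain g' where g': "smooth_real g'" "\<And>t. (g has_real_derivative g' t) (at t)"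
    using smooth_real_deriv[OF assms(2)] by auto
  have "((\<lambda>x. f x / g x ^ k) has_real_derivative
      (f' t * g t + (- real k) * (f t * g' t)) / g t ^ Suc k) (at t)" for t
  proof (cases k)
    case 0 then show ?thesis using f'(2)[of t] assms(3)[of t] by simp
  next
    case (Suc l)
    show ?thesis
      by (rule derivative_eq_intros f' g' refl)+ (use assms(3)[of t] in \<open>auto simp: Suc field_simps\<close>)
  qed
  moreover have "smooth_real (\<lambda>t. f' t * g t + (- real k) * (f t * g' t))"
    by (intro smooth_real_add smooth_real_mult f' g' h assms smooth_real_const)
  ultimately show "\<exists>g\<in>?C. \<forall>t. (h has_real_derivative g t) (at t)"
    unfolding h(1)
    by (intro bexI[of _ "\<lambda>t. (f' t * g t + (- real k) * (f t * g' t)) / g t ^ Suc k"])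
       (simp, unfold mem_Collect_eq, intro exI conjI, rule refl)
qed

text \<open>The functions \<open>flat q\<close> contain \<open>exp (- 1 / t)\<close>, cut off at \<open>0\<close>, and are closed under
  differentiation.\<close>

definition flat :: "real poly \<Rightarrow> real \<Rightarrow> real" where
  "flat q t = (if t > 0 then poly q (1 / t) * exp (- (1 / t)) else 0)"

lemma poly_exp_tendsto_0: "((\<lambda>x::real. poly q x * exp (- x)) \<longlongrightarrow> 0) at_top"
proof -
  \<comment> \<open>The additional power of x is what makes the induction close: passing from q to
    \<open>pCons a q\<close> moves one factor x from the polynomial into it.\<close>
  have "((\<lambda>x::real. x ^ k * poly q x * exp (- x)) \<longlongrightarrow> 0) at_top" for k
  proof (induction q arbitrary: k)
    case (pCons a q)
    have "((\<lambda>x::real. a * (x ^ k / exp x) + x ^ Suc k * poly q x * exp (- x)) \<longlongrightarrow> a * 0 + 0) at_top"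
      by (intro tendsto_add tendsto_mult tendsto_const tendsto_power_div_exp_0 pCons)
    then show ?case by (simp add: algebra_simps exp_minus divide_inverse)
  qed simp
  from this[of 0] show ?thesis by simp
qed

lemma flat_tendsto_0: "(flat q \<longlongrightarrow> 0) (at 0)"
proof (rule filterlim_split_at)
  have "((\<lambda>t. poly q (inverse t) * exp (- inverse t)) \<longlongrightarrow> 0) (at_right 0)"
    using poly_exp_tendsto_0 filterlim_inverse_at_top_right by (rule filterlim_compose)
  moreover have "eventually (\<lambda>t. poly q (inverse t) * exp (- inverse t) = flat q t) (at_right 0)"
    using eventually_at_right_less[of 0] by eventually_elim (simp add: flat_def divide_inverse)
  ultimately show "(flat q \<longlongrightarrow> 0) (at_right 0)" by (rule Lim_transform_eventually)
  have "eventually (\<lambda>t::real. t < 0) (at_left 0)"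
    by (simp add: eventually_at_filter)
  then have "eventually (\<lambda>t. 0 = flat q t) (at_left 0)"
    by eventually_elim (simp add: flat_def)
  then show "(flat q \<longlongrightarrow> 0) (at_left 0)" by (rule Lim_transform_eventually[OF tendsto_const])
qed

text \<open>With s = 1/t, the derivative of q(s) exp(-s) with respect to t is s^2 (q - q')(s)
  exp(-s), and \<open>[:0, 0, 1:]\<close> is the factor s^2. At t = 0 the difference quotient is
  itself \<open>flat\<close> of s q(s), which tends to 0 from both sides.\<close>

lemma flat_has_derivative:
  "(flat q has_real_derivative flat ([:0, 0, 1:] * (q - pderiv q)) t) (at t)"
proof -
  consider "t > 0" | "t < 0" | "t = 0" by linarith
  then show ?thesis
  proof cases
    case 1
    have inv: "((\<lambda>t. 1 / t) has_real_derivative - (1 / t ^ 2)) (at t)"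
      using 1 by (auto intro!: derivative_eq_intros simp: power2_eq_square)
    have "((\<lambda>t. poly q (1 / t) * exp (- (1 / t))) has_real_derivative
        poly (pderiv q) (1 / t) * (- (1 / t ^ 2)) * exp (- (1 / t)) +
        exp (- (1 / t)) * (- (- (1 / t ^ 2))) * poly q (1 / t)) (at t)"
      by (intro DERIV_mult DERIV_chain2[OF poly_DERIV] DERIV_chain2[OF DERIV_exp] DERIV_minus inv)
    also have "poly (pderiv q) (1 / t) * (- (1 / t ^ 2)) * exp (- (1 / t)) +
        exp (- (1 / t)) * (- (- (1 / t ^ 2))) * poly q (1 / t) = flat ([:0, 0, 1:] * (q - pderiv q)) t"
      using 1 by (simp add: flat_def power2_eq_square algebra_simps)
    finally have "((\<lambda>t. poly q (1 / t) * exp (- (1 / t))) has_real_derivative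
        flat ([:0, 0, 1:] * (q - pderiv q)) t) (at t)" .
    then show ?thesis
      by (rule has_field_derivative_transform_within_open[where S = "{0<..}"])
         (use 1 in \<open>auto simp: flat_def\<close>)
  next
    case 2
    have "((\<lambda>t. 0) has_real_derivative flat ([:0, 0, 1:] * (q - pderiv q)) t) (at t)"
      using 2 by (auto simp: flat_def)
    then show ?thesis
      by (rule has_field_derivative_transform_within_open[where S = "{..<0}"])
         (use 2 in \<open>auto simp: flat_def\<close>)
  next
    case 3
    have "(\<lambda>h. (flat q (0 + h) - flat q 0) / h) = flat ([:0, 1:] * q)"
      by (auto simp: flat_def fun_eq_iff)
    then show ?thesis
      using flat_tendsto_0[of "[:0, 1:] * q"] 3 by (simp add: DERIV_def flat_def)
  qed
qed

lemma smooth_real_flat: "smooth_real (flat q)"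
  by (rule smooth_realI[where C = "range flat"]) (use flat_has_derivative in blast)+

text \<open>The quotient f(t) / (f(t) + f(1 - t)) with f(t) = exp(-1/t) for t > 0 and 0 otherwise.
  The denominator is positive because t > 0 or t < 1.\<close>

lemma smooth_real_step:
  "\<exists>r. smooth_real r \<and> (\<forall>t. 0 \<le> r t \<and> r t \<le> 1) \<and> (\<forall>t\<le>0. r t = 0) \<and> (\<forall>t\<ge>1. r t = 1)"
proof (intro exI conjI allI impI)
  let ?f = "flat 1" and ?g = "\<lambda>t. flat 1 ((-1) * t + 1)"
  have pos: "?f t + ?g t > 0" for t :: real
    by (cases "t > 0"; cases "t < 1") (simp_all add: flat_def add_pos_pos)
  show "smooth_real (\<lambda>t. ?f t / (?f t + ?g t))"
    by (intro smooth_real_divide smooth_real_add smooth_real_affine smooth_real_flat)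
      (rule pos[THEN less_imp_neq, symmetric])
  have nn: "?f t \<ge> 0" "?g t \<ge> 0" for t by (auto simp: flat_def)
  show "0 \<le> ?f t / (?f t + ?g t)" for t using nn pos[of t] by (intro divide_nonneg_pos)
  show "?f t / (?f t + ?g t) \<le> 1" for t
    using nn[of t] pos[of t] by (subst pos_divide_le_eq) simp_all
  show "?f t / (?f t + ?g t) = 0" if "t \<le> 0" for t using that by (simp add: flat_def)
  show "?f t / (?f t + ?g t) = 1" if "t \<ge> 1" for t using that pos[of t] by (simp add: flat_def)
qed

text \<open>The chain rule for h(q x) produces the factor dq(x) besides h'(q x); the coefficient f
  collects such factors.\<close>

inductive_set comp_sums :: "(real^'n \<Rightarrow> real) \<Rightarrow> 'n::finite cfun set" for q where
  base: "smooth f \<Longrightarrow> smooth_real h \<Longrightarrow> (\<lambda>x. f x * of_real (h (q x))) \<in> comp_sums q"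
| add: "u \<in> comp_sums q \<Longrightarrow> v \<in> comp_sums q \<Longrightarrow> (\<lambda>x. u x + v x) \<in> comp_sums q"

lemma smooth_real_imp_continuous: "smooth_real h \<Longrightarrow> continuous_on UNIV h"
  using smooth_real_deriv by (meson DERIV_continuous_on DERIV_subset subset_UNIV)

lemma smooth_compose:
  assumes q: "smooth (\<lambda>x. of_real (q x))" and h: "smooth_real h"
  shows "smooth (\<lambda>x. of_real (h (q x)))"
proof (rule smooth_coinduct)
  have "(\<lambda>x. 1 * of_real (h (q x))) \<in> comp_sums q" by (intro comp_sums.base h smooth_const)
  then show "(\<lambda>x. of_real (h (q x))) \<in> comp_sums q" by simp
  have cq: "continuous_on UNIV q"
    using continuous_on_Re[OF smooth_imp(1)[OF q]] by simp
  fix u :: "'a cfun" assume "u \<in> comp_sums q"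
  then show "continuous_on UNIV u"
  proof induction
    case (base f h)
    have "continuous_on UNIV (\<lambda>x. h (q x))"
      by (rule continuous_on_compose2[OF smooth_real_imp_continuous[OF base(2)] cq]) auto
    then show ?case using smooth_imp(1)[OF base(1)] by (intro continuous_intros)
  qed (intro continuous_intros)
next
  fix u :: "'a cfun" and i assume "u \<in> comp_sums q"
  then show "\<exists>g\<in>comp_sums q. \<forall>x. ((\<lambda>t. u (x + t *\<^sub>R axis i 1)) has_vector_derivative g x) (at 0)"
  proof induction
    case (base f h)
    obtain h' where h': "smooth_real h'" "\<And>t. (h has_real_derivative h' t) (at t)"
      using smooth_real_deriv[OF base(2)] by auto
    let ?dq = "dpart i (\<lambda>x. of_real (q x))"
    show ?case
    proof (intro bexI allI)
      show "(\<lambda>x. (f x * ?dq x) * of_real (h' (q x)) + dpart i f x * of_real (h (q x))) \<in> comp_sums q"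
        by (intro comp_sums.intros smooth_dpart smooth_mult base h' q)
      fix x
      have dq: "((\<lambda>t. complex_of_real (q (x + t *\<^sub>R axis i 1))) has_vector_derivative ?dq x) (at 0)"
        by (rule dpart_has_vector_derivative0[OF q])
      then have dqr: "((\<lambda>t. q (x + t *\<^sub>R axis i 1)) has_real_derivative Re (?dq x)) (at 0)"
        using bounded_linear.has_vector_derivative[OF bounded_linear_Re dq]
        by (simp add: has_real_derivative_iff_has_vector_derivative)
      \<comment> \<open>The derivative of a real-valued function is real, although
        \<open>?dq\<close> is complex by its type. This identifies \<open>?dq x\<close> with its
        real part, as the real chain rule requires.\<close>
      have "((\<lambda>t. complex_of_real (q (x + t *\<^sub>R axis i 1))) has_vector_derivative of_real (Re (?dq x))) (at 0)"
        by (rule has_vector_derivative_of_real[OF dqr])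
      then have re: "of_real (Re (?dq x)) = ?dq x"
        using dq vector_derivative_unique_at by blast
      have "((\<lambda>t. h (q (x + t *\<^sub>R axis i 1))) has_real_derivative h' (q (x + 0 *\<^sub>R axis i 1)) * Re (?dq x)) (at 0)"
        using DERIV_chain2[OF h'(2) dqr] .
      then have "((\<lambda>t. complex_of_real (h (q (x + t *\<^sub>R axis i 1)))) has_vector_derivative
          of_real (h' (q x)) * of_real (Re (?dq x))) (at 0)"
        using has_vector_derivative_of_real by force
      from has_vector_derivative_mult[OF dpart_has_vector_derivative0[OF base(1)] this, of x]
      show "((\<lambda>t. f (x + t *\<^sub>R axis i 1) * of_real (h (q (x + t *\<^sub>R axis i 1)))) has_vector_derivative
        (f x * ?dq x) * of_real (h' (q x)) + dpart i f x * of_real (h (q x))) (at 0)"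
        by (simp add: re mult_ac)
    qed
  next
    case (add u v)
    then obtain g1 g2 where "g1 \<in> comp_sums q" "g2 \<in> comp_sums q"
      "\<forall>x. ((\<lambda>t. u (x + t *\<^sub>R axis i 1)) has_vector_derivative g1 x) (at 0)"
      "\<forall>x. ((\<lambda>t. v (x + t *\<^sub>R axis i 1)) has_vector_derivative g2 x) (at 0)" by blast
    then show ?case
      by (intro bexI[of _ "\<lambda>x. g1 x + g2 x"] allI comp_sums.add)
         (auto intro!: has_vector_derivative_add)
  qed
qed

lemma smooth_ball_bump:
  fixes y :: "real^'n::finite"
  assumes "\<delta> > 0"
  shows "\<exists>b. smooth (\<lambda>x. of_real (b x)) \<and> (\<forall>x. 0 \<le> b x \<and> b x \<le> 1) \<and>
    (\<forall>x. dist x y \<le> \<delta> / 2 \<longrightarrow> b x = 1) \<and> (\<forall>x. dist x y \<ge> \<delta> \<longrightarrow> b x = 0)"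
proof -
  obtain r where r: "smooth_real r" "\<And>t. 0 \<le> r t \<and> r t \<le> 1" "\<And>t. t \<le> 0 \<Longrightarrow> r t = 0" "\<And>t. t \<ge> 1 \<Longrightarrow> r t = 1"
    using smooth_real_step by blast
  \<comment> \<open>The squared distance is a polynomial and hence smooth also at y. The scaling
    makes q equal to 1 at distance \<delta>/2, since \<delta>^2 - (\<delta>/2)^2 = 3 \<delta>^2 / 4,
    and 0 at distance \<delta>.\<close>
  define q where "q x = (\<delta>\<^sup>2 - (dist x y)\<^sup>2) * (4 / (3 * \<delta>\<^sup>2))" for x
  have d: "(dist x y)\<^sup>2 = (\<Sum>i\<in>UNIV. (x $ i - y $ i)\<^sup>2)" for x
    by (simp add: dist_vec_def L2_set_def dist_real_def sum_nonneg)
  have "(\<lambda>x. complex_of_real (q x)) = (\<lambda>x. (of_real (4 / (3 * \<delta>\<^sup>2)) * (of_real (\<delta>\<^sup>2) -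
      (\<Sum>i\<in>UNIV. (of_real (x $ i) - of_real (y $ i))\<^sup>2))))"
    by (simp add: q_def d mult.commute)
  moreover have "smooth \<dots>"
    by (intro smooth_cmult smooth_diff smooth_sum smooth_power smooth_const smooth_coord)
  ultimately have "smooth (\<lambda>x. complex_of_real (q x))" by (simp only:)
  then have sm: "smooth (\<lambda>x. of_real (r (q x)))" by (rule smooth_compose) (rule r)
  have in1: "r (q x) = 1" if "dist x y \<le> \<delta> / 2" for x
  proof (rule r(4))
    have "(dist x y)\<^sup>2 \<le> (\<delta> / 2)\<^sup>2" using that by (intro power_mono) auto
    then have "3 * \<delta>\<^sup>2 / 4 \<le> \<delta>\<^sup>2 - (dist x y)\<^sup>2" by (simp add: power_divide)
    then have "(3 * \<delta>\<^sup>2 / 4) * (4 / (3 * \<delta>\<^sup>2)) \<le> q x"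
      unfolding q_def by (intro mult_right_mono) auto
    then show "1 \<le> q x" using assms by simp
  qed
  have out0: "r (q x) = 0" if "dist x y \<ge> \<delta>" for x
  proof (rule r(3))
    have "\<delta>\<^sup>2 \<le> (dist x y)\<^sup>2" using that assms by (intro power_mono) auto
    then show "q x \<le> 0" using assms unfolding q_def by (intro mult_nonpos_nonneg) auto
  qed
  show ?thesis
    by (intro exI[of _ "\<lambda>x. r (q x)"] conjI allI impI sm in1 out0) (use r(2) in blast)+
qed

lemma smooth_cutoff:
  fixes K :: "(real^'n::finite) set"
  assumes "compact K" "\<delta> > 0"
  obtains b V where "smooth (\<lambda>x. of_real (b x))" "\<And>x. 0 \<le> b x \<and> b x \<le> 1"
    "open V" "K \<subseteq> V" "\<And>x. x \<in> V \<Longrightarrow> b x = 1"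
    "\<And>x. b x \<noteq> 0 \<Longrightarrow> \<exists>y\<in>K. dist x y < \<delta>"
proof -
  have "K \<subseteq> (\<Union>y\<in>K. ball y (\<delta> / 2))" using assms by auto
  from compactE_image[OF assms(1) _ this] obtain T
    where T: "T \<subseteq> K" "finite T" "K \<subseteq> (\<Union>y\<in>T. ball y (\<delta> / 2))" by auto
  have "\<exists>b. smooth (\<lambda>x. of_real (b x)) \<and> (\<forall>x. 0 \<le> b x \<and> b x \<le> 1) \<and>
    (\<forall>x. dist x y \<le> \<delta> / 2 \<longrightarrow> b x = 1) \<and> (\<forall>x. dist x y \<ge> \<delta> \<longrightarrow> b x = 0)" for y :: "real^'n"
    by (rule smooth_ball_bump[OF assms(2)])
  then obtain b where b: "\<And>y :: real^'n. smooth (\<lambda>x. of_real (b y x))"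
    "\<And>y x :: real^'n. 0 \<le> b y x \<and> b y x \<le> 1"
    "\<And>y x. dist x y \<le> \<delta> / 2 \<Longrightarrow> b y x = 1" "\<And>y x. dist x y \<ge> \<delta> \<Longrightarrow> b y x = 0"
    by metis
  \<comment> \<open>This combination stays in [0,1], is 1 as soon as one bump is 1, and is 0 where
    all bumps vanish; a plain sum could exceed 1.\<close>
  define c where "c x = 1 - (\<Prod>y\<in>T. 1 - b y x)" for x
  show ?thesis
  proof (rule that[of c "\<Union>y\<in>T. ball y (\<delta> / 2)"])
    have "(\<lambda>x. complex_of_real (c x)) = (\<lambda>x. 1 - (\<Prod>y\<in>T. 1 - of_real (b y x)))"
      by (simp add: c_def)
    moreover have "smooth \<dots>" by (intro smooth_diff smooth_prod smooth_const b)
    ultimately show "smooth (\<lambda>x. of_real (c x))" by (simp only:)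
    show "0 \<le> c x \<and> c x \<le> 1" for x
    proof -
      have "0 \<le> 1 - b y x" "1 - b y x \<le> 1" for y using b(2)[of y x] by linarith+
      then have "0 \<le> (\<Prod>y\<in>T. 1 - b y x)" "(\<Prod>y\<in>T. 1 - b y x) \<le> 1"
        by (blast intro: prod_nonneg prod_le_1)+
      then show ?thesis unfolding c_def by linarith
    qed
    show "open (\<Union>y\<in>T. ball y (\<delta> / 2))" by auto
    show "K \<subseteq> (\<Union>y\<in>T. ball y (\<delta> / 2))" by fact
    fix x assume "x \<in> (\<Union>y\<in>T. ball y (\<delta> / 2))"
    then obtain y where "y \<in> T" "dist y x < \<delta> / 2" by auto
    then have "\<exists>y\<in>T. 1 - b y x = 0"
      by (intro bexI[of _ y]) (simp_all add: b(3) dist_commute)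
    then show "c x = 1" using T(2) unfolding c_def by (simp add: prod_zero)
  next
    fix x assume "c x \<noteq> 0"
    show "\<exists>y\<in>K. dist x y < \<delta>"
    proof (rule ccontr)
      assume "\<not> ?thesis"
      then have "b y x = 0" if "y \<in> T" for y
        using that T(1) by (intro b(4)) (meson not_less subsetD)
      then have "c x = 0" unfolding c_def by simp
      with \<open>c x \<noteq> 0\<close> show False by simp
    qed
  qed
qed

section \<open>Estimates for derivatives of products\<close>

lemma mi_deg_eq_length: "count_list is = \<alpha> \<Longrightarrow> mi_deg \<alpha> = length is"
  unfolding mi_deg_def using sum_count_set[of "is" UNIV] by simp

text \<open>A Leibniz estimate without binomial coefficients. The reverse induction strips the
  innermost derivative, which acts on h u directly and gives h \<partial>u + \<partial>h u, two
  products of the same form. The seminorm over the single point x collects the derivatives of u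
  there, so the constant is common to all u and all x in K.\<close>

lemma foldr_dpart_mult_bound:
  "smooth h \<Longrightarrow> compact K \<Longrightarrow> \<exists>C\<ge>0. \<forall>u. smooth u \<longrightarrow>
    (\<forall>x\<in>K. norm (foldr dpart is (\<lambda>x. h x * u x) x) \<le> C * seminorm_C {x} (length is) u)"
proof (induction "is" arbitrary: h rule: rev_induct)
  case Nil
  have "\<forall>x\<in>K. norm (h x) \<le> sup_on K h" using sup_on_upper Nil by blast
  moreover have "norm (u x) \<le> seminorm_C {x} 0 u" if "smooth u" for u and x :: "real^'a"
  proof -
    have "count_list [] = (\<lambda>_::'a. 0)" by auto
    then have "pd (\<lambda>_. 0) u = u" using pd_foldr[OF that, of "[]"] by (metis foldr_Nil id_apply)
    then show ?thesis
      using seminorm_C_upper[OF compact_sing that, of x x "\<lambda>_. 0" 0] by (simp add: mi_deg_def)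
  qed
  ultimately show ?case
    using sup_on_nonneg[OF Nil(2,1)]
    by (intro exI[of _ "sup_on K h"]) (auto simp: norm_mult intro!: mult_mono)
next
  case (snoc i js)
  obtain C where C: "C \<ge> 0" "\<And>u x. smooth u \<Longrightarrow> x \<in> K \<Longrightarrow>
      norm (foldr dpart js (\<lambda>x. h x * u x) x) \<le> C * seminorm_C {x} (length js) u"
    using snoc.IH[OF snoc.prems] by blast
  obtain D where D: "D \<ge> 0" "\<And>u x. smooth u \<Longrightarrow> x \<in> K \<Longrightarrow>
      norm (foldr dpart js (\<lambda>x. dpart i h x * u x) x) \<le> D * seminorm_C {x} (length js) u"
    using snoc.IH[OF smooth_dpart[OF snoc.prems(1)] snoc.prems(2)] by blast
  have mono: "seminorm_C {x} (length js) u \<le> seminorm_C {x} (Suc (length js)) u" if "smooth u" for u x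
    using that by (intro seminorm_C_least seminorm_C_nonneg) (auto intro: seminorm_C_upper)
  have dp: "seminorm_C {x} (length js) (dpart i u) \<le> seminorm_C {x} (Suc (length js)) u" if u: "smooth u" for u x
  proof (intro seminorm_C_least seminorm_C_nonneg u)
    fix y and \<alpha> :: "'a \<Rightarrow> nat" assume a: "y \<in> {x}" "mi_deg \<alpha> \<le> length js"
    have "pd \<alpha> (dpart i u) = pd (\<lambda>j. \<alpha> j + count_list [i] j) u"
      using pd_pd[OF u, of \<alpha> "count_list [i]"] pd_foldr[OF u, of "[i]"] by simp
    moreover have "mi_deg (\<lambda>j. \<alpha> j + count_list [i] j) \<le> Suc (length js)"
      using a mi_deg_eq_length[of "[i]", OF refl]
      by (simp only: mi_deg_def sum.distrib) simp
    ultimately show "norm (pd \<alpha> (dpart i u) y) \<le> seminorm_C {x} (Suc (length js)) u"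
      using a seminorm_C_upper[OF _ u] by simp
  qed simp
  show ?case
  proof (intro exI[of _ "C + D"] conjI allI impI ballI)
    fix u :: "'a cfun" and x assume u: "smooth u" and x: "x \<in> K"
    have "foldr dpart (js @ [i]) (\<lambda>x. h x * u x) x =
        foldr dpart js (\<lambda>x. h x * dpart i u x) x + foldr dpart js (\<lambda>x. dpart i h x * u x) x"
      using snoc.prems u by (simp add: dpart_mult foldr_dpart_add smooth_mult smooth_dpart)
    also have "norm \<dots> \<le> C * seminorm_C {x} (length js) (dpart i u) + D * seminorm_C {x} (length js) u"
      by (intro norm_triangle_mono C D smooth_dpart u x)
    also have "\<dots> \<le> C * seminorm_C {x} (Suc (length js)) u + D * seminorm_C {x} (Suc (length js)) u"
      by (intro add_mono mult_left_mono mono dp u C D)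
    finally show "norm (foldr dpart (js @ [i]) (\<lambda>x. h x * u x) x) \<le> (C + D) * seminorm_C {x} (length (js @ [i])) u"
      by (simp add: algebra_simps)
  qed (use C D in auto)
qed

lemma pd_mult_bound:
  fixes h :: "'n::finite cfun"
  assumes "smooth h" "compact K"
  shows "\<exists>C\<ge>0. \<forall>\<alpha> u x. mi_deg \<alpha> \<le> j \<longrightarrow> smooth u \<longrightarrow> x \<in> K \<longrightarrow>
    norm (pd \<alpha> (\<lambda>x. h x * u x) x) \<le> C * seminorm_C {x} j u"
proof -
  have "\<exists>C\<ge>0. \<forall>u (x :: real^'n). smooth u \<longrightarrow> x \<in> K \<longrightarrow>
    norm (pd \<alpha> (\<lambda>x. h x * u x) x) \<le> C * seminorm_C {x} (mi_deg \<alpha>) u" for \<alpha> :: "'n \<Rightarrow> nat"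
  proof -
    obtain "is" where "is": "count_list is = \<alpha>" using ex_count_list by blast
    show ?thesis
      using foldr_dpart_mult_bound[OF assms, of "is"]
      by (simp add: pd_foldr[OF smooth_mult[OF assms(1)]] "is" mi_deg_eq_length[OF "is"]) blast
  qed
  then obtain C where C: "\<And>\<alpha>. C \<alpha> \<ge> 0" "\<And>\<alpha> u (x :: real^'n). smooth u \<Longrightarrow> x \<in> K \<Longrightarrow>
    norm (pd \<alpha> (\<lambda>x. h x * u x) x) \<le> C \<alpha> * seminorm_C {x} (mi_deg \<alpha>) u" by metis
  show ?thesis
  proof (intro exI[of _ "\<Sum>\<alpha> | mi_deg \<alpha> \<le> j. C \<alpha>"] conjI allI impI)
    fix \<alpha> :: "'n \<Rightarrow> nat" and u :: "'n cfun" and x :: "real^'n" assume *: "mi_deg \<alpha> \<le> j" "smooth u" "x \<in> K"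
    have "norm (pd \<alpha> (\<lambda>x. h x * u x) x) \<le> C \<alpha> * seminorm_C {x} (mi_deg \<alpha>) u" using C * by blast
    also have "\<dots> \<le> (\<Sum>\<alpha> | mi_deg \<alpha> \<le> j. C \<alpha>) * seminorm_C {x} j u"
      using * C(1) by (intro mult_mono member_le_sum seminorm_C_least seminorm_C_nonneg finite_mi sum_nonneg)
        (auto intro: seminorm_C_upper)
    finally show "norm (pd \<alpha> (\<lambda>x. h x * u x) x) \<le> (\<Sum>\<alpha> | mi_deg \<alpha> \<le> j. C \<alpha>) * seminorm_C {x} j u" .
  qed (auto intro: sum_nonneg C)
qed

section \<open>Polynomials and their weights\<close>

definition cvec :: "real^'n::finite \<Rightarrow> complex^'n" where
  "cvec x = (\<chi> i. of_real (x $ i))"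

definition csymbol :: "nat \<Rightarrow> (('n::finite \<Rightarrow> nat) \<Rightarrow> complex) \<Rightarrow> complex^'n \<Rightarrow> complex" where
  "csymbol m p z = (\<Sum>\<alpha> | mi_deg \<alpha> \<le> m. p \<alpha> * (\<Prod>i\<in>UNIV. (z $ i) ^ \<alpha> i))"

lemma cvec_nth [simp]: "cvec x $ i = of_real (x $ i)"
  by (simp add: cvec_def)

text \<open>Here \<open>g i k\<close> plays the k-th derivative of the i-th one-variable factor, so
  differentiation only moves an index. Derivatives of monomials of every order follow at
  once.\<close>

lemma dpart_prod_coord:
  fixes g :: "'n::finite \<Rightarrow> nat \<Rightarrow> real \<Rightarrow> complex"
  assumes "\<And>i k t. (g i k has_vector_derivative g i (Suc k) t) (at t)"
  shows "dpart j (\<lambda>x. \<Prod>i\<in>UNIV. g i (c i) (x $ i)) =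
    (\<lambda>x. \<Prod>i\<in>UNIV. g i (if i = j then Suc (c i) else c i) (x $ i))"
proof (rule dpart_eqI)
  fix x :: "real^'n"
  have split: "(\<Prod>i\<in>UNIV. h i) = h j * (\<Prod>i\<in>UNIV - {j}. h i)" for h :: "'n \<Rightarrow> complex"
    by (simp add: prod.remove)
  have e: "(\<Prod>i\<in>UNIV. g i (c i) ((x + t *\<^sub>R axis j 1) $ i)) =
      g j (c j) (x $ j + t) * (\<Prod>i\<in>UNIV - {j}. g i (c i) (x $ i))" for t
    by (simp add: split axis_nth_of_real)
  have "((\<lambda>t. g j (c j) (x $ j + t)) has_vector_derivative g j (Suc (c j)) (x $ j)) (at 0)"
  proof -
    have "(g j (c j) \<circ> (\<lambda>t. x $ j + t) has_vector_derivative 1 *\<^sub>R g j (Suc (c j)) (x $ j)) (at 0)"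
      by (rule vector_diff_chain_at) (use assms[of j "c j" "x $ j"] in \<open>auto intro!: derivative_eq_intros\<close>)
    then show ?thesis by (simp add: o_def)
  qed
  from has_vector_derivative_mult_left[OF this, of "\<Prod>i\<in>UNIV - {j}. g i (c i) (x $ i)"]
  show "((\<lambda>t. \<Prod>i\<in>UNIV. g i (c i) ((x + t *\<^sub>R axis j 1) $ i)) has_vector_derivative
      (\<Prod>i\<in>UNIV. g i (if i = j then Suc (c i) else c i) (x $ i))) (at 0)"
    unfolding e by (simp add: split)
qed

lemma pd_prod_coord:
  fixes g :: "'n::finite \<Rightarrow> nat \<Rightarrow> real \<Rightarrow> complex"
  assumes "\<And>i k t. (g i k has_vector_derivative g i (Suc k) t) (at t)"
  shows "pd \<alpha> (\<lambda>x. \<Prod>i\<in>UNIV. g i 0 (x $ i)) = (\<lambda>x. \<Prod>i\<in>UNIV. g i (\<alpha> i) (x $ i))"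
proof -
  have *: "foldr dpart is (\<lambda>x. \<Prod>i\<in>UNIV. g i 0 (x $ i)) = (\<lambda>x. \<Prod>i\<in>UNIV. g i (count_list is i) (x $ i))" for "is"
  proof (induction "is")
    case (Cons j js)
    have "(\<lambda>i. if i = j then Suc (count_list js i) else count_list js i) = count_list (j # js)" by auto
    then show ?case
      using Cons dpart_prod_coord[of g j "count_list js", OF assms]
      by (simp add: if_distrib cong: if_cong) (auto simp: fun_eq_iff intro!: prod.cong)
  qed simp
  show ?thesis
    unfolding pd_def * using someI_ex[OF ex_count_list[of \<alpha>]] by simp
qed

lemma smooth_monomial: "smooth (\<lambda>x::real^'n::finite. complex_of_real (\<Prod>i\<in>UNIV. (x $ i) ^ b i))"
proof -
  have "smooth (\<lambda>x::real^'n. \<Prod>i\<in>UNIV. complex_of_real (x $ i) ^ b i)"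
    by (intro smooth_prod smooth_power smooth_coord)
  then show ?thesis by simp
qed

lemma smooth_symbol: "smooth (symbol m p)"
  unfolding symbol_def[abs_def] by (intro smooth_sum smooth_cmult smooth_monomial)

lemma pd_monomial:
  "pd \<kappa> (\<lambda>x::real^'n::finite. complex_of_real (\<Prod>i\<in>UNIV. (x $ i) ^ b i)) x =
    (\<Prod>i\<in>UNIV. of_nat (fact (\<kappa> i) * (b i choose \<kappa> i)) * of_real (x $ i) ^ (b i - \<kappa> i))"
proof -
  \<comment> \<open>The coefficient k! (b choose k) is the falling factorial of b. It vanishes for k
    > b, so the truncated exponent b - k does no harm there.\<close>
  define g where "g i k t = of_nat (fact k * (b i choose k)) * complex_of_real (t ^ (b i - k))" for i k t
  have "(g i k has_vector_derivative g i (Suc k) t) (at t)" for i k t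
  proof -
    have "((\<lambda>t. real (fact k * (b i choose k)) * t ^ (b i - k)) has_real_derivative
      real (fact k * (b i choose k)) * (real (b i - k) * t ^ (b i - k - 1))) (at t)"
      by (auto intro!: derivative_eq_intros)
    moreover have "fact k * (b i choose k) * (b i - k) = fact (Suc k) * (b i choose Suc k)"
    proof (cases "k < b i")
      case True
      then have "(b i - k) * (b i choose k) = (b i choose Suc k) * Suc k"
        by (metis binomial_absorb_comp binomial_absorption mult.commute less_imp_Suc_add diff_Suc_1 choose_mult_lemma times_binomial_minus1_eq zero_less_Suc) 
      then show ?thesis by (simp add: algebra_simps)
    qed (simp add: binomial_eq_0)
    ultimately have "((\<lambda>t. real (fact k * (b i choose k)) * t ^ (b i - k)) has_real_derivative
      real (fact (Suc k) * (b i choose Suc k)) * t ^ (b i - Suc k)) (at t)"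
      by (metis (no_types, lifting) diff_Suc_eq_diff_pred diff_commute diff_diff_left mult.assoc of_nat_mult plus_1_eq_Suc add.commute)
    from has_vector_derivative_of_real[OF this] show ?thesis by (simp add: g_def[abs_def] algebra_simps)
  qed
  from pd_prod_coord[of g, OF this, of \<kappa>] show ?thesis by (simp add: g_def fun_eq_iff)
qed

lemma pd_symbol:
  "pd \<kappa> (symbol m p) x = (\<Sum>\<alpha> | mi_deg \<alpha> \<le> m. p \<alpha> * pd \<kappa> (\<lambda>x. of_real (\<Prod>i\<in>UNIV. (x $ i) ^ \<alpha> i)) x)"
  unfolding symbol_def[abs_def] by (simp add: pd_sum pd_cmult smooth_cmult smooth_monomial del: of_real_prod)

lemma mi_le_deg: "\<alpha> i \<le> mi_deg \<alpha>"
  unfolding mi_deg_def by (rule member_le_sum) auto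

lemma monomial_taylor:
  fixes b :: "'n::finite \<Rightarrow> nat"
  assumes "mi_deg b \<le> m"
  shows "(\<Prod>i\<in>UNIV. (of_real (x $ i) + s i) ^ b i) = (\<Sum>\<kappa> | mi_deg \<kappa> \<le> m.
    pd \<kappa> (\<lambda>x. of_real (\<Prod>i\<in>UNIV. (x $ i) ^ b i)) x * (\<Prod>i\<in>UNIV. s i ^ \<kappa> i / fact (\<kappa> i)))"
proof -
  let ?t = "\<lambda>i k. of_nat (b i choose k) * s i ^ k * of_real (x $ i) ^ (b i - k)"
  have bm: "b i \<le> m" for i using mi_le_deg[of b i] assms by linarith
  have "(of_real (x $ i) + s i) ^ b i = (\<Sum>k\<le>m. ?t i k)" for i
  proof -
    have "(of_real (x $ i) + s i) ^ b i = (\<Sum>k\<le>b i. ?t i k)"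
      by (subst add.commute) (rule binomial_ring)
    also have "\<dots> = (\<Sum>k\<le>m. ?t i k)"
      using bm[of i] by (intro sum.mono_neutral_left) (auto simp: binomial_eq_0)
    finally show ?thesis .
  qed
  then have "(\<Prod>i\<in>UNIV. (of_real (x $ i) + s i) ^ b i) = (\<Prod>i\<in>UNIV. \<Sum>k\<le>m. ?t i k)" by simp
  also have "\<dots> = (\<Sum>\<kappa>\<in>PiE UNIV (\<lambda>_. {..m}). \<Prod>i\<in>UNIV. ?t i (\<kappa> i))"
    by (rule prod_sum_PiE) auto
  also have "\<dots> = (\<Sum>\<kappa> | mi_deg \<kappa> \<le> m. \<Prod>i\<in>UNIV. ?t i (\<kappa> i))"
  \<comment> \<open>A multi-index of degree above m exceeds b in some coordinate, since |b| \<le> m;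
    the binomial coefficient of that coordinate is 0.\<close>
  proof (rule sum.mono_neutral_right)
    show "{\<kappa>. mi_deg \<kappa> \<le> m} \<subseteq> PiE UNIV (\<lambda>_::'n. {..m})"
      using mi_le_deg order_trans by (auto simp: PiE_def Pi_def) blast
    show "\<forall>\<kappa>\<in>PiE UNIV (\<lambda>_. {..m}) - {\<kappa>. mi_deg \<kappa> \<le> m}. (\<Prod>i\<in>UNIV. ?t i (\<kappa> i)) = 0"
    proof
      fix \<kappa> assume "\<kappa> \<in> PiE UNIV (\<lambda>_::'n. {..m}) - {\<kappa>. mi_deg \<kappa> \<le> m}"
      then have "\<not> mi_deg \<kappa> \<le> mi_deg b" using assms by simp
      then have "\<exists>i. b i < \<kappa> i" unfolding mi_deg_def by (metis not_le sum_mono)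
      then obtain i where "b i < \<kappa> i" ..
      then have "?t i (\<kappa> i) = 0" by (simp add: binomial_eq_0)
      then show "(\<Prod>i\<in>UNIV. ?t i (\<kappa> i)) = 0" by (intro prod_zero) auto
    qed
  qed (auto intro: finite_PiE)
  also have "\<dots> = (\<Sum>\<kappa> | mi_deg \<kappa> \<le> m.
    pd \<kappa> (\<lambda>x. of_real (\<Prod>i\<in>UNIV. (x $ i) ^ b i)) x * (\<Prod>i\<in>UNIV. s i ^ \<kappa> i / fact (\<kappa> i)))"
    unfolding pd_monomial prod.distrib[symmetric]
    by (intro sum.cong prod.cong refl) simp
  finally show ?thesis .
qed

text \<open>Expansion at a real point with a complex increment. It expresses the values of the
  polynomial at complex points by exactly those derivatives from which \<open>tilde\<close> is
  formed.\<close>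

lemma csymbol_taylor:
  "csymbol m p (cvec x + s) = (\<Sum>\<kappa> | mi_deg \<kappa> \<le> m.
    pd \<kappa> (symbol m p) x * (\<Prod>i\<in>UNIV. (s $ i) ^ \<kappa> i / fact (\<kappa> i)))"
proof -
  have "csymbol m p (cvec x + s) = (\<Sum>\<alpha> | mi_deg \<alpha> \<le> m. p \<alpha> * (\<Sum>\<kappa> | mi_deg \<kappa> \<le> m.
    pd \<kappa> (\<lambda>x. of_real (\<Prod>i\<in>UNIV. (x $ i) ^ \<alpha> i)) x * (\<Prod>i\<in>UNIV. (s $ i) ^ \<kappa> i / fact (\<kappa> i))))"
    unfolding csymbol_def by (intro sum.cong refl) (simp add: monomial_taylor del: of_real_prod)
  also have "\<dots> = (\<Sum>\<kappa> | mi_deg \<kappa> \<le> m. \<Sum>\<alpha> | mi_deg \<alpha> \<le> m. p \<alpha> *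
    pd \<kappa> (\<lambda>x. of_real (\<Prod>i\<in>UNIV. (x $ i) ^ \<alpha> i)) x * (\<Prod>i\<in>UNIV. (s $ i) ^ \<kappa> i / fact (\<kappa> i)))"
    unfolding sum_distrib_left mult.assoc by (rule sum.swap)
  also have "\<dots> = (\<Sum>\<kappa> | mi_deg \<kappa> \<le> m.
    pd \<kappa> (symbol m p) x * (\<Prod>i\<in>UNIV. (s $ i) ^ \<kappa> i / fact (\<kappa> i)))"
    unfolding pd_symbol sum_distrib_right ..
  finally show ?thesis .
qed

text \<open>The number \<open>\<mu> j t\<close> is the coefficient of degree j of the Lagrange basis
  polynomial for node t. Interpolation at the m + 1 nodes 0,...,m reproduces monomials of degree k
  \<le> m, and comparison of coefficients gives the identity.\<close>

lemma lagrange_dual_basis: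
  "\<exists>\<mu> :: nat \<Rightarrow> nat \<Rightarrow> complex. \<forall>j\<le>m. \<forall>k\<le>m. (\<Sum>t\<le>m. \<mu> j t * of_nat t ^ k) = (if j = k then 1 else 0)"
proof -
  define L :: "nat \<Rightarrow> complex poly" where
    "L t = (\<Prod>u\<in>{..m} - {t}. smult (1 / (of_nat t - of_nat u)) [:- of_nat u, 1:])" for t
  have degL: "degree (L t) \<le> m" if "t \<le> m" for t
  proof -
    have "degree (L t) \<le> (\<Sum>u\<in>{..m} - {t}. degree (smult (1 / (of_nat t - of_nat u)) [:- of_nat u, 1 :: complex:]))"
      unfolding L_def by (rule order_trans[OF degree_prod_sum_le]) (simp_all only: o_def, simp_all)
    also have "\<dots> \<le> (\<Sum>u\<in>{..m} - {t}. 1)" by (intro sum_mono) simp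
    also have "\<dots> = m" using that by simp
    finally show ?thesis .
  qed
  have evL: "poly (L t) (of_nat s) = (if s = t then 1 else 0)" if "s \<le> m" "t \<le> m" for s t
  proof (cases "s = t")
    case True
    then show ?thesis
      by (auto simp: L_def poly_prod diff_divide_distrib[symmetric] intro!: prod.neutral)
  next
    case False
    then show ?thesis using that by (auto simp: L_def poly_prod intro!: prod_zero bexI[of _ s])
  qed
  have mon: "monom 1 k = (\<Sum>t\<le>m. smult (of_nat t ^ k) (L t))" if "k \<le> m" for k
  proof (rule poly_eqI_degree[where A = "of_nat ` {..m}"])
    have c: "card ((of_nat :: nat \<Rightarrow> complex) ` {..m}) = Suc m" by (simp add: card_image inj_on_def)
    show "card ((of_nat :: nat \<Rightarrow> complex) ` {..m}) > degree (monom (1::complex) k)"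
      using that unfolding c by (simp add: degree_monom_eq)
    have "degree (\<Sum>t\<le>m. smult (of_nat t ^ k) (L t)) \<le> m"
      by (intro degree_sum_le) (auto intro!: order_trans[OF degree_smult_le] degL)
    then show "card ((of_nat :: nat \<Rightarrow> complex) ` {..m}) > degree (\<Sum>t\<le>m. smult (of_nat t ^ k) (L t))"
      unfolding c by simp
    fix x :: complex assume "x \<in> of_nat ` {..m}"
    then obtain s where s: "s \<le> m" "x = of_nat s" by auto
    have "poly (\<Sum>t\<le>m. smult (of_nat t ^ k) (L t)) x = (\<Sum>t\<le>m. of_nat t ^ k * (if s = t then 1 else 0))"
      unfolding poly_sum s(2) by (intro sum.cong) (use s evL in auto)
    also have "\<dots> = of_nat s ^ k" using s by (simp add: if_distrib cong: if_cong)
    finally show "poly (monom 1 k) x = poly (\<Sum>t\<le>m. smult (of_nat t ^ k) (L t)) x"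
      using s by (simp add: poly_monom)
  qed
  show ?thesis
  proof (intro exI[of _ "\<lambda>j t. coeff (L t) j"] allI impI)
    fix j k assume "j \<le> m" "k \<le> m"
    from arg_cong[OF mon[OF this(2)], of "\<lambda>q. coeff q j"]
    show "(\<Sum>t\<le>m. coeff (L t) j * of_nat t ^ k) = (if j = k then 1 else 0)"
      by (simp add: coeff_sum mult.commute eq_commute[of k])
  qed
qed

section \<open>Size and variation of the weight\<close>

lemma tilde_nonneg: "0 \<le> tilde m p x"
  unfolding tilde_def by (intro real_sqrt_ge_zero sum_nonneg) simp

lemma tilde_L2_set: "tilde m p x = L2_set (\<lambda>\<alpha>. norm (pd \<alpha> (symbol m p) x)) {\<alpha>. mi_deg \<alpha> \<le> m}"
  by (simp add: tilde_def L2_set_def)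

lemma pd_le_tilde: "mi_deg \<kappa> \<le> m \<Longrightarrow> norm (pd \<kappa> (symbol m p) x) \<le> tilde m p x"
  unfolding tilde_L2_set by (intro member_le_L2_set finite_mi) simp

lemma tilde_le_sum: "tilde m p x \<le> (\<Sum>\<alpha> | mi_deg \<alpha> \<le> m. norm (pd \<alpha> (symbol m p) x))"
  unfolding tilde_L2_set by (rule L2_set_le_sum) simp

lemma continuous_on_tilde: "continuous_on UNIV (tilde m p)"
  unfolding tilde_def[abs_def]
  by (intro continuous_intros smooth_imp(1) smooth_pd smooth_symbol)

text \<open>On polynomials of degree at most \<open>m\<close>, every Taylor coefficient at \<open>x\<close> is a fixed linear
  combination of the values on the grid \<open>x + \<tau> {0,\<dots>,m}\<^sup>n\<close>, by tensorized Lagrange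
  interpolation.\<close>

lemma tilde_le_grid:
  assumes "\<tau> > 0"
  shows "\<exists>C>0. \<forall>p (x :: real^'n::finite). \<exists>\<theta>. (\<forall>i. \<theta> i \<le> m) \<and>
    tilde m p x \<le> C * norm (csymbol m p (cvec x + (\<chi> i. of_real \<tau> * of_nat (\<theta> i))))"
proof -
  obtain \<mu> :: "nat \<Rightarrow> nat \<Rightarrow> complex"
    where \<mu>: "\<And>j k. j \<le> m \<Longrightarrow> k \<le> m \<Longrightarrow> (\<Sum>t\<le>m. \<mu> j t * of_nat t ^ k) = (if j = k then 1 else 0)"
    using lagrange_dual_basis[of m] by blast
  define I where "I = {\<kappa> :: 'n \<Rightarrow> nat. mi_deg \<kappa> \<le> m}"
  define G where "G = PiE (UNIV :: 'n set) (\<lambda>_. {..m})"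
  have finG: "finite G" unfolding G_def by (intro finite_PiE) auto
  have finI: "finite I" unfolding I_def by (rule finite_mi)
  \<comment> \<open>\<open>W\<close> is the tensor product of the one-dimensional weights: it
    isolates the index \<kappa> among the values on the grid. \<open>F\<close> is the factor
    \<tau>^|\<kappa>| / \<kappa>! that stands next to the derivative in the Taylor expansion on the
    grid.\<close>
  define W where "W \<kappa> \<theta> = (\<Prod>i\<in>UNIV. \<mu> (\<kappa> i) (\<theta> i))" for \<kappa> \<theta> :: "'n \<Rightarrow> nat"
  define F where "F \<kappa> = (\<Prod>i\<in>UNIV. \<tau> ^ \<kappa> i / fact (\<kappa> i))" for \<kappa> :: "'n \<Rightarrow> nat"
  have Fpos: "F \<kappa> > 0" for \<kappa> unfolding F_def using assms by (intro prod_pos) simp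
  define C where "C = 1 + (\<Sum>\<kappa>\<in>I. (\<Sum>\<theta>\<in>G. norm (W \<kappa> \<theta>)) / F \<kappa>)"
  have Cpos: "C > 0" unfolding C_def
    using Fpos by (intro add_pos_nonneg sum_nonneg divide_nonneg_pos) auto
  show ?thesis
  proof (intro exI[of _ C] conjI Cpos allI)
    fix p and x :: "real^'n"
    define v where "v \<theta> = csymbol m p (cvec x + (\<chi> i. of_real \<tau> * of_nat (\<theta> i)))" for \<theta> :: "'n \<Rightarrow> nat"
    have G0: "G \<noteq> {}" unfolding G_def by (simp add: PiE_eq_empty_iff)
    have "Max ((\<lambda>\<theta>. norm (v \<theta>)) ` G) \<in> (\<lambda>\<theta>. norm (v \<theta>)) ` G" using finG G0 by (intro Max_in) auto
    then obtain \<theta>0 where \<theta>0: "\<theta>0 \<in> G" "Max ((\<lambda>\<theta>. norm (v \<theta>)) ` G) = norm (v \<theta>0)" by auto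
    have mx: "norm (v \<theta>) \<le> norm (v \<theta>0)" if "\<theta> \<in> G" for \<theta>
      using that finG unfolding \<theta>0(2)[symmetric] by (intro Max_ge) auto
    have v_eq: "v \<theta> = (\<Sum>\<kappa>\<in>I. pd \<kappa> (symbol m p) x * of_real (F \<kappa>) * (\<Prod>i\<in>UNIV. of_nat (\<theta> i) ^ \<kappa> i))" for \<theta>
      unfolding v_def csymbol_taylor I_def[symmetric] F_def
      by (intro sum.cong refl) (simp add: power_mult_distrib prod.distrib prod_dividef mult_ac)
    have ident: "pd \<kappa> (symbol m p) x * of_real (F \<kappa>) = (\<Sum>\<theta>\<in>G. W \<kappa> \<theta> * v \<theta>)" if \<kappa>: "\<kappa> \<in> I" for \<kappa>
    proof -
      have km: "\<kappa>' i \<le> m" if "\<kappa>' \<in> I" for \<kappa>' i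
        using that mi_le_deg[of \<kappa>' i] unfolding I_def by simp
      have "(\<Sum>\<theta>\<in>G. W \<kappa> \<theta> * v \<theta>) = (\<Sum>\<theta>\<in>G. \<Sum>\<kappa>'\<in>I. pd \<kappa>' (symbol m p) x * of_real (F \<kappa>') *
          (\<Prod>i\<in>UNIV. \<mu> (\<kappa> i) (\<theta> i) * of_nat (\<theta> i) ^ \<kappa>' i))"
        unfolding v_eq sum_distrib_left W_def by (intro sum.cong refl) (simp add: prod.distrib mult_ac)
      also have "\<dots> = (\<Sum>\<kappa>'\<in>I. pd \<kappa>' (symbol m p) x * of_real (F \<kappa>') *
          (\<Sum>\<theta>\<in>G. \<Prod>i\<in>UNIV. \<mu> (\<kappa> i) (\<theta> i) * of_nat (\<theta> i) ^ \<kappa>' i))"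
        by (subst sum.swap) (simp add: sum_distrib_left)
      also have "\<dots> = (\<Sum>\<kappa>'\<in>I. pd \<kappa>' (symbol m p) x * of_real (F \<kappa>') * (if \<kappa> = \<kappa>' then 1 else 0))"
      proof (intro sum.cong refl arg_cong2[where f = "(*)"])
        fix \<kappa>' assume \<kappa>': "\<kappa>' \<in> I"
        have "(\<Sum>\<theta>\<in>G. \<Prod>i\<in>UNIV. \<mu> (\<kappa> i) (\<theta> i) * of_nat (\<theta> i) ^ \<kappa>' i) =
            (\<Prod>i\<in>UNIV. \<Sum>t\<le>m. \<mu> (\<kappa> i) t * of_nat t ^ \<kappa>' i)"
          unfolding G_def by (rule prod_sum_PiE[symmetric]) auto
        also have "\<dots> = (\<Prod>i\<in>UNIV. if \<kappa> i = \<kappa>' i then 1 else 0)"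
          by (intro prod.cong refl \<mu> km \<kappa> \<kappa>')
        also have "\<dots> = (if \<kappa> = \<kappa>' then 1 else 0)"
          by (auto simp: fun_eq_iff intro!: prod_zero)
        finally show "(\<Sum>\<theta>\<in>G. \<Prod>i\<in>UNIV. \<mu> (\<kappa> i) (\<theta> i) * of_nat (\<theta> i) ^ \<kappa>' i) = (if \<kappa> = \<kappa>' then 1 else 0)" .
      qed
      also have "\<dots> = pd \<kappa> (symbol m p) x * of_real (F \<kappa>)"
        using \<kappa> finI by (simp add: if_distrib cong: if_cong)
      finally show ?thesis by simp
    qed
    have est: "norm (pd \<kappa> (symbol m p) x) \<le> ((\<Sum>\<theta>\<in>G. norm (W \<kappa> \<theta>)) / F \<kappa>) * norm (v \<theta>0)"
      if \<kappa>: "\<kappa> \<in> I" for \<kappa>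
    proof -
      have "norm (pd \<kappa> (symbol m p) x) * F \<kappa> = norm (pd \<kappa> (symbol m p) x * of_real (F \<kappa>))"
        using Fpos[of \<kappa>] by (simp add: norm_mult)
      also have "\<dots> \<le> (\<Sum>\<theta>\<in>G. norm (W \<kappa> \<theta>) * norm (v \<theta>0))"
        unfolding ident[OF \<kappa>] by (intro sum_norm_le) (auto simp: norm_mult intro!: mult_left_mono mx)
      also have "\<dots> = (\<Sum>\<theta>\<in>G. norm (W \<kappa> \<theta>)) * norm (v \<theta>0)" by (simp add: sum_distrib_right)
      finally show ?thesis
        using Fpos[of \<kappa>] by (simp add: pos_le_divide_eq)
    qed
    have "tilde m p x \<le> (\<Sum>\<kappa>\<in>I. norm (pd \<kappa> (symbol m p) x))"
      unfolding I_def by (rule tilde_le_sum)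
    also have "\<dots> \<le> (\<Sum>\<kappa>\<in>I. ((\<Sum>\<theta>\<in>G. norm (W \<kappa> \<theta>)) / F \<kappa>) * norm (v \<theta>0))"
      by (intro sum_mono est)
    also have "\<dots> \<le> C * norm (v \<theta>0)"
      unfolding C_def sum_distrib_right[symmetric] by (intro mult_right_mono) auto
    finally have "tilde m p x \<le> C * norm (v \<theta>0)" .
    moreover have "\<forall>i. \<theta>0 i \<le> m" using \<theta>0(1) unfolding G_def by (auto simp: PiE_def Pi_def)
    ultimately show "\<exists>\<theta>. (\<forall>i. \<theta> i \<le> m) \<and>
      tilde m p x \<le> C * norm (csymbol m p (cvec x + (\<chi> i. of_real \<tau> * of_nat (\<theta> i))))"
      unfolding v_def by blast
  qed
qed

text \<open>Interpolation bounds the weight at x + y by a single value of the polynomial at a grid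
  point near x + y. Expanding that value at x instead, each component of the increment is at most (1
  + |y|)(1 + m), which gives the power m and a constant independent of the polynomial.\<close>

lemma tilde_growth:
  "\<exists>C>0. \<forall>p (x :: real^'n::finite) y. tilde m p (x + y) \<le> C * (1 + norm y) ^ m * tilde m p x"
proof -
  obtain C where C: "C > 0" "\<And>p (x :: real^'n). \<exists>\<theta>. (\<forall>i. \<theta> i \<le> m) \<and>
    tilde m p x \<le> C * norm (csymbol m p (cvec x + (\<chi> i. of_real 1 * of_nat (\<theta> i))))"
    using tilde_le_grid[of 1 m] by auto
  define N where "N = card {\<kappa> :: 'n \<Rightarrow> nat. mi_deg \<kappa> \<le> m}"
  have Npos: "N > 0" unfolding N_def
    by (simp add: card_gt_0_iff finite_mi) (rule exI[of _ "\<lambda>_. 0"], simp add: mi_deg_def)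
  show ?thesis
  proof (intro exI[of _ "C * (real N * (1 + real m) ^ m)"] conjI allI)
    show "C * (real N * (1 + real m) ^ m) > 0" using C(1) Npos by simp
    fix p and x y :: "real^'n"
    obtain \<theta> where \<theta>: "\<And>i. \<theta> i \<le> m"
      "tilde m p (x + y) \<le> C * norm (csymbol m p (cvec (x + y) + (\<chi> i. of_nat (\<theta> i))))"
      using C(2)[of p "x + y"] by auto
    define s :: "complex^'n" where "s = cvec y + (\<chi> i. of_nat (\<theta> i))"
    define B where "B = (1 + norm y) * (1 + real m)"
    have B1: "1 \<le> B" unfolding B_def by (simp add: algebra_simps)
    have sB: "norm (s $ i) \<le> B" for i
    proof -
      have "norm (s $ i) \<le> norm (complex_of_real (y $ i)) + norm (of_nat (\<theta> i) :: complex)"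
        unfolding s_def vector_add_component cvec_nth vec_lambda_beta by (rule norm_triangle_ineq)
      also have "\<dots> \<le> norm y + real m"
        using \<theta>(1)[of i] component_le_norm_cart[of y i] by (intro add_mono) auto
      also have "\<dots> \<le> B" unfolding B_def by (simp add: algebra_simps)
      finally show ?thesis .
    qed
    have "cvec (x + y) + (\<chi> i. of_nat (\<theta> i)) = cvec x + s"
      unfolding s_def by (simp add: vec_eq_iff)
    then have "norm (csymbol m p (cvec (x + y) + (\<chi> i. of_nat (\<theta> i)))) =
        norm (\<Sum>\<kappa> | mi_deg \<kappa> \<le> m. pd \<kappa> (symbol m p) x * (\<Prod>i\<in>UNIV. (s $ i) ^ \<kappa> i / fact (\<kappa> i)))"
      by (simp add: csymbol_taylor)
    also have "\<dots> \<le> (\<Sum>\<kappa>::'n\<Rightarrow>nat | mi_deg \<kappa> \<le> m. tilde m p x * B ^ m)"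
    proof (rule sum_norm_le)
      fix \<kappa> :: "'n \<Rightarrow> nat" assume "\<kappa> \<in> {\<kappa>. mi_deg \<kappa> \<le> m}"
      then have \<kappa>: "mi_deg \<kappa> \<le> m" by simp
      have "norm (\<Prod>i\<in>UNIV. (s $ i) ^ \<kappa> i / fact (\<kappa> i)) \<le> (\<Prod>i\<in>UNIV. B ^ \<kappa> i)"
        unfolding prod_norm[symmetric]
      proof (intro prod_mono conjI)
        fix i
        have "norm ((s $ i) ^ \<kappa> i / fact (\<kappa> i)) \<le> norm (s $ i) ^ \<kappa> i / 1"
          unfolding norm_divide norm_power by (intro divide_left_mono) (auto simp: norm_fact)
        also have "\<dots> \<le> B ^ \<kappa> i" using sB[of i] by (simp add: power_mono)
        finally show "norm ((s $ i) ^ \<kappa> i / fact (\<kappa> i)) \<le> B ^ \<kappa> i" .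
      qed simp
      also have "\<dots> = B ^ mi_deg \<kappa>" by (simp add: mi_deg_def power_sum)
      also have "\<dots> \<le> B ^ m" using B1 \<kappa> by (intro power_increasing)
      finally show "norm (pd \<kappa> (symbol m p) x * (\<Prod>i\<in>UNIV. (s $ i) ^ \<kappa> i / fact (\<kappa> i))) \<le> tilde m p x * B ^ m"
        unfolding norm_mult using \<kappa> by (intro mult_mono pd_le_tilde tilde_nonneg) auto
    qed
    also have "\<dots> = real N * (tilde m p x * B ^ m)" by (simp add: N_def)
    finally have "C * norm (csymbol m p (cvec (x + y) + (\<chi> i. of_nat (\<theta> i)))) \<le> C * (real N * (tilde m p x * B ^ m))"
      using C(1) by (intro mult_left_mono) auto
    with \<theta>(2) show "tilde m p (x + y) \<le> C * (real N * (1 + real m) ^ m) * (1 + norm y) ^ m * tilde m p x"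
      unfolding B_def power_mult_distrib by (simp add: mult_ac)
  qed
qed

text \<open>At a fixed point the weight is Lipschitz in the coefficients. This transfers
  moderateness from coefficients to weights and makes lower bounds independent of the representative
  up to negligible errors.\<close>

lemma tilde_diff_bound:
  "\<exists>C\<ge>0. \<forall>p q. \<bar>tilde m p x - tilde m q x\<bar> \<le> C * (\<Sum>\<alpha> | mi_deg \<alpha> \<le> m. norm (p \<alpha> - q \<alpha>))"
proof -
  let ?I = "{\<alpha> :: 'a \<Rightarrow> nat. mi_deg \<alpha> \<le> m}"
  let ?d = "\<lambda>\<kappa> \<alpha>. norm (pd \<kappa> (\<lambda>x. complex_of_real (\<Prod>i\<in>UNIV. (x $ i) ^ \<alpha> i)) x)"
  define C where "C = (\<Sum>\<kappa>\<in>?I. \<Sum>\<alpha>\<in>?I. ?d \<kappa> \<alpha>)"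
  have le: "tilde m p x \<le> tilde m q x + C * (\<Sum>\<alpha>\<in>?I. norm (p \<alpha> - q \<alpha>))" for p q
  proof -
    let ?r = "\<lambda>\<alpha>. p \<alpha> - q \<alpha>"
    have "tilde m p x = L2_set (\<lambda>\<alpha>. norm (pd \<alpha> (symbol m q) x + pd \<alpha> (symbol m ?r) x)) ?I"
      unfolding tilde_L2_set pd_symbol by (simp add: sum.distrib[symmetric] algebra_simps)
    also have "\<dots> \<le> L2_set (\<lambda>\<alpha>. norm (pd \<alpha> (symbol m q) x) + norm (pd \<alpha> (symbol m ?r) x)) ?I"
      by (intro L2_set_mono norm_triangle_ineq) simp
    also have "\<dots> \<le> tilde m q x + tilde m ?r x"
      unfolding tilde_L2_set by (rule L2_set_triangle_ineq)
    also have "tilde m ?r x \<le> (\<Sum>\<kappa>\<in>?I. norm (pd \<kappa> (symbol m ?r) x))" by (rule tilde_le_sum)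
    also have "\<dots> \<le> (\<Sum>\<kappa>\<in>?I. \<Sum>\<alpha>\<in>?I. ?d \<kappa> \<alpha> * (\<Sum>\<alpha>\<in>?I. norm (?r \<alpha>)))"
    proof (rule sum_mono)
      fix \<kappa> :: "'a \<Rightarrow> nat"
      show "norm (pd \<kappa> (symbol m ?r) x) \<le> (\<Sum>\<alpha>\<in>?I. ?d \<kappa> \<alpha> * (\<Sum>\<alpha>\<in>?I. norm (?r \<alpha>)))"
        unfolding pd_symbol norm_mult[symmetric]
      proof (rule sum_norm_le)
        fix \<alpha> :: "'a \<Rightarrow> nat" assume "\<alpha> \<in> ?I"
        then have "norm (?r \<alpha>) \<le> (\<Sum>\<alpha>\<in>?I. norm (?r \<alpha>))"
          by (intro member_le_sum finite_mi) auto
        then show "norm (?r \<alpha> * pd \<kappa> (\<lambda>x. complex_of_real (\<Prod>i\<in>UNIV. (x $ i) ^ \<alpha> i)) x)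
           \<le> ?d \<kappa> \<alpha> * (\<Sum>\<alpha>\<in>?I. norm (?r \<alpha>))"
          unfolding norm_mult by (subst mult.commute) (intro mult_left_mono, auto)
      qed
    qed
    also have "\<dots> = C * (\<Sum>\<alpha>\<in>?I. norm (?r \<alpha>))" by (simp add: C_def sum_distrib_right)
    finally show ?thesis by simp
  qed
  show ?thesis
  proof (intro exI[of _ C] conjI allI)
    show "C \<ge> 0" unfolding C_def by (intro sum_nonneg) simp
    fix p q :: "('a \<Rightarrow> nat) \<Rightarrow> complex"
    show "\<bar>tilde m p x - tilde m q x\<bar> \<le> C * (\<Sum>\<alpha>\<in>?I. norm (p \<alpha> - q \<alpha>))"
      using le[of p q] le[of q p] by (simp add: norm_minus_commute)
  qed
qed

text \<open>Among the \<open>m + 1\<close> radii, spaced by \<open>1 / (m + 1)\<close>, at least one stays away from the moduli of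
  all the (at most \<open>m\<close>) roots.\<close>

lemma poly_circle_bound:
  fixes q :: "complex poly"
  assumes "degree q \<le> m"
  shows "\<exists>l\<in>{1..m + 1}. \<forall>z. norm z = real l / real (m + 1) \<longrightarrow>
    (1 / (6 * real (m + 1))) ^ m * norm (poly q 1) \<le> norm (poly q z)"
proof (cases "q = 0")
  case True then show ?thesis by (intro bexI[of _ 1]) auto
next
  case False
  from alg_closed_imp_factorization[OF this]
  obtain A where A: "size A = degree q" "q = smult (lead_coeff q) (\<Prod>x\<in>#A. [:-x, 1:])"
    by (elim exE conjE)
  define M where "M = real (m + 1)"
  have M1: "M \<ge> 1" unfolding M_def by simp
  \<comment> \<open>\<open>Bad x\<close> are the radii within half a spacing of the modulus of the
    root x; at most one of the radii l / M can be that close.\<close>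
  define Bad where "Bad x = {l\<in>{1..m + 1}. \<bar>real l / M - norm x\<bar> < 1 / (2 * M)}" for x :: complex
  have cardB: "card (Bad x) \<le> 1" for x
  proof -
    have "k = l" if "k \<in> Bad x" "l \<in> Bad x" for k l
    proof -
      have "\<bar>real k / M - real l / M\<bar> < 1 / (2 * M) + 1 / (2 * M)" using that unfolding Bad_def by auto
      also have "1 / (2 * M) + 1 / (2 * M) = 1 / M" by simp
      also have "real k / M - real l / M = (real k - real l) / M" by (simp add: diff_divide_distrib)
      finally have "\<bar>real k - real l\<bar> / M < 1 / M" using M1 by (simp add: abs_divide)
      then have "\<bar>real k - real l\<bar> < 1" using M1 by (simp add: divide_less_cancel)
      then show ?thesis by linarith
    qed
    then show ?thesis by (intro card_le_Suc0_iff_eq[THEN iffD2, unfolded One_nat_def[symmetric]]) (auto simp: Bad_def)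
  qed
  have "card (\<Union>x\<in>set_mset A. Bad x) \<le> (\<Sum>x\<in>set_mset A. card (Bad x))"
    by (rule card_UN_le) simp
  also have "\<dots> \<le> (\<Sum>x\<in>set_mset A. 1)" by (intro sum_mono cardB)
  also have "\<dots> \<le> size A" unfolding size_multiset_overloaded_eq by (intro sum_mono) simp
  also have "\<dots> < card {1..m + 1}" using A(1) assms by simp
  finally have "card (\<Union>x\<in>set_mset A. Bad x) < card {1..m + 1}" .
  then have "\<not> {1..m + 1} \<subseteq> (\<Union>x\<in>set_mset A. Bad x)"
    using card_mono[of "\<Union>x\<in>set_mset A. Bad x" "{1..m + 1}"] by (auto simp: Bad_def)
  then obtain l where l: "l \<in> {1..m + 1}" and nb: "l \<notin> (\<Union>x\<in>set_mset A. Bad x)" by blast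
  have l2: "1 / (2 * M) \<le> \<bar>real l / M - norm x\<bar>" if "x \<in># A" for x
  proof -
    have "l \<notin> Bad x" using nb that by blast
    then show ?thesis using l unfolding Bad_def by simp
  qed
  \<comment> \<open>For a root with |x| \<le> 2 one has |1 - x| \<le> 3 and |z - x| \<ge> 1/(2M),
    whose quotient is 1/(6M). For |x| > 2 the comparison even holds with the factor 1/3.\<close>
  define c where "c = 1 / (6 * M)"
  have c: "0 < c" "c \<le> 1" using M1 unfolding c_def by (simp_all add: field_simps)
  show ?thesis
  proof (intro bexI[of _ l] allI impI l)
    fix z :: complex assume z: "norm z = real l / real (m + 1)"
    have z1: "norm z \<le> 1" using l unfolding z by simp
    have fac: "c * norm (1 - x) \<le> norm (z - x)" if x: "x \<in># A" for x
    proof (cases "norm x \<le> 2")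
      case True
      have "norm (1 - x) \<le> 3" using norm_triangle_ineq4[of 1 x] True by simp
      then have "c * norm (1 - x) \<le> c * 3" using c by (intro mult_left_mono) auto
      also have "\<dots> = 1 / (2 * M)" unfolding c_def by simp
      also have "\<dots> \<le> \<bar>norm z - norm x\<bar>" using l2[OF x] z unfolding M_def by simp
      also have "\<dots> \<le> norm (z - x)" by (rule norm_triangle_ineq3)
      finally show ?thesis .
    next
      case False
      have "c * norm (1 - x) \<le> (1 / 3) * norm (1 - x)"
        using M1 unfolding c_def by (intro mult_right_mono) (simp_all add: field_simps)
      also have "\<dots> \<le> (1 / 3) * (1 + norm x)" using norm_triangle_ineq4[of 1 x] by simp
      also have "\<dots> \<le> norm x - norm z" using False z1 by simp
      also have "\<dots> \<le> norm (z - x)" using norm_triangle_ineq2[of x z] by (simp add: norm_minus_commute)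
      finally show ?thesis .
    qed
    \<comment> \<open>Induction over sub-multisets of A keeps every factor a root of q, counted with
      multiplicity, so that \<open>fac\<close> applies to it.\<close>
    have "c ^ size B * norm (\<Prod>x\<in>#B. 1 - x) \<le> norm (\<Prod>x\<in>#B. z - x)" if "B \<subseteq># A" for B
      using that
    proof (induction B)
      case (add x B)
      have "(c * norm (1 - x)) * (c ^ size B * norm (\<Prod>x\<in>#B. 1 - x)) \<le> norm (z - x) * norm (\<Prod>x\<in>#B. z - x)"
        using add c by (intro mult_mono fac) (auto dest: mset_subset_eq_insertD subset_mset.less_imp_le)
      then show ?case by (simp add: norm_mult mult_ac)
    qed simp
    then have "c ^ size A * norm (\<Prod>x\<in>#A. 1 - x) \<le> norm (\<Prod>x\<in>#A. z - x)" by simp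
    moreover have "c ^ m * norm (\<Prod>x\<in>#A. 1 - x) \<le> c ^ size A * norm (\<Prod>x\<in>#A. 1 - x)"
      using c A(1) assms by (intro mult_right_mono power_decreasing) auto
    ultimately have *: "c ^ m * norm (\<Prod>x\<in>#A. 1 - x) \<le> norm (\<Prod>x\<in>#A. z - x)" by linarith
    have ev: "poly q w = lead_coeff q * (\<Prod>x\<in>#A. w - x)" for w
      by (subst A(2)) (simp add: poly_prod_mset)
    have "norm (lead_coeff q) * (c ^ m * norm (\<Prod>x\<in>#A. 1 - x)) \<le> norm (lead_coeff q) * norm (\<Prod>x\<in>#A. z - x)"
      by (intro mult_left_mono * norm_ge_zero)
    then show "(1 / (6 * real (m + 1))) ^ m * norm (poly q 1) \<le> norm (poly q z)"
      unfolding ev norm_mult c_def M_def by (simp only: mult_ac)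
  qed
qed

text \<open>On the complex line through x in a good grid direction the symbol becomes a polynomial q
  of one variable and degree at most m, with |q(1)| comparable to the weight. Some circle about 0 of
  radius l/(m+1) inherits this bound, and its radius is absorbed into the vector. Only finitely many
  vectors arise, since l and \<theta> range over finite sets.\<close>

lemma symbol_lower_bound:
  fixes r :: real
  assumes "r > 0"
  shows "\<exists>(V :: (real^'n::finite) set) c. finite V \<and> c > 0 \<and> (\<forall>v\<in>V. norm v \<le> r) \<and>
    (\<forall>p x. \<exists>v\<in>V. \<forall>w. norm w = 1 \<longrightarrow>
      c * tilde m p x \<le> norm (csymbol m p (cvec x + (\<chi> i. w * of_real (v $ i)))))"
proof -
  \<comment> \<open>With this choice \<tau> (m + 1) = r / n, so each component of an admissible
    vector is at most r / n and the sum of the n components at most r.\<close>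
  define \<tau> where "\<tau> = r / (real CARD('n) * real (m + 1))"
  have \<tau>: "\<tau> > 0" unfolding \<tau>_def using assms by simp
  obtain C where C: "C > 0" "\<And>p (x :: real^'n). \<exists>\<theta>. (\<forall>i. \<theta> i \<le> m) \<and>
    tilde m p x \<le> C * norm (csymbol m p (cvec x + (\<chi> i. of_real \<tau> * of_nat (\<theta> i))))"
    using tilde_le_grid[OF \<tau>, of m] by blast
  define vv where "vv l \<theta> = (\<chi> i. real l / real (m + 1) * (\<tau> * real (\<theta> i)))" for l and \<theta> :: "'n \<Rightarrow> nat"
  define V where "V = (\<lambda>(l, \<theta>). vv l \<theta>) ` ({1..m + 1} \<times> PiE UNIV (\<lambda>_. {..m}))"
  define d where "d = (1 / (6 * real (m + 1))) ^ m"
  have d: "d > 0" unfolding d_def by simp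
  show ?thesis
  proof (intro exI[of _ V] exI[of _ "d / C"] conjI ballI allI)
    show "finite V" unfolding V_def by (intro finite_imageI finite_cartesian_product finite_PiE) auto
    show "d / C > 0" using d C by simp
    fix v assume "v \<in> V"
    then obtain l \<theta> where l: "l \<le> m + 1" and \<theta>: "\<And>i. \<theta> i \<le> m" and v: "v = vv l \<theta>"
    proof -
      from \<open>v \<in> V\<close> obtain k where "k \<in> {1..m + 1} \<times> PiE UNIV (\<lambda>_. {..m})" "v = (\<lambda>(l, \<theta>). vv l \<theta>) k"
        unfolding V_def by blast
      then show ?thesis by (intro that[of "fst k" "snd k"]) (auto simp: PiE_def Pi_def split: prod.splits)
    qed
    have "norm v \<le> (\<Sum>i\<in>UNIV. \<bar>v $ i\<bar>)" by (rule norm_le_l1_cart)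
    also have "\<dots> \<le> (\<Sum>i\<in>(UNIV :: 'n set). \<tau> * real (m + 1))"
    proof (rule sum_mono)
      fix i
      have "real l / real (m + 1) \<le> 1" using l by simp
      moreover have "\<tau> * real (\<theta> i) \<le> \<tau> * real (m + 1)" using \<tau> \<theta>[of i] by (intro mult_left_mono) auto
      ultimately have "real l / real (m + 1) * (\<tau> * real (\<theta> i)) \<le> 1 * (\<tau> * real (m + 1))"
        using \<tau> by (intro mult_mono) auto
      moreover have "0 \<le> v $ i" unfolding v vv_def using \<tau> by simp
      ultimately show "\<bar>v $ i\<bar> \<le> \<tau> * real (m + 1)" unfolding v vv_def by simp
    qed
    also have "\<dots> = r" unfolding \<tau>_def by simp
    finally show "norm v \<le> r" .
  next
    fix p and x :: "real^'n"
    obtain \<theta> where \<theta>: "\<And>i. \<theta> i \<le> m"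
      "tilde m p x \<le> C * norm (csymbol m p (cvec x + (\<chi> i. of_real \<tau> * of_nat (\<theta> i))))"
      using C(2)[of p x] by blast
    \<comment> \<open>The restriction of the symbol to the points x + z \<tau> \<theta>, written as
      a polynomial in z.\<close>
    define q where "q = (\<Sum>\<alpha> | mi_deg \<alpha> \<le> m. smult (p \<alpha>)
      (\<Prod>i\<in>UNIV. [:complex_of_real (x $ i), of_real (\<tau> * real (\<theta> i)):] ^ \<alpha> i))"
    have evq: "poly q z = csymbol m p (cvec x + (\<chi> i. z * of_real (\<tau> * real (\<theta> i))))" for z
      unfolding q_def csymbol_def by (simp add: poly_sum poly_prod)
    have "degree q \<le> m"
      unfolding q_def
    proof (rule degree_sum_le[OF finite_mi])
      fix \<alpha> :: "'n \<Rightarrow> nat" assume "\<alpha> \<in> {\<alpha>. mi_deg \<alpha> \<le> m}"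
      have "degree (smult (p \<alpha>) (\<Prod>i\<in>UNIV. [:complex_of_real (x $ i), of_real (\<tau> * real (\<theta> i)):] ^ \<alpha> i))
        \<le> degree (\<Prod>i\<in>UNIV. [:complex_of_real (x $ i), of_real (\<tau> * real (\<theta> i)):] ^ \<alpha> i)"
        by (rule degree_smult_le)
      also have "\<dots> \<le> (\<Sum>i\<in>UNIV. degree ([:complex_of_real (x $ i), of_real (\<tau> * real (\<theta> i)):] ^ \<alpha> i))"
        by (rule order_trans[OF degree_prod_sum_le]) (simp_all only: o_def, simp_all)
      also have "\<dots> \<le> (\<Sum>i\<in>UNIV. \<alpha> i)"
        by (intro sum_mono order_trans[OF degree_power_le]) (simp split: if_splits)
      also have "\<dots> \<le> m" using \<open>\<alpha> \<in> _\<close> by (simp add: mi_deg_def)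
      finally show "degree (smult (p \<alpha>) (\<Prod>i\<in>UNIV. [:complex_of_real (x $ i), of_real (\<tau> * real (\<theta> i)):] ^ \<alpha> i)) \<le> m" .
    qed
    then obtain l where l: "l \<in> {1..m + 1}" "\<And>z. norm z = real l / real (m + 1) \<Longrightarrow> d * norm (poly q 1) \<le> norm (poly q z)"
      using poly_circle_bound[of q m] unfolding d_def by blast
    show "\<exists>v\<in>V. \<forall>w. norm w = 1 \<longrightarrow>
      d / C * tilde m p x \<le> norm (csymbol m p (cvec x + (\<chi> i. w * of_real (v $ i))))"
    proof (intro bexI[of _ "vv l \<theta>"] allI impI)
      show "vv l \<theta> \<in> V" unfolding V_def using l(1) \<theta>(1) by (intro image_eqI[of _ _ "(l, \<theta>)"]) auto
      fix w :: complex assume w: "norm w = 1"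
      have "tilde m p x \<le> C * norm (poly q 1)" using \<theta>(2) unfolding evq by simp
      then have "d / C * tilde m p x \<le> d / C * (C * norm (poly q 1))"
        using d C by (intro mult_left_mono) auto
      also have "\<dots> = d * norm (poly q 1)" using C by simp
      also have "\<dots> \<le> norm (poly q (w * of_real (real l / real (m + 1))))"
        by (intro l(2)) (simp only: norm_mult w norm_of_real, simp)
      also have "poly q (w * of_real (real l / real (m + 1))) = csymbol m p (cvec x + (\<chi> i. w * of_real (vv l \<theta> $ i)))"
        unfolding evq vv_def by (simp only: vec_lambda_beta of_real_mult mult.assoc)
      finally show "d / C * tilde m p x \<le> norm (csymbol m p (cvec x + (\<chi> i. w * of_real (vv l \<theta> $ i))))" .
    qed
  qed
qed

text \<open>For finitely many candidates the first admissible one is a measurable choice: each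
  induction step is a case distinction on one Borel set.\<close>

lemma measurable_selection_finite:
  fixes S :: "'b::topological_space \<Rightarrow> 'a::topological_space set"
  assumes "finite V" "\<And>v. v \<in> V \<Longrightarrow> S v \<in> sets borel"
  shows "\<exists>f\<in>borel_measurable borel. \<forall>x\<in>(\<Union>v\<in>V. S v). f x \<in> V \<and> x \<in> S (f x)"
  using assms
proof (induction V)
  case empty
  show ?case by (rule bexI[of _ "\<lambda>_. undefined"]) auto
next
  case (insert a V)
  then obtain f where "f \<in> borel_measurable borel" "\<forall>x\<in>(\<Union>v\<in>V. S v). f x \<in> V \<and> x \<in> S (f x)" by auto
  moreover have "(\<lambda>x. if x \<in> S a then a else f x) \<in> borel_measurable borel"
    using insert.prems[of a] calculation(1) by (intro measurable_If_set) auto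
  ultimately show ?case by (intro bexI[of _ "\<lambda>x. if x \<in> S a then a else f x"]) auto
qed

lemma continuous_on_csymbol: "continuous_on UNIV (csymbol m p)"
  unfolding csymbol_def[abs_def] by (intro continuous_intros)

lemma continuous_on_cvec: "continuous_on UNIV cvec"
  unfolding cvec_def[abs_def] by (intro continuous_intros)

lemma symbol_lower_bound_selection:
  fixes r :: real
  assumes "r > 0"
  shows "\<exists>c>0. \<forall>p. \<exists>v :: real^'n::finite \<Rightarrow> real^'n. v \<in> borel_measurable borel \<and> (\<forall>x. norm (v x) \<le> r) \<and>
    (\<forall>x w. norm w = 1 \<longrightarrow> c * tilde m p x \<le> norm (csymbol m p (cvec x + (\<chi> i. w * of_real (v x $ i)))))"
proof -
  obtain V :: "(real^'n) set" and c where V: "finite V" "c > 0" "\<And>v. v \<in> V \<Longrightarrow> norm v \<le> r"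
    "\<And>p x. \<exists>v\<in>V. \<forall>w. norm w = 1 \<longrightarrow>
      c * tilde m p x \<le> norm (csymbol m p (cvec x + (\<chi> i. w * of_real (v $ i))))"
    using symbol_lower_bound[OF assms, of m, where 'n = 'n] by metis
  show ?thesis
  proof (intro exI[of _ c] conjI V(2) allI)
    fix p :: "('n \<Rightarrow> nat) \<Rightarrow> complex"
    \<comment> \<open>The intersection runs over the whole unit circle, but every condition is a
      weak inequality between continuous functions of x. The set is therefore closed, in particular
      Borel.\<close>
    define S where "S v = (\<Inter>w\<in>{w. norm w = 1}. {x :: real^'n.
        c * tilde m p x \<le> norm (csymbol m p (cvec x + (\<chi> i. w * of_real (v $ i))))})" for v :: "real^'n"
    have "closed (S v)" for v
      unfolding S_def
      by (intro closed_INT ballI closed_Collect_le continuous_intros continuous_on_tilde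
          continuous_on_compose2[OF continuous_on_csymbol] continuous_on_cvec) auto
    then have "\<exists>f\<in>borel_measurable borel. \<forall>x\<in>(\<Union>v\<in>V. S v). f x \<in> V \<and> x \<in> S (f x)"
      by (intro measurable_selection_finite V(1)) simp
    moreover have "(\<Union>v\<in>V. S v) = UNIV" using V(4)[of p] unfolding S_def by auto
    ultimately obtain f where "f \<in> borel_measurable borel" "\<And>x. f x \<in> V \<and> x \<in> S (f x)" by auto
    then show "\<exists>v. v \<in> borel_measurable borel \<and> (\<forall>x. norm (v x) \<le> r) \<and>
      (\<forall>x w. norm w = 1 \<longrightarrow> c * tilde m p x \<le> norm (csymbol m p (cvec x + (\<chi> i. w * of_real (v x $ i)))))"
      using V(3) unfolding S_def by (intro exI[of _ f]) auto
  qed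
qed

section \<open>The Fourier--Laplace transform\<close>

text \<open>The axis vectors identify coordinates with \<open>Basis\<close>, and
  \<open>lborel\<close> is the image of the product measure indexed by \<open>Basis\<close>, where
  integrals of products split.\<close>

lemma lborel_vec_prod:
  fixes h :: "'n::finite \<Rightarrow> real \<Rightarrow> complex"
  assumes "\<And>i. integrable lborel (h i)"
  shows "integrable lborel (\<lambda>x::real^'n. \<Prod>i\<in>UNIV. h i (x $ i))"
    and "(LINT x|lborel. (\<Prod>i\<in>UNIV. h i ((x::real^'n) $ i))) = (\<Prod>i\<in>UNIV. LINT t|lborel. h i t)"
proof -
  let ?ax = "\<lambda>i. axis i 1 :: real^'n"
  have inj: "inj ?ax" by (simp add: inj_def axis_eq_axis)
  have B: "(Basis :: (real^'n) set) = range ?ax" by (auto simp: Basis_vec_def)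
  define k where "k b = h (inv ?ax b)" for b
  have k: "k (?ax i) = h i" for i by (simp add: k_def inv_f_f[OF inj])
  have P: "(\<Prod>i\<in>UNIV. h i (x $ i)) = (\<Prod>b\<in>Basis. k b (x \<bullet> b))" for x :: "real^'n"
    unfolding B by (subst prod.reindex[OF inj]) (simp add: k inner_axis)
  have I: "(\<Prod>i\<in>UNIV. LINT t|lborel. h i t) = (\<Prod>b\<in>(Basis :: (real^'n) set). LINT t|lborel. k b t)"
    unfolding B by (subst prod.reindex[OF inj]) (simp add: k)
  interpret product_sigma_finite "\<lambda>_::real^'n. lborel :: real measure" ..
  have kint: "integrable lborel (k b)" for b unfolding k_def by (rule assms)
  have T: "(\<lambda>f. \<Sum>b\<in>Basis. f b *\<^sub>R b) \<in> measurable (\<Pi>\<^sub>M b\<in>(Basis :: (real^'n) set). lborel) borel" by simp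
  have M: "(\<lambda>x::real^'n. \<Prod>b\<in>Basis. k b (x \<bullet> b)) \<in> borel_measurable borel"
  proof (intro borel_measurable_prod)
    fix b :: "real^'n"
    have "k b \<in> borel_measurable borel" using borel_measurable_integrable[OF kint[of b]] by simp
    then show "(\<lambda>x. k b (x \<bullet> b)) \<in> borel_measurable borel" by measurable
  qed
  have e: "(\<Prod>b\<in>Basis. k b ((\<Sum>c\<in>Basis. f c *\<^sub>R c) \<bullet> b)) = (\<Prod>b\<in>(Basis :: (real^'n) set). k b (f b))" for f
    by (intro prod.cong) (simp_all add: inner_sum_left_Basis)
  show "integrable lborel (\<lambda>x::real^'n. \<Prod>i\<in>UNIV. h i (x $ i))"
    unfolding P by (subst lborel_eq, subst integrable_distr_eq[OF T M])
      (unfold e, intro product_integrable_prod kint, simp)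
  show "(LINT x|lborel. (\<Prod>i\<in>UNIV. h i ((x::real^'n) $ i))) = (\<Prod>i\<in>UNIV. LINT t|lborel. h i t)"
    unfolding P I by (subst lborel_eq, subst integral_distr[OF T M])
      (unfold e, intro product_integral_prod kint, simp)
qed

lemma integrable_inverse_square: "integrable lborel (\<lambda>t::real. inverse (1 + t\<^sup>2))"
  using integrable_inverse_1_plus_square by (simp add: set_integrable_def)

text \<open>Each factor satisfies 1 + x_i^2 \<le> (1 + |x|)^2, so the power 2n dominates the product
  of the one-dimensional weights. This is the reserve of 2n powers in all later estimates.\<close>

lemma integrable_weight: "integrable lborel (\<lambda>x::real^'n::finite. inverse ((1 + norm x) ^ (2 * CARD('n))))"
proof (rule Bochner_Integration.integrable_bound)
  have "integrable lborel (\<lambda>x::real^'n. \<Prod>i\<in>UNIV. complex_of_real (inverse (1 + (x $ i)\<^sup>2)))"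
    by (intro lborel_vec_prod integrable_of_real integrable_inverse_square)
  then show "integrable lborel (\<lambda>x::real^'n. \<Prod>i\<in>UNIV. complex_of_real (inverse (1 + (x $ i)\<^sup>2)))" .
  show "AE x in lborel. norm (inverse ((1 + norm x) ^ (2 * CARD('n)))) \<le>
      norm (\<Prod>i\<in>UNIV. complex_of_real (inverse (1 + ((x::real^'n) $ i)\<^sup>2)))"
  proof (rule AE_I2)
    fix x :: "real^'n"
    have "inverse ((1 + norm x) ^ (2 * CARD('n))) = (\<Prod>i\<in>(UNIV :: 'n set). inverse ((1 + norm x)\<^sup>2))"
      by (simp add: power_mult power_inverse)
    also have "\<dots> \<le> (\<Prod>i\<in>UNIV. inverse (1 + (x $ i)\<^sup>2))"
    proof (intro prod_mono conjI le_imp_inverse_le)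
      fix i
      have "(x $ i)\<^sup>2 \<le> (norm x)\<^sup>2" using component_le_norm_cart[of x i] by (metis abs_le_square_iff abs_norm_cancel)
      then show "1 + (x $ i)\<^sup>2 \<le> (1 + norm x)\<^sup>2"
      proof -
        have "(1 + norm x)\<^sup>2 = 1 + 2 * norm x + (norm x)\<^sup>2" by (simp add: power2_eq_square algebra_simps)
        with \<open>(x $ i)\<^sup>2 \<le> (norm x)\<^sup>2\<close> show ?thesis using norm_ge_zero[of x] by linarith
      qed
    qed (auto intro: add_pos_nonneg)
    also have "\<dots> = norm (\<Prod>i\<in>UNIV. complex_of_real (inverse (1 + (x $ i)\<^sup>2)))"
      unfolding prod_norm[symmetric] by (intro prod.cong refl) (simp only: norm_of_real, simp)
    finally show "norm (inverse ((1 + norm x) ^ (2 * CARD('n)))) \<le>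
      norm (\<Prod>i\<in>UNIV. complex_of_real (inverse (1 + (x $ i)\<^sup>2)))" by simp
  qed
qed measurable

lemma lborel_integral_shift:
  fixes f :: "'a::euclidean_space \<Rightarrow> 'b::{banach, second_countable_topology}"
  shows "(LINT x|lborel. f (x + c)) = (LINT x|lborel. f x)"
proof (cases "f \<in> borel_measurable borel")
  case True
  have "(LINT x|lborel. f x) = (LINT x|distr lborel borel ((+) c). f x)" by (simp add: lborel_distr_plus)
  also have "\<dots> = (LINT x|lborel. f (c + x))" using True by (subst integral_distr) simp_all
  finally show ?thesis by (simp add: add.commute)
next
  case False
  \<comment> \<open>For a non-measurable f both integrals have the default value 0.\<close>
  have "\<not> integrable lborel f" using False by (auto dest: borel_measurable_integrable)
  moreover have "\<not> integrable lborel (\<lambda>x. f (x + c))"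
  proof
    assume "integrable lborel (\<lambda>x. f (x + c))"
    then have "(\<lambda>x. f (x + c)) \<in> borel_measurable borel" by (auto dest: borel_measurable_integrable)
    then have "(\<lambda>x. f ((x - c) + c)) \<in> borel_measurable borel"
      by (rule measurable_compose[rotated]) simp
    with False show False by simp
  qed
  ultimately show ?thesis by (simp add: not_integrable_integral_eq)
qed

lemma lborel_integrable_shift:
  fixes f :: "'a::euclidean_space \<Rightarrow> 'b::{banach, second_countable_topology}"
  assumes "integrable lborel f"
  shows "integrable lborel (\<lambda>x. f (x + c))"
proof -
  have "integrable (distr lborel borel ((+) c)) f" using assms by (simp add: lborel_distr_plus)
  then have "integrable lborel (\<lambda>x. f (c + x))" by (subst (asm) integrable_distr_eq) (use assms in \<open>auto dest: borel_measurable_integrable\<close>)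
  then show ?thesis by (simp add: add.commute)
qed

lemma lborel_integral_scale:
  fixes f :: "'a::euclidean_space \<Rightarrow> 'b::{banach, second_countable_topology}"
  assumes "f \<in> borel_measurable borel" "c \<noteq> 0"
  shows "(LINT x|lborel. f x) = \<bar>c\<bar> ^ DIM('a) *\<^sub>R (LINT x|lborel. f (c *\<^sub>R x))"
proof -
  have "(LINT x|lborel. f x) = (LINT x|density (distr lborel borel (\<lambda>x. 0 + c *\<^sub>R x)) (\<lambda>_. ennreal (\<bar>c\<bar> ^ DIM('a))). f x)"
    using lborel_affine[of c "0 :: 'a"] assms by simp
  also have "\<dots> = (LINT x|distr lborel borel (\<lambda>x. 0 + c *\<^sub>R x). (\<bar>c\<bar> ^ DIM('a)) *\<^sub>R f x)"
    using assms by (subst integral_density) auto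
  also have "\<dots> = (LINT x|lborel. (\<bar>c\<bar> ^ DIM('a)) *\<^sub>R f (c *\<^sub>R x))"
    using assms by (subst integral_distr) auto
  finally show ?thesis using assms by simp
qed

lemma lborel_integrable_scale:
  fixes f :: "'a::euclidean_space \<Rightarrow> 'b::{banach, second_countable_topology}"
  assumes "integrable lborel f" "c \<noteq> 0"
  shows "integrable lborel (\<lambda>x. f (c *\<^sub>R x))"
proof -
  have m: "f \<in> borel_measurable borel" using assms by (auto dest: borel_measurable_integrable)
  have "integrable (density (distr lborel borel (\<lambda>x. 0 + c *\<^sub>R x)) (\<lambda>_. ennreal (\<bar>c\<bar> ^ DIM('a)))) f"
    using lborel_affine[of c "0 :: 'a"] assms by simp
  then have "integrable (distr lborel borel (\<lambda>x. 0 + c *\<^sub>R x)) (\<lambda>x. (\<bar>c\<bar> ^ DIM('a)) *\<^sub>R f x)"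
    using m by (subst (asm) integrable_density) auto
  then have "integrable lborel (\<lambda>x. (\<bar>c\<bar> ^ DIM('a)) *\<^sub>R f (c *\<^sub>R x))"
    using m by (subst (asm) integrable_distr_eq) auto
  from integrable_scaleR_right[OF this, of "inverse (\<bar>c\<bar> ^ DIM('a))"] show ?thesis using assms by simp
qed

section \<open>Product measures, segments and the shift of contours\<close>

lemma integrable_pair_bound:
  fixes f :: "'a \<times> 'b \<Rightarrow> 'c::{banach, second_countable_topology}"
  assumes "pair_sigma_finite M1 M2" and [measurable]: "f \<in> borel_measurable (M1 \<Otimes>\<^sub>M M2)"
    and g: "integrable M1 g" and h: "integrable M2 h"
    and b: "\<And>x y. x \<in> space M1 \<Longrightarrow> y \<in> space M2 \<Longrightarrow> norm (f (x, y)) \<le> g x * (h y :: real)"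
  shows "integrable (M1 \<Otimes>\<^sub>M M2) f"
proof (rule Bochner_Integration.integrable_bound)
  interpret pair_sigma_finite M1 M2 by fact
  have [measurable]: "g \<in> borel_measurable M1" "h \<in> borel_measurable M2" using g h by auto
  show "integrable (M1 \<Otimes>\<^sub>M M2) (\<lambda>z. g (fst z) * h (snd z))"
    by (rule Fubini_integrable) (use g h in \<open>auto simp: abs_mult\<close>)
  show "AE z in M1 \<Otimes>\<^sub>M M2. norm (f z) \<le> norm (g (fst z) * h (snd z))"
    using b by (intro AE_I2) (auto simp: space_pair_measure intro: order_trans[OF _ abs_ge_self])
qed fact

text \<open>A finite measure in its own right rather than a set integral, so that products with
  \<open>lborel\<close> fall under Fubini. The length T is a parameter because
  \<open>contour_shift\<close> lets it grow.\<close>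

definition unit_seg :: "real \<Rightarrow> real measure" where
  "unit_seg T = restrict_space lborel {0..T}"

lemma finite_measure_unit_seg: "finite_measure (unit_seg T)"
  unfolding unit_seg_def
  by (rule finite_measureI) (simp add: space_restrict_space emeasure_restrict_space emeasure_lborel_Icc_eq)

lemma sets_unit_seg [measurable_cong]: "sets (unit_seg T) = sets (restrict_space borel {0..T})"
  by (simp add: unit_seg_def sets_restrict_space)

lemma space_unit_seg [simp]: "space (unit_seg T) = {0..T}"
  by (simp add: unit_seg_def space_restrict_space)

lemma measurable_unit_seg_ident [measurable]: "(\<lambda>t. t) \<in> borel_measurable (unit_seg T)"
  by (simp add: unit_seg_def measurable_restrict_space1)

lemma measure_unit_seg: "T \<ge> 0 \<Longrightarrow> measure (unit_seg T) {0..T} = T"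
  by (simp add: unit_seg_def measure_restrict_space)

lemma pair_sigma_finite_unit_seg:
  "sigma_finite_measure M \<Longrightarrow> pair_sigma_finite M (unit_seg T)"
  using finite_measure.sigma_finite_measure[OF finite_measure_unit_seg]
  by (intro pair_sigma_finite.intro)

lemma unit_seg_FTC:
  fixes F :: "real \<Rightarrow> 'a::euclidean_space"
  assumes "T \<ge> 0" "\<And>t. 0 \<le> t \<Longrightarrow> t \<le> T \<Longrightarrow> (F has_vector_derivative f t) (at t within {0..T})" "continuous_on {0..T} f"
  shows "(LINT t|unit_seg T. f t) = F T - F 0" "integrable (unit_seg T) f"
proof -
  have "has_bochner_integral lborel (\<lambda>x. indicator {0..T} x *\<^sub>R f x) (F T - F 0)"
    by (rule has_bochner_integral_FTC_Icc) (use assms in auto)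
  then show "(LINT t|unit_seg T. f t) = F T - F 0" "integrable (unit_seg T) f"
    unfolding unit_seg_def by (simp_all add: integral_restrict_space integrable_restrict_space has_bochner_integral_iff)
qed

text \<open>Averaging over translates in a direction \<open>e\<close> reduces statements about integrals over the
  whole space to one-dimensional ones on lines parallel to \<open>e\<close>.\<close>

lemma integral_average_translates:
  fixes G :: "'a::euclidean_space \<Rightarrow> complex"
  assumes G: "integrable lborel G" and T: "T \<ge> 0"
  shows "integrable lborel (\<lambda>x. LINT t|unit_seg T. G (x + t *\<^sub>R e))"
    and "(LINT x|lborel. LINT t|unit_seg T. G (x + t *\<^sub>R e)) = T *\<^sub>R (LINT x|lborel. G x)"
proof -
  interpret finite_measure "unit_seg T" by (rule finite_measure_unit_seg)
  interpret S: pair_sigma_finite "unit_seg T" "lborel :: 'a measure" ..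
  interpret S': pair_sigma_finite "lborel :: 'a measure" "unit_seg T" ..
  have [measurable]: "G \<in> borel_measurable borel" using G by (auto dest: borel_measurable_integrable)
  have m: "(\<lambda>z. G (snd z + fst z *\<^sub>R e)) \<in> borel_measurable (unit_seg T \<Otimes>\<^sub>M lborel)" by measurable
  have I: "integrable (unit_seg T \<Otimes>\<^sub>M lborel) (\<lambda>z. G (snd z + fst z *\<^sub>R e))"
  proof (rule S.Fubini_integrable[OF m])
    show "AE t in unit_seg T. integrable lborel (\<lambda>y. G (snd (t, y) + fst (t, y) *\<^sub>R e))"
      using lborel_integrable_shift[OF G] by simp
    show "integrable (unit_seg T) (\<lambda>t. LINT y|lborel. norm (G (snd (t, y) + fst (t, y) *\<^sub>R e)))"
      by (simp add: lborel_integral_shift[of "\<lambda>x. norm (G x)"])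
  qed
  have I': "integrable (lborel \<Otimes>\<^sub>M unit_seg T) (\<lambda>(x, t). G (x + t *\<^sub>R e))"
    using S.integrable_product_swap[OF I] by (simp add: case_prod_beta)
  show "integrable lborel (\<lambda>x. LINT t|unit_seg T. G (x + t *\<^sub>R e))"
    using S'.integrable_fst'[OF I'] by simp
  have "(LINT x|lborel. LINT t|unit_seg T. G (x + t *\<^sub>R e)) = (LINT t|unit_seg T. LINT x|lborel. G (x + t *\<^sub>R e))"
    using S'.Fubini_integral[OF I'] by simp
  also have "\<dots> = T *\<^sub>R (LINT x|lborel. G x)"
    by (simp add: lborel_integral_shift measure_unit_seg[OF T])
  finally show "(LINT x|lborel. LINT t|unit_seg T. G (x + t *\<^sub>R e)) = T *\<^sub>R (LINT x|lborel. G x)" .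
qed

text \<open>Averaging over translates by t e with t in [0,1] replaces G(x) by F(x + e) - F(x), and
  translation invariance makes the integral vanish. Integrability of F and G takes the place of
  boundary terms at infinity.\<close>

lemma integral_directional_derivative_zero:
  fixes F G :: "'a::euclidean_space \<Rightarrow> complex"
  assumes F: "integrable lborel F" and G: "integrable lborel G" "continuous_on UNIV G"
    and d: "\<And>x t. ((\<lambda>t. F (x + t *\<^sub>R e)) has_vector_derivative G (x + t *\<^sub>R e)) (at t)"
  shows "(LINT x|lborel. G x) = 0"
proof -
  have "(LINT x|lborel. G x) = (LINT x|lborel. LINT t|unit_seg 1. G (x + t *\<^sub>R e))"
    using integral_average_translates(2)[OF G(1), of 1 e] by simp
  also have "\<dots> = (LINT x|lborel. F (x + 1 *\<^sub>R e) - F (x + 0 *\<^sub>R e))"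
  proof (intro Bochner_Integration.integral_cong refl unit_seg_FTC(1))
    fix x :: 'a
    show "continuous_on {0..1} (\<lambda>t. G (x + t *\<^sub>R e))"
      by (rule continuous_on_compose2[OF G(2)]) (auto intro!: continuous_intros)
  qed (auto intro: has_vector_derivative_at_within d)
  also have "\<dots> = (LINT x|lborel. F (x + e)) - (LINT x|lborel. F x)"
    using F lborel_integrable_shift[OF F, of e] by simp
  also have "\<dots> = 0" by (simp add: lborel_integral_shift)
  finally show ?thesis .
qed

text \<open>Take rectangles of length T on each line in direction e and integrate over all starting
  points. The horizontal sides contribute T times the difference of the two integrals; the vertical
  sides stay below 2 |\<sigma>| times the integral of B, whatever T is. Letting T grow forces the
  difference to be 0. The assumption \<open>tr\<close> says that moving x along e is a real shift of
  s.\<close>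

lemma contour_shift:
  fixes \<Phi> :: "'a::euclidean_space \<Rightarrow> complex \<Rightarrow> complex"
  assumes hol: "\<And>x. \<Phi> x holomorphic_on {s. \<bar>Im s\<bar> < \<rho>}"
    and tr: "\<And>x t s. \<bar>Im s\<bar> < \<rho> \<Longrightarrow> \<Phi> x (of_real t + s) = \<Phi> (x + t *\<^sub>R e) s"
    and bd: "\<And>x \<tau>. \<bar>\<tau>\<bar> < \<rho> \<Longrightarrow> norm (\<Phi> x (\<i> * of_real \<tau>)) \<le> B x"
    and B: "integrable lborel B"
    and meas: "\<And>\<tau>. \<bar>\<tau>\<bar> < \<rho> \<Longrightarrow> (\<lambda>x. \<Phi> x (\<i> * of_real \<tau>)) \<in> borel_measurable borel"
    and \<sigma>: "\<bar>\<sigma>\<bar> < \<rho>"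
  shows "(LINT x|lborel. \<Phi> x 0) = (LINT x|lborel. \<Phi> x (\<i> * of_real \<sigma>))"
proof -
  have \<rho>: "\<rho> > 0" using \<sigma> by linarith
  let ?S = "{s. \<bar>Im s\<bar> < \<rho>}"
  have openS: "open ?S" by (intro open_Collect_less continuous_intros)
  have convS: "convex ?S"
  proof -
    have "?S = {s. Im s < \<rho>} \<inter> {s. Im s > - \<rho>}" by auto
    then show ?thesis by (simp add: convex_Int convex_halfspace_Im_lt convex_halfspace_Im_gt)
  qed
  define I where "I \<tau> = (LINT x|lborel. \<Phi> x (\<i> * of_real \<tau>))" for \<tau>
  have B0: "0 \<le> B x" for x
    by (rule order_trans[OF norm_ge_zero bd[of 0 x]]) (use \<rho> in simp)
  have int: "integrable lborel (\<lambda>x. \<Phi> x (\<i> * of_real \<tau>))" if "\<bar>\<tau>\<bar> < \<rho>" for \<tau>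
    using bd[OF that] meas[OF that] B0 by (intro Bochner_Integration.integrable_bound[OF B] AE_I2) auto
  have main: "T * norm (I 0 - I \<sigma>) \<le> 2 * \<bar>\<sigma>\<bar> * (LINT x|lborel. B x)" if T: "T \<ge> 0" for T
  proof -
    have tr': "\<Phi> (x + t *\<^sub>R e) (\<i> * of_real \<tau>) = \<Phi> x (of_real t + \<i> * of_real \<tau>)" if "\<bar>\<tau>\<bar> < \<rho>" for x t \<tau>
      by (rule tr[symmetric]) (use that in simp)
    have pt: "norm ((LINT t|unit_seg T. \<Phi> (x + t *\<^sub>R e) (\<i> * of_real 0)) -
        (LINT t|unit_seg T. \<Phi> (x + t *\<^sub>R e) (\<i> * of_real \<sigma>))) \<le> \<bar>\<sigma>\<bar> * (B (x + T *\<^sub>R e) + B x)" for x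
    proof -
      \<comment> \<open>A primitive on the convex strip replaces Cauchy's theorem on the rectangle:
        horizontal integrals become differences of P, and vertical ones are bounded by the mean
        value inequality.\<close>
      obtain P where P: "\<And>s. s \<in> ?S \<Longrightarrow> (P has_field_derivative \<Phi> x s) (at s within ?S)"
        using holomorphic_convex_primitive'[OF convS openS hol] by blast
      have P': "(P has_field_derivative \<Phi> x s) (at s)" if "s \<in> ?S" for s
        using P[OF that] at_within_open[OF that openS] by simp
      have hor: "(LINT t|unit_seg T. \<Phi> (x + t *\<^sub>R e) (\<i> * of_real \<tau>)) =
          P (of_real T + \<i> * of_real \<tau>) - P (of_real 0 + \<i> * of_real \<tau>)" if \<tau>: "\<bar>\<tau>\<bar> < \<rho>" for \<tau>
        unfolding tr'[OF \<tau>]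
      proof (rule unit_seg_FTC(1)[OF T])
        fix t :: real
        have "((\<lambda>t. complex_of_real t + \<i> * of_real \<tau>) has_vector_derivative (of_real 1 + 0)) (at t within {0..T})"
          by (intro has_vector_derivative_add has_vector_derivative_of_real has_vector_derivative_const DERIV_ident)
        then show "((\<lambda>t. P (of_real t + \<i> * of_real \<tau>)) has_vector_derivative \<Phi> x (of_real t + \<i> * of_real \<tau>)) (at t within {0..T})"
          using field_vector_diff_chain_within[of "\<lambda>t. of_real t + \<i> * of_real \<tau>" 1 t "{0..T}" P "\<Phi> x (of_real t + \<i> * of_real \<tau>)"]
            has_field_derivative_at_within[OF P'[of "of_real t + \<i> * of_real \<tau>"]] \<tau>
          by (auto simp: o_def intro!: derivative_eq_intros)
      next
        show "continuous_on {0..T} (\<lambda>t. \<Phi> x (of_real t + \<i> * of_real \<tau>))"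
          by (rule continuous_on_compose2[OF holomorphic_on_imp_continuous_on[OF hol]])
             (use \<tau> in \<open>auto intro!: continuous_intros\<close>)
      qed
      have ver: "norm (P (of_real t + \<i> * of_real \<sigma>) - P (of_real t + \<i> * of_real 0)) \<le> B (x + t *\<^sub>R e) * \<bar>\<sigma>\<bar>" for t
      proof -
        let ?s = "closed_segment (of_real t + \<i> * of_real 0) (of_real t + \<i> * of_real \<sigma>)"
        have seg: "\<exists>\<tau>. z = of_real t + \<i> * of_real \<tau> \<and> \<bar>\<tau>\<bar> < \<rho>" if "z \<in> ?s" for z
        proof -
          obtain u where u: "0 \<le> u" "u \<le> 1" "z = (1 - u) *\<^sub>R (of_real t + \<i> * of_real 0) + u *\<^sub>R (of_real t + \<i> * of_real \<sigma>)"
            using \<open>z \<in> ?s\<close> by (auto simp: closed_segment_def)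
          have "\<bar>u * \<sigma>\<bar> \<le> 1 * \<bar>\<sigma>\<bar>" unfolding abs_mult using u by (intro mult_right_mono) auto
          moreover have "z = of_real t + \<i> * of_real (u * \<sigma>)"
            unfolding u(3) by (simp add: scaleR_conv_of_real algebra_simps)
          ultimately show ?thesis using \<sigma> by (intro exI[of _ "u * \<sigma>"]) auto
        qed
        have "norm (P (of_real t + \<i> * of_real \<sigma>) - P (of_real t + \<i> * of_real 0)) \<le>
            B (x + t *\<^sub>R e) * norm ((of_real t + \<i> * of_real \<sigma>) - (of_real t + \<i> * of_real 0))"
        proof (rule field_differentiable_bound[of ?s P "\<Phi> x"])
          fix z assume "z \<in> ?s"
          then obtain \<tau> where \<tau>: "z = of_real t + \<i> * of_real \<tau>" "\<bar>\<tau>\<bar> < \<rho>" using seg by blast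
          show "(P has_field_derivative \<Phi> x z) (at z within ?s)"
            by (rule has_field_derivative_at_within[OF P']) (use \<tau> in simp)
          show "norm (\<Phi> x z) \<le> B (x + t *\<^sub>R e)"
            using bd[OF \<tau>(2), of "x + t *\<^sub>R e"] unfolding tr'[OF \<tau>(2)] \<tau>(1) .
        qed auto
        also have "norm ((of_real t + \<i> * of_real \<sigma>) - (of_real t + \<i> * of_real 0) :: complex) = \<bar>\<sigma>\<bar>"
          by (simp add: norm_mult)
        finally show ?thesis .
      qed
      have "norm ((LINT t|unit_seg T. \<Phi> (x + t *\<^sub>R e) (\<i> * of_real 0)) -
        (LINT t|unit_seg T. \<Phi> (x + t *\<^sub>R e) (\<i> * of_real \<sigma>))) =
        norm ((P (of_real 0 + \<i> * of_real \<sigma>) - P (of_real 0 + \<i> * of_real 0)) -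
          (P (of_real T + \<i> * of_real \<sigma>) - P (of_real T + \<i> * of_real 0)))"
        unfolding hor[OF \<sigma>] using \<rho> by (subst hor) (auto simp: algebra_simps)
      also have "\<dots> \<le> B (x + 0 *\<^sub>R e) * \<bar>\<sigma>\<bar> + B (x + T *\<^sub>R e) * \<bar>\<sigma>\<bar>"
        by (rule order_trans[OF norm_triangle_ineq4 add_mono[OF ver ver]])
      finally show ?thesis by (simp add: algebra_simps)
    qed
    have i1: "integrable lborel (\<lambda>x. LINT t|unit_seg T. \<Phi> (x + t *\<^sub>R e) (\<i> * of_real \<tau>))" if "\<bar>\<tau>\<bar> < \<rho>" for \<tau>
      by (rule integral_average_translates(1)[OF int[OF that] T])
    have i2: "(LINT x|lborel. LINT t|unit_seg T. \<Phi> (x + t *\<^sub>R e) (\<i> * of_real \<tau>)) = T *\<^sub>R I \<tau>" if "\<bar>\<tau>\<bar> < \<rho>" for \<tau>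
      unfolding I_def by (rule integral_average_translates(2)[OF int[OF that] T])
    have z: "\<bar>0\<bar> < \<rho>" using \<rho> by simp
    have "T * norm (I 0 - I \<sigma>) = norm (T *\<^sub>R I 0 - T *\<^sub>R I \<sigma>)" using T by (simp flip: scaleR_diff_right)
    also have "\<dots> = norm (LINT x|lborel. (LINT t|unit_seg T. \<Phi> (x + t *\<^sub>R e) (\<i> * of_real 0)) -
        (LINT t|unit_seg T. \<Phi> (x + t *\<^sub>R e) (\<i> * of_real \<sigma>)))"
      unfolding i2[OF z, symmetric] i2[OF \<sigma>, symmetric]
      by (subst Bochner_Integration.integral_diff[OF i1[OF z] i1[OF \<sigma>]]) simp
    also have "\<dots> \<le> (LINT x|lborel. \<bar>\<sigma>\<bar> * (B (x + T *\<^sub>R e) + B x))"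
      by (rule Bochner_Integration.integral_norm_bound_integral[OF Bochner_Integration.integrable_diff[OF i1[OF z] i1[OF \<sigma>]] _ pt])
         (intro integrable_mult_right Bochner_Integration.integrable_add lborel_integrable_shift B)
    also have "\<dots> = 2 * \<bar>\<sigma>\<bar> * (LINT x|lborel. B x)"
      using B lborel_integrable_shift[OF B] by (simp add: lborel_integral_shift)
    finally show ?thesis .
  qed
  have "norm (I 0 - I \<sigma>) = 0"
  proof (rule ccontr)
    assume "norm (I 0 - I \<sigma>) \<noteq> 0"
    then have p: "norm (I 0 - I \<sigma>) > 0" by simp
    define C where "C = 2 * \<bar>\<sigma>\<bar> * (LINT x|lborel. B x)"
    have C: "C \<ge> 0" unfolding C_def using B0 by simp
    have "(C + 1) / norm (I 0 - I \<sigma>) * norm (I 0 - I \<sigma>) \<le> C"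
      unfolding C_def by (rule main) (use C p in \<open>simp add: C_def\<close>)
    then show False using p by simp
  qed
  then show ?thesis unfolding I_def by simp
qed

section \<open>Exponentials with complex frequency and the Fourier-Laplace transform\<close>

definition ee :: "complex^'n::finite \<Rightarrow> real^'n \<Rightarrow> complex" where
  "ee z x = exp (\<i> * (\<Sum>i\<in>UNIV. z $ i * of_real (x $ i)))"

text \<open>The sign of the exponent is opposite to that of \<open>fourier\<close>, and the pairing
  of z and x is bilinear without conjugation. On real arguments this is the inverse transform up to
  the factor (2 pi)^-n.\<close>

definition fourier_laplace :: "'n::finite cfun \<Rightarrow> complex^'n \<Rightarrow> complex" where
  "fourier_laplace f z = (LINT x|lborel. ee z x * f x)"

lemma ee_add: "ee (z + w) x = ee z x * ee w x"
  by (simp add: ee_def exp_add[symmetric] algebra_simps sum.distrib)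

lemma ee_add_right: "ee z (x + y) = ee z x * ee z y"
  by (simp add: ee_def exp_add[symmetric] algebra_simps sum.distrib)

lemma ee_minus: "ee (- z) x * ee z x = 1"
  unfolding ee_add[symmetric] by (simp add: ee_def)

lemma norm_ee: "norm (ee z x) = exp (- (\<Sum>i\<in>UNIV. Im (z $ i) * x $ i))"
  by (simp add: ee_def Re_sum Im_sum)

lemma norm_ee_le: "norm (ee z x) \<le> exp (norm (\<chi> i. Im (z $ i)) * norm x)"
proof -
  have "\<bar>(\<chi> i. Im (z $ i)) \<bullet> x\<bar> \<le> norm (\<chi> i. Im (z $ i)) * norm x" by (rule Cauchy_Schwarz_ineq2)
  then show ?thesis by (simp add: norm_ee inner_vec_def)
qed

lemma ee_cvec: "ee (cvec \<xi>) x = exp (\<i> * of_real (x \<bullet> \<xi>))"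
  by (simp add: ee_def inner_vec_def mult.commute)

lemma norm_ee_cvec [simp]: "norm (ee (cvec \<xi>) x) = 1"
  by (simp add: ee_cvec)

lemma cvec_minus: "cvec (- x) = - cvec x"
  and cvec_0 [simp]: "cvec 0 = 0"
  by (simp_all add: vec_eq_iff)

lemma fourier_eq: "fourier f \<xi> = fourier_laplace f (cvec (- \<xi>))"
  by (simp add: fourier_def fourier_laplace_def ee_cvec)

lemma continuous_on_ee: "continuous_on UNIV (\<lambda>p. ee (fst p) (snd p))"
  unfolding ee_def by (intro continuous_intros)

lemma borel_measurable_ee [measurable]:
  assumes "f \<in> borel_measurable M" "g \<in> borel_measurable M"
  shows "(\<lambda>x. ee (f x) (g x)) \<in> borel_measurable M"
  by (rule borel_measurable_continuous_Pair[OF assms, of ee])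
     (use continuous_on_ee in simp)

lemma borel_measurable_cvec [measurable]: "cvec \<in> borel_measurable borel"
  by (intro borel_measurable_continuous_onI continuous_on_cvec)

lemma ee_has_vector_derivative:
  "((\<lambda>t. ee z (x + t *\<^sub>R axis i 1)) has_vector_derivative \<i> * z $ i * ee z (x + t *\<^sub>R axis i 1)) (at t)"
proof -
  have s: "(\<Sum>j\<in>UNIV. z $ j * of_real ((x + t *\<^sub>R axis i 1) $ j)) =
      (\<Sum>j\<in>UNIV. z $ j * of_real (x $ j)) + z $ i * of_real t" for t
  proof -
    have "z $ j * of_real ((x + t *\<^sub>R axis i 1) $ j) =
        z $ j * of_real (x $ j) + (if j = i then z $ i * of_real t else 0)" for j
      by (cases "j = i") (simp_all add: axis_nth_of_real algebra_simps)
    then show ?thesis by (simp only: sum.distrib) simp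
  qed
  have "((\<lambda>w. exp (\<i> * ((\<Sum>j\<in>UNIV. z $ j * of_real (x $ j)) + z $ i * w))) has_field_derivative
      \<i> * z $ i * exp (\<i> * ((\<Sum>j\<in>UNIV. z $ j * of_real (x $ j)) + z $ i * of_real t))) (at (of_real t))"
    by (auto intro!: derivative_eq_intros)
  from has_vector_derivative_real_field[OF this] show ?thesis unfolding ee_def s .
qed

text \<open>Integration by parts: the derivative of \<open>ee z x * f x\<close> along the i-th axis
  has integral 0.\<close>

lemma fourier_laplace_dpart:
  assumes f: "smooth f" and i: "integrable lborel (\<lambda>x. ee z x * f x)" "integrable lborel (\<lambda>x. ee z x * dpart i f x)"
  shows "fourier_laplace (dpart i f) z = (- \<i> * z $ i) * fourier_laplace f z"
proof -
  have c: "continuous_on UNIV (\<lambda>x. ee z x)"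
    unfolding ee_def by (intro continuous_intros)
  have "(LINT x|lborel. ee z x * dpart i f x + (\<i> * z $ i) * (ee z x * f x)) = 0"
  proof (rule integral_directional_derivative_zero[OF i(1), of _ "axis i 1"])
    show "integrable lborel (\<lambda>x. ee z x * dpart i f x + (\<i> * z $ i) * (ee z x * f x))"
      by (intro Bochner_Integration.integrable_add integrable_mult_right i)
    show "continuous_on UNIV (\<lambda>x. ee z x * dpart i f x + (\<i> * z $ i) * (ee z x * f x))"
      using smooth_imp(1)[OF f] smooth_imp(1)[OF smooth_dpart[OF f]] by (intro continuous_intros c)
    fix x t
    show "((\<lambda>t. ee z (x + t *\<^sub>R axis i 1) * f (x + t *\<^sub>R axis i 1)) has_vector_derivative
        ee z (x + t *\<^sub>R axis i 1) * dpart i f (x + t *\<^sub>R axis i 1) +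
        (\<i> * z $ i) * (ee z (x + t *\<^sub>R axis i 1) * f (x + t *\<^sub>R axis i 1))) (at t)"
      using has_vector_derivative_mult[OF ee_has_vector_derivative[of z x i t] dpart_has_vector_derivative[OF f, of x i t]]
      by (simp add: mult_ac)
  qed
  moreover have "(LINT x|lborel. ee z x * dpart i f x + (\<i> * z $ i) * (ee z x * f x)) =
      fourier_laplace (dpart i f) z + (\<i> * z $ i) * fourier_laplace f z"
    unfolding fourier_laplace_def
    by (subst Bochner_Integration.integral_add) (use i in auto)
  ultimately show ?thesis by (simp add: add_eq_0_iff)
qed

lemma fourier_laplace_foldr_dpart:
  assumes f: "smooth f"
  shows "(\<And>js. length js \<le> length is \<Longrightarrow> integrable lborel (\<lambda>x. ee z x * foldr dpart js f x)) \<Longrightarrow>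
    fourier_laplace (foldr dpart is f) z = (\<Prod>i\<in>UNIV. (- \<i> * z $ i) ^ count_list is i) * fourier_laplace f z"
proof (induction "is")
  case (Cons j js)
  let ?g = "\<lambda>i. - \<i> * z $ i"
  have sp: "(\<Prod>i\<in>UNIV. ?g i ^ c i) = ?g j ^ c j * (\<Prod>i\<in>UNIV - {j}. ?g i ^ c i)" for c
    by (simp add: prod.remove)
  have "fourier_laplace (foldr dpart (j # js) f) z = ?g j * fourier_laplace (foldr dpart js f) z"
    using fourier_laplace_dpart[OF smooth_foldr[OF f], of z js j] Cons.prems[of js] Cons.prems[of "j # js"] by simp
  also have "fourier_laplace (foldr dpart js f) z = (\<Prod>i\<in>UNIV. ?g i ^ count_list js i) * fourier_laplace f z"
    by (rule Cons.IH) (rule Cons.prems, simp)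
  also have "?g j * ((\<Prod>i\<in>UNIV. ?g i ^ count_list js i) * fourier_laplace f z) =
      (\<Prod>i\<in>UNIV. ?g i ^ count_list (j # js) i) * fourier_laplace f z"
    unfolding sp by (simp add: mult_ac)
  finally show ?case .
qed simp

lemma fourier_laplace_pd:
  assumes f: "smooth f" and i: "\<And>\<beta>. mi_deg \<beta> \<le> mi_deg \<alpha> \<Longrightarrow> integrable lborel (\<lambda>x. ee z x * pd \<beta> f x)"
  shows "fourier_laplace (pd \<alpha> f) z = (\<Prod>i\<in>UNIV. (- \<i> * z $ i) ^ \<alpha> i) * fourier_laplace f z"
proof -
  obtain "is" where "is": "count_list is = \<alpha>" using ex_count_list by blast
  have "fourier_laplace (foldr dpart is f) z = (\<Prod>i\<in>UNIV. (- \<i> * z $ i) ^ count_list is i) * fourier_laplace f z"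
  proof (rule fourier_laplace_foldr_dpart[OF f])
    fix js :: "'a list" assume "length js \<le> length is"
    then have "mi_deg (count_list js) \<le> mi_deg \<alpha>"
      using mi_deg_eq_length[OF "is"] mi_deg_eq_length[of js, OF refl] by simp
    then show "integrable lborel (\<lambda>x. ee z x * foldr dpart js f x)"
      unfolding pd_foldr[OF f] by (rule i)
  qed
  then show ?thesis unfolding pd_foldr[OF f] "is" .
qed

lemma norm_vec_le_sum_norm: "norm (z :: complex^'n::finite) \<le> (\<Sum>i\<in>UNIV. norm (z $ i))"
  unfolding norm_vec_def by (rule L2_set_le_sum) simp

text \<open>Only the component z_j of largest modulus matters: order 0 if |z_j| \<le> 1, and the
  k-th derivative in direction j otherwise. The factor (1 + n)^k comes from 1 + |z| \<le> (1 + n)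
  max(1, |z_j|).\<close>

lemma fourier_laplace_decay:
  fixes f :: "'n::finite cfun"
  assumes f: "smooth f" and i: "\<And>\<beta>. mi_deg \<beta> \<le> k \<Longrightarrow> integrable lborel (\<lambda>x. ee z x * pd \<beta> f x)"
    and M: "\<And>\<beta>. mi_deg \<beta> \<le> k \<Longrightarrow> (LINT x|lborel. norm (ee z x * pd \<beta> f x)) \<le> M"
  shows "norm (fourier_laplace f z) * (1 + norm z) ^ k \<le> (1 + real CARD('n)) ^ k * M"
proof -
  have le: "(\<Prod>i\<in>UNIV. norm (z $ i) ^ \<beta> i) * norm (fourier_laplace f z) \<le> M" if \<beta>: "mi_deg \<beta> \<le> k" for \<beta>
  proof -
    have "(\<Prod>i\<in>UNIV. norm (z $ i) ^ \<beta> i) * norm (fourier_laplace f z) = norm (fourier_laplace (pd \<beta> f) z)"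
      using fourier_laplace_pd[OF f, of \<beta> z] i \<beta>
      by (simp add: norm_mult norm_power prod_norm[symmetric])
    also have "\<dots> \<le> (LINT x|lborel. norm (ee z x * pd \<beta> f x))"
      unfolding fourier_laplace_def by (rule integral_norm_bound)
    also have "\<dots> \<le> M" by (rule M[OF \<beta>])
    finally show ?thesis .
  qed
  have "Max (range (\<lambda>i. norm (z $ i))) \<in> range (\<lambda>i. norm (z $ i))" by (intro Max_in) auto
  then obtain j where j: "Max (range (\<lambda>i. norm (z $ i))) = norm (z $ j)" by blast
  have mx: "norm (z $ i) \<le> norm (z $ j)" for i
    unfolding j[symmetric] by (intro Max_ge) auto
  define \<mu> where "\<mu> = max 1 (norm (z $ j))"
  have "norm z \<le> (\<Sum>i\<in>(UNIV :: 'n set). norm (z $ j))"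
    by (rule order_trans[OF norm_vec_le_sum_norm]) (intro sum_mono mx)
  then have "norm z \<le> real CARD('n) * norm (z $ j)" by simp
  also have "\<dots> \<le> real CARD('n) * \<mu>" unfolding \<mu>_def by (intro mult_left_mono) auto
  finally have "1 + norm z \<le> \<mu> + real CARD('n) * \<mu>"
    unfolding \<mu>_def by (intro add_mono) auto
  then have zb: "1 + norm z \<le> (1 + real CARD('n)) * \<mu>" by (simp add: algebra_simps)
  have "norm (fourier_laplace f z) * \<mu> ^ k \<le> M"
  proof (cases "norm (z $ j) \<le> 1")
    case True
    then show ?thesis using le[of "\<lambda>_. 0"] by (simp add: \<mu>_def max_def mi_deg_def)
  next
    case False
    have "(\<Prod>i\<in>UNIV. norm (z $ i) ^ (if i = j then k else 0)) = norm (z $ j) ^ k"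
      by (subst prod.remove[of _ j]) auto
    then show ?thesis using le[of "\<lambda>i. if i = j then k else 0"] False by (simp add: \<mu>_def max_def mi_deg_def mult.commute)
  qed
  then have "(1 + real CARD('n)) ^ k * (norm (fourier_laplace f z) * \<mu> ^ k) \<le> (1 + real CARD('n)) ^ k * M"
    by (intro mult_left_mono) auto
  moreover have "norm (fourier_laplace f z) * (1 + norm z) ^ k \<le>
      norm (fourier_laplace f z) * ((1 + real CARD('n)) * \<mu>) ^ k"
    by (intro mult_left_mono power_mono zb) auto
  moreover have "norm (fourier_laplace f z) * ((1 + real CARD('n)) * \<mu>) ^ k =
      (1 + real CARD('n)) ^ k * (norm (fourier_laplace f z) * \<mu> ^ k)"
    by (simp only: power_mult_distrib mult_ac)
  ultimately show ?thesis by linarith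
qed

lemma pair_sigma_finite_lborel:
  "pair_sigma_finite (lborel :: 'a::euclidean_space measure) (lborel :: 'b::euclidean_space measure)"
  by (intro pair_sigma_finite.intro lborel.sigma_finite_measure_axioms)

section \<open>Fourier inversion by Gaussian regularization\<close>

lemma fourier_mult_swap:
  assumes f: "integrable lborel f" and g: "integrable lborel g"
  shows "(LINT \<xi>|lborel. fourier f \<xi> * g \<xi>) = (LINT x|lborel. f x * fourier g x)"
proof -
  have [measurable]: "f \<in> borel_measurable borel" "g \<in> borel_measurable borel" using f g by auto
  have I: "integrable (lborel \<Otimes>\<^sub>M lborel) (\<lambda>(x, \<xi>). ee (cvec (- \<xi>)) x * f x * g \<xi>)"
    by (rule integrable_pair_bound[OF pair_sigma_finite_lborel, where g = "\<lambda>x. norm (f x)" and h = "\<lambda>x. norm (g x)"])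
       (use f g in \<open>auto simp: norm_mult\<close>)
  have sym: "ee (cvec (- \<xi>)) x = ee (cvec (- x)) \<xi>" for x \<xi> :: "real^'a"
    by (simp add: ee_cvec inner_commute)
  have "(LINT \<xi>|lborel. fourier f \<xi> * g \<xi>) = (LINT \<xi>|lborel. LINT x|lborel. ee (cvec (- \<xi>)) x * f x * g \<xi>)"
    unfolding fourier_eq fourier_laplace_def
    by (intro Bochner_Integration.integral_cong refl) (rule integral_mult_left_zero[symmetric])
  also have "\<dots> = (LINT x|lborel. LINT \<xi>|lborel. ee (cvec (- \<xi>)) x * f x * g \<xi>)"
    by (rule pair_sigma_finite.Fubini_integral[OF pair_sigma_finite_lborel I])
  also have "\<dots> = (LINT x|lborel. f x * fourier g x)"
  proof (rule Bochner_Integration.integral_cong[OF refl])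
    fix x
    have "(LINT \<xi>|lborel. ee (cvec (- \<xi>)) x * f x * g \<xi>) = (LINT \<xi>|lborel. f x * (ee (cvec (- x)) \<xi> * g \<xi>))"
      by (rule Bochner_Integration.integral_cong[OF refl]) (subst sym, simp only: mult_ac)
    also have "\<dots> = f x * fourier g x"
      unfolding fourier_eq fourier_laplace_def by (rule integral_mult_right_zero)
    finally show "(LINT \<xi>|lborel. ee (cvec (- \<xi>)) x * f x * g \<xi>) = f x * fourier g x" .
  qed
  finally show ?thesis .
qed

definition gauss :: "real^'n::finite \<Rightarrow> real" where
  "gauss x = exp (- (norm x)\<^sup>2 / 2)"

lemma gauss_le_1: "gauss x \<le> 1" and gauss_pos: "0 < gauss x"
  by (simp_all add: gauss_def)

lemma gauss_measurable [measurable]: "gauss \<in> borel_measurable borel"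
  unfolding gauss_def[abs_def] by (intro borel_measurable_continuous_onI continuous_intros) auto

lemma gauss_prod: "gauss x = (\<Prod>i\<in>UNIV. exp (- (x $ i)\<^sup>2 / 2))"
proof -
  have "(norm x)\<^sup>2 = (\<Sum>i\<in>UNIV. (x $ i)\<^sup>2)" by (simp add: norm_vec_def L2_set_def sum_nonneg)
  then show ?thesis
    by (simp add: gauss_def exp_sum[symmetric] sum_divide_distrib sum_negf)
qed

lemma integral_gauss_real:
  "integrable lborel (\<lambda>t. exp (\<i> * of_real (s * t)) * complex_of_real (exp (- t\<^sup>2 / 2)))"
  "(LINT t|lborel. exp (\<i> * of_real (s * t)) * complex_of_real (exp (- t\<^sup>2 / 2))) = of_real (sqrt (2 * pi) * exp (- s\<^sup>2 / 2))"
proof -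
  define r where "r = sqrt (2 * pi)"
  have r: "r > 0" by (simp add: r_def)
  define E where "E t = exp (- t\<^sup>2 / 2)" for t :: real
  have d: "std_normal_density t = inverse r * E t" for t
    by (simp add: normal_density_def inverse_eq_divide r_def E_def)
  have E: "E t = r * (std_normal_density t * t ^ 0)" for t using r unfolding d by simp
  have I: "integrable lborel E"
    unfolding E[abs_def] by (intro integrable_mult_right integrable_std_normal_moment)
  have [measurable]: "E \<in> borel_measurable borel" using I by auto
  have "integrable lborel (\<lambda>t. exp (\<i> * of_real (s * t)) * complex_of_real (E t))"
    by (rule Bochner_Integration.integrable_bound[OF I]) (auto simp: norm_mult)
  then show "integrable lborel (\<lambda>t. exp (\<i> * of_real (s * t)) * complex_of_real (exp (- t\<^sup>2 / 2)))"
    unfolding E_def .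
  \<comment> \<open>The Gaussian integral is the characteristic function of the standard normal
    distribution, up to the normalization r of its density.\<close>
  have "complex_of_real (E s) = (LINT t|density lborel std_normal_density. exp (\<i> * of_real (s * t)))"
    using fun_cong[OF char_std_normal_distribution, of s] unfolding char_def E_def by simp
  also have "\<dots> = (LINT t|lborel. std_normal_density t *\<^sub>R exp (\<i> * of_real (s * t)))"
    by (subst integral_density) auto
  also have "\<dots> = (LINT t|lborel. of_real (inverse r) * (exp (\<i> * of_real (s * t)) * complex_of_real (E t)))"
    by (intro Bochner_Integration.integral_cong refl) (simp only: d scaleR_conv_of_real of_real_mult mult_ac)
  also have "\<dots> = of_real (inverse r) * (LINT t|lborel. exp (\<i> * of_real (s * t)) * complex_of_real (E t))"
    by (rule integral_mult_right_zero)
  finally have e: "complex_of_real (E s) = of_real (inverse r) *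
    (LINT t|lborel. exp (\<i> * of_real (s * t)) * complex_of_real (E t))" .
  have "(LINT t|lborel. exp (\<i> * of_real (s * t)) * complex_of_real (E t)) = of_real r * complex_of_real (E s)"
    unfolding e using r by simp
  then show "(LINT t|lborel. exp (\<i> * of_real (s * t)) * complex_of_real (exp (- t\<^sup>2 / 2))) =
      of_real (sqrt (2 * pi) * exp (- s\<^sup>2 / 2))" unfolding E_def r_def of_real_mult .
qed

lemma fourier_gauss:
  fixes \<xi> :: "real^'n::finite"
  shows "integrable lborel (\<lambda>x::real^'n. complex_of_real (gauss x))"
    "fourier (\<lambda>x. of_real (gauss x)) \<xi> = of_real (sqrt (2 * pi) ^ CARD('n) * gauss \<xi>)"
proof -
  let ?h = "\<lambda>i t. exp (\<i> * of_real ((- \<xi>) $ i * t)) * complex_of_real (exp (- t\<^sup>2 / 2))"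
  have e: "ee (cvec (- \<xi>)) x * of_real (gauss x) = (\<Prod>i\<in>UNIV. ?h i (x $ i))" for x
    unfolding gauss_prod prod.distrib by (simp add: ee_def sum_distrib_left exp_sum)
  have "integrable lborel (\<lambda>x. ee (cvec (- \<xi>)) x * of_real (gauss x))"
    unfolding e by (rule lborel_vec_prod(1)) (rule integral_gauss_real)
  then show "integrable lborel (\<lambda>x::real^'n. complex_of_real (gauss x))"
    by (rule Bochner_Integration.integrable_bound) (auto simp: norm_mult)
  have "fourier (\<lambda>x. of_real (gauss x)) \<xi> = (\<Prod>i\<in>UNIV. LINT t|lborel. ?h i t)"
    unfolding fourier_eq fourier_laplace_def e by (rule lborel_vec_prod(2)) (rule integral_gauss_real)
  also have "\<dots> = (\<Prod>i\<in>UNIV. of_real (sqrt (2 * pi) * exp (- ((- \<xi>) $ i)\<^sup>2 / 2)))"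
    by (intro prod.cong refl integral_gauss_real)
  also have "\<dots> = of_real (sqrt (2 * pi) ^ CARD('n) * gauss \<xi>)"
    unfolding of_real_prod[symmetric] prod.distrib gauss_prod by simp
  finally show "fourier (\<lambda>x. of_real (gauss x)) \<xi> = of_real (sqrt (2 * pi) ^ CARD('n) * gauss \<xi>)" .
qed

text \<open>The factor G(c \<xi>) turns the left side into an integral to which
  \<open>fourier_mult_swap\<close> applies, and rescaling moves c into the argument of f. As c tends
  to 0, dominated convergence gives the integral of the transform on one side and \<kappa> f(0)
  times the integral of G on the other. Since G has transform \<kappa> G, that integral is \<kappa>
  as well, and \<kappa>^2 = (2 pi)^n.\<close>

lemma fourier_inversion_0:
  fixes f :: "'n::finite cfun"
  assumes f: "integrable lborel f" "continuous_on UNIV f" "\<And>x. norm (f x) \<le> M"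
    and ft: "integrable lborel (fourier f)"
  shows "(LINT \<xi>|lborel. fourier f \<xi>) = of_real ((2 * pi) ^ CARD('n)) * f 0"
proof -
  define G :: "'n cfun" where "G x = of_real (gauss x)" for x
  define \<kappa> where "\<kappa> = sqrt (2 * pi) ^ CARD('n)"
  have [measurable]: "G \<in> borel_measurable borel" unfolding G_def[abs_def] by measurable
  have [measurable]: "f \<in> borel_measurable borel" "fourier f \<in> borel_measurable borel" using f ft by auto
  have Gi: "integrable lborel G" unfolding G_def[abs_def] by (rule fourier_gauss)
  have GF: "fourier G x = of_real \<kappa> * G x" for x
    unfolding G_def[abs_def] \<kappa>_def using fourier_gauss(2) by simp
  have id: "(LINT \<xi>|lborel. fourier f \<xi> * G (c *\<^sub>R \<xi>)) = (LINT y|lborel. of_real \<kappa> * (f (c *\<^sub>R y) * G y))"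
    if c: "c > 0" for c
  proof -
    have Gc: "integrable lborel (\<lambda>\<xi>. G (c *\<^sub>R \<xi>))" by (rule lborel_integrable_scale[OF Gi]) (use c in simp)
    have FG: "c ^ CARD('n) *\<^sub>R fourier (\<lambda>\<xi>. G (c *\<^sub>R \<xi>)) x = of_real \<kappa> * G (inverse c *\<^sub>R x)" for x
    proof -
      have "fourier G (inverse c *\<^sub>R x) = \<bar>c\<bar> ^ DIM(real^'n) *\<^sub>R
          (LINT y|lborel. exp (- \<i> * of_real ((c *\<^sub>R y) \<bullet> (inverse c *\<^sub>R x))) * G (c *\<^sub>R y))"
        unfolding fourier_def by (rule lborel_integral_scale) (measurable, use c in simp)
      moreover have eq: "(c *\<^sub>R y) \<bullet> (inverse c *\<^sub>R x) = y \<bullet> x" for y using c by simp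
      ultimately have "fourier G (inverse c *\<^sub>R x) = \<bar>c\<bar> ^ DIM(real^'n) *\<^sub>R fourier (\<lambda>\<xi>. G (c *\<^sub>R \<xi>)) x"
        by (simp only: eq fourier_def)
      then show ?thesis using c by (simp add: GF)
    qed
    have "(LINT \<xi>|lborel. fourier f \<xi> * G (c *\<^sub>R \<xi>)) = (LINT x|lborel. f x * fourier (\<lambda>\<xi>. G (c *\<^sub>R \<xi>)) x)"
      by (rule fourier_mult_swap[OF f(1) Gc])
    also have "\<dots> = \<bar>c\<bar> ^ DIM(real^'n) *\<^sub>R (LINT y|lborel. f (c *\<^sub>R y) * fourier (\<lambda>\<xi>. G (c *\<^sub>R \<xi>)) (c *\<^sub>R y))"
    proof (rule lborel_integral_scale)
      have "fourier (\<lambda>\<xi>. G (c *\<^sub>R \<xi>)) = (\<lambda>x. inverse (c ^ CARD('n)) *\<^sub>R (of_real \<kappa> * G (inverse c *\<^sub>R x)))"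
        unfolding FG[symmetric] using c by (simp add: fun_eq_iff)
      then show "(\<lambda>x. f x * fourier (\<lambda>\<xi>. G (c *\<^sub>R \<xi>)) x) \<in> borel_measurable borel" by simp
    qed (use c in simp)
    also have "\<dots> = (LINT y|lborel. f (c *\<^sub>R y) * (c ^ CARD('n) *\<^sub>R fourier (\<lambda>\<xi>. G (c *\<^sub>R \<xi>)) (c *\<^sub>R y)))"
      using c by (simp flip: integral_scaleR_right)
    also have "\<dots> = (LINT y|lborel. of_real \<kappa> * (f (c *\<^sub>R y) * G y))"
      unfolding FG using c by (intro Bochner_Integration.integral_cong refl) simp
    finally show ?thesis .
  qed
  define c where "c k = inverse (real (Suc k))" for k
  have c0: "c \<longlonglongrightarrow> 0" unfolding c_def[abs_def] by (rule LIMSEQ_inverse_real_of_nat)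
  have cpos: "c k > 0" for k by (simp add: c_def)
  have G0: "G 0 = 1" by (simp add: G_def gauss_def)
  have contG: "continuous_on UNIV G" unfolding G_def[abs_def] gauss_def[abs_def] by (intro continuous_intros) auto
  have nG: "norm (G x) \<le> 1" for x unfolding G_def using gauss_le_1[of x] gauss_pos[of x] by simp
  have tend: "(\<lambda>k. h (c k *\<^sub>R x)) \<longlonglongrightarrow> h 0" if "continuous_on UNIV h" for h :: "'n cfun" and x
  proof -
    have "(\<lambda>k. c k *\<^sub>R x) \<longlonglongrightarrow> 0 *\<^sub>R x" by (intro tendsto_intros c0)
    moreover have "isCont h 0" using that by (simp add: continuous_on_eq_continuous_at)
    ultimately show ?thesis by (metis isCont_tendsto_compose scaleR_zero_left)
  qed
  have "(\<lambda>k. LINT \<xi>|lborel. fourier f \<xi> * G (c k *\<^sub>R \<xi>)) \<longlonglongrightarrow> (LINT \<xi>|lborel. fourier f \<xi>)"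
  proof (rule integral_dominated_convergence[where w = "\<lambda>\<xi>. norm (fourier f \<xi>)"])
    show "AE x in lborel. (\<lambda>k. fourier f x * G (c k *\<^sub>R x)) \<longlonglongrightarrow> fourier f x"
      using tendsto_mult[OF tendsto_const tend[OF contG]] G0 by (intro AE_I2) (metis mult.right_neutral)
    show "AE x in lborel. norm (fourier f x * G (c k *\<^sub>R x)) \<le> norm (fourier f x)" for k
      using nG by (intro AE_I2) (simp add: norm_mult mult_left_le)
  qed (use ft in auto)
  moreover have "(\<lambda>k. LINT y|lborel. of_real \<kappa> * (f (c k *\<^sub>R y) * G y)) \<longlonglongrightarrow> (LINT y|lborel. of_real \<kappa> * (f 0 * G y))"
  proof (rule integral_dominated_convergence[where w = "\<lambda>y. \<bar>\<kappa>\<bar> * (M * norm (G y))"])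
    show "AE x in lborel. (\<lambda>k. of_real \<kappa> * (f (c k *\<^sub>R x) * G x)) \<longlonglongrightarrow> of_real \<kappa> * (f 0 * G x)"
      by (intro AE_I2 tendsto_intros tend f)
    show "AE x in lborel. norm (of_real \<kappa> * (f (c k *\<^sub>R x) * G x)) \<le> \<bar>\<kappa>\<bar> * (M * norm (G x))" for k
      using f(3) by (intro AE_I2) (simp add: norm_mult mult_left_mono mult_right_mono)
  qed (use Gi in auto)
  ultimately have "(LINT \<xi>|lborel. fourier f \<xi>) = (LINT y|lborel. of_real \<kappa> * (f 0 * G y))"
    unfolding id[OF cpos] by (rule LIMSEQ_unique)
  also have "\<dots> = of_real \<kappa> * f 0 * fourier G 0" by (simp add: fourier_def)
  also have "\<dots> = of_real (\<kappa> * \<kappa>) * f 0" by (simp add: GF G0)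
  also have "\<kappa> * \<kappa> = (2 * pi) ^ CARD('n)" unfolding \<kappa>_def power_mult_distrib[symmetric] by simp
  finally show ?thesis .
qed

lemma fourier_inversion:
  fixes f :: "'n::finite cfun"
  assumes f: "integrable lborel f" "continuous_on UNIV f" "\<And>x. norm (f x) \<le> M"
    and ft: "integrable lborel (fourier f)"
  shows "(LINT \<xi>|lborel. ee (cvec \<xi>) x * fourier f \<xi>) = of_real ((2 * pi) ^ CARD('n)) * f x"
proof -
  let ?g = "\<lambda>y. f (y + x)"
  have F: "fourier ?g \<xi> = ee (cvec \<xi>) x * fourier f \<xi>" for \<xi>
  proof -
    have "fourier f \<xi> = (LINT y|lborel. ee (cvec (- \<xi>)) (y + x) * f (y + x))"
      unfolding fourier_eq fourier_laplace_def by (rule lborel_integral_shift[symmetric])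
    also have "\<dots> = ee (cvec (- \<xi>)) x * fourier ?g \<xi>"
      unfolding fourier_eq fourier_laplace_def ee_add_right
      by (subst integral_mult_right_zero[symmetric]) (intro Bochner_Integration.integral_cong refl, simp add: mult_ac)
    finally show ?thesis using ee_minus[of "cvec \<xi>" x] by (simp add: cvec_minus mult_ac)
  qed
  have "(LINT \<xi>|lborel. fourier ?g \<xi>) = of_real ((2 * pi) ^ CARD('n)) * ?g 0"
  proof (rule fourier_inversion_0)
    show "integrable lborel ?g" by (rule lborel_integrable_shift[OF f(1)])
    show "continuous_on UNIV ?g" by (rule continuous_on_compose2[OF f(2)]) (auto intro!: continuous_intros)
    show "norm (?g y) \<le> M" for y by (rule f(3))
    show "integrable lborel (fourier ?g)"
      unfolding F by (rule Bochner_Integration.integrable_bound[OF ft]) (use ft in \<open>auto simp: norm_mult\<close>)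
  qed
  then show ?thesis unfolding F by simp
qed

section \<open>The transform of the hyperbolic secant\<close>

lemma cosh_csqrt_conv_cos: "cosh (csqrt z) = cos (csqrt (- z))"
proof -
  have "(\<i> * csqrt z)\<^sup>2 = (csqrt (- z))\<^sup>2" by (simp add: power_mult_distrib)
  then have "\<i> * csqrt z = csqrt (- z) \<or> \<i> * csqrt z = - csqrt (- z)" by (simp only: power2_eq_iff)
  then show ?thesis by (auto simp: cosh_conv_cos)
qed

text \<open>Since cosh is even, the choice of the square root does not matter. Across the cut the
  function equals cos(sqrt(-z)), and 0 is a removable singularity. Through |x|^2, a polynomial, this
  continues cosh(a|x|) analytically although |x| is not smooth at 0.\<close>

lemma holomorphic_cosh_csqrt: "(\<lambda>z. cosh (csqrt z)) holomorphic_on UNIV"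
proof (rule no_isolated_singularity'[where K = "{0}"])
  show "(\<lambda>z. cosh (csqrt z)) holomorphic_on UNIV - {0}"
  proof -
    have 1: "(\<lambda>z. cosh (csqrt z)) holomorphic_on - \<real>\<^sub>\<le>\<^sub>0"
      unfolding cosh_conv_cos by (intro holomorphic_intros) auto
    have "(\<lambda>z. cos (csqrt (- z))) holomorphic_on {z. Re z < 0}"
      by (intro holomorphic_intros) (auto simp: complex_nonpos_Reals_iff)
    then have 2: "(\<lambda>z. cosh (csqrt z)) holomorphic_on {z. Re z < 0}"
      unfolding cosh_csqrt_conv_cos .
    have "open (- \<real>\<^sub>\<le>\<^sub>0 :: complex set)" "open {z. Re z < 0}"
      by (auto intro: open_halfspace_Re_lt simp: closed_nonpos_Reals_complex open_Compl)
    from holomorphic_on_Un[OF 1 2 this]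
    have "(\<lambda>z. cosh (csqrt z)) holomorphic_on (- \<real>\<^sub>\<le>\<^sub>0 \<union> {z. Re z < 0})" .
    then show ?thesis
      by (rule holomorphic_on_subset) (auto simp: complex_nonpos_Reals_iff complex_eq_iff)
  qed
next
  fix z :: complex assume z: "z \<in> {0}"
  have "((\<lambda>w. norm (csqrt w)) \<longlongrightarrow> 0) (at 0)"
    unfolding norm_csqrt by (intro tendsto_eq_intros) auto
  then have "(csqrt \<longlongrightarrow> 0) (at 0)" by (rule tendsto_norm_zero_cancel)
  then have "((\<lambda>w. cosh (csqrt w)) \<longlongrightarrow> cosh 0) (at 0)"
    unfolding cosh_field_def by (intro tendsto_intros) auto
  then show "((\<lambda>z. cosh (csqrt z)) \<longlongrightarrow> cosh (csqrt z)) (at z within UNIV)" using z by simp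
qed auto

lemma cos_ge_half: "\<bar>v\<bar> \<le> 1 \<Longrightarrow> 1 / 2 \<le> cos (v::real)"
proof -
  assume v: "\<bar>v\<bar> \<le> 1"
  have "\<bar>sin (v / 2)\<bar> \<le> 1 / 2" using abs_sin_x_le_abs_x[of "v / 2"] v by simp
  then have "\<bar>sin (v / 2)\<bar>\<^sup>2 \<le> (1 / 2)\<^sup>2" by (intro power_mono) auto
  then have "(sin (v / 2))\<^sup>2 \<le> 1 / 4" by (simp add: power2_eq_square)
  moreover have "cos v = 1 - 2 * (sin (v / 2))\<^sup>2" using cos_double_sin[of "v / 2"] by simp
  ultimately show ?thesis by simp
qed

text \<open>The real part of cosh p is cos(Im p) cosh(Re p), and the cosine is at least 1/2 on the
  strip.\<close>

lemma norm_cosh_lower: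
  fixes p :: complex
  assumes "\<bar>Im p\<bar> \<le> 1"
  shows "exp (Re p) / 4 \<le> norm (cosh p)"
proof -
  have "Re (cosh p) = cos (Im p) * ((exp (Re p) + exp (- Re p)) / 2)"
    unfolding cosh_conv_cos by (simp add: Re_cos)
  moreover have "(1 / 2) * ((exp (Re p) + 0) / 2) \<le> cos (Im p) * ((exp (Re p) + exp (- Re p)) / 2)"
    using cos_ge_half[OF assms] by (intro mult_mono divide_right_mono add_mono) auto
  ultimately show ?thesis using complex_Re_le_cmod[of "cosh p"] by simp
qed

text \<open>The square root of \<open>a\<^sup>2 (x + \<i> \<tau> e)\<^sup>2\<close> stays in the strip \<open>\<bar>Im\<bar> \<le> a \<bar>\<tau>\<bar>\<close>, where \<open>cosh\<close> has no
  zeros.\<close>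

lemma norm_cosh_csqrt_lower:
  fixes a X y \<tau> :: real
  assumes a: "a > 0" "a * \<bar>\<tau>\<bar> \<le> 1" and X: "\<bar>y\<bar> \<le> X"
  shows "exp (a * X - 1) / 4 \<le> norm (cosh (csqrt (of_real (a\<^sup>2) * (of_real (X\<^sup>2 - \<tau>\<^sup>2) + 2 * \<i> * of_real (\<tau> * y)))))"
proof -
  define p where "p = csqrt (of_real (a\<^sup>2) * (of_real (X\<^sup>2 - \<tau>\<^sup>2) + 2 * \<i> * of_real (\<tau> * y)))"
  define u v where "u = Re p" and "v = Im p"
  have p2: "p\<^sup>2 = of_real (a\<^sup>2) * (of_real (X\<^sup>2 - \<tau>\<^sup>2) + 2 * \<i> * of_real (\<tau> * y))" unfolding p_def by simp
  have u0: "u \<ge> 0" unfolding u_def p_def using csqrt_principal[of "of_real (a\<^sup>2) * (of_real (X\<^sup>2 - \<tau>\<^sup>2) + 2 * \<i> * of_real (\<tau> * y))"] by auto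
  have re: "u\<^sup>2 - v\<^sup>2 = a\<^sup>2 * (X\<^sup>2 - \<tau>\<^sup>2)"
    using arg_cong[OF p2, of Re] by (simp add: u_def v_def power2_eq_square algebra_simps)
  have im: "u * v = a\<^sup>2 * (\<tau> * y)"
    using arg_cong[OF p2, of Im] by (simp add: u_def v_def power2_eq_square algebra_simps)
  have X0: "X \<ge> 0" using X by linarith
  \<comment> \<open>If |v| exceeded a |\<tau>|, then \<open>re\<close> would give |u| > a X, and the
    product |u v| would exceed a^2 |\<tau>| X. This contradicts \<open>im\<close>, because |y| \<le>
    X.\<close>
  have v: "v\<^sup>2 \<le> (a * \<tau>)\<^sup>2"
  proof (rule ccontr)
    assume "\<not> ?thesis"
    then have v1: "(a * \<tau>)\<^sup>2 < v\<^sup>2" by simp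
    then have u1: "(a * X)\<^sup>2 < u\<^sup>2" using re by (simp add: power_mult_distrib algebra_simps)
    have "(a * X)\<^sup>2 * (a * \<tau>)\<^sup>2 < u\<^sup>2 * v\<^sup>2"
      by (rule mult_strict_mono'[OF u1 v1]) auto
    also have "u\<^sup>2 * v\<^sup>2 = (a\<^sup>2 * (\<tau> * y))\<^sup>2" unfolding im[symmetric] by (simp add: power_mult_distrib)
    also have "\<dots> = ((a * \<tau>)\<^sup>2 * a\<^sup>2) * \<bar>y\<bar>\<^sup>2" by (simp add: power_mult_distrib power2_eq_square)
    also have "\<dots> \<le> ((a * \<tau>)\<^sup>2 * a\<^sup>2) * X\<^sup>2" using X by (intro mult_left_mono power_mono) auto
    also have "\<dots> = (a * X)\<^sup>2 * (a * \<tau>)\<^sup>2" by (simp add: power_mult_distrib)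
    finally show False by simp
  qed
  then have v2: "\<bar>v\<bar> \<le> a * \<bar>\<tau>\<bar>" using a by (metis abs_le_square_iff abs_mult abs_of_pos)
  \<comment> \<open>For X \<le> |\<tau>| the left side is at most 0. Otherwise u^2 \<ge> a^2 (X^2 -
    \<tau>^2) \<ge> a^2 (X - |\<tau>|)^2, and a |\<tau>| \<le> 1 is the loss of 1.\<close>
  have u2: "a * X - 1 \<le> u"
  proof (cases "X \<le> \<bar>\<tau>\<bar>")
    case True
    then have "a * X \<le> a * \<bar>\<tau>\<bar>" using a by (intro mult_left_mono) auto
    then show ?thesis using a u0 by linarith
  next
    case False
    have "(a * (X - \<bar>\<tau>\<bar>))\<^sup>2 \<le> a\<^sup>2 * ((X - \<bar>\<tau>\<bar>) * (X + \<bar>\<tau>\<bar>))"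
      unfolding power_mult_distrib using False X0 by (intro mult_left_mono) (auto simp: power2_eq_square intro!: mult_left_mono)
    also have "\<dots> = a\<^sup>2 * (X\<^sup>2 - \<bar>\<tau>\<bar>\<^sup>2)" by (simp add: power2_eq_square algebra_simps)
    also have "\<dots> \<le> u\<^sup>2" using re zero_le_power2[of v] by (simp only: power2_abs)
    finally have "a * (X - \<bar>\<tau>\<bar>) \<le> u" using u0 by (rule power2_le_imp_le)
    then show ?thesis using a by (simp add: algebra_simps)
  qed
  have "exp (a * X - 1) / 4 \<le> exp u / 4" using u2 by simp
  also have "\<dots> \<le> norm (cosh p)" unfolding u_def by (rule norm_cosh_lower) (use v2 a v_def in linarith)
  finally show ?thesis unfolding p_def .
qed

lemma power_le_exp:
  fixes b :: real
  assumes "b > 0"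
  shows "\<exists>c>0. \<forall>t\<ge>0. (1 + t) ^ k \<le> c * exp (b * t)"
proof (intro exI conjI allI impI)
  \<comment> \<open>The successor avoids division by 0 for k = 0. The number c below is chosen such
    that 1 + t \<le> c (1 + b t / ?k), after which (1 + s/n)^n \<le> exp s applies.\<close>
  let ?k = "Suc k"
  define c where "c = max 1 (real ?k / b)"
  show "c ^ ?k > 0" unfolding c_def by (intro zero_less_power) simp
  fix t :: real assume t: "t \<ge> 0"
  have c: "1 \<le> c" "1 \<le> c * b / ?k"
    using assms unfolding c_def by (simp_all add: max_def field_simps)
  have "1 + t \<le> c + (c * b / ?k) * t" using c t mult_right_mono[of 1 "c * b / ?k" t] by simp
  also have "\<dots> = c * (1 + b * t / ?k)" by (simp add: algebra_simps)
  finally have "(1 + t) ^ ?k \<le> (c * (1 + b * t / ?k)) ^ ?k" using t by (intro power_mono) auto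
  also have "\<dots> = c ^ ?k * (1 + b * t / ?k) ^ ?k" by (rule power_mult_distrib)
  also have "\<dots> \<le> c ^ ?k * exp (b * t)"
  proof (intro mult_left_mono exp_ge_one_plus_x_over_n_power_n)
    have "0 \<le> b * t" using assms t by simp
    then show "- real ?k \<le> b * t" by linarith
  qed (use c in auto)
  finally have "(1 + t) ^ ?k \<le> c ^ ?k * exp (b * t)" .
  moreover have "(1 + t) ^ k \<le> (1 + t) ^ ?k" using t by (intro power_increasing) auto
  ultimately show "(1 + t) ^ k \<le> c ^ ?k * exp (b * t)" by linarith
qed

lemma integrable_exp_norm:
  assumes "b > 0"
  shows "integrable lborel (\<lambda>x::real^'n::finite. exp (- b * norm x))"
proof -
  obtain c where c: "c > 0" "\<And>t. t \<ge> 0 \<Longrightarrow> (1 + t) ^ (2 * CARD('n)) \<le> c * exp (b * t)"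
    using power_le_exp[OF assms] by blast
  show ?thesis
  proof (rule Bochner_Integration.integrable_bound)
    show "integrable lborel (\<lambda>x::real^'n. c * inverse ((1 + norm x) ^ (2 * CARD('n))))"
      by (intro integrable_mult_right integrable_weight)
    show "AE x in lborel. norm (exp (- b * norm x)) \<le> norm (c * inverse ((1 + norm (x::real^'n)) ^ (2 * CARD('n))))"
    proof (rule AE_I2)
      fix x :: "real^'n"
      have p: "0 < (1 + norm x) ^ (2 * CARD('n))" by (intro zero_less_power add_pos_nonneg) auto
      have "exp (- b * norm x) * (1 + norm x) ^ (2 * CARD('n)) \<le> exp (- b * norm x) * (c * exp (b * norm x))"
        by (intro mult_left_mono c) auto
      also have "\<dots> = c" by (simp add: exp_minus)
      finally have "exp (- b * norm x) \<le> c * inverse ((1 + norm x) ^ (2 * CARD('n)))"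
        using p by (simp add: pos_le_divide_eq divide_inverse[symmetric])
      then show "norm (exp (- b * norm x)) \<le> norm (c * inverse ((1 + norm x) ^ (2 * CARD('n))))"
        using c(1) p by (simp add: abs_mult)
    qed
  qed measurable
qed

definition sech_transform :: "real \<Rightarrow> complex^'n::finite \<Rightarrow> complex" where
  "sech_transform a z = (LINT x|lborel. ee z x * of_real (1 / cosh (a * norm x)))"

text \<open>Of the decay exp(-a|x|) one half absorbs the growth of \<open>ee\<close> for imaginary
  parts up to a/2; the other half is left for integrability.\<close>

lemma norm_ee_sech_le:
  assumes "a > 0" "norm (\<chi> i. Im (z $ i)) \<le> a / 2"
  shows "norm (ee z x * of_real (1 / cosh (a * norm x))) \<le> 2 * exp (- (a / 2) * norm x)"
proof -
  have "norm (ee z x) \<le> exp (a / 2 * norm x)"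
    by (rule order_trans[OF norm_ee_le]) (simp only: exp_le_cancel_iff, intro mult_right_mono assms norm_ge_zero)
  moreover have "1 / cosh (a * norm x) \<le> 2 * exp (- (a * norm x))"
  proof -
    have "exp (a * norm x) / 2 \<le> cosh (a * norm x)" by (simp add: cosh_field_def)
    then have "1 / cosh (a * norm x) \<le> 1 / (exp (a * norm x) / 2)" by (intro divide_left_mono) (auto intro: cosh_real_pos)
    also have "1 / (exp (a * norm x) / 2) = 2 * exp (- (a * norm x))" by (simp add: exp_minus field_simps)
    finally show ?thesis .
  qed
  ultimately have "norm (ee z x) * (1 / cosh (a * norm x)) \<le> exp (a / 2 * norm x) * (2 * exp (- (a * norm x)))"
    by (intro mult_mono) auto
  also have "\<dots> = 2 * (exp (a / 2 * norm x) * exp (- (a * norm x)))" by (simp only: mult_ac)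
  also have "exp (a / 2 * norm x) * exp (- (a * norm x)) = exp (- (a / 2) * norm x)"
    unfolding exp_add[symmetric] by (simp add: algebra_simps)
  finally show ?thesis by (simp add: norm_mult norm_divide)
qed

lemma integrable_ee_sech:
  assumes "a > 0" "norm (\<chi> i. Im (z $ i)) \<le> a / 2"
  shows "integrable lborel (\<lambda>x::real^'n::finite. ee z x * of_real (1 / cosh (a * norm x)))"
proof (rule Bochner_Integration.integrable_bound)
  show "integrable lborel (\<lambda>x::real^'n. 2 * exp (- (a / 2) * norm x))"
    using assms by (intro integrable_mult_right integrable_exp_norm) simp
  show "AE x in lborel. norm (ee z x * of_real (1 / cosh (a * norm x))) \<le> norm (2 * exp (- (a / 2) * norm x))"
    using norm_ee_sech_le[OF assms] by (intro AE_I2) simp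
  show "(\<lambda>x. ee z x * of_real (1 / cosh (a * norm x))) \<in> borel_measurable lborel"
    unfolding cosh_field_def by measurable
qed

text \<open>Replacing x by x + i \<sigma> e_j multiplies the exponential by exp(-\<sigma> z_j), of
  modulus exp(-\<sigma> Re z_j), while the continued 1/cosh keeps the bound 4 exp(1 - a|x|). The
  condition on a |\<sigma>| keeps the contour inside the strip where cosh has no zero.\<close>

lemma sech_transform_shift:
  fixes z :: "complex^'n::finite"
  assumes a: "a > 0" and z: "norm (\<chi> i. Im (z $ i)) \<le> a / 2" and \<sigma>: "a * \<bar>\<sigma>\<bar> < 1"
  shows "norm (sech_transform a z) \<le> exp (- \<sigma> * Re (z $ j)) * (4 * exp 1 * (LINT x|lborel. exp (- (a / 2) * norm (x::real^'n))))"
proof -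
  \<comment> \<open>The holomorphic continuation in s of a^2 |x + s e_j|^2 from real s.\<close>
  define q where "q x s = of_real (a\<^sup>2) * (of_real ((norm x)\<^sup>2) + 2 * s * of_real (x $ j) + s\<^sup>2)" for x :: "real^'n" and s :: complex
  define \<Phi> where "\<Phi> x s = ee z x * exp (\<i> * s * z $ j) / cosh (csqrt (q x s))" for x :: "real^'n" and s :: complex
  define e where "e = (axis j 1 :: real^'n)"
  have qtr: "q x (of_real t + s) = q (x + t *\<^sub>R e) s" for x t s
  proof -
    have "(norm (x + t *\<^sub>R e))\<^sup>2 = (norm x)\<^sup>2 + 2 * t * x $ j + t\<^sup>2"
      unfolding power2_norm_eq_inner e_def
      by (simp add: inner_add_left inner_add_right inner_axis inner_axis' algebra_simps power2_eq_square axis_nth_of_real)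
    then show ?thesis
      unfolding q_def e_def by (simp add: axis_nth_of_real power2_eq_square algebra_simps)
  qed
  have eetr: "ee z (t *\<^sub>R e) = exp (\<i> * of_real t * z $ j)" for t
  proof -
    have "(\<Sum>i\<in>UNIV. z $ i * of_real ((t *\<^sub>R e) $ i)) = (\<Sum>i\<in>UNIV. if i = j then z $ j * of_real t else 0)"
      unfolding e_def by (intro sum.cong refl) (auto simp: axis_nth_of_real)
    then show ?thesis by (simp add: ee_def mult_ac)
  qed
  have tr: "\<Phi> x (of_real t + s) = \<Phi> (x + t *\<^sub>R e) s" for x t s
  proof -
    have "exp (\<i> * (of_real t + s) * z $ j) = exp (\<i> * of_real t * z $ j) * exp (\<i> * s * z $ j)"
      unfolding exp_add[symmetric] by (simp add: algebra_simps)
    then show ?thesis unfolding \<Phi>_def qtr ee_add_right eetr by (simp only: mult.assoc)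
  qed
  have low: "exp (a * norm x - 1) / 4 \<le> norm (cosh (csqrt (q x (\<i> * of_real \<tau>))))" if "a * \<bar>\<tau>\<bar> \<le> 1" for x \<tau>
  proof -
    have "q x (\<i> * of_real \<tau>) = of_real (a\<^sup>2) * (of_real ((norm x)\<^sup>2 - \<tau>\<^sup>2) + 2 * \<i> * of_real (\<tau> * x $ j))"
      unfolding q_def by (simp add: power_mult_distrib algebra_simps)
    then show ?thesis
      using norm_cosh_csqrt_lower[OF a that component_le_norm_cart[of x j]] by simp
  qed
  have nz: "cosh (csqrt (q x s)) \<noteq> 0" if "\<bar>Im s\<bar> < 1 / a" for x s
  proof -
    have "s = of_real (Re s) + \<i> * of_real (Im s)" by (simp add: complex_eq_iff)
    then have "q x s = q (x + Re s *\<^sub>R e) (\<i> * of_real (Im s))" using qtr by metis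
    moreover have "a * \<bar>Im s\<bar> \<le> 1" using that a by (simp add: field_simps)
    ultimately have "exp (a * norm (x + Re s *\<^sub>R e) - 1) / 4 \<le> norm (cosh (csqrt (q x s)))" using low by metis
    then show ?thesis by (metis exp_gt_zero divide_pos_pos norm_zero not_le zero_less_numeral)
  qed
  have bd0: "norm (\<Phi> x (\<i> * of_real \<tau>)) \<le> exp (- \<tau> * Re (z $ j)) * (4 * exp 1 * exp (- (a / 2) * norm x))"
    if "a * \<bar>\<tau>\<bar> \<le> 1" for x \<tau>
  proof -
    have "norm (ee z x) \<le> exp (a / 2 * norm x)"
      by (rule order_trans[OF norm_ee_le]) (simp only: exp_le_cancel_iff, intro mult_right_mono z norm_ge_zero)
    moreover have "norm (exp (\<i> * (\<i> * of_real \<tau>) * z $ j)) = exp (- \<tau> * Re (z $ j))"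
      by (simp add: mult.assoc[symmetric])
    moreover have "inverse (norm (cosh (csqrt (q x (\<i> * of_real \<tau>))))) \<le> inverse (exp (a * norm x - 1) / 4)"
      by (intro le_imp_inverse_le low that) simp
    ultimately have "norm (\<Phi> x (\<i> * of_real \<tau>)) \<le> (exp (a / 2 * norm x) * exp (- \<tau> * Re (z $ j))) * inverse (exp (a * norm x - 1) / 4)"
      unfolding \<Phi>_def norm_mult divide_inverse norm_inverse by (intro mult_mono) auto
    also have "inverse (exp (a * norm x - 1) / 4) = 4 * exp (1 - a * norm x)"
      by (simp add: exp_diff field_simps)
    also have "exp (a / 2 * norm x) * exp (- \<tau> * Re (z $ j)) * (4 * exp (1 - a * norm x)) =
        exp (- \<tau> * Re (z $ j)) * (4 * (exp (a / 2 * norm x) * exp (1 - a * norm x)))" by (simp only: mult_ac)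
    also have "exp (a / 2 * norm x) * exp (1 - a * norm x) = exp 1 * exp (- (a / 2) * norm x)"
      unfolding exp_add[symmetric] by (simp add: algebra_simps)
    finally show ?thesis by (simp only: mult_ac)
  qed
  \<comment> \<open>One bound for the whole strip |\<tau>| < 1/a. Its dependence on z is harmless:
    \<open>contour_shift\<close> uses only integrability, and the final estimate is made at the
    single height \<sigma>.\<close>
  define B where "B x = exp (norm (z $ j) / a) * (4 * exp 1 * exp (- (a / 2) * norm x))" for x :: "real^'n"
  have cc: "continuous_on UNIV (\<lambda>w. cosh (csqrt w))"
    by (rule holomorphic_on_imp_continuous_on[OF holomorphic_cosh_csqrt])
  have meas: "(\<lambda>x. \<Phi> x (\<i> * of_real \<tau>)) \<in> borel_measurable borel" for \<tau>
  proof -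
    have "continuous_on UNIV (\<lambda>x. q x (\<i> * of_real \<tau>))" unfolding q_def by (intro continuous_intros)
    then have "continuous_on UNIV (\<lambda>x. cosh (csqrt (q x (\<i> * of_real \<tau>))))"
      by (rule continuous_on_compose2[OF cc]) simp
    then have [measurable]: "(\<lambda>x. cosh (csqrt (q x (\<i> * of_real \<tau>)))) \<in> borel_measurable borel"
      by (rule borel_measurable_continuous_onI)
    show ?thesis unfolding \<Phi>_def by measurable
  qed
  have main: "(LINT x|lborel. \<Phi> x 0) = (LINT x|lborel. \<Phi> x (\<i> * of_real \<sigma>))"
  proof (rule contour_shift[where \<rho> = "1 / a" and e = e and B = B])
    show "\<Phi> x holomorphic_on {s. \<bar>Im s\<bar> < 1 / a}" for x
    proof -
      have "(\<lambda>w. cosh (csqrt w)) \<circ> q x holomorphic_on {s. \<bar>Im s\<bar> < 1 / a}"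
        by (rule holomorphic_on_compose_gen[OF _ holomorphic_cosh_csqrt])
           (auto simp: q_def[abs_def] intro!: holomorphic_intros)
      then have "(\<lambda>s. cosh (csqrt (q x s))) holomorphic_on {s. \<bar>Im s\<bar> < 1 / a}" by (simp add: o_def)
      then show ?thesis unfolding \<Phi>_def[abs_def] using nz by (intro holomorphic_intros) auto
    qed
    show "\<Phi> x (of_real t + s) = \<Phi> (x + t *\<^sub>R e) s" for x t s by (rule tr)
    show "norm (\<Phi> x (\<i> * of_real \<tau>)) \<le> B x" if \<tau>: "\<bar>\<tau>\<bar> < 1 / a" for x \<tau>
    proof -
      have "a * \<bar>\<tau>\<bar> \<le> 1" using \<tau> a by (simp add: field_simps)
      moreover have "- \<tau> * Re (z $ j) \<le> norm (z $ j) / a"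
      proof -
        have "- \<tau> * Re (z $ j) \<le> \<bar>- \<tau> * Re (z $ j)\<bar>" by (rule abs_ge_self)
        also have "\<dots> \<le> (1 / a) * norm (z $ j)" unfolding abs_mult using \<tau> a abs_Re_le_cmod by (intro mult_mono) auto
        finally show ?thesis by simp
      qed
      ultimately show ?thesis
        unfolding B_def by (intro order_trans[OF bd0] mult_right_mono) auto
    qed
    show "integrable lborel B" unfolding B_def[abs_def] using a by (intro integrable_mult_right integrable_exp_norm) simp
    show "(\<lambda>x. \<Phi> x (\<i> * of_real \<tau>)) \<in> borel_measurable borel" for \<tau> by (rule meas)
    show "\<bar>\<sigma>\<bar> < 1 / a" using \<sigma> a by (simp add: field_simps)
  qed
  have "\<Phi> x 0 = ee z x * of_real (1 / cosh (a * norm x))" for x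
  proof -
    have "q x 0 = of_real ((a * norm x)\<^sup>2)" unfolding q_def by (simp add: power_mult_distrib)
    then have "csqrt (q x 0) = of_real (a * norm x)" using a by (simp only: csqrt_of_real zero_le_power2) (simp add: real_sqrt_abs)
    moreover have "cosh (complex_of_real t) = of_real (cosh t)" for t
      by (simp add: cosh_field_def exp_of_real flip: of_real_minus)
    ultimately have "cosh (csqrt (q x 0)) = of_real (cosh (a * norm x))" by (simp only:)
    then show ?thesis unfolding \<Phi>_def by (simp add: divide_inverse)
  qed
  then have "sech_transform a z = (LINT x|lborel. \<Phi> x (\<i> * of_real \<sigma>))" unfolding sech_transform_def main[symmetric] by simp
  also have "norm \<dots> \<le> (LINT x|lborel. exp (- \<sigma> * Re (z $ j)) * (4 * exp 1 * exp (- (a / 2) * norm (x::real^'n))))"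
  proof (rule Bochner_Integration.integral_norm_bound_integral)
    show I: "integrable lborel (\<lambda>x. exp (- \<sigma> * Re (z $ j)) * (4 * exp 1 * exp (- (a / 2) * norm (x::real^'n))))"
      using a by (intro integrable_mult_right integrable_exp_norm) simp
    show bd: "norm (\<Phi> x (\<i> * of_real \<sigma>)) \<le> exp (- \<sigma> * Re (z $ j)) * (4 * exp 1 * exp (- (a / 2) * norm x))" for x
      using \<sigma> by (intro bd0) simp
    show "integrable lborel (\<lambda>x. \<Phi> x (\<i> * of_real \<sigma>))"
      by (rule Bochner_Integration.integrable_bound[OF I]) (use meas bd in \<open>auto intro!: AE_I2\<close>)
  qed
  finally show ?thesis by simp
qed

text \<open>Shifting along the largest component y_j of the real part gives exp(-|y_j| / (2a)). As
  |y| \<le> n |y_j|, this is exponential decay in |y| and beats every power.\<close>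

lemma sech_transform_decay:
  assumes a: "a > 0"
  shows "\<exists>C>0. \<forall>z :: complex^'n::finite. norm (\<chi> i. Im (z $ i)) \<le> a / 2 \<longrightarrow>
    norm (sech_transform a z) * (1 + norm (\<chi> i. Re (z $ i))) ^ k \<le> C"
proof -
  define J where "J = 4 * exp 1 * (LINT x|lborel. exp (- (a / 2) * norm (x::real^'n)))"
  have J0: "J \<ge> 0" unfolding J_def by simp
  obtain c where c: "c > 0" "\<And>t. t \<ge> 0 \<Longrightarrow> (1 + t) ^ k \<le> c * exp (1 / (2 * a * real CARD('n)) * t)"
    using power_le_exp[of "1 / (2 * a * real CARD('n))" k] a by auto
  show ?thesis
  proof (intro exI[of _ "c * J + 1"] conjI allI impI)
    show "c * J + 1 > 0" using c(1) J0 by (simp add: add_nonneg_pos)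
    fix z :: "complex^'n" assume z: "norm (\<chi> i. Im (z $ i)) \<le> a / 2"
    define y :: "real^'n" where "y = (\<chi> i. Re (z $ i))"
    have "Max (range (\<lambda>i. \<bar>y $ i\<bar>)) \<in> range (\<lambda>i. \<bar>y $ i\<bar>)" by (intro Max_in) auto
    then obtain j where j: "Max (range (\<lambda>i. \<bar>y $ i\<bar>)) = \<bar>y $ j\<bar>" by blast
    have mx: "\<bar>y $ i\<bar> \<le> \<bar>y $ j\<bar>" for i
      unfolding j[symmetric] by (intro Max_ge) auto
    have "norm y \<le> (\<Sum>i\<in>(UNIV :: 'n set). \<bar>y $ j\<bar>)"
      by (rule order_trans[OF norm_le_l1_cart]) (intro sum_mono mx)
    then have ny: "norm y \<le> real CARD('n) * \<bar>y $ j\<bar>" by simp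
    \<comment> \<open>The sign makes \<sigma> y_j = |y_j| / (2a); the height 1/(2a) is half of the
      admissible one.\<close>
    define \<sigma> where "\<sigma> = sgn (y $ j) / (2 * a)"
    have \<sigma>: "a * \<bar>\<sigma>\<bar> < 1" using a by (simp add: \<sigma>_def abs_divide abs_mult abs_sgn_eq)
    have "norm (sech_transform a z) \<le> exp (- \<sigma> * Re (z $ j)) * J"
      unfolding J_def by (rule sech_transform_shift[OF a z \<sigma>])
    also have "- \<sigma> * Re (z $ j) = - (1 / (2 * a) * \<bar>y $ j\<bar>)"
      by (simp add: \<sigma>_def y_def abs_sgn mult.commute)
    finally have 1: "norm (sech_transform a z) \<le> exp (- (1 / (2 * a) * \<bar>y $ j\<bar>)) * J" .
    have "(1 + norm y) ^ k \<le> c * exp (1 / (2 * a * real CARD('n)) * norm y)" by (rule c(2)) simp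
    also have "\<dots> \<le> c * exp (1 / (2 * a * real CARD('n)) * (real CARD('n) * \<bar>y $ j\<bar>))"
      using c(1) a ny by (intro mult_left_mono exp_le_cancel_iff[THEN iffD2]) auto
    also have "\<dots> = c * exp (1 / (2 * a) * \<bar>y $ j\<bar>)" by simp
    finally have "norm (sech_transform a z) * (1 + norm y) ^ k \<le>
        (exp (- (1 / (2 * a) * \<bar>y $ j\<bar>)) * J) * (c * exp (1 / (2 * a) * \<bar>y $ j\<bar>))"
      using J0 by (intro mult_mono 1) auto
    also have "\<dots> = c * J" by (simp add: exp_minus)
    finally show "norm (sech_transform a z) * (1 + norm (\<chi> i. Re (z $ i))) ^ k \<le> c * J + 1" unfolding y_def by simp
  qed
qed

section \<open>Transforms of test and Schwartz functions\<close>

lemma pd_zero_open: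
  assumes V: "open V" and zero: "\<And>x. x \<in> V \<Longrightarrow> f x = 0" and x: "x \<in> V"
  shows "pd \<alpha> f x = 0"
proof -
  have "foldr dpart is f y = 0" if "y \<in> V" for "is" y
    using that
  proof (induction "is" arbitrary: y)
    case Nil then show ?case using zero by simp
  next
    case (Cons i js)
    have "open ((\<lambda>t. y + t *\<^sub>R axis i 1) -` V)"
      by (intro open_vimage V continuous_intros)
    moreover have "0 \<in> (\<lambda>t. y + t *\<^sub>R axis i 1) -` V" using Cons.prems by simp
    ultimately have "((\<lambda>t. foldr dpart js f (y + t *\<^sub>R axis i 1)) has_vector_derivative 0) (at 0)"
      using Cons.IH by (intro has_vector_derivative_transform_within_open[OF has_vector_derivative_const]) auto
    then have "vector_derivative (\<lambda>t. foldr dpart js f (y + t *\<^sub>R axis i 1)) (at 0) = 0"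
      by (rule vector_derivative_at)
    then show ?case by (simp only: foldr_Cons o_apply dpart_def[of i "foldr dpart js f"])
  qed
  then show ?thesis using x unfolding pd_def by blast
qed

lemma pd_zero_outside:
  assumes "f \<in> test_on K" "compact K" "x \<notin> K"
  shows "pd \<alpha> f x = 0"
  by (rule pd_zero_open[of "- K"]) (use assms in \<open>auto simp: compact_imp_closed open_Compl test_on_def\<close>)

lemma integrable_compact_support:
  fixes g :: "real^'n::finite \<Rightarrow> complex"
  assumes "compact K" "continuous_on UNIV g" "\<And>x. x \<notin> K \<Longrightarrow> g x = 0"
  shows "integrable lborel g"
proof -
  have "integrable lborel (\<lambda>x. indicator K x *\<^sub>R g x)"
    using assms by (intro borel_integrable_compact continuous_on_subset[OF assms(2)]) auto
  also have "(\<lambda>x. indicator K x *\<^sub>R g x) = g" using assms(3) by (auto simp: indicator_def)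
  finally show ?thesis .
qed

lemma test_on_smooth: "f \<in> test_on K \<Longrightarrow> smooth f"
  by (simp add: test_on_def)

lemma continuous_on_ee_right: "continuous_on UNIV (\<lambda>x. ee z x)"
  unfolding ee_def by (intro continuous_intros)

lemma integrable_ee_test:
  assumes "f \<in> test_on K" "compact K"
  shows "integrable lborel (\<lambda>x. ee z x * pd \<beta> f x)"
proof (rule integrable_compact_support[OF assms(2)])
  show "continuous_on UNIV (\<lambda>x. ee z x * pd \<beta> f x)"
    by (intro continuous_on_mult continuous_on_ee_right smooth_imp(1) smooth_pd test_on_smooth[OF assms(1)])
qed (simp add: pd_zero_outside[OF assms])

text \<open>On K the exponential is at most exp(|r| R), so the constant depends on K, r and k only
  and the bound is linear in a seminorm of f. Continuity of E on test functions rests on this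
  form.\<close>

lemma test_decay:
  fixes K :: "(real^'n::finite) set"
  assumes K: "compact K"
  shows "\<exists>C\<ge>0. \<forall>f\<in>test_on K. \<forall>z. norm (\<chi> i. Im (z $ i)) \<le> r \<longrightarrow>
    norm (fourier_laplace f z) * (1 + norm z) ^ k \<le> C * seminorm_C K k f"
proof -
  obtain R where R: "R \<ge> 0" "\<And>x. x \<in> K \<Longrightarrow> norm x \<le> R"
    using compact_imp_bounded[OF K] unfolding bounded_iff by (metis norm_ge_zero order_trans abs_ge_self abs_ge_zero)
  define D where "D = exp (\<bar>r\<bar> * R) * measure lborel K"
  show ?thesis
  proof (intro exI[of _ "(1 + real CARD('n)) ^ k * D"] conjI ballI allI impI)
    show "(1 + real CARD('n)) ^ k * D \<ge> 0" unfolding D_def by simp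
    fix f and z :: "complex^'n" assume f: "f \<in> test_on K" and z: "norm (\<chi> i. Im (z $ i)) \<le> r"
    have "norm (fourier_laplace f z) * (1 + norm z) ^ k \<le> (1 + real CARD('n)) ^ k * (D * seminorm_C K k f)"
    proof (rule fourier_laplace_decay[OF test_on_smooth[OF f]])
      fix \<beta> :: "'n \<Rightarrow> nat" assume \<beta>: "mi_deg \<beta> \<le> k"
      show "integrable lborel (\<lambda>x. ee z x * pd \<beta> f x)" by (rule integrable_ee_test[OF f K])
      have "(LINT x|lborel. norm (ee z x * pd \<beta> f x)) \<le> (LINT x|lborel. (exp (\<bar>r\<bar> * R) * seminorm_C K k f) * indicator K x)"
      proof (rule integral_mono)
        show "integrable lborel (\<lambda>x. norm (ee z x * pd \<beta> f x))" by (intro integrable_norm integrable_ee_test[OF f K])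
        show "integrable lborel (\<lambda>x. (exp (\<bar>r\<bar> * R) * seminorm_C K k f) * indicator K x)"
          using K by (intro integrable_mult_right) (auto intro!: integrable_real_indicator emeasure_compact_finite simp: compact_imp_closed)
        fix x
        show "norm (ee z x * pd \<beta> f x) \<le> (exp (\<bar>r\<bar> * R) * seminorm_C K k f) * indicator K x"
        proof (cases "x \<in> K")
          case True
          have "norm (ee z x) \<le> exp (norm (\<chi> i. Im (z $ i)) * norm x)" by (rule norm_ee_le)
          also have "\<dots> \<le> exp (\<bar>r\<bar> * R)" using z R(2)[OF True] by (simp only: exp_le_cancel_iff) (intro mult_mono, auto)
          finally have "norm (ee z x) \<le> exp (\<bar>r\<bar> * R)" .
          then show ?thesis unfolding norm_mult using True seminorm_C_upper[OF K test_on_smooth[OF f] True \<beta>]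
            by (simp add: mult_mono)
        next
          case False then show ?thesis by (simp add: pd_zero_outside[OF f K])
        qed
      qed
      also have "\<dots> = D * seminorm_C K k f" unfolding D_def using K by (simp add: compact_imp_closed)
      finally show "(LINT x|lborel. norm (ee z x * pd \<beta> f x)) \<le> D * seminorm_C K k f" .
    qed
    then show "norm (fourier_laplace f z) * (1 + norm z) ^ k \<le> (1 + real CARD('n)) ^ k * D * seminorm_C K k f"
      by (simp add: mult.assoc)
  qed
qed

lemma schwartz_smooth: "f \<in> schwartz \<Longrightarrow> smooth f"
  by (simp add: schwartz_def)

lemma seminorm_S_upper:
  assumes "f \<in> schwartz" "mi_deg \<alpha> \<le> N"
  shows "(1 + norm x) ^ N * norm (pd \<alpha> f x) \<le> seminorm_S N f"
  unfolding seminorm_S_def using assms by (intro cSup_upper) (auto simp: schwartz_def)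

lemma schwartz_pd_bound:
  fixes f :: "'n::finite cfun"
  assumes "f \<in> schwartz" "mi_deg \<alpha> \<le> N" "2 * CARD('n) \<le> N"
  shows "norm (pd \<alpha> f x) \<le> seminorm_S N f * inverse ((1 + norm x) ^ (2 * CARD('n)))"
proof -
  have p: "0 < (1 + norm x) ^ (2 * CARD('n))" by (intro zero_less_power add_pos_nonneg) auto
  have "(1 + norm x) ^ (2 * CARD('n)) * norm (pd \<alpha> f x) \<le> (1 + norm x) ^ N * norm (pd \<alpha> f x)"
    using assms(3) by (intro mult_right_mono power_increasing) auto
  also have "\<dots> \<le> seminorm_S N f" by (rule seminorm_S_upper[OF assms(1,2)])
  finally show ?thesis using p by (simp add: pos_le_divide_eq divide_inverse[symmetric] mult.commute)
qed

lemma integrable_ee_schwartz: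
  fixes f :: "'n::finite cfun"
  assumes f: "f \<in> schwartz"
  shows "integrable lborel (\<lambda>x. ee (cvec \<xi>) x * pd \<beta> f x)"
proof (rule Bochner_Integration.integrable_bound)
  define N where "N = max (mi_deg \<beta>) (2 * CARD('n))"
  show "integrable lborel (\<lambda>x::real^'n. seminorm_S N f * inverse ((1 + norm x) ^ (2 * CARD('n))))"
    by (intro integrable_mult_right integrable_weight)
  have "continuous_on UNIV (pd \<beta> f)" by (intro smooth_imp smooth_pd schwartz_smooth f)
  then have [measurable]: "pd \<beta> f \<in> borel_measurable borel" by (rule borel_measurable_continuous_onI)
  show "(\<lambda>x. ee (cvec \<xi>) x * pd \<beta> f x) \<in> borel_measurable lborel" by measurable
  show "AE x in lborel. norm (ee (cvec \<xi>) x * pd \<beta> f x) \<le> norm (seminorm_S N f * inverse ((1 + norm (x::real^'n)) ^ (2 * CARD('n))))"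
    using schwartz_pd_bound[OF f, of \<beta> N] by (intro AE_I2) (auto simp: norm_mult N_def intro: order_trans[OF _ abs_ge_self])
qed

lemma norm_cvec: "norm (cvec x) = norm x"
  by (simp add: norm_vec_def)

text \<open>Besides k derivatives, 2n powers of 1 + |x| are spent on integrability in x; this
  explains the order of the seminorm.\<close>

lemma schwartz_decay:
  "\<exists>C\<ge>0. \<forall>f\<in>schwartz. \<forall>\<xi> :: real^'n::finite.
    norm (fourier_laplace f (cvec \<xi>)) * (1 + norm \<xi>) ^ k \<le> C * seminorm_S (max k (2 * CARD('n))) f"
proof -
  define D where "D = (LINT x|lborel. inverse ((1 + norm (x::real^'n)) ^ (2 * CARD('n))))"
  show ?thesis
  proof (intro exI[of _ "(1 + real CARD('n)) ^ k * D"] conjI ballI allI)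
    show "(1 + real CARD('n)) ^ k * D \<ge> 0" unfolding D_def by (intro mult_nonneg_nonneg Bochner_Integration.integral_nonneg) auto
    fix f :: "'n cfun" and \<xi> :: "real^'n" assume f: "f \<in> schwartz"
    let ?S = "seminorm_S (max k (2 * CARD('n))) f"
    have "norm (fourier_laplace f (cvec \<xi>)) * (1 + norm (cvec \<xi>)) ^ k \<le> (1 + real CARD('n)) ^ k * (D * ?S)"
    proof (rule fourier_laplace_decay[OF schwartz_smooth[OF f]])
      fix \<beta> :: "'n \<Rightarrow> nat" assume \<beta>: "mi_deg \<beta> \<le> k"
      show "integrable lborel (\<lambda>x. ee (cvec \<xi>) x * pd \<beta> f x)" by (rule integrable_ee_schwartz[OF f])
      have "(LINT x|lborel. norm (ee (cvec \<xi>) x * pd \<beta> f x)) \<le> (LINT x|lborel. ?S * inverse ((1 + norm (x::real^'n)) ^ (2 * CARD('n))))"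
      proof (rule integral_mono)
        show "integrable lborel (\<lambda>x. norm (ee (cvec \<xi>) x * pd \<beta> f x))" by (intro integrable_norm integrable_ee_schwartz[OF f])
        show "integrable lborel (\<lambda>x::real^'n. ?S * inverse ((1 + norm x) ^ (2 * CARD('n))))"
          by (intro integrable_mult_right integrable_weight)
        show "norm (ee (cvec \<xi>) x * pd \<beta> f x) \<le> ?S * inverse ((1 + norm x) ^ (2 * CARD('n)))" for x
          using schwartz_pd_bound[OF f, of \<beta> "max k (2 * CARD('n))" x] \<beta> by (simp add: norm_mult)
      qed
      also have "\<dots> = D * ?S" unfolding D_def by simp
      finally show "(LINT x|lborel. norm (ee (cvec \<xi>) x * pd \<beta> f x)) \<le> D * ?S" .
    qed
    then show "norm (fourier_laplace f (cvec \<xi>)) * (1 + norm \<xi>) ^ k \<le> (1 + real CARD('n)) ^ k * D * ?S"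
      by (simp add: mult.assoc norm_cvec)
  qed
qed

lemma test_funs_subset_schwartz: "test_funs \<subseteq> schwartz"
proof
  fix f :: "'a cfun" assume "f \<in> test_funs"
  then obtain K where K: "compact K" "f \<in> test_on K" by (auto simp: test_funs_def)
  have "bdd_above {(1 + norm x) ^ N * norm (pd \<alpha> f x) |x \<alpha>. mi_deg \<alpha> \<le> N}" for N
  proof -
    obtain R where R: "\<And>x. x \<in> K \<Longrightarrow> norm x \<le> R" using compact_imp_bounded[OF K(1)] unfolding bounded_iff by blast
    have R1: "(1 + norm x) ^ N * norm (pd \<alpha> f x) \<le> (1 + \<bar>R\<bar>) ^ N * seminorm_C K N f" if "mi_deg \<alpha> \<le> N" for x \<alpha>
    proof (cases "x \<in> K")
      case True
      have "norm x \<le> \<bar>R\<bar>" using R[OF True] by linarith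
      then show ?thesis
        using seminorm_C_upper[OF K(1) test_on_smooth[OF K(2)] True that]
        by (intro mult_mono power_mono) auto
    next
      case False
      then show ?thesis
        using seminorm_C_nonneg[OF K(1) test_on_smooth[OF K(2)], of N] by (simp add: pd_zero_outside[OF K(2,1)])
    qed
    then show ?thesis by (auto intro!: bdd_aboveI[of _ "(1 + \<bar>R\<bar>) ^ N * seminorm_C K N f"])
  qed
  then show "f \<in> schwartz" using test_on_smooth[OF K(2)] by (simp add: schwartz_def)
qed

text \<open>The du Bois-Reymond lemma, used for uniqueness of Fourier functions. Cutoffs shrinking
  to a compact K show that d has integral 0 over K. By inner regularity the bounded sets where Re (c
  d) > 0 are then null.\<close>

lemma set_lebesgue_AE_zero:
  fixes d :: "real^'n::finite \<Rightarrow> complex"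
  assumes d: "d \<in> borel_measurable lebesgue" "\<And>K. compact K \<Longrightarrow> set_integrable lebesgue K d"
    and z: "\<And>f. f \<in> test_funs \<Longrightarrow> (LINT x|lebesgue. d x * f x) = 0"
  shows "AE x in lebesgue. d x = 0"
proof -
  have cpt: "(LINT x|lebesgue. indicator K x *\<^sub>R d x) = 0" if K: "compact K" for K
  proof -
    \<comment> \<open>A common compact carrier: all cutoffs live within distance 1/(k+1) \<le> 1 of
      K, so |d| on L dominates the sequence.\<close>
    define L where "L = {x + y | x y. x \<in> K \<and> y \<in> cball (0::real^'n) 1}"
    have L: "compact L" unfolding L_def by (intro compact_sums K compact_cball)
    have "\<exists>b. smooth (\<lambda>x. complex_of_real (b x)) \<and> (\<forall>x. 0 \<le> b x \<and> b x \<le> 1) \<and> (\<forall>x\<in>K. b x = 1) \<and>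
        (\<forall>x. b x \<noteq> 0 \<longrightarrow> (\<exists>y\<in>K. dist x y < inverse (real (Suc k))))" for k
      by (rule smooth_cutoff[OF K, of "inverse (real (Suc k))"]) (simp, blast)
    then obtain b where b: "\<And>k. smooth (\<lambda>x. complex_of_real (b k x))" "\<And>k x. 0 \<le> b k x \<and> b k x \<le> 1"
        "\<And>k x. x \<in> K \<Longrightarrow> b k x = 1" "\<And>k x. b k x \<noteq> 0 \<Longrightarrow> \<exists>y\<in>K. dist x y < inverse (real (Suc k))"
      by metis
    have bL: "x \<in> L" if "b k x \<noteq> 0" for k x
    proof -
      obtain y where y: "y \<in> K" "dist x y < inverse (real (Suc k))" using b(4)[OF \<open>b k x \<noteq> 0\<close>] by blast
      moreover have "inverse (real (Suc k)) \<le> 1" by (simp add: inverse_le_1_iff)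
      ultimately have "norm (x - y) \<le> 1" by (simp add: dist_norm)
      then show ?thesis unfolding L_def using y(1) by (intro CollectI exI[of _ y] exI[of _ "x - y"]) auto
    qed
    have zero: "(LINT x|lebesgue. d x * of_real (b k x)) = 0" for k
    proof (rule z)
      have "(\<lambda>x. complex_of_real (b k x)) \<in> test_on L" using b(1) bL unfolding test_on_def by force
      then show "(\<lambda>x. complex_of_real (b k x)) \<in> test_funs" using L unfolding test_funs_def by blast
    qed
    have bm: "(\<lambda>x. complex_of_real (b k x)) \<in> borel_measurable lebesgue" for k
      using borel_measurable_continuous_onI[OF smooth_imp(1)[OF b(1)[of k]]] by (intro measurable_completion) simp
    have ind: "(indicator K :: real^'n \<Rightarrow> real) \<in> borel_measurable lebesgue"
      using K by (intro borel_measurable_indicator) (simp add: compact_imp_closed borel_closed sets_completionI_sets)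
    have "(\<lambda>k. LINT x|lebesgue. d x * of_real (b k x)) \<longlonglongrightarrow> (LINT x|lebesgue. d x * of_real (indicator K x))"
    proof (rule integral_dominated_convergence[where w = "\<lambda>x. indicator L x * norm (d x)"])
      show "(\<lambda>x. d x * complex_of_real (indicator K x)) \<in> borel_measurable lebesgue"
        using d(1) ind by measurable
      show "(\<lambda>x. d x * complex_of_real (b k x)) \<in> borel_measurable lebesgue" for k
        using d(1) bm by (intro borel_measurable_times) auto
      show "integrable lebesgue (\<lambda>x. indicator L x * norm (d x))"
        using integrable_norm[OF d(2)[OF L, unfolded set_integrable_def]] by simp
      show "AE x in lebesgue. norm (d x * of_real (b k x)) \<le> indicator L x * norm (d x)" for k
      proof (rule AE_I2)
        fix x
        show "norm (d x * of_real (b k x)) \<le> indicator L x * norm (d x)"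
        proof (cases "x \<in> L")
          case True then show ?thesis using b(2)[of k x] by (simp add: norm_mult mult_left_le)
        next
          case False
          then have "b k x = 0" using bL by blast
          then show ?thesis by simp
        qed
      qed
      show "AE x in lebesgue. (\<lambda>k. d x * complex_of_real (b k x)) \<longlonglongrightarrow> d x * complex_of_real (indicator K x)"
      proof (intro AE_I2 tendsto_intros)
        fix x
        show "(\<lambda>k. b k x) \<longlonglongrightarrow> indicator K x"
        proof (cases "x \<in> K")
          case True then show ?thesis using b(3) by simp
        next
          case False
          have "open (- K)" using K by (simp add: compact_imp_closed open_Compl)
          then obtain e where e: "e > 0" "ball x e \<subseteq> - K" using False by (auto simp: open_contains_ball)
          have "eventually (\<lambda>k. inverse (real (Suc k)) < e) sequentially"
            using LIMSEQ_inverse_real_of_nat e(1) by (rule order_tendstoD(2))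
          then have "eventually (\<lambda>k. b k x = 0) sequentially"
          proof eventually_elim
            case (elim k)
            show ?case
            proof (rule ccontr)
              assume "b k x \<noteq> 0"
              then obtain y where "y \<in> K" "dist x y < inverse (real (Suc k))" using b(4) by blast
              then show False using elim e(2) by (auto simp: subset_eq)
            qed
          qed
          then show ?thesis using False by (simp add: tendsto_eventually)
        qed
      qed
    qed
    then have "(LINT x|lebesgue. d x * of_real (indicator K x)) = 0"
      unfolding zero by (simp add: LIMSEQ_const_iff)
    then show ?thesis by (simp add: scaleR_conv_of_real mult.commute)
  qed
  have null: "{x \<in> cball 0 (real R). 0 < Re (c * d x)} \<in> null_sets lebesgue" for c :: complex and R :: nat
  proof -
    define A where "A = {x \<in> cball (0::real^'n) (real R). 0 < Re (c * d x)}"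
    have "(\<lambda>x. Re (c * d x)) \<in> borel_measurable lebesgue" using d(1) by measurable
    then have *: "{x \<in> space lebesgue. 0 < Re (c * d x)} \<in> sets lebesgue" by measurable
    have "A = cball 0 (real R) \<inter> {x \<in> space lebesgue. 0 < Re (c * d x)}" unfolding A_def by auto
    then have A: "A \<in> sets lebesgue"
      using sets.Int[OF fmeasurableD[OF lmeasurable_cball] *] by simp
    have small: "emeasure lebesgue A \<le> ennreal e" if e: "e > 0" for e
    proof -
      \<comment> \<open>On the compact set T the function Re (c d) is positive but has integral 0,
        so T is null; the rest of A has measure below e.\<close>
      obtain T where T: "closed T" "T \<subseteq> A" "A - T \<in> lmeasurable" "emeasure lebesgue (A - T) < ennreal e"
        using sets_lebesgue_inner_closed[OF A e] by blast
      have "bounded T" by (rule bounded_subset[OF bounded_cball[of 0 "real R"]]) (use T(2) in \<open>auto simp: A_def\<close>)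
      with T(1) have cT: "compact T" by (simp add: compact_eq_bounded_closed)
      have I: "integrable lebesgue (\<lambda>x. indicator T x *\<^sub>R d x)" using d(2)[OF cT] unfolding set_integrable_def .
      have I2: "integrable lebesgue (\<lambda>x. Re (c * (indicator T x *\<^sub>R d x)))" by (intro integrable_Re integrable_mult_right I)
      have "(LINT x|lebesgue. Re (c * (indicator T x *\<^sub>R d x))) = Re (c * (LINT x|lebesgue. indicator T x *\<^sub>R d x))"
        by (subst integral_Re[OF integrable_mult_right[OF I]]) (simp only: integral_mult_right_zero)
      also have "\<dots> = 0" by (simp add: cpt[OF cT])
      finally have "AE x in lebesgue. Re (c * (indicator T x *\<^sub>R d x)) = 0"
        using T(2) by (subst (asm) integral_nonneg_eq_0_iff_AE[OF I2]) (auto simp: A_def indicator_def intro!: AE_I2 less_imp_le)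
      then have "AE x in lebesgue. x \<notin> T"
        by eventually_elim (use T(2) in \<open>auto simp: A_def indicator_def\<close>)
      then have "T \<in> null_sets lebesgue"
        using cT by (subst AE_iff_null_sets) (auto simp: compact_imp_closed borel_closed sets_completionI_sets)
      then have "emeasure lebesgue T = 0" by auto
      moreover have "emeasure lebesgue A \<le> emeasure lebesgue T + emeasure lebesgue (A - T)"
        using T(2,3) cT A by (intro order_trans[OF _ emeasure_subadditive] emeasure_mono) (auto simp: compact_imp_closed borel_closed sets_completionI_sets)
      ultimately show ?thesis using T(4) by simp
    qed
    have "emeasure lebesgue A \<le> 0"
      by (rule ennreal_le_epsilon) (use small in auto)
    then show ?thesis using A unfolding A_def[symmetric] by auto
  qed
  have ae: "AE x in lebesgue. x \<notin> {x \<in> cball 0 (real R). 0 < Re (c * d x)}" for c :: complex and R :: nat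
    using null[of R c] by (rule AE_not_in)
  \<comment> \<open>The four values of c bound the real and imaginary parts of d from both sides by
    0, and the balls exhaust the space; countably many null sets are discarded.\<close>
  have "AE x in lebesgue. \<forall>R::nat. \<forall>c\<in>{1, -1, \<i>, -\<i>}. x \<notin> {x \<in> cball 0 (real R). 0 < Re (c * d x)}"
    unfolding AE_all_countable using ae by (intro allI AE_ball_countable') auto
  then show ?thesis
  proof eventually_elim
    case (elim x)
    obtain R :: nat where "norm x \<le> real R" using real_arch_simple by blast
    then have "\<not> 0 < Re (c * d x)" if "c \<in> {1, -1, \<i>, -\<i>}" for c
      using elim that by (auto simp: dist_norm)
    from this[of 1] this[of "-1"] this[of \<i>] this[of "-\<i>"] show ?case by (simp add: complex_eq_iff)
  qed
qed

section \<open>Division by a symbol along circles\<close>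

definition shiftv :: "real^'n::finite \<Rightarrow> complex \<Rightarrow> complex^'n" where
  "shiftv y w = (\<chi> i. w * of_real (y $ i))"

text \<open>The frequency \<xi> and the circle parameter t form one measure space, so that the later
  exchange with \<eta> is Fubini for two factors.\<close>

definition param_space :: "((real^'n::finite) \<times> real) measure" where
  "param_space = lborel \<Otimes>\<^sub>M unit_seg 1"

definition circle_point :: "(real^'n::finite \<Rightarrow> real^'n) \<Rightarrow> (real^'n) \<times> real \<Rightarrow> complex^'n" where
  "circle_point v s = cvec (fst s) + shiftv (v (fst s)) (cis (2 * pi * snd s))"

lemma borel_measurable_shiftv [measurable]:
  assumes "f \<in> borel_measurable M" "g \<in> borel_measurable M"
  shows "(\<lambda>x. shiftv (f x) (g x)) \<in> borel_measurable M"
proof (rule borel_measurable_continuous_Pair[OF assms, of shiftv])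
  show "continuous_on UNIV (\<lambda>x. shiftv (fst x) (snd x))" unfolding shiftv_def by (intro continuous_intros)
qed

lemma sets_param_space [measurable_cong]:
  "sets (param_space :: ((real^'n::finite) \<times> real) measure) = sets (borel \<Otimes>\<^sub>M restrict_space borel {0..1})"
  unfolding param_space_def by (intro sets_pair_measure_cong) (simp_all add: sets_unit_seg)

lemma pair_lborel_unit_seg: "pair_sigma_finite (lborel :: (real^'n::finite) measure) (unit_seg T)"
  by (intro pair_sigma_finite_unit_seg lborel.sigma_finite_measure_axioms)

lemma sigma_finite_param_space: "sigma_finite_measure (param_space :: ((real^'n::finite) \<times> real) measure)"
proof -
  interpret pair_sigma_finite "lborel :: (real^'n) measure" "unit_seg 1" by (rule pair_lborel_unit_seg)
  show ?thesis unfolding param_space_def by unfold_locales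
qed

lemma borel_measurable_snd_param [measurable]:
  "(\<lambda>s. snd s) \<in> borel_measurable (param_space :: ((real^'n::finite) \<times> real) measure)"
  unfolding param_space_def by measurable

lemma cis_measurable [measurable]: "cis \<in> borel_measurable borel"
  by (intro borel_measurable_continuous_onI continuous_intros)

lemma borel_measurable_circle_point [measurable]:
  fixes v :: "real^'n::finite \<Rightarrow> real^'n"
  assumes [measurable]: "v \<in> borel_measurable borel"
  shows "circle_point v \<in> borel_measurable param_space"
  unfolding circle_point_def[abs_def] by measurable

lemma borel_measurable_csymbol [measurable]: "csymbol m p \<in> borel_measurable borel"
  by (intro borel_measurable_continuous_onI continuous_on_csymbol)

lemma borel_measurable_fourier_laplace [measurable]:
  assumes [measurable]: "f \<in> borel_measurable borel"
  shows "fourier_laplace f \<in> borel_measurable borel"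
  unfolding fourier_laplace_def[abs_def]
  by (rule lborel.borel_measurable_lebesgue_integral) measurable

lemma borel_measurable_sech_transform [measurable]: "sech_transform a \<in> borel_measurable borel"
  unfolding sech_transform_def[abs_def] cosh_field_def
  by (rule lborel.borel_measurable_lebesgue_integral) measurable

text \<open>The circle parameter has total mass 1, so a bound depending on \<xi> alone carries over
  without a constant.\<close>

lemma integrable_param_space:
  fixes F :: "(real^'n::finite) \<times> real \<Rightarrow> complex"
  assumes "F \<in> borel_measurable param_space" "integrable lborel B"
    and "\<And>\<xi> t. t \<in> {0..1} \<Longrightarrow> norm (F (\<xi>, t)) \<le> B \<xi>"
  shows "integrable param_space F" "norm (LINT s|param_space. F s) \<le> (LINT \<xi>|lborel. B \<xi>)"
proof -
  interpret pair_sigma_finite "lborel :: (real^'n) measure" "unit_seg 1" by (rule pair_lborel_unit_seg)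
  interpret U: finite_measure "unit_seg 1" by (rule finite_measure_unit_seg)
  show I: "integrable param_space F"
    unfolding param_space_def
    by (rule integrable_pair_bound[OF pair_sigma_finite_axioms, where g = B and h = "\<lambda>_. 1"])
       (use assms in \<open>auto simp: param_space_def\<close>)
  have Im: "integrable (lborel \<Otimes>\<^sub>M unit_seg 1) F" using I unfolding param_space_def .
  have "(LINT s|param_space. F s) = (LINT \<xi>|lborel. LINT t|unit_seg 1. F (\<xi>, t))"
    unfolding param_space_def by (rule integral_fst'[OF Im, symmetric])
  also have "norm \<dots> \<le> (LINT \<xi>|lborel. B \<xi>)"
  proof (rule Bochner_Integration.integral_norm_bound_integral)
    show "integrable lborel (\<lambda>\<xi>. LINT t|unit_seg 1. F (\<xi>, t))" by (rule integrable_fst'[OF Im])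
    show "norm (LINT t|unit_seg 1. F (\<xi>, t)) \<le> B \<xi>" for \<xi>
    proof -
      have "norm (LINT t|unit_seg 1. F (\<xi>, t)) \<le> (LINT t|unit_seg 1. norm (F (\<xi>, t)))" by (rule integral_norm_bound)
      also have "\<dots> \<le> (LINT t|unit_seg 1. B \<xi>)"
      proof (rule integral_mono')
        show "0 \<le> B \<xi>" by (rule order_trans[OF norm_ge_zero assms(3)[of 0]]) simp
      qed (use assms(3) in auto)
      also have "\<dots> = B \<xi>" by (simp add: measure_unit_seg)
      finally show ?thesis .
    qed
  qed fact
  finally show "norm (LINT s|param_space. F s) \<le> (LINT \<xi>|lborel. B \<xi>)" .
qed

text \<open>The mean value property of exp(b z) at 0, from Cauchy's formula on the unit circle.
  Exponentials suffice, because \<open>ee\<close> along a circle is the exponential of a linear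
  function of the circle point.\<close>

lemma circle_exp_mean: "(LINT t|unit_seg 1. exp (b * cis (2 * pi * t))) = 1"
proof -
  have "(\<lambda>z. exp (b * z)) holomorphic_on cball 0 1" by (intro holomorphic_intros)
  from Cauchy_integral_circlepath_simple[OF this, of 0]
  have "((\<lambda>u. exp (b * u) / (u - 0)) has_contour_integral 2 * of_real pi * \<i> * exp (b * 0)) (circlepath 0 1)" by simp
  then have "((\<lambda>t. exp (b * circlepath 0 1 t) / (circlepath 0 1 t - 0) * vector_derivative (circlepath 0 1) (at t within {0..1}))
      has_integral 2 * of_real pi * \<i>) {0..1}"
    unfolding has_contour_integral_def by simp
  then have *: "((\<lambda>t. exp (b * circlepath 0 1 t) / (circlepath 0 1 t - 0) * vector_derivative (circlepath 0 1) (at t within {0..1}))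
      has_integral (2 * of_real pi * \<i>) * 1) {0..1}" by simp
  have eq: "exp (b * circlepath 0 1 t) / (circlepath 0 1 t - 0) * vector_derivative (circlepath 0 1) (at t within {0..1}) =
      2 * of_real pi * \<i> * exp (b * cis (2 * pi * t))" if t: "t \<in> {0..1}" for t
  proof -
    have "circlepath 0 1 t = cis (2 * pi * t)"
      by (simp add: circlepath cis_conv_exp mult_ac)
    moreover have "vector_derivative (circlepath 0 1) (at t within {0..1}) = 2 * of_real pi * \<i> * cis (2 * pi * t)"
      using t by (simp add: vector_derivative_circlepath01 cis_conv_exp mult_ac)
    ultimately show ?thesis by simp
  qed
  have h: "((\<lambda>t. (2 * of_real pi * \<i>) * exp (b * cis (2 * pi * t))) has_integral (2 * of_real pi * \<i>) * 1) {0..1}"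
    by (rule has_integral_eq[OF eq *])
  define \<kappa> where "\<kappa> = 2 * complex_of_real pi * \<i>"
  have \<kappa>: "\<kappa> \<noteq> 0" by (simp add: \<kappa>_def)
  from has_integral_mult_right[OF h[folded \<kappa>_def], of "inverse \<kappa>"]
  have h1: "((\<lambda>t. exp (b * cis (2 * pi * t))) has_integral 1) {0..1}" using \<kappa> by (simp add: mult.assoc[symmetric])
  have c: "continuous_on {0..1} (\<lambda>t. exp (b * cis (2 * pi * t)))" by (intro continuous_intros)
  have "integrable lborel (\<lambda>t. indicator {0..1} t *\<^sub>R exp (b * cis (2 * pi * t)))"
    by (rule borel_integrable_compact[OF compact_Icc c])
  then have "(LINT t:{0..1}|lborel. exp (b * cis (2 * pi * t))) = integral {0..1} (\<lambda>t. exp (b * cis (2 * pi * t)))"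
    by (intro set_borel_integral_eq_integral) (simp add: set_integrable_def)
  also have "\<dots> = 1" by (rule integral_unique[OF h1])
  finally show ?thesis
    unfolding unit_seg_def set_lebesgue_integral_def by (simp add: integral_restrict_space)
qed

lemma lborel_integral_reflect:
  fixes f :: "real^'n::finite \<Rightarrow> complex"
  assumes "f \<in> borel_measurable borel"
  shows "(LINT x|lborel. f (- x)) = (LINT x|lborel. f x)"
  using lborel_integral_scale[OF assms, of "-1"] by simp

lemma power_mult_inverse_power: "y > 0 \<Longrightarrow> y ^ k * inverse (y ^ (k + l)) = inverse (y ^ l)" for y :: real
  by (simp add: power_add)

lemma ee_0 [simp]: "ee 0 x = 1" by (simp add: ee_def)

lemma test_on_borel: "f \<in> test_on K \<Longrightarrow> f \<in> borel_measurable borel"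
  by (intro borel_measurable_continuous_onI smooth_imp(1) test_on_smooth)

lemma pd_zero_index: "smooth f \<Longrightarrow> pd (\<lambda>_. 0) f = f"
proof -
  assume "smooth f"
  have "count_list [] = (\<lambda>_::'a. 0)" by auto
  then show ?thesis using pd_foldr[OF \<open>smooth f\<close>, of "[]"] by (metis foldr_Nil id_apply)
qed

lemma integrable_ee_test0:
  assumes "f \<in> test_on K" "compact K"
  shows "integrable lborel (\<lambda>x. ee z x * f x)"
  using integrable_ee_test[OF assms, of z "\<lambda>_. 0"] by (simp add: pd_zero_index[OF test_on_smooth[OF assms(1)]])

lemma integrable_test:
  assumes "f \<in> test_on K" "compact K" shows "integrable lborel f"
  using integrable_ee_test0[OF assms, of 0] by simp

lemma fourier_laplace_test_integrable:
  assumes f: "f \<in> test_on K" "compact K"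
  shows "integrable lborel (\<lambda>\<xi>. fourier_laplace f (cvec \<xi>))"
proof -
  have s: "f \<in> schwartz" using f test_funs_subset_schwartz unfolding test_funs_def by blast
  obtain C where C: "\<And>\<xi>. norm (fourier_laplace f (cvec \<xi>)) * (1 + norm \<xi>) ^ (2 * CARD('a)) \<le> C"
    using schwartz_decay[of "2 * CARD('a)", where 'n = 'a] s by blast
  show ?thesis
  proof (rule Bochner_Integration.integrable_bound)
    show "integrable lborel (\<lambda>\<xi>::real^'a. C * inverse ((1 + norm \<xi>) ^ (2 * CARD('a))))"
      by (intro integrable_mult_right integrable_weight)
    have [measurable]: "f \<in> borel_measurable borel" by (rule test_on_borel[OF f(1)])
    show "(\<lambda>\<xi>. fourier_laplace f (cvec \<xi>)) \<in> borel_measurable lborel" by measurable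
    show "AE \<xi> in lborel. norm (fourier_laplace f (cvec \<xi>)) \<le> norm (C * inverse ((1 + norm \<xi>) ^ (2 * CARD('a))))"
    proof (rule AE_I2)
      fix \<xi> :: "real^'a"
      have "0 < (1 + norm \<xi>) ^ (2 * CARD('a))" by (intro zero_less_power add_pos_nonneg) auto
      then have "norm (fourier_laplace f (cvec \<xi>)) \<le> C * inverse ((1 + norm \<xi>) ^ (2 * CARD('a)))"
        using C[of \<xi>] by (simp add: pos_le_divide_eq divide_inverse[symmetric])
      then show "norm (fourier_laplace f (cvec \<xi>)) \<le> norm (C * inverse ((1 + norm \<xi>) ^ (2 * CARD('a))))"
        unfolding real_norm_def by linarith
    qed
  qed
qed

lemma test_bounded:
  assumes f: "f \<in> test_on K" "compact K"
  obtains M where "\<And>x. norm (f x) \<le> M"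
proof
  fix x
  show "norm (f x) \<le> seminorm_C K 0 f"
  proof (cases "x \<in> K")
    case True
    then show ?thesis using seminorm_C_upper[OF f(2) test_on_smooth[OF f(1)] True, of "\<lambda>_. 0" 0]
      by (simp add: pd_zero_index[OF test_on_smooth[OF f(1)]] mi_deg_def)
  next
    case False
    then show ?thesis using f seminorm_C_nonneg[OF f(2) test_on_smooth[OF f(1)], of 0] by (simp add: test_on_def)
  qed
qed

lemma fourier_test_integrable:
  assumes f: "f \<in> test_on K" "compact K"
  shows "integrable lborel (fourier f)"
proof -
  have "integrable lborel (\<lambda>\<xi>. fourier_laplace f (cvec ((-1) *\<^sub>R \<xi>)))"
    by (rule lborel_integrable_scale[OF fourier_laplace_test_integrable[OF f]]) simp
  moreover have "(\<lambda>\<xi>. fourier_laplace f (cvec ((-1) *\<^sub>R \<xi>))) = fourier f" by (simp add: fun_eq_iff fourier_eq)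
  ultimately show ?thesis by simp
qed

lemma fourier_inversion_test:
  fixes f :: "'n::finite cfun"
  assumes f: "f \<in> test_on K" "compact K"
  shows "(LINT \<xi>|lborel. ee (cvec \<xi>) x * fourier f \<xi>) = of_real ((2 * pi) ^ CARD('n)) * f x"
proof -
  obtain M where "\<And>x. norm (f x) \<le> M" using test_bounded[OF f] by blast
  then show ?thesis
    by (intro fourier_inversion integrable_test[OF f] smooth_imp(1) test_on_smooth[OF f(1)] fourier_test_integrable[OF f])
qed

lemma norm_shiftv_parts:
  assumes "norm w = 1"
  shows "norm (\<chi> i. Re (shiftv y w $ i)) \<le> norm y" "norm (\<chi> i. Im (shiftv y w $ i)) \<le> norm y"
proof -
  have r: "(\<chi> i. Re (shiftv y w $ i)) = Re w *\<^sub>R y" "(\<chi> i. Im (shiftv y w $ i)) = Im w *\<^sub>R y"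
    by (simp_all add: vec_eq_iff shiftv_def)
  have "\<bar>Re w\<bar> \<le> 1" "\<bar>Im w\<bar> \<le> 1" using assms abs_Re_le_cmod[of w] abs_Im_le_cmod[of w] by auto
  then show "norm (\<chi> i. Re (shiftv y w $ i)) \<le> norm y" "norm (\<chi> i. Im (shiftv y w $ i)) \<le> norm y"
    unfolding r norm_scaleR by (simp_all add: mult_left_le_one_le)
qed

lemma norm_Re_vec_le: "norm (\<chi> i. Re (z $ i)) \<le> norm (z :: complex^'n::finite)"
  unfolding norm_vec_def by (intro L2_set_mono) (auto simp: abs_Re_le_cmod)

text \<open>The transposed operator with numerical coefficients, one for each \<epsilon>. The factor
  (-1)^|\<alpha>| is the transposition, and (-\<i>)^|\<alpha>| turns \<partial>^\<alpha> into
  D^\<alpha>.\<close>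

definition transpose_symbol :: "nat \<Rightarrow> (('n::finite \<Rightarrow> nat) \<Rightarrow> complex) \<Rightarrow> 'n cfun \<Rightarrow> 'n cfun" where
  "transpose_symbol m p u = (\<lambda>x. \<Sum>\<alpha> | mi_deg \<alpha> \<le> m. ((- 1) ^ mi_deg \<alpha> * p \<alpha> * (- \<i>) ^ mi_deg \<alpha>) * pd \<alpha> u x)"

text \<open>The complex shifts \<open>v\<close> avoid the zeros of the symbol: on the circle of radius \<open>v \<xi>\<close>
  around \<open>\<xi>\<close> the symbol is comparable with \<open>tilde m p \<xi>\<close>.\<close>

locale symbol_division =
  fixes m :: nat and p :: "('n::finite \<Rightarrow> nat) \<Rightarrow> complex" and v :: "real^'n \<Rightarrow> real^'n" and a c G :: real
  assumes a_pos: "a > 0" and c_pos: "c > 0" and G_pos: "G > 0"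
    and v_measurable [measurable]: "v \<in> borel_measurable borel"
    and v_le: "norm (v x) \<le> a / 2"
    and lower: "norm w = 1 \<Longrightarrow> c * tilde m p x \<le> norm (csymbol m p (cvec x + shiftv (v x) w))"
    and growth: "tilde m p (x + y) \<le> G * (1 + norm y) ^ m * tilde m p x"
    and tilde0: "tilde m p 0 > 0"
begin

abbreviation "zeta \<equiv> circle_point v"

definition E :: "'n cfun \<Rightarrow> complex" where
  "E u = inverse (of_real ((2 * pi) ^ CARD('n))) * (LINT s|param_space. fourier_laplace u (zeta s) / csymbol m p (zeta s))"

text \<open>Formally E applied to exp(-i x \<eta>) / cosh(a|x|), the value expected of the Fourier
  transform of E/cosh(a|x|) at \<eta>.\<close>

definition g :: "'n cfun" where
  "g \<eta> = inverse (of_real ((2 * pi) ^ CARD('n))) * (LINT s|param_space. sech_transform a (zeta s - cvec \<eta>) / csymbol m p (zeta s))"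

text \<open>The tempered distribution with Fourier transform g: it pairs g with the inverse
  transform of f, so that inserting \<open>fourier f\<close> leaves g f.\<close>

definition w :: "'n cfun \<Rightarrow> complex" where
  "w f = (LINT \<eta>|lborel. g \<eta> * (inverse (of_real ((2 * pi) ^ CARD('n))) * fourier_laplace f (cvec \<eta>)))"

lemma tilde_pos: "tilde m p x > 0"
proof (rule ccontr)
  assume "\<not> ?thesis"
  then have "tilde m p x = 0" using tilde_nonneg[of m p x] by linarith
  then show False using growth[of x "- x"] tilde0 by simp
qed

lemma tilde_inverse_le: "inverse (tilde m p x) \<le> G * (1 + norm x) ^ m * inverse (tilde m p 0)"
proof -
  have "tilde m p 0 \<le> G * (1 + norm x) ^ m * tilde m p x" using growth[of x "- x"] by simp
  then show ?thesis using tilde_pos[of x] tilde0 by (simp add: field_simps)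
qed

lemma symbol_zeta: "c * tilde m p \<xi> \<le> norm (csymbol m p (zeta (\<xi>, t)))"
  unfolding circle_point_def by (simp add: lower)

lemma symbol_zeta_nonzero: "csymbol m p (zeta s) \<noteq> 0"
proof -
  have "0 < c * tilde m p (fst s)" using c_pos tilde_pos by simp
  also have "\<dots> \<le> norm (csymbol m p (zeta s))" using symbol_zeta[of "fst s" "snd s"] by simp
  finally show ?thesis by auto
qed

lemma norm_inverse_symbol: "norm (inverse (csymbol m p (zeta (\<xi>, t)))) \<le> inverse c * inverse (tilde m p \<xi>)"
  unfolding norm_inverse inverse_mult_distrib[symmetric]
  by (intro le_imp_inverse_le symbol_zeta mult_pos_pos c_pos tilde_pos)

text \<open>The shift has length at most a/2. It keeps the argument in the strip where the
  transforms decay and changes 1 + |\<xi> - \<eta>| at most by the factor 1 + a/2, so decay in the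
  complex point becomes decay in \<xi> - \<eta>.\<close>

lemma zeta_diff_parts:
  "norm (\<chi> i. Im ((zeta (\<xi>, t) - cvec \<eta>) $ i)) \<le> a / 2"
  "1 + norm (\<xi> - \<eta>) \<le> (1 + a / 2) * (1 + norm (\<chi> i. Re ((zeta (\<xi>, t) - cvec \<eta>) $ i)))"
proof -
  let ?s = "shiftv (v \<xi>) (cis (2 * pi * t))"
  have I: "(\<chi> i. Im ((zeta (\<xi>, t) - cvec \<eta>) $ i)) = (\<chi> i. Im (?s $ i))"
    and R: "(\<chi> i. Re ((zeta (\<xi>, t) - cvec \<eta>) $ i)) = (\<xi> - \<eta>) + (\<chi> i. Re (?s $ i))"
    by (simp_all add: vec_eq_iff circle_point_def)
  have n: "norm (\<chi> i. Im (?s $ i)) \<le> a / 2" "norm (\<chi> i. Re (?s $ i)) \<le> a / 2"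
    using norm_shiftv_parts[of "cis (2 * pi * t)" "v \<xi>"] v_le[of \<xi>] by auto
  show "norm (\<chi> i. Im ((zeta (\<xi>, t) - cvec \<eta>) $ i)) \<le> a / 2" unfolding I by (rule n)
  have "norm (\<xi> - \<eta>) \<le> norm ((\<xi> - \<eta>) + (\<chi> i. Re (?s $ i))) + norm (\<chi> i. Re (?s $ i))"
    using norm_triangle_ineq4[of "(\<xi> - \<eta>) + (\<chi> i. Re (?s $ i))" "\<chi> i. Re (?s $ i)"] by simp
  also have "\<dots> \<le> norm ((\<xi> - \<eta>) + (\<chi> i. Re (?s $ i))) + a / 2" using n by simp
  finally have "1 + norm (\<xi> - \<eta>) \<le> (1 + norm ((\<xi> - \<eta>) + (\<chi> i. Re (?s $ i)))) + a / 2 * 1" by simp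
  also have "\<dots> \<le> (1 + norm ((\<xi> - \<eta>) + (\<chi> i. Re (?s $ i)))) + a / 2 * (1 + norm ((\<xi> - \<eta>) + (\<chi> i. Re (?s $ i))))"
    using a_pos by (intro add_left_mono mult_left_mono) auto
  finally show "1 + norm (\<xi> - \<eta>) \<le> (1 + a / 2) * (1 + norm (\<chi> i. Re ((zeta (\<xi>, t) - cvec \<eta>) $ i)))"
    unfolding R by (simp add: algebra_simps)
qed

lemma zeta_parts:
  "norm (\<chi> i. Im (zeta (\<xi>, t) $ i)) \<le> a / 2"
  "1 + norm \<xi> \<le> (1 + a / 2) * (1 + norm (zeta (\<xi>, t)))"
proof -
  show "norm (\<chi> i. Im (zeta (\<xi>, t) $ i)) \<le> a / 2" using zeta_diff_parts(1)[of \<xi> t 0] by simp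
  have "1 + norm \<xi> \<le> (1 + a / 2) * (1 + norm (\<chi> i. Re (zeta (\<xi>, t) $ i)))" using zeta_diff_parts(2)[of \<xi> 0 t] by simp
  also have "\<dots> \<le> (1 + a / 2) * (1 + norm (zeta (\<xi>, t)))" using a_pos norm_Re_vec_le by (intro mult_left_mono add_left_mono) auto
  finally show "1 + norm \<xi> \<le> (1 + a / 2) * (1 + norm (zeta (\<xi>, t)))" .
qed

lemma decay_at_zeta:
  assumes "\<And>z. norm (\<chi> i. Im (z $ i)) \<le> a / 2 \<Longrightarrow> norm (fourier_laplace u z) * (1 + norm z) ^ k \<le> B"
  shows "norm (fourier_laplace u (zeta (\<xi>, t))) * (1 + norm \<xi>) ^ k \<le> (1 + a / 2) ^ k * B"
proof -
  have "norm (fourier_laplace u (zeta (\<xi>, t))) * (1 + norm \<xi>) ^ k \<le>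
      norm (fourier_laplace u (zeta (\<xi>, t))) * ((1 + a / 2) * (1 + norm (zeta (\<xi>, t)))) ^ k"
    by (intro mult_left_mono power_mono zeta_parts) auto
  also have "\<dots> = (1 + a / 2) ^ k * (norm (fourier_laplace u (zeta (\<xi>, t))) * (1 + norm (zeta (\<xi>, t))) ^ k)"
    by (simp only: power_mult_distrib mult_ac)
  also have "\<dots> \<le> (1 + a / 2) ^ k * B" using a_pos by (intro mult_left_mono assms zeta_parts) auto
  finally show ?thesis .
qed

definition W :: real where "W = (LINT x|lborel. inverse ((1 + norm (x::real^'n)) ^ (2 * CARD('n))))"

text \<open>By slow variation 1/\<open>tilde\<close> at \<xi> is at most (1 + |\<xi>|)^m /
  \<open>tilde\<close>(0) up to a constant. This consumes m of the m + 2n powers of decay and leaves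
  an integrable weight.\<close>

lemma E_integrand_bound:
  assumes B: "\<And>z. norm (\<chi> i. Im (z $ i)) \<le> a / 2 \<Longrightarrow> norm (fourier_laplace u z) * (1 + norm z) ^ (m + 2 * CARD('n)) \<le> B"
  shows "norm (fourier_laplace u (zeta (\<xi>, t)) / csymbol m p (zeta (\<xi>, t))) \<le>
    (1 + a / 2) ^ (m + 2 * CARD('n)) * B * inverse c * G * inverse (tilde m p 0) * inverse ((1 + norm \<xi>) ^ (2 * CARD('n)))"
proof -
  let ?x = "1 + norm \<xi>"
  have x: "?x > 0" by (intro add_pos_nonneg) auto
  have 1: "norm (fourier_laplace u (zeta (\<xi>, t))) \<le> (1 + a / 2) ^ (m + 2 * CARD('n)) * B * inverse (?x ^ (m + 2 * CARD('n)))"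
    using decay_at_zeta[where k = "m + 2 * CARD('n)", OF B, of \<xi> t] x by (simp add: pos_le_divide_eq divide_inverse[symmetric])
  have 2: "norm (inverse (csymbol m p (zeta (\<xi>, t)))) \<le> inverse c * (G * ?x ^ m * inverse (tilde m p 0))"
    using c_pos by (intro order_trans[OF norm_inverse_symbol] mult_left_mono tilde_inverse_le) auto
  have "norm (fourier_laplace u (zeta (\<xi>, t)) / csymbol m p (zeta (\<xi>, t))) =
      norm (fourier_laplace u (zeta (\<xi>, t))) * norm (inverse (csymbol m p (zeta (\<xi>, t))))"
    by (simp only: divide_inverse norm_mult)
  also have "\<dots> \<le> ((1 + a / 2) ^ (m + 2 * CARD('n)) * B * inverse (?x ^ (m + 2 * CARD('n)))) * (inverse c * (G * ?x ^ m * inverse (tilde m p 0)))"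
    by (intro mult_mono 1 2 order_trans[OF norm_ge_zero 1]) auto
  also have "\<dots> = (1 + a / 2) ^ (m + 2 * CARD('n)) * B * inverse c * G * inverse (tilde m p 0) * inverse (?x ^ (2 * CARD('n)))"
    using x by (simp add: power_add field_simps)
  finally show ?thesis .
qed

lemma E_integrable_bound:
  assumes [measurable]: "u \<in> borel_measurable borel"
    and B: "\<And>z. norm (\<chi> i. Im (z $ i)) \<le> a / 2 \<Longrightarrow> norm (fourier_laplace u z) * (1 + norm z) ^ (m + 2 * CARD('n)) \<le> B"
  shows "integrable param_space (\<lambda>s. fourier_laplace u (zeta s) / csymbol m p (zeta s))"
    "norm (E u) \<le> inverse ((2 * pi) ^ CARD('n)) * ((1 + a / 2) ^ (m + 2 * CARD('n)) * B * inverse c * G * inverse (tilde m p 0) * W)"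
proof -
  let ?C = "(1 + a / 2) ^ (m + 2 * CARD('n)) * B * inverse c * G * inverse (tilde m p 0)"
  have m: "(\<lambda>s. fourier_laplace u (zeta s) / csymbol m p (zeta s)) \<in> borel_measurable param_space" by measurable
  have i: "integrable lborel (\<lambda>\<xi>::real^'n. ?C * inverse ((1 + norm \<xi>) ^ (2 * CARD('n))))"
    by (intro integrable_mult_right integrable_weight)
  note * = integrable_param_space[OF m i E_integrand_bound[OF B]]
  show "integrable param_space (\<lambda>s. fourier_laplace u (zeta s) / csymbol m p (zeta s))" by (rule *(1))
  have "norm (E u) = inverse ((2 * pi) ^ CARD('n)) * norm (LINT s|param_space. fourier_laplace u (zeta s) / csymbol m p (zeta s))"
    unfolding E_def norm_mult norm_inverse norm_of_real by (simp add: abs_mult)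
  also have "\<dots> \<le> inverse ((2 * pi) ^ CARD('n)) * (?C * W)"
    using *(2) unfolding W_def by (intro mult_left_mono) auto
  finally show "norm (E u) \<le> inverse ((2 * pi) ^ CARD('n)) * (?C * W)" .
qed

lemma E_integrable_test:
  assumes u: "u \<in> test_on K" "compact K"
  shows "integrable param_space (\<lambda>s. fourier_laplace u (zeta s) / csymbol m p (zeta s))"
proof -
  obtain C where "\<forall>f\<in>test_on K. \<forall>z. norm (\<chi> i. Im (z $ i)) \<le> a / 2 \<longrightarrow>
    norm (fourier_laplace f z) * (1 + norm z) ^ (m + 2 * CARD('n)) \<le> C * seminorm_C K (m + 2 * CARD('n)) f"
    using test_decay[OF u(2), of "a / 2" "m + 2 * CARD('n)"] by blast
  then show ?thesis using u by (intro E_integrable_bound(1)[OF test_on_borel[OF u(1)]]) auto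
qed

lemma E_add:
  assumes "u \<in> test_on K" "u' \<in> test_on K'" "compact K" "compact K'"
  shows "E (\<lambda>x. u x + u' x) = E u + E u'"
proof -
  have "fourier_laplace (\<lambda>x. u x + u' x) z = fourier_laplace u z + fourier_laplace u' z" for z
    unfolding fourier_laplace_def distrib_left
    by (rule Bochner_Integration.integral_add) (use assms in \<open>auto intro: integrable_ee_test0\<close>)
  then show ?thesis
    unfolding E_def add_divide_distrib
    by (simp add: Bochner_Integration.integral_add[OF E_integrable_test[OF assms(1,3)] E_integrable_test[OF assms(2,4)]]
        add_divide_distrib algebra_simps)
qed

lemma E_cmult: "E (\<lambda>x. b * u x) = b * E u"
proof -
  have "fourier_laplace (\<lambda>x. b * u x) z = b * fourier_laplace u z" for z
    unfolding fourier_laplace_def by (subst integral_mult_right_zero[symmetric]) (simp only: mult_ac)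
  then show ?thesis unfolding E_def by (simp add: mult.left_commute flip: times_divide_eq_right)
qed

lemma fourier_laplace_transpose_symbol:
  assumes u: "u \<in> test_on K" "compact K"
  shows "fourier_laplace (transpose_symbol m p u) z = csymbol m p z * fourier_laplace u z"
proof -
  have "fourier_laplace (transpose_symbol m p u) z =
      (\<Sum>\<alpha> | mi_deg \<alpha> \<le> m. ((- 1) ^ mi_deg \<alpha> * p \<alpha> * (- \<i>) ^ mi_deg \<alpha>) * fourier_laplace (pd \<alpha> u) z)"
  proof -
    have "ee z x * transpose_symbol m p u x = (\<Sum>\<alpha> | mi_deg \<alpha> \<le> m. ((- 1) ^ mi_deg \<alpha> * p \<alpha> * (- \<i>) ^ mi_deg \<alpha>) * (ee z x * pd \<alpha> u x))" for x
      unfolding transpose_symbol_def sum_distrib_left by (simp only: mult_ac)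
    then show ?thesis
      unfolding fourier_laplace_def
      by (simp add: Bochner_Integration.integral_sum integrable_ee_test[OF u])
  qed
  also have "\<dots> = (\<Sum>\<alpha> | mi_deg \<alpha> \<le> m. (p \<alpha> * (\<Prod>i\<in>UNIV. (z $ i) ^ \<alpha> i)) * fourier_laplace u z)"
  proof (rule sum.cong[OF refl])
    fix \<alpha> :: "'n \<Rightarrow> nat" assume "\<alpha> \<in> {\<alpha>. mi_deg \<alpha> \<le> m}"
    have "fourier_laplace (pd \<alpha> u) z = (\<Prod>i\<in>UNIV. (- \<i> * z $ i) ^ \<alpha> i) * fourier_laplace u z"
      by (rule fourier_laplace_pd[OF test_on_smooth[OF u(1)]]) (rule integrable_ee_test[OF u])
    also have "(\<Prod>i\<in>UNIV. (- \<i> * z $ i) ^ \<alpha> i) = (- \<i>) ^ mi_deg \<alpha> * (\<Prod>i\<in>UNIV. (z $ i) ^ \<alpha> i)"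
      by (simp only: power_mult_distrib prod.distrib mi_deg_def power_sum)
    finally have e: "fourier_laplace (pd \<alpha> u) z = (- \<i>) ^ mi_deg \<alpha> * (\<Prod>i\<in>UNIV. (z $ i) ^ \<alpha> i) * fourier_laplace u z" .
    \<comment> \<open>The sign of the transposition cancels the two powers of -\<i>, one from
      D^\<alpha> and one from the transform of \<partial>^\<alpha>, because (-1)(-\<i>)(-\<i>) =
      1.\<close>
    have "(- 1) ^ mi_deg \<alpha> * ((- \<i>) ^ mi_deg \<alpha> * (- \<i>) ^ mi_deg \<alpha>) = (1::complex)"
      unfolding power_mult_distrib[symmetric] by simp
    then have "((- 1) ^ mi_deg \<alpha> * p \<alpha> * (- \<i>) ^ mi_deg \<alpha>) * ((- \<i>) ^ mi_deg \<alpha> * (\<Prod>i\<in>UNIV. (z $ i) ^ \<alpha> i) * fourier_laplace u z) =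
        1 * (p \<alpha> * (\<Prod>i\<in>UNIV. (z $ i) ^ \<alpha> i) * fourier_laplace u z)"
      by (simp only: mult_ac) (metis (no_types, lifting) mult.assoc mult.left_commute mult_1)
    then show "((- 1) ^ mi_deg \<alpha> * p \<alpha> * (- \<i>) ^ mi_deg \<alpha>) * fourier_laplace (pd \<alpha> u) z =
        (p \<alpha> * (\<Prod>i\<in>UNIV. (z $ i) ^ \<alpha> i)) * fourier_laplace u z" unfolding e by simp
  qed
  also have "\<dots> = csymbol m p z * fourier_laplace u z" unfolding csymbol_def sum_distrib_right ..
  finally show ?thesis .
qed

text \<open>The mean is taken for each \<xi> separately, so v may jump with \<xi>; measurability of
  v is all that the construction asks for.\<close>

lemma fourier_laplace_circle_mean:
  assumes u: "u \<in> test_on K" "compact K"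
  shows "(LINT t|unit_seg 1. fourier_laplace u (zeta (\<xi>, t))) = fourier_laplace u (cvec \<xi>)"
proof -
  have [measurable]: "u \<in> borel_measurable borel" by (rule test_on_borel[OF u(1)])
  interpret U: finite_measure "unit_seg 1" by (rule finite_measure_unit_seg)
  obtain R where R: "R \<ge> 0" "\<And>x. x \<in> K \<Longrightarrow> norm x \<le> R"
    using compact_imp_bounded[OF u(2)] unfolding bounded_iff by (metis norm_ge_zero order_trans abs_ge_self abs_ge_zero)
  have mz: "(\<lambda>z. ee (zeta (\<xi>, snd z)) (fst z) * u (fst z)) \<in> borel_measurable (lborel \<Otimes>\<^sub>M unit_seg 1)"
    unfolding circle_point_def by measurable
  have I: "integrable (lborel \<Otimes>\<^sub>M unit_seg 1) (\<lambda>z. ee (zeta (\<xi>, snd z)) (fst z) * u (fst z))"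
  proof (rule integrable_pair_bound[OF pair_lborel_unit_seg mz, where g = "\<lambda>x. exp (a / 2 * R) * norm (u x)" and h = "\<lambda>_. 1"])
    show "integrable lborel (\<lambda>x. exp (a / 2 * R) * norm (u x))"
      by (intro integrable_mult_right integrable_norm integrable_test[OF u])
    show "norm (ee (zeta (\<xi>, snd (x, y))) (fst (x, y)) * u (fst (x, y))) \<le> exp (a / 2 * R) * norm (u x) * 1" for x y
    proof (cases "x \<in> K")
      case True
      have "norm (ee (zeta (\<xi>, y)) x) \<le> exp (norm (\<chi> i. Im (zeta (\<xi>, y) $ i)) * norm x)" by (rule norm_ee_le)
      also have "\<dots> \<le> exp (a / 2 * R)" using zeta_parts(1)[of \<xi> y] R(2)[OF True] a_pos
        by (simp only: exp_le_cancel_iff) (intro mult_mono, auto)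
      finally show ?thesis by (simp add: norm_mult mult_right_mono)
    next
      case False then show ?thesis using u(1) by (simp add: test_on_def)
    qed
  qed simp
  have "(LINT t|unit_seg 1. fourier_laplace u (zeta (\<xi>, t))) = (LINT t|unit_seg 1. LINT x|lborel. ee (zeta (\<xi>, t)) x * u x)"
    unfolding fourier_laplace_def ..
  also have "\<dots> = (LINT x|lborel. LINT t|unit_seg 1. ee (zeta (\<xi>, t)) x * u x)"
    by (rule pair_sigma_finite.Fubini_integral[OF pair_lborel_unit_seg]) (use I in \<open>simp only: case_prod_unfold\<close>)
  also have "\<dots> = (LINT x|lborel. ee (cvec \<xi>) x * u x)"
  proof (rule Bochner_Integration.integral_cong[OF refl])
    fix x
    define b where "b = \<i> * (\<Sum>i\<in>UNIV. of_real (v \<xi> $ i) * complex_of_real (x $ i))"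
    have eq: "ee (zeta (\<xi>, t)) x * u x = (ee (cvec \<xi>) x * u x) * exp (b * cis (2 * pi * t))" for t
    proof -
      have "ee (shiftv (v \<xi>) (cis (2 * pi * t))) x = exp (b * cis (2 * pi * t))"
        unfolding ee_def shiftv_def b_def by (simp add: sum_distrib_left sum_distrib_right mult_ac)
      then show ?thesis unfolding circle_point_def ee_add by simp
    qed
    show "(LINT t|unit_seg 1. ee (zeta (\<xi>, t)) x * u x) = ee (cvec \<xi>) x * u x"
      unfolding eq integral_mult_right_zero circle_exp_mean by simp
  qed
  finally show ?thesis unfolding fourier_laplace_def .
qed

text \<open>Division by P was only ever carried out at points where it is bounded away from 0, so it
  cancels pointwise and the circle means leave the transform at real frequencies. The reflection
  \<xi> to -\<xi> adapts to the sign convention of \<open>fourier\<close>.\<close>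

lemma E_fundamental:
  assumes u: "u \<in> test_on K" "compact K"
  shows "E (transpose_symbol m p u) = u 0"
proof -
  interpret pair_sigma_finite "lborel :: (real^'n) measure" "unit_seg 1" by (rule pair_lborel_unit_seg)
  have [measurable]: "u \<in> borel_measurable borel" by (rule test_on_borel[OF u(1)])
  obtain C where C: "\<forall>f\<in>test_on K. \<forall>z. norm (\<chi> i. Im (z $ i)) \<le> a / 2 \<longrightarrow>
    norm (fourier_laplace f z) * (1 + norm z) ^ (2 * CARD('n)) \<le> C * seminorm_C K (2 * CARD('n)) f"
    using test_decay[OF u(2), of "a / 2" "2 * CARD('n)"] by blast
  let ?B = "(1 + a / 2) ^ (2 * CARD('n)) * (C * seminorm_C K (2 * CARD('n)) u)"
  have I: "integrable param_space (\<lambda>s. fourier_laplace u (zeta s))"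
  proof (rule integrable_param_space(1))
    show "integrable lborel (\<lambda>\<xi>::real^'n. ?B * inverse ((1 + norm \<xi>) ^ (2 * CARD('n))))"
      by (intro integrable_mult_right integrable_weight)
    fix \<xi> :: "real^'n" and t :: real
    have x: "1 + norm \<xi> > 0" by (intro add_pos_nonneg) auto
    have "norm (fourier_laplace u (zeta (\<xi>, t))) * (1 + norm \<xi>) ^ (2 * CARD('n)) \<le> ?B"
      by (rule decay_at_zeta) (use C u in auto)
    then show "norm (fourier_laplace u (zeta (\<xi>, t))) \<le> ?B * inverse ((1 + norm \<xi>) ^ (2 * CARD('n)))"
      using x by (simp add: pos_le_divide_eq divide_inverse[symmetric])
  qed measurable
  have "E (transpose_symbol m p u) = inverse (of_real ((2 * pi) ^ CARD('n))) * (LINT s|param_space. fourier_laplace u (zeta s))"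
    unfolding E_def fourier_laplace_transpose_symbol[OF u] using symbol_zeta_nonzero by simp
  also have "(LINT s|param_space. fourier_laplace u (zeta s)) = (LINT \<xi>|lborel. LINT t|unit_seg 1. fourier_laplace u (zeta (\<xi>, t)))"
    using integral_fst'[of "\<lambda>s. fourier_laplace u (zeta s)"] I unfolding param_space_def by simp
  also have "\<dots> = (LINT \<xi>|lborel. fourier_laplace u (cvec \<xi>))"
    unfolding fourier_laplace_circle_mean[OF u] ..
  also have "\<dots> = (LINT \<xi>|lborel. fourier_laplace u (cvec (- \<xi>)))"
    by (rule lborel_integral_reflect[symmetric]) measurable
  also have "\<dots> = (LINT \<xi>|lborel. ee (cvec \<xi>) 0 * fourier u \<xi>)" unfolding fourier_eq by (simp add: ee_cvec)
  also have "\<dots> = of_real ((2 * pi) ^ CARD('n)) * u 0" by (rule fourier_inversion_test[OF u])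
  also have "inverse (of_real ((2 * pi) ^ CARD('n))) * (of_real ((2 * pi) ^ CARD('n)) * u 0) = u 0"
    by (subst mult.assoc[symmetric], subst left_inverse) auto
  finally show ?thesis .
qed

end

section \<open>The Fourier transform of E / cosh(a|x|)\<close>

context symbol_division
begin

lemma sech_integrand_bound:
  assumes C: "\<And>z :: complex^'n. norm (\<chi> i. Im (z $ i)) \<le> a / 2 \<Longrightarrow>
    norm (sech_transform a z) * (1 + norm (\<chi> i. Re (z $ i))) ^ k \<le> C"
  shows "norm (sech_transform a (zeta (\<xi>, t) - cvec \<eta>) / csymbol m p (zeta (\<xi>, t))) \<le>
    (1 + a / 2) ^ k * C * inverse c * (inverse (tilde m p \<xi>) * inverse ((1 + norm (\<xi> - \<eta>)) ^ k))"
proof -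
  let ?z = "zeta (\<xi>, t) - cvec \<eta>"
  have x: "0 < 1 + norm (\<xi> - \<eta>)" by (intro add_pos_nonneg) auto
  have "norm (sech_transform a ?z) * (1 + norm (\<xi> - \<eta>)) ^ k \<le>
      norm (sech_transform a ?z) * ((1 + a / 2) * (1 + norm (\<chi> i. Re (?z $ i)))) ^ k"
    by (intro mult_left_mono power_mono zeta_diff_parts) auto
  also have "\<dots> = (1 + a / 2) ^ k * (norm (sech_transform a ?z) * (1 + norm (\<chi> i. Re (?z $ i))) ^ k)"
    by (simp only: power_mult_distrib mult_ac)
  also have "\<dots> \<le> (1 + a / 2) ^ k * C" using a_pos by (intro mult_left_mono C zeta_diff_parts) auto
  finally have 1: "norm (sech_transform a ?z) \<le> (1 + a / 2) ^ k * C * inverse ((1 + norm (\<xi> - \<eta>)) ^ k)"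
    using x by (simp add: pos_le_divide_eq divide_inverse[symmetric])
  have "norm (sech_transform a ?z / csymbol m p (zeta (\<xi>, t))) =
      norm (sech_transform a ?z) * norm (inverse (csymbol m p (zeta (\<xi>, t))))"
    by (simp only: divide_inverse norm_mult)
  also have "\<dots> \<le> ((1 + a / 2) ^ k * C * inverse ((1 + norm (\<xi> - \<eta>)) ^ k)) * (inverse c * inverse (tilde m p \<xi>))"
    by (intro mult_mono 1 norm_inverse_symbol order_trans[OF norm_ge_zero 1]) auto
  finally show ?thesis by (simp only: mult_ac)
qed

lemma measurable_g [measurable]: "g \<in> borel_measurable borel"
proof -
  interpret P: sigma_finite_measure "param_space :: ((real^'n) \<times> real) measure" by (rule sigma_finite_param_space)
  have "(\<lambda>\<eta>. LINT s|param_space. sech_transform a (zeta s - cvec \<eta>) / csymbol m p (zeta s)) \<in> borel_measurable borel"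
    by (rule P.borel_measurable_lebesgue_integral) measurable
  then show ?thesis unfolding g_def[abs_def] by measurable
qed

text \<open>The decisive cancellation: the weight at \<eta> is at most G (1 + |\<xi> - \<eta>|)^m
  times the weight at \<xi>, which cancels the weight from dividing by the symbol. The m powers are
  paid by the decay of the hyperbolic secant's transform, and no quantity depending on p survives in
  the constant.\<close>

lemma tilde_g_bound:
  assumes C: "\<And>z :: complex^'n. norm (\<chi> i. Im (z $ i)) \<le> a / 2 \<Longrightarrow>
    norm (sech_transform a z) * (1 + norm (\<chi> i. Re (z $ i))) ^ (m + 2 * CARD('n)) \<le> C"
  shows "tilde m p \<eta> * norm (g \<eta>) \<le>
    inverse ((2 * pi) ^ CARD('n)) * ((1 + a / 2) ^ (m + 2 * CARD('n)) * C * inverse c * G * W)"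
proof -
  let ?k = "m + 2 * CARD('n)"
  let ?A = "(1 + a / 2) ^ ?k * C * inverse c"
  have A0: "?A \<ge> 0"
    using a_pos c_pos order_trans[OF _ C[of 0]] by (intro mult_nonneg_nonneg) (auto simp: zero_vec_def[symmetric])
  let ?F = "\<lambda>s. of_real (tilde m p \<eta>) * (sech_transform a (zeta s - cvec \<eta>) / csymbol m p (zeta s))"
  have "norm (LINT s|param_space. ?F s) \<le> (LINT \<xi>|lborel. ?A * G * inverse ((1 + norm (\<xi> + - \<eta>)) ^ (2 * CARD('n))))"
  proof (rule integrable_param_space(2))
    show "integrable lborel (\<lambda>\<xi>. ?A * G * inverse ((1 + norm (\<xi> + - \<eta>)) ^ (2 * CARD('n))))"
      by (intro integrable_mult_right lborel_integrable_shift integrable_weight)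
    fix \<xi> :: "real^'n" and t :: real
    let ?y = "1 + norm (\<xi> - \<eta>)"
    have y: "0 < ?y" by (intro add_pos_nonneg) auto
    have tl: "tilde m p \<eta> \<le> G * ?y ^ m * tilde m p \<xi>"
      using growth[of \<xi> "\<eta> - \<xi>"] by (simp add: norm_minus_commute)
    have "norm (?F (\<xi>, t)) = tilde m p \<eta> * norm (sech_transform a (zeta (\<xi>, t) - cvec \<eta>) / csymbol m p (zeta (\<xi>, t)))"
      unfolding norm_mult norm_of_real using tilde_nonneg[of m p \<eta>] by simp
    also have "\<dots> \<le> (G * ?y ^ m * tilde m p \<xi>) * (?A * (inverse (tilde m p \<xi>) * inverse (?y ^ ?k)))"
      using y G_pos tilde_pos[of \<xi>] by (intro mult_mono tl sech_integrand_bound C) auto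
    also have "\<dots> = ?A * G * (tilde m p \<xi> * inverse (tilde m p \<xi>)) * (?y ^ m * inverse (?y ^ ?k))" by (simp only: mult_ac)
    also have "tilde m p \<xi> * inverse (tilde m p \<xi>) = 1" using tilde_pos[of \<xi>] by simp
    also have "?y ^ m * inverse (?y ^ ?k) = inverse (?y ^ (2 * CARD('n)))" using y by (simp add: power_add)
    finally show "norm (?F (\<xi>, t)) \<le> ?A * G * inverse ((1 + norm (\<xi> + - \<eta>)) ^ (2 * CARD('n)))" by simp
  qed measurable
  also have "\<dots> = ?A * G * W"
    unfolding W_def using lborel_integral_shift[of "\<lambda>\<xi>. inverse ((1 + norm (\<xi>::real^'n)) ^ (2 * CARD('n)))" "- \<eta>"] by simp
  finally have b: "norm (LINT s|param_space. ?F s) \<le> ?A * G * W" .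
  have "tilde m p \<eta> * norm (g \<eta>) = inverse ((2 * pi) ^ CARD('n)) * norm (LINT s|param_space. ?F s)"
    unfolding g_def integral_mult_right_zero norm_mult norm_inverse norm_of_real using tilde_nonneg[of m p \<eta>] by (simp add: abs_mult)
  also have "\<dots> \<le> inverse ((2 * pi) ^ CARD('n)) * (?A * G * W)" using b by (intro mult_left_mono) auto
  finally show ?thesis .
qed

text \<open>Polynomial growth makes w tempered and g locally integrable. The constant contains
  1/\<open>tilde\<close>(0), which is harmless because it enters no uniform estimate.\<close>

lemma g_growth: "\<exists>D\<ge>0. \<forall>\<eta>. norm (g \<eta>) \<le> D * (1 + norm \<eta>) ^ m"
proof -
  obtain C where C: "\<And>z :: complex^'n. norm (\<chi> i. Im (z $ i)) \<le> a / 2 \<Longrightarrow>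
    norm (sech_transform a z) * (1 + norm (\<chi> i. Re (z $ i))) ^ (m + 2 * CARD('n)) \<le> C"
    using sech_transform_decay[OF a_pos, of "m + 2 * CARD('n)", where 'n = 'n] by blast
  define B where "B = inverse ((2 * pi) ^ CARD('n)) * ((1 + a / 2) ^ (m + 2 * CARD('n)) * C * inverse c * G * W)"
  have B: "tilde m p \<eta> * norm (g \<eta>) \<le> B" for \<eta> unfolding B_def by (rule tilde_g_bound[OF C])
  have B0: "B \<ge> 0" by (rule order_trans[OF mult_nonneg_nonneg[OF tilde_nonneg norm_ge_zero] B[of 0]])
  show ?thesis
  proof (intro exI[of _ "B * (G * inverse (tilde m p 0))"] conjI allI)
    show "B * (G * inverse (tilde m p 0)) \<ge> 0" using B0 G_pos tilde0 by simp
    fix \<eta>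
    have "norm (g \<eta>) = (tilde m p \<eta> * norm (g \<eta>)) * inverse (tilde m p \<eta>)" using tilde_pos[of \<eta>] by simp
    also have "\<dots> \<le> B * (G * (1 + norm \<eta>) ^ m * inverse (tilde m p 0))"
      using B0 tilde_pos[of \<eta>] by (intro mult_mono B tilde_inverse_le) auto
    finally show "norm (g \<eta>) \<le> B * (G * inverse (tilde m p 0)) * (1 + norm \<eta>) ^ m" by (simp only: mult_ac)
  qed
qed

lemma w_integrable_bound:
  "\<exists>D\<ge>0. \<forall>f\<in>schwartz. integrable lborel (\<lambda>\<eta>. g \<eta> * (inverse (of_real ((2 * pi) ^ CARD('n))) * fourier_laplace f (cvec \<eta>))) \<and>
    norm (w f) \<le> D * seminorm_S (m + 2 * CARD('n)) f"
proof -
  obtain D where D: "D \<ge> 0" "\<And>\<eta>. norm (g \<eta>) \<le> D * (1 + norm \<eta>) ^ m" using g_growth by blast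
  let ?k = "m + 2 * CARD('n)"
  have mk: "max ?k (2 * CARD('n)) = ?k" by simp
  obtain C where C: "C \<ge> 0" "\<And>f \<xi>. f \<in> schwartz \<Longrightarrow>
    norm (fourier_laplace f (cvec (\<xi> :: real^'n))) * (1 + norm \<xi>) ^ ?k \<le> C * seminorm_S ?k f"
    using schwartz_decay[of ?k, where 'n = 'n, unfolded mk] by blast
  let ?i = "inverse ((2 * pi) ^ CARD('n))"
  show ?thesis
  proof (intro exI[of _ "D * ?i * C * W"] conjI ballI)
    have "W \<ge> 0" unfolding W_def by (intro Bochner_Integration.integral_nonneg) auto
    then show "D * ?i * C * W \<ge> 0" using D C by simp
    fix f :: "'n cfun" assume f: "f \<in> schwartz"
    have [measurable]: "f \<in> borel_measurable borel"
      by (intro borel_measurable_continuous_onI smooth_imp(1) schwartz_smooth f)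
    let ?F = "\<lambda>\<eta>. g \<eta> * (inverse (of_real ((2 * pi) ^ CARD('n))) * fourier_laplace f (cvec \<eta>))"
    let ?S = "seminorm_S ?k f"
    have bd: "norm (?F \<eta>) \<le> D * ?i * C * ?S * inverse ((1 + norm \<eta>) ^ (2 * CARD('n)))" for \<eta>
    proof -
      let ?y = "1 + norm \<eta>"
      have y: "0 < ?y" by (intro add_pos_nonneg) auto
      have 1: "norm (fourier_laplace f (cvec \<eta>)) \<le> C * ?S * inverse (?y ^ ?k)"
        using C(2)[OF f, of \<eta>] y by (simp add: pos_le_divide_eq divide_inverse[symmetric])
      have "norm (?F \<eta>) = norm (g \<eta>) * (?i * norm (fourier_laplace f (cvec \<eta>)))"
        unfolding norm_mult norm_inverse norm_of_real by (simp add: abs_mult)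
      also have "\<dots> \<le> (D * ?y ^ m) * (?i * (C * ?S * inverse (?y ^ ?k)))"
        using D y by (intro mult_mono D mult_left_mono 1) auto
      also have "\<dots> = D * ?i * C * ?S * (?y ^ m * inverse (?y ^ ?k))" by (simp only: mult_ac)
      also have "?y ^ m * inverse (?y ^ ?k) = inverse (?y ^ (2 * CARD('n)))" using y by (simp add: power_add)
      finally show ?thesis .
    qed
    have i: "integrable lborel (\<lambda>\<eta>::real^'n. D * ?i * C * ?S * inverse ((1 + norm \<eta>) ^ (2 * CARD('n))))"
      by (intro integrable_mult_right integrable_weight)
    have m: "?F \<in> borel_measurable borel" by measurable
    show I: "integrable lborel ?F"
    proof (rule Bochner_Integration.integrable_bound[OF i])
      show "AE \<eta> in lborel. norm (?F \<eta>) \<le> norm (D * ?i * C * ?S * inverse ((1 + norm \<eta>) ^ (2 * CARD('n))))"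
        by (intro AE_I2 order_trans[OF bd]) (simp only: real_norm_def abs_ge_self)
    qed (use m in simp)
    have "norm (w f) \<le> (LINT \<eta>|lborel. D * ?i * C * ?S * inverse ((1 + norm (\<eta>::real^'n)) ^ (2 * CARD('n))))"
      unfolding w_def by (rule Bochner_Integration.integral_norm_bound_integral[OF I i bd])
    also have "\<dots> = D * ?i * C * W * ?S" unfolding W_def integral_mult_right_zero by (simp only: mult_ac)
    finally show "norm (w f) \<le> D * ?i * C * W * ?S" .
  qed
qed

lemma tempered_w: "tempered w"
proof -
  obtain D where D: "\<forall>f\<in>schwartz. integrable lborel (\<lambda>\<eta>. g \<eta> * (inverse (of_real ((2 * pi) ^ CARD('n))) * fourier_laplace f (cvec \<eta>))) \<and>
    norm (w f) \<le> D * seminorm_S (m + 2 * CARD('n)) f" using w_integrable_bound by blast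
  have int0: "integrable lborel (\<lambda>x. ee (cvec \<xi>) x * f x)" if "f \<in> schwartz" for f :: "'n cfun" and \<xi>
    using integrable_ee_schwartz[OF that, of \<xi> "\<lambda>_. 0"] by (simp add: pd_zero_index schwartz_smooth[OF that])
  have "w (\<lambda>x. f x + h x) = w f + w h" if "f \<in> schwartz" "h \<in> schwartz" for f h
  proof -
    have "fourier_laplace (\<lambda>x. f x + h x) (cvec \<eta>) = fourier_laplace f (cvec \<eta>) + fourier_laplace h (cvec \<eta>)" for \<eta>
      unfolding fourier_laplace_def distrib_left by (rule Bochner_Integration.integral_add) (intro int0 that)+
    then show ?thesis
      unfolding w_def using D that by (simp add: distrib_left Bochner_Integration.integral_add)
  qed
  moreover have "w (\<lambda>x. b * f x) = b * w f" for f b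
  proof -
    have "fourier_laplace (\<lambda>x. b * f x) z = b * fourier_laplace f z" for z
      unfolding fourier_laplace_def by (subst integral_mult_right_zero[symmetric]) (simp only: mult_ac)
    then show ?thesis unfolding w_def by (subst integral_mult_right_zero[symmetric]) (simp only: mult_ac)
  qed
  ultimately show ?thesis
    using D unfolding tempered_def linear_on_funs_def by blast
qed

text \<open>The inverse transform inside w returns f from \<open>fourier f\<close>, which leaves the
  integral of g f.\<close>

lemma is_fourier_fun_w: "is_fourier_fun w g"
  unfolding is_fourier_fun_def
proof (intro conjI allI impI ballI)
  show "g \<in> borel_measurable lebesgue" by (intro measurable_completion) simp
  fix K :: "(real^'n) set" assume K: "compact K"
  obtain D where D: "D \<ge> 0" "\<And>\<eta>. norm (g \<eta>) \<le> D * (1 + norm \<eta>) ^ m" using g_growth by blast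
  have "integrable lborel (\<lambda>x. indicator K x *\<^sub>R g x)"
  proof (rule Bochner_Integration.integrable_bound)
    show "integrable lborel (\<lambda>x. indicator K x *\<^sub>R (D * (1 + norm x) ^ m))"
      by (intro borel_integrable_compact K continuous_intros)
    show "(\<lambda>x. indicator K x *\<^sub>R g x) \<in> borel_measurable lborel"
      using K by (intro borel_measurable_scaleR borel_measurable_indicator) (auto simp: compact_imp_closed)
    show "AE x in lborel. norm (indicator K x *\<^sub>R g x) \<le> norm (indicator K x *\<^sub>R (D * (1 + norm x) ^ m))"
      using D by (intro AE_I2) (auto simp: indicator_def intro: order_trans[OF _ abs_ge_self])
  qed
  then show "set_integrable lebesgue K g" unfolding set_integrable_def by (rule integrable_completion[THEN iffD2, rotated]) (use K in \<open>auto intro!: borel_measurable_scaleR borel_measurable_indicator simp: compact_imp_closed\<close>)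
next
  fix f :: "'n cfun" assume "f \<in> test_funs"
  then obtain K where f: "f \<in> test_on K" "compact K" unfolding test_funs_def by blast
  have [measurable]: "f \<in> borel_measurable borel" by (rule test_on_borel[OF f(1)])
  have e: "inverse (of_real ((2 * pi) ^ CARD('n))) * fourier_laplace (fourier f) (cvec \<eta>) = f \<eta>" for \<eta>
  proof -
    have "fourier_laplace (fourier f) (cvec \<eta>) = (LINT \<xi>|lborel. ee (cvec \<xi>) \<eta> * fourier f \<xi>)"
      unfolding fourier_laplace_def by (simp add: ee_cvec inner_commute)
    also have "\<dots> = of_real ((2 * pi) ^ CARD('n)) * f \<eta>" by (rule fourier_inversion_test[OF f])
    finally show ?thesis by (simp only:) (subst mult.assoc[symmetric], subst left_inverse, auto)
  qed
  have "w (fourier f) = (LINT \<eta>|lborel. g \<eta> * f \<eta>)" unfolding w_def e ..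
  also have "\<dots> = (LINT \<eta>|lebesgue. g \<eta> * f \<eta>)" by (rule integral_completion[symmetric]) measurable
  finally show "w (fourier f) = (LINT \<eta>|lebesgue. g \<eta> * f \<eta>)" .
qed

text \<open>\<open>B_norm\<close> selects some Fourier function of w. Agreement with g almost
  everywhere transfers the explicit bound to the selected one.\<close>

lemma fourier_fun_unique:
  assumes "is_fourier_fun w h"
  shows "AE x in lebesgue. h x = g x"
proof -
  note gh = assms[unfolded is_fourier_fun_def] is_fourier_fun_w[unfolded is_fourier_fun_def]
  have test: "integrable lebesgue (\<lambda>x. k x * f x)"
    if f: "f \<in> test_on K" "compact K" and k: "set_integrable lebesgue K k" for f k :: "'n cfun" and K
  proof -
    obtain M where M: "\<And>x. norm (f x) \<le> M" using test_bounded[OF f] by blast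
    have i1: "integrable lebesgue (\<lambda>x. M *\<^sub>R (indicator K x *\<^sub>R k x))"
      using k unfolding set_integrable_def by (intro integrable_scaleR_right)
    have eq: "(\<lambda>x. k x * f x) = (\<lambda>x. (indicator K x *\<^sub>R k x) * f x)"
      using f(1) by (auto simp: fun_eq_iff indicator_def test_on_def)
    have m1: "(\<lambda>x. k x * f x) \<in> borel_measurable lebesgue"
      unfolding eq
      by (rule borel_measurable_times[OF borel_measurable_integrable[OF k[unfolded set_integrable_def]] measurable_completion])
         (simp add: test_on_borel[OF f(1)])
    have "0 \<le> M" by (rule order_trans[OF norm_ge_zero M])
    then have "AE x in lebesgue. norm (k x * f x) \<le> norm (M *\<^sub>R (indicator K x *\<^sub>R k x))"
      using M f(1) by (intro AE_I2) (auto simp: norm_mult indicator_def test_on_def mult.commute[of M] intro!: mult_left_mono)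
    then show ?thesis by (rule Bochner_Integration.integrable_bound[OF i1 m1])
  qed
  have "AE x in lebesgue. h x - g x = 0"
  proof (rule set_lebesgue_AE_zero)
    show "(\<lambda>x. h x - g x) \<in> borel_measurable lebesgue" using gh by (intro borel_measurable_diff) auto
    show "set_integrable lebesgue K (\<lambda>x. h x - g x)" if "compact K" for K
      using gh that by (intro set_integral_diff(1)) auto
    fix f :: "'n cfun" assume ft: "f \<in> test_funs"
    then obtain K where f: "f \<in> test_on K" "compact K" unfolding test_funs_def by blast
    have "(LINT x|lebesgue. (h x - g x) * f x) = (LINT x|lebesgue. h x * f x) - (LINT x|lebesgue. g x * f x)"
      unfolding left_diff_distrib
      by (rule Bochner_Integration.integral_diff) (use gh f in \<open>auto intro: test\<close>)
    also have "\<dots> = 0" using gh ft by simp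
    finally show "(LINT x|lebesgue. (h x - g x) * f x) = 0" .
  qed
  then show ?thesis by simp
qed

text \<open>The convolution theorem in the form needed here: exchanging the integrals and inverting
  in \<eta> shows that convolving the two transforms corresponds to multiplying the
  functions.\<close>

lemma inner_sech_integral:
  fixes f :: "'n cfun" and z :: "complex^'n"
  assumes f: "f \<in> test_on K" "compact K" and z: "norm (\<chi> i. Im (z $ i)) \<le> a / 2"
  shows "(LINT \<eta>|lborel. sech_transform a (z - cvec \<eta>) * (inverse (of_real ((2 * pi) ^ CARD('n))) * fourier_laplace f (cvec \<eta>))) =
    fourier_laplace (\<lambda>x. of_real (1 / cosh (a * norm x)) * f x) z"
proof -
  let ?i = "inverse (of_real ((2 * pi) ^ CARD('n))) :: complex"
  let ?s = "\<lambda>x::real^'n. of_real (1 / cosh (a * norm x)) :: complex"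
  have [measurable]: "f \<in> borel_measurable borel" by (rule test_on_borel[OF f(1)])
  have [measurable]: "?s \<in> borel_measurable borel" unfolding cosh_field_def by measurable
  have m: "(\<lambda>y. ee (z - cvec (snd y)) (fst y) * ?s (fst y) * (?i * fourier_laplace f (cvec (snd y)))) \<in> borel_measurable (lborel \<Otimes>\<^sub>M lborel)"
    by measurable
  have split: "ee (z - cvec \<eta>) x = ee z x * ee (cvec (- \<eta>)) x" for \<eta> x
    using ee_add[of z "cvec (- \<eta>)" x] by (simp add: cvec_minus)
  have I: "integrable (lborel \<Otimes>\<^sub>M lborel) (\<lambda>y. ee (z - cvec (snd y)) (fst y) * ?s (fst y) * (?i * fourier_laplace f (cvec (snd y))))"
  proof (rule integrable_pair_bound[OF pair_sigma_finite_lborel m, where g = "\<lambda>x. norm (ee z x * ?s x)" and h = "\<lambda>\<eta>. norm (?i * fourier_laplace f (cvec \<eta>))"])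
    show "integrable lborel (\<lambda>x. norm (ee z x * ?s x))" by (intro integrable_norm integrable_ee_sech a_pos z)
    show "integrable lborel (\<lambda>\<eta>. norm (?i * fourier_laplace f (cvec \<eta>)))"
      by (intro integrable_norm integrable_mult_right fourier_laplace_test_integrable[OF f])
    show "norm (ee (z - cvec (snd (x, \<eta>))) (fst (x, \<eta>)) * ?s (fst (x, \<eta>)) * (?i * fourier_laplace f (cvec (snd (x, \<eta>))))) \<le>
        norm (ee z x * ?s x) * norm (?i * fourier_laplace f (cvec \<eta>))" for x \<eta>
      unfolding split fst_conv snd_conv norm_mult by simp
  qed
  have "(LINT \<eta>|lborel. sech_transform a (z - cvec \<eta>) * (?i * fourier_laplace f (cvec \<eta>))) =
      (LINT \<eta>|lborel. LINT x|lborel. ee (z - cvec \<eta>) x * ?s x * (?i * fourier_laplace f (cvec \<eta>)))"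
    unfolding sech_transform_def integral_mult_left_zero ..
  also have "\<dots> = (LINT x|lborel. LINT \<eta>|lborel. ee (z - cvec \<eta>) x * ?s x * (?i * fourier_laplace f (cvec \<eta>)))"
    by (rule pair_sigma_finite.Fubini_integral[OF pair_sigma_finite_lborel]) (use I in \<open>simp only: case_prod_unfold\<close>)
  also have "\<dots> = (LINT x|lborel. ee z x * (?s x * f x))"
  proof (rule Bochner_Integration.integral_cong[OF refl])
    fix x
    have "(LINT \<eta>|lborel. ee (z - cvec \<eta>) x * ?s x * (?i * fourier_laplace f (cvec \<eta>))) =
        (LINT \<eta>|lborel. (ee z x * ?s x * ?i) * (ee (cvec (- \<eta>)) x * fourier_laplace f (cvec \<eta>)))"
      unfolding split by (simp only: mult_ac)
    also have "\<dots> = (ee z x * ?s x * ?i) * (LINT \<eta>|lborel. ee (cvec (- \<eta>)) x * fourier_laplace f (cvec \<eta>))"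
      by (rule integral_mult_right_zero)
    also have "(LINT \<eta>|lborel. ee (cvec (- \<eta>)) x * fourier_laplace f (cvec \<eta>)) =
        (LINT \<eta>|lborel. ee (cvec (- (- \<eta>))) x * fourier_laplace f (cvec (- \<eta>)))"
      by (rule lborel_integral_reflect[symmetric]) measurable
    also have "\<dots> = (LINT \<eta>|lborel. ee (cvec \<eta>) x * fourier f \<eta>)" by (simp add: fourier_eq)
    also have "\<dots> = of_real ((2 * pi) ^ CARD('n)) * f x" by (rule fourier_inversion_test[OF f])
    also have "(ee z x * ?s x * ?i) * (of_real ((2 * pi) ^ CARD('n)) * f x) = ee z x * (?s x * f x) * (?i * of_real ((2 * pi) ^ CARD('n)))"
      by (simp only: mult_ac)
    also have "?i * of_real ((2 * pi) ^ CARD('n)) = 1" by (rule left_inverse) simp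
    finally show "(LINT \<eta>|lborel. ee (z - cvec \<eta>) x * ?s x * (?i * fourier_laplace f (cvec \<eta>))) = ee z x * (?s x * f x)" by simp
  qed
  finally show ?thesis unfolding fourier_laplace_def .
qed

lemma w_extends: "extends_dist w (mult_dist (\<lambda>x. 1 / cosh (a * norm x)) E)"
  unfolding extends_dist_def mult_dist_def
proof
  fix f :: "'n cfun" assume ft: "f \<in> test_funs"
  then obtain K where f: "f \<in> test_on K" "compact K" unfolding test_funs_def by blast
  have [measurable]: "f \<in> borel_measurable borel" by (rule test_on_borel[OF f(1)])
  let ?i = "inverse (of_real ((2 * pi) ^ CARD('n))) :: complex"
  let ?k = "m + 2 * CARD('n)"
  let ?T = "\<lambda>s \<eta>. sech_transform a (zeta s - cvec \<eta>) / csymbol m p (zeta s) * (?i * fourier_laplace f (cvec \<eta>))"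
  obtain C where C: "C > 0" "\<And>z :: complex^'n. norm (\<chi> i. Im (z $ i)) \<le> a / 2 \<Longrightarrow>
    norm (sech_transform a z) * (1 + norm (\<chi> i. Re (z $ i))) ^ ?k \<le> C"
    using sech_transform_decay[OF a_pos, of ?k, where 'n = 'n] by blast
  have fs: "f \<in> schwartz" using ft test_funs_subset_schwartz by blast
  \<comment> \<open>Of these powers, ?k are given up below when \<xi> and \<eta> are separated, and
    2n remain for the integral over \<eta>.\<close>
  obtain C' where C': "\<And>\<xi>. norm (fourier_laplace f (cvec \<xi>)) * (1 + norm \<xi>) ^ (?k + 2 * CARD('n)) \<le> C'"
    using schwartz_decay[of "?k + 2 * CARD('n)", where 'n = 'n] fs by blast
  interpret P: sigma_finite_measure "param_space :: ((real^'n) \<times> real) measure" by (rule sigma_finite_param_space)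
  have ps: "pair_sigma_finite (param_space :: ((real^'n) \<times> real) measure) (lborel :: (real^'n) measure)"
    by (intro pair_sigma_finite.intro sigma_finite_param_space lborel.sigma_finite_measure_axioms)
  define A where "A = (1 + a / 2) ^ ?k * C * inverse c * (G * inverse (tilde m p 0))"
  have m: "(\<lambda>y. ?T (fst y) (snd y)) \<in> borel_measurable (param_space \<Otimes>\<^sub>M lborel)" by measurable
  have I: "integrable (param_space \<Otimes>\<^sub>M lborel) (\<lambda>y. ?T (fst y) (snd y))"
  proof (rule integrable_pair_bound[OF ps m, where g = "\<lambda>s. A * inverse ((1 + norm (fst s)) ^ (2 * CARD('n)))" and
        h = "\<lambda>\<eta>. norm ?i * C' * inverse ((1 + norm \<eta>) ^ (2 * CARD('n)))"])
    show "integrable lborel (\<lambda>\<eta>::real^'n. norm ?i * C' * inverse ((1 + norm \<eta>) ^ (2 * CARD('n))))"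
      by (intro integrable_mult_right integrable_weight)
    have "integrable param_space (\<lambda>s. complex_of_real (inverse ((1 + norm (fst s :: real^'n)) ^ (2 * CARD('n)))))"
      by (rule integrable_param_space(1)[OF _ integrable_weight]) (measurable, simp only: fst_conv norm_of_real, simp)
    then have "integrable param_space (\<lambda>s. Re (complex_of_real (inverse ((1 + norm (fst s :: real^'n)) ^ (2 * CARD('n))))))"
      by (rule integrable_Re)
    then show "integrable param_space (\<lambda>s. A * inverse ((1 + norm (fst s :: real^'n)) ^ (2 * CARD('n))))"
      unfolding Re_complex_of_real by (intro integrable_mult_right)
    fix s :: "(real^'n) \<times> real" and \<eta> :: "real^'n"
    obtain \<xi> t where s: "s = (\<xi>, t)" by (cases s)
    let ?x = "1 + norm \<xi>" and ?y = "1 + norm \<eta>" and ?d = "1 + norm (\<xi> - \<eta>)"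
    have pos: "0 < ?x" "0 < ?y" "0 < ?d" by (intro add_pos_nonneg; simp)+
    \<comment> \<open>Peetre's inequality. It trades decay in \<xi> - \<eta> for decay in \<xi> and
      growth in \<eta>, so the integrand is dominated by a product of functions of one variable
      each.\<close>
    have "?x \<le> ?d * ?y"
    proof -
      have "?d * ?y = 1 + norm \<eta> + norm (\<xi> - \<eta>) + norm \<eta> * norm (\<xi> - \<eta>)" by (simp add: algebra_simps)
      moreover have "0 \<le> norm \<eta> * norm (\<xi> - \<eta>)" by (rule mult_nonneg_nonneg) auto
      moreover have "norm \<xi> \<le> norm (\<xi> - \<eta>) + norm \<eta>" using norm_triangle_ineq[of "\<xi> - \<eta>" \<eta>] by simp
      ultimately show ?thesis by linarith
    qed
    then have "?x ^ ?k \<le> ?d ^ ?k * ?y ^ ?k" using pos unfolding power_mult_distrib[symmetric] by (intro power_mono) auto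
    then have d: "inverse (?d ^ ?k) \<le> inverse (?x ^ ?k) * ?y ^ ?k" using pos by (simp add: field_simps)
    have 1: "norm (sech_transform a (zeta s - cvec \<eta>) / csymbol m p (zeta s)) \<le> A * inverse (?x ^ (2 * CARD('n))) * ?y ^ ?k"
    proof -
      have "norm (sech_transform a (zeta s - cvec \<eta>) / csymbol m p (zeta s)) \<le>
          (1 + a / 2) ^ ?k * C * inverse c * (inverse (tilde m p \<xi>) * inverse (?d ^ ?k))"
        unfolding s by (rule sech_integrand_bound[OF C(2)])
      also have "\<dots> \<le> (1 + a / 2) ^ ?k * C * inverse c * ((G * ?x ^ m * inverse (tilde m p 0)) * (inverse (?x ^ ?k) * ?y ^ ?k))"
        using a_pos c_pos C(1) G_pos tilde0 pos by (intro mult_left_mono mult_mono tilde_inverse_le d) auto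
      also have "\<dots> = A * (?x ^ m * inverse (?x ^ ?k)) * ?y ^ ?k" unfolding A_def by (simp only: mult_ac)
      also have "?x ^ m * inverse (?x ^ ?k) = inverse (?x ^ (2 * CARD('n)))" using pos by (simp add: power_add)
      finally show ?thesis .
    qed
    have 2: "norm (fourier_laplace f (cvec \<eta>)) \<le> C' * inverse (?y ^ (?k + 2 * CARD('n)))"
      using C'[of \<eta>] pos by (simp add: pos_le_divide_eq divide_inverse[symmetric])
    have "norm (?T s \<eta>) = norm (sech_transform a (zeta s - cvec \<eta>) / csymbol m p (zeta s)) * (norm ?i * norm (fourier_laplace f (cvec \<eta>)))"
      unfolding norm_mult ..
    also have "\<dots> \<le> (A * inverse (?x ^ (2 * CARD('n))) * ?y ^ ?k) * (norm ?i * (C' * inverse (?y ^ (?k + 2 * CARD('n)))))"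
      by (intro mult_mono 1 mult_left_mono 2 order_trans[OF norm_ge_zero 1]) auto
    also have "\<dots> = A * inverse (?x ^ (2 * CARD('n))) * (norm ?i * C' * (?y ^ ?k * inverse (?y ^ (?k + 2 * CARD('n)))))" by (simp only: mult_ac)
    also have "?y ^ ?k * inverse (?y ^ (?k + 2 * CARD('n))) = inverse (?y ^ (2 * CARD('n)))"
      by (rule power_mult_inverse_power[OF pos(2)])
    finally show "norm (?T (fst (s, \<eta>)) (snd (s, \<eta>))) \<le> A * inverse ((1 + norm (fst s)) ^ (2 * CARD('n))) * (norm ?i * C' * inverse (?y ^ (2 * CARD('n))))"
      by (simp only: fst_conv snd_conv s)
  qed
  have "w f = (LINT \<eta>|lborel. ?i * (LINT s|param_space. ?T s \<eta>))"
    unfolding w_def g_def integral_mult_left_zero by (simp only: mult.assoc)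
  also have "\<dots> = ?i * (LINT \<eta>|lborel. LINT s|param_space. ?T s \<eta>)" by (rule integral_mult_right_zero)
  also have "(LINT \<eta>|lborel. LINT s|param_space. ?T s \<eta>) = (LINT s|param_space. LINT \<eta>|lborel. ?T s \<eta>)"
    by (rule pair_sigma_finite.Fubini_integral[OF ps]) (use I in \<open>simp only: case_prod_unfold\<close>)
  also have "\<dots> = (LINT s|param_space. fourier_laplace (\<lambda>x. of_real (1 / cosh (a * norm x)) * f x) (zeta s) / csymbol m p (zeta s))"
  proof (rule Bochner_Integration.integral_cong[OF refl])
    fix s :: "(real^'n) \<times> real"
    obtain \<xi> t where s: "s = (\<xi>, t)" by (cases s)
    have "(LINT \<eta>|lborel. ?T s \<eta>) = (LINT \<eta>|lborel. inverse (csymbol m p (zeta s)) *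
        (sech_transform a (zeta s - cvec \<eta>) * (?i * fourier_laplace f (cvec \<eta>))))"
      by (simp only: divide_inverse mult_ac)
    also have "\<dots> = inverse (csymbol m p (zeta s)) * (LINT \<eta>|lborel. sech_transform a (zeta s - cvec \<eta>) * (?i * fourier_laplace f (cvec \<eta>)))"
      by (rule integral_mult_right_zero)
    also have "(LINT \<eta>|lborel. sech_transform a (zeta s - cvec \<eta>) * (?i * fourier_laplace f (cvec \<eta>))) =
        fourier_laplace (\<lambda>x. of_real (1 / cosh (a * norm x)) * f x) (zeta s)"
      by (rule inner_sech_integral[OF f]) (simp only: s zeta_parts)
    finally show "(LINT \<eta>|lborel. ?T s \<eta>) = fourier_laplace (\<lambda>x. of_real (1 / cosh (a * norm x)) * f x) (zeta s) / csymbol m p (zeta s)"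
      by (simp only: divide_inverse mult_ac)
  qed
  finally show "w f = E (\<lambda>x. complex_of_real (1 / cosh (a * norm x)) * f x)" unfolding E_def .
qed

end

section \<open>Estimates uniform in the polynomial\<close>

context symbol_division
begin

text \<open>The quotient by \<open>tilde m p 0\<close> is set apart: with the other constants chosen
  for all polynomials of degree at most m, it is what has to be controlled along a net.\<close>

lemma E_test_bound:
  assumes D: "\<forall>f\<in>test_on K. \<forall>z. norm (\<chi> i. Im (z $ i)) \<le> a / 2 \<longrightarrow>
      norm (fourier_laplace f z) * (1 + norm z) ^ (m + 2 * CARD('n)) \<le> D * seminorm_C K (m + 2 * CARD('n)) f"
    and f: "f \<in> test_on K"
  shows "norm (E f) \<le> (inverse ((2 * pi) ^ CARD('n)) * ((1 + a / 2) ^ (m + 2 * CARD('n)) * D * inverse c * G *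
      (LINT x|lborel. inverse ((1 + norm (x::real^'n)) ^ (2 * CARD('n)))))) / tilde m p 0 * seminorm_C K (m + 2 * CARD('n)) f"
proof -
  have "norm (E f) \<le> inverse ((2 * pi) ^ CARD('n)) * ((1 + a / 2) ^ (m + 2 * CARD('n)) *
      (D * seminorm_C K (m + 2 * CARD('n)) f) * inverse c * G * inverse (tilde m p 0) * W)"
    using D f by (intro E_integrable_bound(2)[OF test_on_borel[OF f]]) auto
  then show ?thesis unfolding W_def by (simp only: divide_inverse mult_ac)
qed

text \<open>One factor (2 pi)^-n belongs to the definition of the norm, the other to g.\<close>

lemma B_norm_w:
  assumes C: "\<And>z :: complex^'n. norm (\<chi> i. Im (z $ i)) \<le> a / 2 \<Longrightarrow>
    norm (sech_transform a z) * (1 + norm (\<chi> i. Re (z $ i))) ^ (m + 2 * CARD('n)) \<le> C"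
  shows "B_norm \<infinity> (tilde m p) w \<le> ennreal ((2 * pi) powr (- real CARD('n)) *
    (inverse ((2 * pi) ^ CARD('n)) * ((1 + a / 2) ^ (m + 2 * CARD('n)) * C * inverse c * G *
      (LINT x|lborel. inverse ((1 + norm (x::real^'n)) ^ (2 * CARD('n)))))))"
proof -
  let ?B = "inverse ((2 * pi) ^ CARD('n)) * ((1 + a / 2) ^ (m + 2 * CARD('n)) * C * inverse c * G * W)"
  define h where "h = (SOME g. is_fourier_fun w g)"
  have h: "is_fourier_fun w h" unfolding h_def by (rule someI[of "is_fourier_fun w", OF is_fourier_fun_w])
  have hm: "h \<in> borel_measurable lebesgue" using h unfolding is_fourier_fun_def by blast
  have tm: "(\<lambda>\<xi>. complex_of_real (tilde m p \<xi>)) \<in> borel_measurable lebesgue"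
    using borel_measurable_continuous_onI[OF continuous_on_of_real[OF continuous_on_tilde]] by (intro measurable_completion) simp
  have "esssup lebesgue (\<lambda>\<xi>. ennreal (norm (of_real (tilde m p \<xi>) * h \<xi>))) \<le> ennreal ?B"
  proof (rule esssup_I)
    show "(\<lambda>\<xi>. ennreal (norm (of_real (tilde m p \<xi>) * h \<xi>))) \<in> borel_measurable lebesgue"
      using borel_measurable_times[OF tm hm] by measurable
    show "AE \<xi> in lebesgue. ennreal (norm (of_real (tilde m p \<xi>) * h \<xi>)) \<le> ennreal ?B"
      using fourier_fun_unique[OF h]
    proof eventually_elim
      case (elim \<xi>)
      have "norm (of_real (tilde m p \<xi>) * h \<xi>) = tilde m p \<xi> * norm (g \<xi>)"
        unfolding elim norm_mult norm_of_real using tilde_nonneg[of m p \<xi>] by simp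
      then show ?case using tilde_g_bound[OF C, of \<xi>] by (intro ennreal_leI) simp
    qed
  qed
  then have "B_norm \<infinity> (tilde m p) w \<le> ennreal ((2 * pi) powr (- real CARD('n))) * ennreal ?B"
    unfolding B_norm_def Lp_norm_def h_def[symmetric] by (simp add: mult_left_mono)
  also have "\<dots> = ennreal ((2 * pi) powr (- real CARD('n)) * ?B)"
    by (rule ennreal_mult'[symmetric]) simp
  finally show ?thesis unfolding W_def .
qed

lemma w_in_B_space: "w \<in> B_space \<infinity> (tilde m p)"
proof -
  obtain C where C: "\<And>z :: complex^'n. norm (\<chi> i. Im (z $ i)) \<le> a / 2 \<Longrightarrow>
    norm (sech_transform a z) * (1 + norm (\<chi> i. Re (z $ i))) ^ (m + 2 * CARD('n)) \<le> C"
    using sech_transform_decay[OF a_pos, of "m + 2 * CARD('n)", where 'n = 'n] by blast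
  have "B_norm \<infinity> (tilde m p) w < \<infinity>" by (rule le_less_trans[OF B_norm_w[OF C]]) simp_all
  then show ?thesis using tempered_w is_fourier_fun_w unfolding B_space_def by blast
qed

lemma E_linear: "linear_on_funs test_funs E"
proof -
  have "E (\<lambda>x. f x + h x) = E f + E h" if "f \<in> test_funs" "h \<in> test_funs" for f h
    using that E_add unfolding test_funs_def by blast
  then show ?thesis unfolding linear_on_funs_def using E_cmult by blast
qed

end

lemma zero_tilde:
  fixes p :: "('n::finite \<Rightarrow> nat) \<Rightarrow> complex"
  assumes "tilde m p 0 = 0" shows "tilde m p x = 0"
proof -
  obtain G where "G > 0" "\<And>(p :: ('n \<Rightarrow> nat) \<Rightarrow> complex) x y. tilde m p (x + y) \<le> G * (1 + norm y) ^ m * tilde m p x"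
    using tilde_growth[of m, where 'n = 'n] by blast
  from this(2)[of p 0 x] show ?thesis using assms tilde_nonneg[of m p x] by simp
qed

lemma zero_in_B_space:
  assumes "\<And>x. tilde m p x = 0"
  shows "(\<lambda>_. 0) \<in> B_space \<infinity> (tilde m p)" "B_norm \<infinity> (tilde m p) (\<lambda>_. 0) = 0"
proof -
  have "esssup lebesgue (\<lambda>x::real^'a. 0::ennreal) \<le> 0" by (rule esssup_I) auto
  then show B: "B_norm \<infinity> (tilde m p) (\<lambda>_. 0) = 0"
    unfolding B_norm_def Lp_norm_def assms by simp
  have "tempered (\<lambda>_ :: 'a cfun. 0)"
    unfolding tempered_def linear_on_funs_def by (auto intro!: exI[of _ 0])
  moreover have "is_fourier_fun (\<lambda>_ :: 'a cfun. 0) (\<lambda>_. 0)"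
    unfolding is_fourier_fun_def by (auto simp: set_integrable_def)
  ultimately show "(\<lambda>_. 0) \<in> B_space \<infinity> (tilde m p)" unfolding B_space_def using B by auto
qed

text \<open>The order of quantifiers is the point: C0 and CK are fixed before p, so one choice of
  constants serves all members of every net.\<close>

lemma uniform_fundamental_kernel:
  fixes a :: real
  assumes a: "a > 0"
  shows "\<exists>C0 (CK :: (real^'n::finite) set \<Rightarrow> real). \<forall>p. \<exists>E w.
     linear_on_funs test_funs E \<and>
     (\<forall>K f. compact K \<longrightarrow> f \<in> test_on K \<longrightarrow>
        norm (E f) \<le> CK K / tilde m p 0 * seminorm_C K (m + 2 * CARD('n)) f) \<and>
     (tilde m p 0 > 0 \<longrightarrow> (\<forall>f\<in>test_funs. E (transpose_symbol m p f) = f 0)) \<and>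
     w \<in> B_space \<infinity> (tilde m p) \<and> extends_dist w (mult_dist (\<lambda>x. 1 / cosh (a * norm x)) E) \<and>
     B_norm \<infinity> (tilde m p) w \<le> ennreal C0"
proof -
  let ?k = "m + 2 * CARD('n)"
  obtain c where c: "c > 0" "\<forall>p. \<exists>v :: real^'n \<Rightarrow> real^'n. v \<in> borel_measurable borel \<and> (\<forall>x. norm (v x) \<le> a / 2) \<and>
    (\<forall>x w. norm w = 1 \<longrightarrow> c * tilde m p x \<le> norm (csymbol m p (cvec x + (\<chi> i. w * of_real (v x $ i)))))"
    using symbol_lower_bound_selection[of "a / 2" m, where 'n = 'n] a by auto
  obtain G where G: "G > 0" "\<And>(p :: ('n \<Rightarrow> nat) \<Rightarrow> complex) x y. tilde m p (x + y) \<le> G * (1 + norm y) ^ m * tilde m p x"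
    using tilde_growth[of m, where 'n = 'n] by blast
  obtain C where C: "\<And>z :: complex^'n. norm (\<chi> i. Im (z $ i)) \<le> a / 2 \<Longrightarrow>
    norm (sech_transform a z) * (1 + norm (\<chi> i. Re (z $ i))) ^ ?k \<le> C"
    using sech_transform_decay[OF a, of ?k, where 'n = 'n] by blast
  have "\<forall>K :: (real^'n) set. \<exists>D. compact K \<longrightarrow> (\<forall>f\<in>test_on K. \<forall>z. norm (\<chi> i. Im (z $ i)) \<le> a / 2 \<longrightarrow>
      norm (fourier_laplace f z) * (1 + norm z) ^ ?k \<le> D * seminorm_C K ?k f)"
    using test_decay[of _ "a / 2" ?k] by blast
  then obtain D where D: "\<And>K :: (real^'n) set. compact K \<Longrightarrow> \<forall>f\<in>test_on K. \<forall>z. norm (\<chi> i. Im (z $ i)) \<le> a / 2 \<longrightarrow>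
      norm (fourier_laplace f z) * (1 + norm z) ^ ?k \<le> D K * seminorm_C K ?k f" by metis
  let ?W = "LINT x|lborel. inverse ((1 + norm (x::real^'n)) ^ (2 * CARD('n)))"
  define CK where "CK K = inverse ((2 * pi) ^ CARD('n)) * ((1 + a / 2) ^ ?k * D K * inverse c * G * ?W)" for K
  define C0 where "C0 = (2 * pi) powr (- real CARD('n)) * (inverse ((2 * pi) ^ CARD('n)) * ((1 + a / 2) ^ ?k * C * inverse c * G * ?W))"
  show ?thesis
  proof (intro exI[of _ C0] exI[of _ CK] allI)
    fix p :: "('n \<Rightarrow> nat) \<Rightarrow> complex"
    show "\<exists>E w. linear_on_funs test_funs E \<and>
     (\<forall>K f. compact K \<longrightarrow> f \<in> test_on K \<longrightarrow>
        norm (E f) \<le> CK K / tilde m p 0 * seminorm_C K ?k f) \<and>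
     (tilde m p 0 > 0 \<longrightarrow> (\<forall>f\<in>test_funs. E (transpose_symbol m p f) = f 0)) \<and>
     w \<in> B_space \<infinity> (tilde m p) \<and> extends_dist w (mult_dist (\<lambda>x. 1 / cosh (a * norm x)) E) \<and>
     B_norm \<infinity> (tilde m p) w \<le> ennreal C0" (is "\<exists>E w. ?P E w")
    proof (cases "tilde m p 0 > 0")
      case True
      obtain v :: "real^'n \<Rightarrow> real^'n" where v: "v \<in> borel_measurable borel" "\<And>x. norm (v x) \<le> a / 2"
        "\<And>x w. norm w = 1 \<Longrightarrow> c * tilde m p x \<le> norm (csymbol m p (cvec x + (\<chi> i. w * of_real (v x $ i))))"
        using c(2) by blast
      interpret symbol_division m p v a c G
        by unfold_locales (use a c(1) G v True in \<open>simp_all add: shiftv_def\<close>)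
      have "norm (E f) \<le> CK K / tilde m p 0 * seminorm_C K ?k f" if "compact K" "f \<in> test_on K" for K f
        unfolding CK_def by (rule E_test_bound[OF D[OF that(1)] that(2)])
      moreover have "\<forall>f\<in>test_funs. E (transpose_symbol m p f) = f 0"
        using E_fundamental unfolding test_funs_def by blast
      moreover have "B_norm \<infinity> (tilde m p) w \<le> ennreal C0" unfolding C0_def by (rule B_norm_w[OF C])
      ultimately have "?P E w" using E_linear w_in_B_space w_extends by blast
      then show ?thesis by blast
    next
      case False
      then have "tilde m p 0 = 0" using tilde_nonneg[of m p 0] by linarith
      then have z: "tilde m p x = 0" for x by (rule zero_tilde)
      \<comment> \<open>If the weight vanishes at 0, it vanishes everywhere, and the zero kernel is
        taken. The quotient by 0 is 0, so the estimate reads 0 \<le> 0, and the weighted norm is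
        0.\<close>
      have "?P (\<lambda>_. 0) (\<lambda>_. 0)"
        using zero_in_B_space[OF z]
        by (auto simp: linear_on_funs_def extends_dist_def mult_dist_def z)
      then show ?thesis by (intro exI)
    qed
  qed
qed

section \<open>Representatives of generalized numbers and functions\<close>

lemma seminorm_C_mono_set:
  assumes "compact L" "smooth u" "K \<subseteq> L" "i \<le> j"
  shows "seminorm_C K i u \<le> seminorm_C L j u"
  using assms by (intro seminorm_C_least seminorm_C_nonneg) (auto intro!: seminorm_C_upper)

lemma seminorm_C_mult_bound:
  fixes h :: "'n::finite cfun"
  assumes h: "smooth h" and K: "compact K"
  shows "\<exists>C\<ge>0. \<forall>u. smooth u \<longrightarrow> seminorm_C K j (\<lambda>x. h x * u x) \<le> C * seminorm_C K j u"
proof -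
  obtain C where C: "C \<ge> 0" "\<And>\<alpha> u (x::real^'n). mi_deg \<alpha> \<le> j \<Longrightarrow> smooth u \<Longrightarrow> x \<in> K \<Longrightarrow>
    norm (pd \<alpha> (\<lambda>x. h x * u x) x) \<le> C * seminorm_C {x} j u"
    using pd_mult_bound[OF h K, of j] by blast
  have "seminorm_C K j (\<lambda>x. h x * u x) \<le> C * seminorm_C K j u" if u: "smooth u" for u
  proof (rule seminorm_C_least)
    show "0 \<le> C * seminorm_C K j u" using C(1) seminorm_C_nonneg[OF K u] by simp
    fix x :: "real^'n" and \<alpha> :: "'n \<Rightarrow> nat" assume "x \<in> K" "mi_deg \<alpha> \<le> j"
    then show "norm (pd \<alpha> (\<lambda>x. h x * u x) x) \<le> C * seminorm_C K j u"
      by (intro order_trans[OF C(2)] mult_left_mono C(1) seminorm_C_mono_set K u) auto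
  qed
  with C(1) show ?thesis by blast
qed

lemma sup_on_pd_le_seminorm:
  assumes "compact K" "smooth u" shows "sup_on K (pd \<alpha> u) \<le> seminorm_C K (mi_deg \<alpha>) u"
  using assms by (intro sup_on_least seminorm_C_nonneg) (auto intro: seminorm_C_upper)

lemma O_eps_cmult: "O_eps b f \<Longrightarrow> O_eps b (\<lambda>\<epsilon>. C * f \<epsilon>)"
  using O_eps_mult[OF O_eps_const[of C]] by simp

lemma O_eps_le_unit:
  assumes "O_eps b g" "\<And>\<epsilon>. \<epsilon> \<in> {0<..1} \<Longrightarrow> \<bar>f \<epsilon>\<bar> \<le> g \<epsilon>"
  shows "O_eps b f"
  using assms(1) by (rule O_eps_le) (use eventually_unit assms(2) in \<open>auto elim: eventually_mono\<close>)

lemma O_eps_seminorm: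
  assumes "compact K" "net_smooth u" "\<And>\<alpha>. mi_deg \<alpha> \<le> j \<Longrightarrow> O_eps b (\<lambda>\<epsilon>. sup_on K (pd \<alpha> (u \<epsilon>)))"
  shows "O_eps b (\<lambda>\<epsilon>. seminorm_C K j (u \<epsilon>))"
proof (rule O_eps_le_unit)
  show "O_eps b (\<lambda>\<epsilon>. \<Sum>\<alpha> | mi_deg \<alpha> \<le> j. sup_on K (pd \<alpha> (u \<epsilon>)))"
    using assms(3) by (intro O_eps_sum) simp
  show "\<bar>seminorm_C K j (u \<epsilon>)\<bar> \<le> (\<Sum>\<alpha> | mi_deg \<alpha> \<le> j. sup_on K (pd \<alpha> (u \<epsilon>)))" if "\<epsilon> \<in> {0<..1}" for \<epsilon>
    using seminorm_C_le_sum[OF assms(1) net_smoothD[OF assms(2) that], of j]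
      seminorm_C_nonneg[OF assms(1) net_smoothD[OF assms(2) that], of j] by linarith
qed

lemma moderate_seminorm:
  fixes u :: "real \<Rightarrow> 'a::finite cfun"
  assumes K: "compact K" and u: "net_moderate u"
  shows "\<exists>N::nat. O_eps (- real N) (\<lambda>\<epsilon>. seminorm_C K j (u \<epsilon>))"
proof -
  have "\<forall>\<alpha>. \<exists>N::nat. O_eps (- real N) (\<lambda>\<epsilon>. sup_on K (pd \<alpha> (u \<epsilon>)))"
    using u K unfolding net_moderate_def by blast
  then obtain M where M: "\<And>\<alpha>. O_eps (- real (M \<alpha>)) (\<lambda>\<epsilon>. sup_on K (pd \<alpha> (u \<epsilon>)))" by metis
  define L where "L = (\<Sum>\<alpha> | mi_deg \<alpha> \<le> j. M \<alpha>)"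
  have "O_eps (- real L) (\<lambda>\<epsilon>. seminorm_C K j (u \<epsilon>))"
  proof (rule O_eps_seminorm[OF K net_moderate_smooth[OF u]])
    fix \<alpha> :: "'a \<Rightarrow> nat" assume "mi_deg \<alpha> \<le> j"
    then have "M \<alpha> \<le> L" unfolding L_def by (intro member_le_sum finite_mi) auto
    then show "O_eps (- real L) (\<lambda>\<epsilon>. sup_on K (pd \<alpha> (u \<epsilon>)))"
      using O_eps_mono[OF M[of \<alpha>], of "- real L"] by simp
  qed
  then show ?thesis by blast
qed

lemma negl_seminorm:
  assumes "net_smooth u" "net_negl_on V u" "compact K" "K \<subseteq> V"
  shows "O_eps (real q) (\<lambda>\<epsilon>. seminorm_C K j (u \<epsilon>))"
  using assms by (intro O_eps_seminorm) (auto simp: net_negl_on_def)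

lemma net_smooth_mult:
  "smooth h \<Longrightarrow> net_smooth u \<Longrightarrow> net_smooth (\<lambda>\<epsilon> x. h x * u \<epsilon> x)"
  by (simp add: net_smooth_def smooth_mult)

lemma O_eps_sup_mult:
  assumes h: "smooth h" and K: "compact K" and u: "net_smooth u"
    and O: "O_eps b (\<lambda>\<epsilon>. seminorm_C K (mi_deg \<alpha>) (u \<epsilon>))"
  shows "O_eps b (\<lambda>\<epsilon>. sup_on K (pd \<alpha> (\<lambda>x. h x * u \<epsilon> x)))"
proof -
  obtain C where C: "\<And>u. smooth u \<Longrightarrow> seminorm_C K (mi_deg \<alpha>) (\<lambda>x. h x * u x) \<le> C * seminorm_C K (mi_deg \<alpha>) u"
    using seminorm_C_mult_bound[OF h K, of "mi_deg \<alpha>"] by blast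
  show ?thesis
  proof (rule O_eps_le_unit[OF O_eps_cmult[OF O, of C]])
    fix \<epsilon> :: real assume e: "\<epsilon> \<in> {0<..1}"
    note s = net_smoothD[OF u e]
    have "0 \<le> sup_on K (pd \<alpha> (\<lambda>x. h x * u \<epsilon> x))" by (intro sup_on_nonneg K smooth_pd smooth_mult h s)
    then show "\<bar>sup_on K (pd \<alpha> (\<lambda>x. h x * u \<epsilon> x))\<bar> \<le> C * seminorm_C K (mi_deg \<alpha>) (u \<epsilon>)"
      using sup_on_pd_le_seminorm[OF K smooth_mult[OF h s], of \<alpha>] C[OF s] by linarith
  qed
qed

lemma net_moderate_mult:
  fixes u :: "real \<Rightarrow> 'a::finite cfun"
  assumes h: "smooth h" and u: "net_moderate u"
  shows "net_moderate (\<lambda>\<epsilon> x. h x * u \<epsilon> x)"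
  unfolding net_moderate_def
proof (intro conjI allI impI)
  show "net_smooth (\<lambda>\<epsilon> x. h x * u \<epsilon> x)" by (intro net_smooth_mult h net_moderate_smooth u)
  fix K :: "(real^'a) set" and \<alpha> :: "'a \<Rightarrow> nat" assume K: "compact K"
  obtain N :: nat where "O_eps (- real N) (\<lambda>\<epsilon>. seminorm_C K (mi_deg \<alpha>) (u \<epsilon>))"
    using moderate_seminorm[OF K u] by blast
  then show "\<exists>N::nat. O_eps (- real N) (\<lambda>\<epsilon>. sup_on K (pd \<alpha> (\<lambda>x. h x * u \<epsilon> x)))"
    using O_eps_sup_mult[OF h K net_moderate_smooth[OF u]] by blast
qed

lemma colombeau_eq_refl: "net_moderate u \<Longrightarrow> colombeau_eq u u"
  by (simp add: colombeau_eq_def)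

lemma abs_colombeau_eq_iff:
  assumes "net_moderate u" "net_moderate v"
  shows "abs_colombeau u = abs_colombeau v \<longleftrightarrow> net_negl_on UNIV (\<lambda>\<epsilon> x. u \<epsilon> x - v \<epsilon> x)"
  using Quotient3_rel[OF Quotient3_colombeau, of u v] assms by (auto simp: colombeau_eq_def)

lemma rep_colombeau: "net_moderate (rep_colombeau u)" "abs_colombeau (rep_colombeau u) = u"
  using Quotient3_rep_reflp[OF Quotient3_colombeau, of u] Quotient3_abs_rep[OF Quotient3_colombeau, of u]
  by (auto simp: colombeau_eq_def)

lemma abs_gen_eq_iff:
  assumes "moderate r" "moderate s"
  shows "abs_gen r = abs_gen s \<longleftrightarrow> negl (\<lambda>\<epsilon>. r \<epsilon> - s \<epsilon>)"
  using Quotient3_rel[OF Quotient3_gen, of r s] assms by (auto simp: gen_eq_def)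

lemma rep_gen: "moderate (rep_gen r)" "abs_gen (rep_gen r) = r"
  using Quotient3_rep_reflp[OF Quotient3_gen, of r] Quotient3_abs_rep[OF Quotient3_gen, of r]
  by (auto simp: gen_eq_def)

lemma gen_eq_refl: "moderate r \<Longrightarrow> gen_eq r r"
  by (simp add: gen_eq_def)

lemma is_rep_add: "is_rep r a \<Longrightarrow> is_rep s b \<Longrightarrow> is_rep (\<lambda>\<epsilon>. r \<epsilon> + s \<epsilon>) (a + b)"
  unfolding is_rep_def using plus_gen.abs_eq[of r s] by (auto simp: moderate_add gen_eq_refl)

lemma is_rep_mult: "is_rep r a \<Longrightarrow> is_rep s b \<Longrightarrow> is_rep (\<lambda>\<epsilon>. r \<epsilon> * s \<epsilon>) (a * b)"
  unfolding is_rep_def using times_gen.abs_eq[of r s] by (auto simp: moderate_mult gen_eq_refl)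

lemma is_rep_const: "is_rep (\<lambda>_. c) (gen_const c)"
  unfolding is_rep_def gen_const_def by simp

lemma is_rep_minus_one_power: "is_rep (\<lambda>_. (- 1) ^ k) ((- 1) ^ k)"
proof (induction k)
  case 0
  show ?case unfolding is_rep_def by (simp add: one_gen_def)
next
  case (Suc k)
  have "is_rep (\<lambda>_. - 1) (- 1 :: 'a gen)"
    unfolding is_rep_def using uminus_gen.abs_eq[of "\<lambda>_. 1 :: 'a"] by (simp add: one_gen_def gen_eq_refl)
  from is_rep_mult[OF this Suc] show ?case by simp
qed

lemma is_crep_add: "is_crep u a \<Longrightarrow> is_crep v b \<Longrightarrow> is_crep (\<lambda>\<epsilon> x. u \<epsilon> x + v \<epsilon> x) (a + b)"
  unfolding is_crep_def using plus_colombeau.abs_eq[of u v] by (auto simp: net_moderate_add colombeau_eq_refl)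

lemma is_crep_0: "is_crep (\<lambda>_ _. 0) 0"
  unfolding is_crep_def by (simp add: zero_colombeau_def)

lemma is_crep_scale: "is_rep r a \<Longrightarrow> is_crep u b \<Longrightarrow> is_crep (\<lambda>\<epsilon> x. r \<epsilon> * u \<epsilon> x) (a *\<^sub>G b)"
  unfolding is_crep_def is_rep_def using gscale.abs_eq[of r u]
  by (auto simp: net_moderate_cmult colombeau_eq_refl gen_eq_refl)

lemma is_crep_pd: "is_crep u a \<Longrightarrow> is_crep (\<lambda>\<epsilon>. pd \<alpha> (u \<epsilon>)) (gpd \<alpha> a)"
  unfolding is_crep_def using gpd.abs_eq[of u \<alpha>] by (auto simp: net_moderate_pd colombeau_eq_refl)

lemma is_crep_sum:
  "finite I \<Longrightarrow> (\<And>i. i \<in> I \<Longrightarrow> is_crep (u i) (a i)) \<Longrightarrow> is_crep (\<lambda>\<epsilon> x. \<Sum>i\<in>I. u i \<epsilon> x) (\<Sum>i\<in>I. a i)"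
  by (induction I rule: finite_induct) (auto intro: is_crep_add is_crep_0)

section \<open>Supports and compactly supported representatives\<close>

lemma vanishes_on_abs: "net_moderate u \<Longrightarrow> vanishes_on V (abs_colombeau u) \<longleftrightarrow> net_negl_on V u"
  by (rule vanishes_on.abs_eq) (rule colombeau_eq_refl)

lemma closed_gsupp: "closed (gsupp u)"
  unfolding gsupp_def by (intro closed_Compl open_Union) auto

text \<open>The complement of the support is a union of open sets on which u vanishes. A compact set
  in that union need not lie in one of them, so it is covered by finitely many balls, each inside
  one, and the suprema are added.\<close>

lemma net_negl_off_gsupp:
  assumes u: "is_crep u_net u"
  shows "net_negl_on (- gsupp u) u_net"
  unfolding net_negl_on_def
proof (intro allI impI)
  fix L :: "(real^'a) set" and \<alpha> and q :: nat assume L: "compact L" "L \<subseteq> - gsupp u"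
  have m: "net_moderate u_net" and s: "net_smooth u_net" using u by (auto simp: is_crep_def net_moderate_smooth)
  have "\<exists>e>0. net_negl_on (cball x e) u_net" if x: "x \<in> L" for x
  proof -
    have "x \<in> \<Union>{V. open V \<and> vanishes_on V u}" using x L(2) unfolding gsupp_def by auto
    then obtain V where V: "open V" "vanishes_on V u" "x \<in> V" by blast
    have "net_negl_on V u_net" using V(2) u vanishes_on_abs[OF m, of V] unfolding is_crep_def by simp
    moreover obtain e where "e > 0" "cball x e \<subseteq> V" using V by (meson open_contains_cball)
    ultimately show ?thesis unfolding net_negl_on_def by (meson order_trans)
  qed
  then obtain e where e: "\<And>x. x \<in> L \<Longrightarrow> e x > 0" "\<And>x. x \<in> L \<Longrightarrow> net_negl_on (cball x (e x)) u_net" by metis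
  have "L \<subseteq> (\<Union>x\<in>L. ball x (e x))" using e(1) by auto
  from compactE_image[OF L(1) _ this] obtain T where T: "T \<subseteq> L" "finite T" "L \<subseteq> (\<Union>x\<in>T. ball x (e x))" by auto
  have c: "compact (L \<inter> cball x (e x))" for x using L(1) by (intro compact_Int_closed) auto
  show "O_eps (real q) (\<lambda>\<epsilon>. sup_on L (pd \<alpha> (u_net \<epsilon>)))"
  proof (rule O_eps_le_unit)
    show "O_eps (real q) (\<lambda>\<epsilon>. \<Sum>x\<in>T. sup_on (L \<inter> cball x (e x)) (pd \<alpha> (u_net \<epsilon>)))"
    proof (intro O_eps_sum)
      fix x assume "x \<in> T"
      then have "net_negl_on (cball x (e x)) u_net" using T(1) e(2) by blast
      then show "O_eps (real q) (\<lambda>\<epsilon>. sup_on (L \<inter> cball x (e x)) (pd \<alpha> (u_net \<epsilon>)))"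
        using c[of x] unfolding net_negl_on_def by blast
    qed
    fix \<epsilon> :: real assume eps: "\<epsilon> \<in> {0<..1}"
    have sm: "smooth (pd \<alpha> (u_net \<epsilon>))" by (intro smooth_pd net_smoothD[OF s eps])
    have nn: "0 \<le> sup_on (L \<inter> cball x (e x)) (pd \<alpha> (u_net \<epsilon>))" for x by (rule sup_on_nonneg[OF c sm])
    have "sup_on L (pd \<alpha> (u_net \<epsilon>)) \<le> (\<Sum>x\<in>T. sup_on (L \<inter> cball x (e x)) (pd \<alpha> (u_net \<epsilon>)))"
    proof (rule sup_on_least)
      show "0 \<le> (\<Sum>x\<in>T. sup_on (L \<inter> cball x (e x)) (pd \<alpha> (u_net \<epsilon>)))" by (intro sum_nonneg nn)
      fix y assume y: "y \<in> L"
      then obtain x where x: "x \<in> T" "y \<in> ball x (e x)" using T(3) by blast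
      then have "y \<in> L \<inter> cball x (e x)" using y by auto
      then have "norm (pd \<alpha> (u_net \<epsilon>) y) \<le> sup_on (L \<inter> cball x (e x)) (pd \<alpha> (u_net \<epsilon>))" by (rule sup_on_upper[OF c sm])
      also have "\<dots> \<le> (\<Sum>x\<in>T. sup_on (L \<inter> cball x (e x)) (pd \<alpha> (u_net \<epsilon>)))"
        by (rule member_le_sum[OF x(1)]) (use nn T(2) in auto)
      finally show "norm (pd \<alpha> (u_net \<epsilon>) y) \<le> (\<Sum>x\<in>T. sup_on (L \<inter> cball x (e x)) (pd \<alpha> (u_net \<epsilon>)))" .
    qed
    then show "\<bar>sup_on L (pd \<alpha> (u_net \<epsilon>))\<bar> \<le> (\<Sum>x\<in>T. sup_on (L \<inter> cball x (e x)) (pd \<alpha> (u_net \<epsilon>)))"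
      using sup_on_nonneg[OF L(1) sm] by linarith
  qed
qed

text \<open>The difference (h - 1) u is 0 on V together with all derivatives, and off V the net u is
  negligible; a compact L is therefore reduced to L - V.\<close>

lemma is_crep_cutoff:
  assumes u: "is_crep u_net u" and h: "smooth (\<lambda>x. complex_of_real (h x))"
    and V: "open V" "gsupp u \<subseteq> V" "\<And>x. x \<in> V \<Longrightarrow> h x = 1"
  shows "is_crep (\<lambda>\<epsilon> x. of_real (h x) * u_net \<epsilon> x) u"
proof -
  have m: "net_moderate u_net" and s: "net_smooth u_net" using u by (auto simp: is_crep_def net_moderate_smooth)
  have mh: "net_moderate (\<lambda>\<epsilon> x. of_real (h x) * u_net \<epsilon> x)" by (rule net_moderate_mult[OF h m])
  let ?k = "\<lambda>x. complex_of_real (h x) - 1"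
  have k: "smooth ?k" by (intro smooth_diff h smooth_const)
  have "net_negl_on UNIV (\<lambda>\<epsilon> x. ?k x * u_net \<epsilon> x)"
    unfolding net_negl_on_def
  proof (intro allI impI)
    fix L :: "(real^'a) set" and \<alpha> and q :: nat assume L: "compact L"
    have cL: "compact (L - V)" using L V(1) by (rule compact_diff)
    have sub: "L - V \<subseteq> - gsupp u" using V(2) by blast
    have O: "O_eps (real q) (\<lambda>\<epsilon>. sup_on (L - V) (pd \<alpha> (\<lambda>x. ?k x * u_net \<epsilon> x)))"
      by (rule O_eps_sup_mult[OF k cL s negl_seminorm[OF s net_negl_off_gsupp[OF u] cL sub]])
    show "O_eps (real q) (\<lambda>\<epsilon>. sup_on L (pd \<alpha> (\<lambda>x. ?k x * u_net \<epsilon> x)))"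
    proof (rule O_eps_le_unit[OF O])
      fix \<epsilon> :: real assume e: "\<epsilon> \<in> {0<..1}"
      have sm: "smooth (pd \<alpha> (\<lambda>x. ?k x * u_net \<epsilon> x))" by (intro smooth_pd smooth_mult k net_smoothD[OF s e])
      have "sup_on L (pd \<alpha> (\<lambda>x. ?k x * u_net \<epsilon> x)) \<le> sup_on (L - V) (pd \<alpha> (\<lambda>x. ?k x * u_net \<epsilon> x))"
      proof (rule sup_on_least[OF sup_on_nonneg[OF cL sm]])
        fix x assume x: "x \<in> L"
        show "norm (pd \<alpha> (\<lambda>x. ?k x * u_net \<epsilon> x) x) \<le> sup_on (L - V) (pd \<alpha> (\<lambda>x. ?k x * u_net \<epsilon> x))"
        proof (cases "x \<in> V")
          case True
          have "pd \<alpha> (\<lambda>x. ?k x * u_net \<epsilon> x) x = 0"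
            by (rule pd_zero_open[OF V(1) _ True]) (simp add: V(3))
          then show ?thesis using sup_on_nonneg[OF cL sm] by simp
        next
          case False then show ?thesis using x by (intro sup_on_upper[OF cL sm]) simp
        qed
      qed
      then show "\<bar>sup_on L (pd \<alpha> (\<lambda>x. ?k x * u_net \<epsilon> x))\<bar> \<le> sup_on (L - V) (pd \<alpha> (\<lambda>x. ?k x * u_net \<epsilon> x))"
        using sup_on_nonneg[OF L sm] by linarith
    qed
  qed
  then have "net_negl_on UNIV (\<lambda>\<epsilon> x. of_real (h x) * u_net \<epsilon> x - u_net \<epsilon> x)" by (simp add: algebra_simps)
  then have "abs_colombeau (\<lambda>\<epsilon> x. of_real (h x) * u_net \<epsilon> x) = abs_colombeau u_net"
    by (subst abs_colombeau_eq_iff[OF mh m])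
  then show ?thesis using u mh unfolding is_crep_def by simp
qed

lemma compact_nbhd1:
  assumes "compact K" shows "compact (nbhd1 K)"
proof -
  have "nbhd1 K = {x + y | x y. x \<in> K \<and> y \<in> cball (0::real^'a) 1}"
  proof (intro set_eqI iffI)
    fix x assume "x \<in> nbhd1 K"
    then obtain y where "y \<in> K" "dist x y \<le> 1" unfolding nbhd1_def by blast
    then show "x \<in> {x + y | x y. x \<in> K \<and> y \<in> cball 0 1}"
      by (intro CollectI) (rule exI[of _ y], rule exI[of _ "x - y"], auto simp: dist_norm norm_minus_commute)
  next
    fix x assume "x \<in> {x + y | x y. x \<in> K \<and> y \<in> cball (0::real^'a) 1}"
    then obtain k y where "x = k + y" "k \<in> K" "norm y \<le> 1" by auto
    then show "x \<in> nbhd1 K" unfolding nbhd1_def by (intro CollectI bexI[of _ k]) (simp_all add: dist_norm)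
  qed
  then show ?thesis using compact_sums[OF assms compact_cball[of 0 1]] by simp
qed

text \<open>The cutoff extends to \<open>nbhd1 K\<close>, the set in \<open>val_C\<close>. Seminorms
  of the cut-off net are thus controlled by those defining the topology, which the continuity proof
  exploits.\<close>

lemma crep_c_in_nbhd1:
  assumes K: "compact K" "gsupp u \<subseteq> K"
  shows "\<exists>h. smooth h \<and> is_crep_c (\<lambda>\<epsilon> x. h x * rep_colombeau u \<epsilon> x) u \<and>
    (\<forall>\<epsilon>\<in>{0<..1}. (\<lambda>x. h x * rep_colombeau u \<epsilon> x) \<in> test_on (nbhd1 K))"
proof -
  obtain b V where b: "smooth (\<lambda>x. complex_of_real (b x))" "open V" "K \<subseteq> V" "\<And>x. x \<in> V \<Longrightarrow> b x = 1"
    "\<And>x. b x \<noteq> 0 \<Longrightarrow> \<exists>y\<in>K. dist x y < 1"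
    using smooth_cutoff[OF K(1), of 1] by (metis zero_less_one)
  have r: "is_crep (rep_colombeau u) u" unfolding is_crep_def using rep_colombeau by blast
  have supp: "b x = 0" if "x \<notin> nbhd1 K" for x
    using that b(5)[of x] unfolding nbhd1_def by force
  have "is_crep (\<lambda>\<epsilon> x. of_real (b x) * rep_colombeau u \<epsilon> x) u"
    by (rule is_crep_cutoff[OF r b(1,2)]) (use K b(3,4) in auto)
  then have "is_crep_c (\<lambda>\<epsilon> x. of_real (b x) * rep_colombeau u \<epsilon> x) u"
    unfolding is_crep_c_def using compact_nbhd1[OF K(1)] supp by (auto intro!: exI[of _ "nbhd1 K"])
  moreover have "(\<lambda>x. of_real (b x) * rep_colombeau u \<epsilon> x) \<in> test_on (nbhd1 K)" if "\<epsilon> \<in> {0<..1}" for \<epsilon>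
    unfolding test_on_def
    using smooth_mult[OF b(1) net_smoothD[OF net_moderate_smooth[OF rep_colombeau(1)] that]] supp by auto
  ultimately show ?thesis using b(1) by (intro exI[of _ "\<lambda>x. of_real (b x)"]) auto
qed

lemma Gc_iff_crep_c: "u \<in> Gc \<longleftrightarrow> (\<exists>u_net. is_crep_c u_net u)"
proof
  assume "u \<in> Gc"
  then have "compact (gsupp u)" by (simp add: Gc_def)
  from crep_c_in_nbhd1[OF this order_refl] show "\<exists>u_net. is_crep_c u_net u" by blast
next
  assume "\<exists>u_net. is_crep_c u_net u"
  then obtain u_net K where u: "is_crep u_net u" "compact K" "\<And>\<epsilon> x. \<epsilon> \<in> {0<..1} \<Longrightarrow> x \<notin> K \<Longrightarrow> u_net \<epsilon> x = 0"
    unfolding is_crep_c_def by blast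
  have o: "open (- K)" using u(2) by (simp add: compact_imp_closed open_Compl)
  have "net_negl_on (- K) u_net"
    unfolding net_negl_on_def
  proof (intro allI impI)
    fix L :: "(real^'a) set" and \<alpha> and q :: nat assume L: "compact L" "L \<subseteq> - K"
    show "O_eps (real q) (\<lambda>\<epsilon>. sup_on L (pd \<alpha> (u_net \<epsilon>)))"
    proof (rule O_eps_le_unit[OF O_eps_0])
      fix \<epsilon> :: real assume e: "\<epsilon> \<in> {0<..1}"
      have "pd \<alpha> (u_net \<epsilon>) x = 0" if "x \<in> L" for x
        by (rule pd_zero_open[OF o]) (use u(3)[OF e] L(2) that in auto)
      then have "sup_on L (pd \<alpha> (u_net \<epsilon>)) \<le> 0" by (intro sup_on_least) auto
      moreover have "0 \<le> sup_on L (pd \<alpha> (u_net \<epsilon>))"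
        using u(1) by (intro sup_on_nonneg L smooth_pd net_smoothD[OF _ e] net_moderate_smooth) (simp add: is_crep_def)
      ultimately show "\<bar>sup_on L (pd \<alpha> (u_net \<epsilon>))\<bar> \<le> 0" by simp
    qed
  qed
  then have "vanishes_on (- K) u" using u(1) vanishes_on_abs[of u_net] unfolding is_crep_def by auto
  then have "gsupp u \<subseteq> K" unfolding gsupp_def using o by blast
  then have "compact (gsupp u)" using u(2) closed_gsupp by (metis compact_Int_closed inf.absorb_iff2)
  then show "u \<in> Gc" by (simp add: Gc_def)
qed

section \<open>Functionals on the Colombeau algebra\<close>

lemma is_rep_cong_ev:
  assumes r: "is_rep r a" and e: "eventually (\<lambda>\<epsilon>. r \<epsilon> = s \<epsilon>) (at_right 0)"
  shows "is_rep s a"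
proof -
  have O: "O_eps b (\<lambda>\<epsilon>. norm (s \<epsilon>))" if "O_eps b (\<lambda>\<epsilon>. norm (r \<epsilon>))" for b
    using that by (rule O_eps_le) (use e in \<open>auto elim: eventually_mono\<close>)
  have ms: "moderate s" using r O unfolding is_rep_def moderate_def by blast
  have "negl (\<lambda>\<epsilon>. s \<epsilon> - r \<epsilon>)"
    unfolding negl_def
  proof
    fix q :: nat
    show "O_eps (real q) (\<lambda>\<epsilon>. norm (s \<epsilon> - r \<epsilon>))"
      by (rule O_eps_le[OF O_eps_0]) (use e in \<open>auto elim: eventually_mono\<close>)
  qed
  then show ?thesis using ms r abs_gen_eq_iff[OF ms, of r] unfolding is_rep_def by simp
qed

lemma is_rep_cong_unit: "is_rep r a \<Longrightarrow> (\<And>\<epsilon>. \<epsilon> \<in> {0<..1} \<Longrightarrow> r \<epsilon> = s \<epsilon>) \<Longrightarrow> is_rep s a"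
  by (erule is_rep_cong_ev) (use eventually_unit in \<open>auto elim: eventually_mono\<close>)

lemma gen_val_rep: "is_rep r a \<Longrightarrow> gen_val a = valuation (\<lambda>\<epsilon>. norm (r \<epsilon>))"
  unfolding is_rep_def using gen_val.abs_eq[of r] by (auto simp: gen_eq_refl)

lemma is_rep_rep_gen: "is_rep (rep_gen a) a"
  unfolding is_rep_def using rep_gen by blast

text \<open>Valuations add under multiplication, and a scalar of norm at most 1 has valuation at
  least 0. The supremum in a valuation need not be attained, hence the intermediate exponent b'
  strictly between b and the valuation of s.\<close>

lemma gen_norm_mult_le:
  assumes "gen_norm r \<le> 1"
  shows "gen_norm (r * s) \<le> gen_norm s"
proof -
  have r0: "0 \<le> gen_val r"
    using assms gen_val_neq_MInf[of r] unfolding gen_norm_def exp_neg_def by (cases "gen_val r") auto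
  have "gen_val s \<le> gen_val (r * s)"
  proof (rule dense_le)
    fix y assume y: "y < gen_val s"
    show "y \<le> gen_val (r * s)"
    proof (cases y)
      case (real b)
      obtain y' where y': "y < y'" "y' < gen_val s" using dense[OF y] by blast
      then obtain b' where b': "y' = ereal b'" using real by (cases y') auto
      have "O_eps b' (\<lambda>\<epsilon>. norm (rep_gen s \<epsilon>))"
        using y'(2) unfolding b' gen_val_rep[OF is_rep_rep_gen] by (rule O_eps_less_valuation)
      moreover have "ereal (- (b' - b)) < 0" using y'(1) b' real by simp
      then have "ereal (- (b' - b)) < valuation (\<lambda>\<epsilon>. norm (rep_gen r \<epsilon>))"
        using r0 unfolding gen_val_rep[OF is_rep_rep_gen] by (rule less_le_trans)
      then have "O_eps (- (b' - b)) (\<lambda>\<epsilon>. norm (rep_gen r \<epsilon>))" by (rule O_eps_less_valuation)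
      ultimately have "O_eps (- (b' - b) + b') (\<lambda>\<epsilon>. norm (rep_gen r \<epsilon>) * norm (rep_gen s \<epsilon>))"
        by (rule O_eps_mult[rotated])
      then have "O_eps b (\<lambda>\<epsilon>. norm (rep_gen r \<epsilon> * rep_gen s \<epsilon>))" by (simp add: norm_mult)
      then show ?thesis
        unfolding real gen_val_rep[OF is_rep_mult[OF is_rep_rep_gen is_rep_rep_gen]] by (rule valuation_ge)
    qed (use y in auto)
  qed
  then show ?thesis unfolding gen_norm_def by (rule exp_neg_antimono) (rule gen_val_neq_MInf)
qed

lemma test_on_test_funs: "f \<in> test_on K \<Longrightarrow> compact K \<Longrightarrow> f \<in> test_funs"
  unfolding test_funs_def by blast

lemma is_crep_c_test:
  assumes "is_crep_c u_net u"
  obtains K where "compact K" "\<And>\<epsilon>. \<epsilon> \<in> {0<..1} \<Longrightarrow> u_net \<epsilon> \<in> test_on K" "net_moderate u_net"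
proof -
  obtain K where "compact K" "\<And>\<epsilon> x. \<epsilon> \<in> {0<..1} \<Longrightarrow> x \<notin> K \<Longrightarrow> u_net \<epsilon> x = 0" "net_moderate u_net"
    using assms unfolding is_crep_c_def is_crep_def by blast
  then show ?thesis using net_smoothD[OF net_moderate_smooth] by (intro that[of K]) (auto simp: test_on_def)
qed

lemma is_crep_c_add:
  assumes "is_crep_c u a" "is_crep_c v b" shows "is_crep_c (\<lambda>\<epsilon> x. u \<epsilon> x + v \<epsilon> x) (a + b)"
proof -
  obtain K L where "compact K" "\<And>\<epsilon> x. \<epsilon> \<in> {0<..1} \<Longrightarrow> x \<notin> K \<Longrightarrow> u \<epsilon> x = 0"
    "compact L" "\<And>\<epsilon> x. \<epsilon> \<in> {0<..1} \<Longrightarrow> x \<notin> L \<Longrightarrow> v \<epsilon> x = 0"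
    using assms unfolding is_crep_c_def by blast
  note K = this
  have "\<forall>\<epsilon>\<in>{0<..1}. \<forall>x. x \<notin> K \<union> L \<longrightarrow> u \<epsilon> x + v \<epsilon> x = 0"
    using K(2,4) by simp
  moreover have "is_crep (\<lambda>\<epsilon> x. u \<epsilon> x + v \<epsilon> x) (a + b)"
    using assms unfolding is_crep_c_def by (intro is_crep_add) simp_all
  ultimately show ?thesis
    unfolding is_crep_c_def using compact_Un[OF K(1,3)] by blast
qed

lemma is_crep_c_scale:
  assumes "is_rep r a" "is_crep_c u b" shows "is_crep_c (\<lambda>\<epsilon> x. r \<epsilon> * u \<epsilon> x) (a *\<^sub>G b)"
proof -
  obtain K where "compact K" "\<And>\<epsilon> x. \<epsilon> \<in> {0<..1} \<Longrightarrow> x \<notin> K \<Longrightarrow> u \<epsilon> x = 0"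
    using assms(2) unfolding is_crep_c_def by blast
  then show ?thesis using assms is_crep_scale unfolding is_crep_c_def
    by (auto intro!: exI[of _ K])
qed

lemma Gc_add: "u \<in> Gc \<Longrightarrow> v \<in> Gc \<Longrightarrow> u + v \<in> Gc"
  unfolding Gc_iff_crep_c using is_crep_c_add by blast

lemma Gc_scale: "u \<in> Gc \<Longrightarrow> r *\<^sub>G u \<in> Gc"
  unfolding Gc_iff_crep_c using is_crep_c_scale[OF is_rep_rep_gen] by blast

lemma Gc_nbhd0_Gc: "Gc_nbhd0 Gc"
  unfolding Gc_nbhd0_def
  by (auto simp: Gc_add Gc_scale Gc_on_def intro!: exI[of _ "{}"] exI[of _ 1])

lemma topspace_Gc: "topspace Gc_topology = (Gc :: 'n::finite colombeau set)"
proof -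
  have o: "openin Gc_topology W \<longleftrightarrow> Gc_open W" for W :: "'n colombeau set"
    unfolding Gc_topology_def by (simp add: istopology_Gc_open topology_inverse')
  have "Gc_open (Gc :: 'n colombeau set)"
    unfolding Gc_open_def
    by (intro conjI ballI exI[of _ Gc] Gc_nbhd0_Gc image_subsetI Gc_add subset_refl)
  then show ?thesis unfolding topspace_def o by (auto simp: Gc_open_def)
qed

lemma openin_Gc: "openin Gc_topology W \<longleftrightarrow> Gc_open W"
  unfolding Gc_topology_def by (simp add: istopology_Gc_open topology_inverse')

text \<open>The estimate of a basic net in terms of orders of growth: applying it costs N powers of
  \<epsilon>, whatever net on K is inserted. Moderateness, independence of the representative and
  continuity all follow from this.\<close>

lemma basic_net_estimate:
  assumes E: "basic_net E" and K: "compact K"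
  shows "\<exists>j N :: nat. \<forall>w b. (\<forall>\<epsilon>\<in>{0<..1}. w \<epsilon> \<in> test_on K) \<longrightarrow>
    O_eps b (\<lambda>\<epsilon>. seminorm_C K j (w \<epsilon>)) \<longrightarrow> O_eps (b - real N) (\<lambda>\<epsilon>. norm (E \<epsilon> (w \<epsilon>)))"
proof -
  obtain j N :: nat and c \<eta> where *: "c > 0" "\<eta> \<in> {0<..1}"
    and "\<forall>f\<in>test_on K. \<forall>\<epsilon>\<in>{0<..\<eta>}. norm (E \<epsilon> f) \<le> c * \<epsilon> powr (- real N) * seminorm_C K j f"
    using E[unfolded basic_net_def, THEN conjunct2, THEN spec, THEN mp, OF K] by metis
  then have bound: "norm (E \<epsilon> f) \<le> c * \<epsilon> powr (- real N) * seminorm_C K j f"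
    if "f \<in> test_on K" "\<epsilon> \<in> {0<..\<eta>}" for f \<epsilon> using that by simp
  show ?thesis
  proof (rule exI[of _ j], rule exI[of _ N], intro allI impI)
    fix w b assume w: "\<forall>\<epsilon>\<in>{0<..1}. w \<epsilon> \<in> test_on K" and O: "O_eps b (\<lambda>\<epsilon>. seminorm_C K j (w \<epsilon>))"
    have "O_eps (- real N) (\<lambda>\<epsilon>. c * \<epsilon> powr (- real N))" by (rule O_eps_cmult) simp
    from O_eps_mult[OF this O] have "O_eps (b - real N) (\<lambda>\<epsilon>. c * \<epsilon> powr (- real N) * seminorm_C K j (w \<epsilon>))"
      by (simp add: algebra_simps)
    then show "O_eps (b - real N) (\<lambda>\<epsilon>. norm (E \<epsilon> (w \<epsilon>)))"
    proof (rule O_eps_le)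
      have "eventually (\<lambda>\<epsilon>::real. \<epsilon> \<in> {0<..\<eta>}) (at_right 0)"
        by (rule eventually_at_rightI[of 0 \<eta>]) (use *(2) in auto)
      then show "\<forall>\<^sub>F \<epsilon> in at_right 0. \<bar>norm (E \<epsilon> (w \<epsilon>))\<bar> \<le> c * \<epsilon> powr (- real N) * seminorm_C K j (w \<epsilon>)"
      proof eventually_elim
        case (elim \<epsilon>)
        then have "w \<epsilon> \<in> test_on K" using w *(2) by auto
        then show ?case using bound[OF _ elim] by simp
      qed
    qed
  qed
qed

lemma basic_net_linear:
  assumes E: "basic_net E" and e: "\<epsilon> \<in> {0<..1}" and f: "f \<in> test_funs" "h \<in> test_funs"
  shows "E \<epsilon> (\<lambda>x. f x + h x) = E \<epsilon> f + E \<epsilon> h" "E \<epsilon> (\<lambda>x. b * f x) = b * E \<epsilon> f"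
  using assms unfolding basic_net_def distribution_def linear_on_funs_def by blast+

lemma basic_net_moderate:
  assumes E: "basic_net E" and u: "is_crep_c u_net u"
  shows "moderate (\<lambda>\<epsilon>. E \<epsilon> (u_net \<epsilon>))"
proof -
  obtain K where K: "compact K" "\<And>\<epsilon>. \<epsilon> \<in> {0<..1} \<Longrightarrow> u_net \<epsilon> \<in> test_on K" "net_moderate u_net"
    using is_crep_c_test[OF u] by blast
  obtain j N :: nat where jN: "\<And>w b. (\<forall>\<epsilon>\<in>{0<..1}. w \<epsilon> \<in> test_on K) \<Longrightarrow>
    O_eps b (\<lambda>\<epsilon>. seminorm_C K j (w \<epsilon>)) \<Longrightarrow> O_eps (b - real N) (\<lambda>\<epsilon>. norm (E \<epsilon> (w \<epsilon>)))"
    using basic_net_estimate[OF E K(1)] by blast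
  obtain M :: nat where "O_eps (- real M) (\<lambda>\<epsilon>. seminorm_C K j (u_net \<epsilon>))" using moderate_seminorm[OF K(1,3)] by blast
  then have "O_eps (- real M - real N) (\<lambda>\<epsilon>. norm (E \<epsilon> (u_net \<epsilon>)))" using K(2) by (intro jN) auto
  also have "- real M - real N = - real (M + N)" by simp
  finally show ?thesis unfolding moderate_def by blast
qed

lemma basic_net_negl:
  assumes E: "basic_net E" and u: "is_crep_c u1 u" "is_crep_c u2 u"
  shows "negl (\<lambda>\<epsilon>. E \<epsilon> (u1 \<epsilon>) - E \<epsilon> (u2 \<epsilon>))"
  unfolding negl_def
proof
  fix q :: nat
  obtain K1 where K1: "compact K1" "\<And>\<epsilon>. \<epsilon> \<in> {0<..1} \<Longrightarrow> u1 \<epsilon> \<in> test_on K1" "net_moderate u1"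
    using is_crep_c_test[OF u(1)] by blast
  obtain K2 where K2: "compact K2" "\<And>\<epsilon>. \<epsilon> \<in> {0<..1} \<Longrightarrow> u2 \<epsilon> \<in> test_on K2" "net_moderate u2"
    using is_crep_c_test[OF u(2)] by blast
  have K: "compact (K1 \<union> K2)" using K1 K2 by blast
  let ?w = "\<lambda>\<epsilon> x. u1 \<epsilon> x - u2 \<epsilon> x"
  have s: "net_smooth ?w" by (intro net_smooth_diff net_moderate_smooth K1 K2)
  have w: "\<forall>\<epsilon>\<in>{0<..1}. ?w \<epsilon> \<in> test_on (K1 \<union> K2)"
    using K1(2) K2(2) net_smoothD[OF s] unfolding test_on_def by auto
  have n: "net_negl_on UNIV ?w"
    using u abs_colombeau_eq_iff[OF K1(3) K2(3)] unfolding is_crep_c_def is_crep_def by simp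
  obtain j N :: nat where jN: "\<And>w b. (\<forall>\<epsilon>\<in>{0<..1}. w \<epsilon> \<in> test_on (K1 \<union> K2)) \<Longrightarrow>
    O_eps b (\<lambda>\<epsilon>. seminorm_C (K1 \<union> K2) j (w \<epsilon>)) \<Longrightarrow> O_eps (b - real N) (\<lambda>\<epsilon>. norm (E \<epsilon> (w \<epsilon>)))"
    using basic_net_estimate[OF E K] by blast
  have "O_eps (real (q + N) - real N) (\<lambda>\<epsilon>. norm (E \<epsilon> (?w \<epsilon>)))"
    by (rule jN[OF w negl_seminorm[OF s n K]]) simp
  then have "O_eps (real q) (\<lambda>\<epsilon>. norm (E \<epsilon> (?w \<epsilon>)))" by simp
  then show "O_eps (real q) (\<lambda>\<epsilon>. norm (E \<epsilon> (u1 \<epsilon>) - E \<epsilon> (u2 \<epsilon>)))"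
  proof (rule O_eps_le_unit)
    fix \<epsilon> :: real assume e: "\<epsilon> \<in> {0<..1}"
    have t: "u1 \<epsilon> \<in> test_funs" "u2 \<epsilon> \<in> test_funs" using test_on_test_funs K1 K2 e by blast+
    have m: "(\<lambda>x. (- 1) * u2 \<epsilon> x) \<in> test_funs"
      using K2(1) K2(2)[OF e] smooth_minus[of "u2 \<epsilon>"] unfolding test_funs_def test_on_def by auto
    have "E \<epsilon> (?w \<epsilon>) = E \<epsilon> (\<lambda>x. u1 \<epsilon> x + (- 1) * u2 \<epsilon> x)" by simp
    also have "\<dots> = E \<epsilon> (u1 \<epsilon>) + (- 1) * E \<epsilon> (u2 \<epsilon>)"
      unfolding basic_net_linear(1)[OF E e t(1) m] basic_net_linear(2)[OF E e t(2) t(2)] ..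
    finally show "\<bar>norm (E \<epsilon> (u1 \<epsilon>) - E \<epsilon> (u2 \<epsilon>))\<bar> \<le> norm (E \<epsilon> (?w \<epsilon>))" by simp
  qed
qed

text \<open>The chosen representative is immaterial by \<open>basic_net_negl\<close>;
  \<open>functional_of_rep\<close> allows any other. The form matches \<open>iota_d\<close>.\<close>

definition functional_of :: "(real \<Rightarrow> 'n::finite cfun \<Rightarrow> complex) \<Rightarrow> 'n colombeau \<Rightarrow> complex gen" where
  "functional_of E u = abs_gen (\<lambda>\<epsilon>. E \<epsilon> ((SOME u_net. is_crep_c u_net u) \<epsilon>))"

lemma functional_of_rep:
  assumes E: "basic_net E" and u: "is_crep_c u_net u"
  shows "is_rep (\<lambda>\<epsilon>. E \<epsilon> (u_net \<epsilon>)) (functional_of E u)"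
proof -
  have s: "is_crep_c (SOME u_net. is_crep_c u_net u) u" by (rule someI[of "\<lambda>u_net. is_crep_c u_net u", OF u])
  show ?thesis unfolding is_rep_def functional_of_def
    using basic_net_moderate[OF E u] basic_net_moderate[OF E s] basic_net_negl[OF E u s] by (simp add: abs_gen_eq_iff)
qed

lemma functional_of_given_by: "basic_net E \<Longrightarrow> given_by (functional_of E) E"
  unfolding given_by_def using functional_of_rep by blast

lemma is_rep_unique: "is_rep r a \<Longrightarrow> is_rep r b \<Longrightarrow> a = b"
  by (simp add: is_rep_def)

lemma functional_of_add:
  assumes E: "basic_net E" and u: "u \<in> Gc" "v \<in> Gc"
  shows "functional_of E (u + v) = functional_of E u + functional_of E v"
proof -
  obtain u1 v1 where 1: "is_crep_c u1 u" "is_crep_c v1 v" using u unfolding Gc_iff_crep_c by blast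
  have "is_rep (\<lambda>\<epsilon>. E \<epsilon> (u1 \<epsilon>) + E \<epsilon> (v1 \<epsilon>)) (functional_of E (u + v))"
  proof (rule is_rep_cong_unit[OF functional_of_rep[OF E is_crep_c_add[OF 1]]])
    fix \<epsilon> :: real assume e: "\<epsilon> \<in> {0<..1}"
    have "u1 \<epsilon> \<in> test_funs" "v1 \<epsilon> \<in> test_funs"
      using is_crep_c_test[OF 1(1)] is_crep_c_test[OF 1(2)] e test_on_test_funs by metis+
    then show "E \<epsilon> (\<lambda>x. u1 \<epsilon> x + v1 \<epsilon> x) = E \<epsilon> (u1 \<epsilon>) + E \<epsilon> (v1 \<epsilon>)"
      by (rule basic_net_linear(1)[OF E e])
  qed
  then show ?thesis
    by (rule is_rep_unique) (intro is_rep_add functional_of_rep E 1)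
qed

lemma functional_of_scale:
  assumes E: "basic_net E" and u: "u \<in> Gc"
  shows "functional_of E (r *\<^sub>G u) = r * functional_of E u"
proof -
  obtain u1 where 1: "is_crep_c u1 u" using u unfolding Gc_iff_crep_c by blast
  have "is_rep (\<lambda>\<epsilon>. rep_gen r \<epsilon> * E \<epsilon> (u1 \<epsilon>)) (functional_of E (r *\<^sub>G u))"
  proof (rule is_rep_cong_unit[OF functional_of_rep[OF E is_crep_c_scale[OF is_rep_rep_gen 1]]])
    fix \<epsilon> :: real assume e: "\<epsilon> \<in> {0<..1}"
    have t: "u1 \<epsilon> \<in> test_funs"
      using is_crep_c_test[OF 1] e test_on_test_funs by metis
    show "E \<epsilon> (\<lambda>x. rep_gen r \<epsilon> * u1 \<epsilon> x) = rep_gen r \<epsilon> * E \<epsilon> (u1 \<epsilon>)"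
      by (rule basic_net_linear(2)[OF E e t t])
  qed
  then show ?thesis
    by (rule is_rep_unique) (intro is_rep_mult functional_of_rep E 1 is_rep_rep_gen)
qed

text \<open>Preimages of balls are closed under addition and small scalars because the norm on
  generalized numbers is an ultrametric one. On functions supported in K a single seminorm then
  suffices.\<close>

lemma functional_of_nbhd0:
  assumes E: "basic_net E" and r: "r > 0"
  shows "Gc_nbhd0 {u \<in> Gc. gen_norm (functional_of E u) < r}" (is "Gc_nbhd0 ?U")
  unfolding Gc_nbhd0_def
proof (intro conjI ballI allI impI)
  show "?U \<subseteq> Gc" by blast
  show "u + v \<in> ?U" if "u \<in> ?U" "v \<in> ?U" for u v
    using that gen_norm_add[of "functional_of E u" "functional_of E v"]
    by (auto simp: Gc_add functional_of_add[OF E])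
  show "s *\<^sub>G u \<in> ?U" if "u \<in> ?U" "gen_norm s \<le> 1" for s u
    using that gen_norm_mult_le[of s "functional_of E u"]
    by (auto simp: Gc_scale functional_of_scale[OF E])
  fix K :: "(real^'a) set" assume K: "compact K"
  have L: "compact (nbhd1 K)" by (rule compact_nbhd1[OF K])
  obtain j N :: nat where jN: "\<And>w b. (\<forall>\<epsilon>\<in>{0<..1}. w \<epsilon> \<in> test_on (nbhd1 K)) \<Longrightarrow>
    O_eps b (\<lambda>\<epsilon>. seminorm_C (nbhd1 K) j (w \<epsilon>)) \<Longrightarrow> O_eps (b - real N) (\<lambda>\<epsilon>. norm (E \<epsilon> (w \<epsilon>)))"
    using basic_net_estimate[OF E L] by blast
  \<comment> \<open>Losing N powers of \<epsilon> multiplies ultra-pseudo-norms by at most e^N,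
    hence the factor e^-N. The cap 1 excludes the valuation -\<infinity>, to which
    \<open>exp_neg\<close> assigns the value exp 0 = 1.\<close>
  define \<delta> where "\<delta> = min 1 (r * exp (- real N))"
  have \<delta>: "\<delta> > 0" unfolding \<delta>_def using r by simp
  have "gen_norm (functional_of E u) < r" if u: "u \<in> Gc_on K" "ultra_seminorm K j u < \<delta>" for u
  proof -
    obtain h where h: "smooth h" "is_crep_c (\<lambda>\<epsilon> x. h x * rep_colombeau u \<epsilon> x) u"
      "\<And>\<epsilon>. \<epsilon> \<in> {0<..1} \<Longrightarrow> (\<lambda>x. h x * rep_colombeau u \<epsilon> x) \<in> test_on (nbhd1 K)"
      using crep_c_in_nbhd1[OF K, of u] u(1) unfolding Gc_on_def by blast
    obtain C where C: "\<And>u. smooth u \<Longrightarrow> seminorm_C (nbhd1 K) j (\<lambda>x. h x * u x) \<le> C * seminorm_C (nbhd1 K) j u"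
      using seminorm_C_mult_bound[OF h(1) L, of j] by blast
    have s: "net_smooth (rep_colombeau u)" by (intro net_moderate_smooth rep_colombeau)
    have "exp_neg (val_C K j u) < \<delta>" using u(2) unfolding ultra_seminorm_def .
    \<comment> \<open>An exponent strictly below the valuation is needed, as the supremum need not
      be attained; strictness of the bound by \<delta> leaves room for it.\<close>
    then obtain b where b: "ereal b < val_C K j u" "exp (- b) < \<delta>"
    proof (cases "val_C K j u")
      case (real v)
      then have "exp (- v) < \<delta>" using \<open>exp_neg _ < \<delta>\<close> by (simp add: exp_neg_def)
      then have "- v < ln \<delta>" using \<delta> by (metis exp_less_cancel_iff exp_ln)
      then obtain b where "- v < - b" "- b < ln \<delta>" using dense by (metis minus_minus)
      then have "exp (- b) < \<delta>" using \<delta> by (metis exp_less_cancel_iff exp_ln)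
      then show ?thesis using that[of b] real \<open>- v < - b\<close> by simp
    next
      case PInf
      have "exp (- (1 - ln \<delta>)) = exp (- 1) * \<delta>" using \<delta> by (simp add: exp_diff exp_minus field_simps)
      also have "\<dots> < 1 * \<delta>" using \<delta> by (intro mult_strict_right_mono) simp_all
      finally have "exp (- (1 - ln \<delta>)) < \<delta>" by simp
      then show ?thesis using that[of "1 - ln \<delta>"] PInf by simp
    next
      case MInf
      then have "1 < \<delta>" using \<open>exp_neg _ < \<delta>\<close> by (simp add: exp_neg_def)
      then show ?thesis unfolding \<delta>_def by simp
    qed
    have "O_eps b (\<lambda>\<epsilon>. seminorm_C (nbhd1 K) j (rep_colombeau u \<epsilon>))"
      using b(1) unfolding val_C_def by (rule O_eps_less_valuation)
    then have "O_eps b (\<lambda>\<epsilon>. seminorm_C (nbhd1 K) j (\<lambda>x. h x * rep_colombeau u \<epsilon> x))"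
    proof (rule O_eps_le_unit[OF O_eps_cmult])
      fix \<epsilon> :: real assume e: "\<epsilon> \<in> {0<..1}"
      show "\<bar>seminorm_C (nbhd1 K) j (\<lambda>x. h x * rep_colombeau u \<epsilon> x)\<bar> \<le> C * seminorm_C (nbhd1 K) j (rep_colombeau u \<epsilon>)"
        using C[OF net_smoothD[OF s e]] seminorm_C_nonneg[OF L smooth_mult[OF h(1) net_smoothD[OF s e]], of j] by linarith
    qed
    then have "O_eps (b - real N) (\<lambda>\<epsilon>. norm (E \<epsilon> (\<lambda>x. h x * rep_colombeau u \<epsilon> x)))"
      using h(3) by (intro jN) auto
    then have "ereal (b - real N) \<le> gen_val (functional_of E u)"
      unfolding gen_val_rep[OF functional_of_rep[OF E h(2)]] by (rule valuation_ge)
    then have "gen_norm (functional_of E u) \<le> exp_neg (ereal (b - real N))"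
      unfolding gen_norm_def by (rule exp_neg_antimono) simp
    also have "\<dots> = exp (- b) * exp (real N)" unfolding exp_neg_def by (simp add: exp_add[symmetric])
    also have "\<dots> < \<delta> * exp (real N)" using b(2) by simp
    also have "\<dots> \<le> (r * exp (- real N)) * exp (real N)" unfolding \<delta>_def by (intro mult_right_mono) auto
    also have "\<dots> = r" by (simp add: exp_minus)
    finally show ?thesis .
  qed
  then show "\<exists>J \<delta>. finite J \<and> \<delta> > 0 \<and> {u \<in> Gc_on K. \<forall>j\<in>J. ultra_seminorm K j u < \<delta>} \<subseteq> ?U"
    using \<delta> by (intro exI[of _ "{j}"] exI[of _ \<delta>]) (auto simp: Gc_on_def)
qed

lemma functional_of_LGc:
  assumes E: "basic_net E"
  shows "functional_of E \<in> LGc"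
proof -
  interpret M: Metric_space UNIV "\<lambda>r s :: complex gen. gen_norm (r - s)" by (rule Metric_space_gen)
  have top: "topspace gen_topology = (UNIV :: complex gen set)" unfolding gen_topology_def by simp
  have "continuous_map Gc_topology gen_topology (functional_of E)"
    unfolding continuous_map_def topspace_Gc top
  proof (intro conjI allI impI)
    fix U :: "complex gen set" assume U: "openin gen_topology U"
    show "openin Gc_topology {x \<in> Gc. functional_of E x \<in> U}"
      unfolding openin_Gc Gc_open_def
    proof (intro conjI ballI)
      fix u assume u: "u \<in> {x \<in> Gc. functional_of E x \<in> U}"
      then obtain r where r: "r > 0" "M.mball (functional_of E u) r \<subseteq> U"
        using U unfolding gen_topology_def M.openin_mtopology by blast
      show "\<exists>W. Gc_nbhd0 W \<and> (+) u ` W \<subseteq> {x \<in> Gc. functional_of E x \<in> U}"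
      proof (intro exI conjI)
        show "Gc_nbhd0 {v \<in> Gc. gen_norm (functional_of E v) < r}" by (rule functional_of_nbhd0[OF E r(1)])
        show "(+) u ` {v \<in> Gc. gen_norm (functional_of E v) < r} \<subseteq> {x \<in> Gc. functional_of E x \<in> U}"
        proof (rule image_subsetI)
          fix v assume v: "v \<in> {v \<in> Gc. gen_norm (functional_of E v) < r}"
          have "gen_norm (functional_of E u - functional_of E (u + v)) = gen_norm (functional_of E v)"
            using u v by (simp add: functional_of_add[OF E] gen_norm_def gen_val_minus)
          then have "functional_of E (u + v) \<in> M.mball (functional_of E u) r" using v by simp
          then show "u + v \<in> {x \<in> Gc. functional_of E x \<in> U}" using r(2) u v Gc_add by auto
        qed
      qed
    qed auto
  qed auto
  then show ?thesis
    unfolding LGc_def using functional_of_add[OF E] functional_of_scale[OF E] by blast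
qed

text \<open>This ties the operator with generalized coefficients to the classical operators for a
  prescribed representative p, so that each P_\<epsilon> can be treated on its own.\<close>

lemma is_crep_c_transpose:
  fixes c :: "('n::finite \<Rightarrow> nat) \<Rightarrow> complex gen"
  assumes p: "poly_rep m p c" and u: "is_crep_c u_net u"
  shows "is_crep_c (\<lambda>\<epsilon>. transpose_symbol m (p \<epsilon>) (u_net \<epsilon>)) (transpose_op m c u)"
proof -
  obtain K where K: "compact K" "\<And>\<epsilon> x. \<epsilon> \<in> {0<..1} \<Longrightarrow> x \<notin> K \<Longrightarrow> u_net \<epsilon> x = 0" and r: "is_crep u_net u"
    using u unfolding is_crep_c_def by blast
  have "is_crep (\<lambda>\<epsilon> x. \<Sum>\<alpha> | mi_deg \<alpha> \<le> m. ((- 1) ^ mi_deg \<alpha> * p \<epsilon> \<alpha>) * ((- \<i>) ^ mi_deg \<alpha> * pd \<alpha> (u_net \<epsilon>) x)) (transpose_op m c u)"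
    unfolding transpose_op_def gD_def
  proof (rule is_crep_sum[OF finite_mi])
    fix \<alpha> :: "'n \<Rightarrow> nat" assume "\<alpha> \<in> {\<alpha>. mi_deg \<alpha> \<le> m}"
    then have "is_rep (\<lambda>\<epsilon>. p \<epsilon> \<alpha>) (c \<alpha>)" using p unfolding poly_rep_def by simp
    then show "is_crep (\<lambda>\<epsilon> x. ((- 1) ^ mi_deg \<alpha> * p \<epsilon> \<alpha>) * ((- \<i>) ^ mi_deg \<alpha> * pd \<alpha> (u_net \<epsilon>) x))
      (((- 1) ^ mi_deg \<alpha> * c \<alpha>) *\<^sub>G gen_const ((- \<i>) ^ mi_deg \<alpha>) *\<^sub>G gpd \<alpha> u)"
      by (intro is_crep_scale is_rep_mult is_rep_minus_one_power is_rep_const is_crep_pd r)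
  qed
  also have "(\<lambda>\<epsilon> x. \<Sum>\<alpha> | mi_deg \<alpha> \<le> m. ((- 1) ^ mi_deg \<alpha> * p \<epsilon> \<alpha>) * ((- \<i>) ^ mi_deg \<alpha> * pd \<alpha> (u_net \<epsilon>) x)) =
      (\<lambda>\<epsilon>. transpose_symbol m (p \<epsilon>) (u_net \<epsilon>))"
    by (simp add: transpose_symbol_def mult.assoc)
  finally have "is_crep (\<lambda>\<epsilon>. transpose_symbol m (p \<epsilon>) (u_net \<epsilon>)) (transpose_op m c u)" .
  moreover have "transpose_symbol m (p \<epsilon>) (u_net \<epsilon>) x = 0" if "\<epsilon> \<in> {0<..1}" "x \<notin> K" for \<epsilon> x
  proof -
    have "pd \<alpha> (u_net \<epsilon>) x = 0" for \<alpha>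
      by (rule pd_zero_open[of "- K"]) (use K that in \<open>auto simp: compact_imp_closed open_Compl\<close>)
    then show ?thesis by (simp add: transpose_symbol_def)
  qed
  ultimately show ?thesis unfolding is_crep_c_def using K(1) by blast
qed

section \<open>Lower bounds for the weight from invertibility\<close>

lemma moderate_sum: "(\<And>i. i \<in> I \<Longrightarrow> moderate (r i)) \<Longrightarrow> moderate (\<lambda>\<epsilon>. \<Sum>i\<in>I. r i \<epsilon>)"
  by (induction I rule: infinite_finite_induct) (auto intro: moderate_add)

lemma moderate_norm: "moderate (\<lambda>\<epsilon>. norm (r \<epsilon>)) \<longleftrightarrow> moderate r"
  by (simp add: moderate_def)

lemma moderate_le_unit:
  assumes "moderate s" "\<And>\<epsilon>. \<epsilon> \<in> {0<..1} \<Longrightarrow> norm (r \<epsilon>) \<le> norm (s \<epsilon>)"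
  shows "moderate r"
proof -
  obtain N :: nat where "O_eps (- real N) (\<lambda>\<epsilon>. norm (s \<epsilon>))" using assms(1) unfolding moderate_def by blast
  then have "O_eps (- real N) (\<lambda>\<epsilon>. norm (r \<epsilon>))"
    by (rule O_eps_le_unit) (simp add: assms(2))
  then show ?thesis unfolding moderate_def by blast
qed

lemma tilde_moderate:
  assumes "\<And>\<alpha>. mi_deg \<alpha> \<le> m \<Longrightarrow> moderate (\<lambda>\<epsilon>. q \<epsilon> \<alpha>)"
  shows "moderate (\<lambda>\<epsilon>. tilde m (q \<epsilon>) x)"
proof -
  obtain C where C: "C \<ge> 0" "\<And>p q. \<bar>tilde m p x - tilde m q x\<bar> \<le> C * (\<Sum>\<alpha> | mi_deg \<alpha> \<le> m. norm (p \<alpha> - q \<alpha>))"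
    using tilde_diff_bound[of m x] by blast
  have "tilde m (\<lambda>_. 0) x = 0" by (simp add: tilde_def symbol_def[abs_def])
  then have le: "tilde m (q \<epsilon>) x \<le> C * (\<Sum>\<alpha> | mi_deg \<alpha> \<le> m. norm (q \<epsilon> \<alpha>))" for \<epsilon>
    using C(2)[of "q \<epsilon>" "\<lambda>_. 0"] by simp
  have "moderate (\<lambda>\<epsilon>. C * (\<Sum>\<alpha> | mi_deg \<alpha> \<le> m. norm (q \<epsilon> \<alpha>)))"
    by (intro moderate_mult moderate_const moderate_sum) (simp add: moderate_norm assms)
  then show ?thesis
  proof (rule moderate_le_unit)
    fix \<epsilon> :: real
    show "norm (tilde m (q \<epsilon>) x) \<le> norm (C * (\<Sum>\<alpha> | mi_deg \<alpha> \<le> m. norm (q \<epsilon> \<alpha>)))"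
      using le[of \<epsilon>] tilde_nonneg[of m "q \<epsilon>" x] unfolding real_norm_def by linarith
  qed
qed

text \<open>An inverse y is moderate, say of order \<epsilon>^-N, and the product of weight and y is
  1 up to a negligible error; hence the weight is at least a multiple of \<epsilon>^N. This holds
  first for the representative q behind \<open>gtilde\<close> and passes to p by the Lipschitz
  estimate.\<close>

lemma tilde_lower_bound:
  fixes c :: "('n::finite \<Rightarrow> nat) \<Rightarrow> complex gen"
  assumes inv: "gtilde m c \<xi> dvd 1" and p: "poly_rep m p c"
  shows "\<exists>(N::nat) C. C > 0 \<and> eventually (\<lambda>\<epsilon>. C * \<epsilon> powr real N \<le> tilde m (p \<epsilon>) \<xi>) (at_right 0)"
proof -
  define q where "q \<epsilon> \<alpha> = rep_gen (c \<alpha>) \<epsilon>" for \<epsilon> \<alpha>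
  obtain y where y: "1 = gtilde m c \<xi> * y" using inv by (rule dvdE)
  have mt: "moderate (\<lambda>\<epsilon>. tilde m (q \<epsilon>) \<xi>)"
    by (rule tilde_moderate) (use rep_gen in \<open>simp add: q_def\<close>)
  then have "is_rep (\<lambda>\<epsilon>. tilde m (q \<epsilon>) \<xi>) (gtilde m c \<xi>)"
    unfolding is_rep_def gtilde_def q_def by simp
  from is_rep_mult[OF this is_rep_rep_gen[of y]]
  have "is_rep (\<lambda>\<epsilon>. tilde m (q \<epsilon>) \<xi> * rep_gen y \<epsilon>) 1" unfolding y .
  then have "negl (\<lambda>\<epsilon>. tilde m (q \<epsilon>) \<xi> * rep_gen y \<epsilon> - 1)"
    using abs_gen_eq_iff[of "\<lambda>\<epsilon>. tilde m (q \<epsilon>) \<xi> * rep_gen y \<epsilon>" "\<lambda>_. 1"] unfolding is_rep_def by (simp add: one_gen_def)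
  then have "O_eps (real 1) (\<lambda>\<epsilon>. norm (tilde m (q \<epsilon>) \<xi> * rep_gen y \<epsilon> - 1))" unfolding negl_def by blast
  then obtain A where A: "A > 0" "eventually (\<lambda>\<epsilon>. norm (norm (tilde m (q \<epsilon>) \<xi> * rep_gen y \<epsilon> - 1)) \<le> A * norm (\<epsilon> powr real 1)) (at_right 0)"
    by (elim landau_o.bigE)
  obtain N :: nat where "O_eps (- real N) (\<lambda>\<epsilon>. norm (rep_gen y \<epsilon>))" using rep_gen(1)[of y] unfolding moderate_def by blast
  then obtain B where B: "B > 0" "eventually (\<lambda>\<epsilon>. norm (norm (rep_gen y \<epsilon>)) \<le> B * norm (\<epsilon> powr (- real N))) (at_right 0)"
    by (elim landau_o.bigE)
  obtain C where C: "C \<ge> 0" "\<And>p q. \<bar>tilde m p \<xi> - tilde m q \<xi>\<bar> \<le> C * (\<Sum>\<alpha> | mi_deg \<alpha> \<le> m. norm (p \<alpha> - q \<alpha>))"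
    using tilde_diff_bound[of m \<xi>] by blast
  \<comment> \<open>One power more than the lower bound \<epsilon>^N, so that the error becomes
    small relative to it.\<close>
  have "O_eps (real (Suc N)) (\<lambda>\<epsilon>. C * (\<Sum>\<alpha> | mi_deg \<alpha> \<le> m. norm (q \<epsilon> \<alpha> - p \<epsilon> \<alpha>)))"
  proof (intro O_eps_cmult O_eps_sum)
    fix \<alpha> :: "'n \<Rightarrow> nat" assume "\<alpha> \<in> {\<alpha>. mi_deg \<alpha> \<le> m}"
    then have "is_rep (\<lambda>\<epsilon>. p \<epsilon> \<alpha>) (c \<alpha>)" using p unfolding poly_rep_def by simp
    then have "negl (\<lambda>\<epsilon>. q \<epsilon> \<alpha> - p \<epsilon> \<alpha>)"
      unfolding q_def is_rep_def using abs_gen_eq_iff[OF rep_gen(1)] rep_gen(2) by metis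
    then show "O_eps (real (Suc N)) (\<lambda>\<epsilon>. norm (q \<epsilon> \<alpha> - p \<epsilon> \<alpha>))" unfolding negl_def by blast
  qed
  then obtain D where D: "D > 0" "eventually (\<lambda>\<epsilon>. norm (C * (\<Sum>\<alpha> | mi_deg \<alpha> \<le> m. norm (q \<epsilon> \<alpha> - p \<epsilon> \<alpha>))) \<le> D * norm (\<epsilon> powr real (Suc N))) (at_right 0)"
    by (elim landau_o.bigE)
  \<comment> \<open>Below 1/(2A) the product with y is at least 1/2, so the weight of q is at least
    \<epsilon>^N / (2B). Below 1/(4BD) passing to p costs at most half of this.\<close>
  have small: "eventually (\<lambda>\<epsilon>::real. \<epsilon> \<in> {0<..<min (1 / (2 * A)) (1 / (4 * B * D))}) (at_right 0)"
    by (rule eventually_at_right_real) (use A B D in simp)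
  have "eventually (\<lambda>\<epsilon>. 1 / (4 * B) * \<epsilon> powr real N \<le> tilde m (p \<epsilon>) \<xi>) (at_right 0)"
    using A(2) B(2) D(2) small
  proof eventually_elim
    case (elim \<epsilon>)
    have e: "\<epsilon> > 0" "\<epsilon> < 1 / (2 * A)" "\<epsilon> < 1 / (4 * B * D)" using elim(4) by auto
    let ?t = "tilde m (q \<epsilon>) \<xi>" and ?y = "rep_gen y \<epsilon>"
    have "A * \<epsilon> < 1 / 2" using e A(1) by (simp add: field_simps)
    moreover have "\<bar>?t * ?y - 1\<bar> \<le> A * \<epsilon>" using elim(1) e by simp
    ultimately have "1 / 2 \<le> ?t * ?y" by linarith
    also have "\<dots> \<le> ?t * \<bar>?y\<bar>" by (intro mult_left_mono tilde_nonneg) auto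
    also have "\<dots> \<le> ?t * (B * \<epsilon> powr (- real N))" using elim(2) by (intro mult_left_mono tilde_nonneg) simp
    finally have "1 / 2 * \<epsilon> powr real N \<le> ?t * (B * \<epsilon> powr (- real N)) * \<epsilon> powr real N" by (intro mult_right_mono) auto
    also have "\<dots> = ?t * B" using e by (simp add: powr_minus)
    finally have 1: "1 / (2 * B) * \<epsilon> powr real N \<le> ?t" using B(1) by (simp add: field_simps)
    have "\<epsilon> powr real (Suc N) = \<epsilon> * \<epsilon> powr real N" using e by (simp add: powr_add)
    then have "\<bar>?t - tilde m (p \<epsilon>) \<xi>\<bar> \<le> D * (\<epsilon> * \<epsilon> powr real N)"
      using elim(3) C(2)[of "q \<epsilon>" "p \<epsilon>"] e(1) abs_ge_self[of "C * (\<Sum>\<alpha> | mi_deg \<alpha> \<le> m. norm (q \<epsilon> \<alpha> - p \<epsilon> \<alpha>))"]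
      by (simp add: abs_mult)
    also have "\<dots> = (D * \<epsilon>) * \<epsilon> powr real N" by simp
    also have "\<dots> \<le> (1 / (4 * B)) * \<epsilon> powr real N"
      using e B(1) D(1) by (intro mult_right_mono) (simp_all add: field_simps)
    finally have "?t - 1 / (4 * B) * \<epsilon> powr real N \<le> tilde m (p \<epsilon>) \<xi>" by linarith
    moreover have "1 / (2 * B) * \<epsilon> powr real N = 1 / (4 * B) * \<epsilon> powr real N + 1 / (4 * B) * \<epsilon> powr real N"
      using B(1) by (simp add: field_simps)
    ultimately show ?case using 1 by linarith
  qed
  then show ?thesis using B(1) by (intro exI[of _ N] exI[of _ "1 / (4 * B)"]) simp
qed

text \<open>The kernel estimates are normalized at the origin. Slow variation moves the bound there
  at the price of a constant depending on \<xi>.\<close>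

lemma tilde_lower_bound_0:
  fixes c :: "('n::finite \<Rightarrow> nat) \<Rightarrow> complex gen"
  assumes "gtilde m c \<xi> dvd 1" "poly_rep m p c"
  shows "\<exists>(N::nat) C \<eta>. C > 0 \<and> \<eta> \<in> {0<..1} \<and> (\<forall>\<epsilon>\<in>{0<..\<eta>}. C * \<epsilon> powr real N \<le> tilde m (p \<epsilon>) 0)"
proof -
  obtain N :: nat and C where C: "C > 0" "eventually (\<lambda>\<epsilon>. C * \<epsilon> powr real N \<le> tilde m (p \<epsilon>) \<xi>) (at_right 0)"
    using tilde_lower_bound[OF assms] by blast
  obtain G where G: "G > 0" "\<And>(p :: ('n \<Rightarrow> nat) \<Rightarrow> complex) x y. tilde m p (x + y) \<le> G * (1 + norm y) ^ m * tilde m p x"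
    using tilde_growth[of m, where 'n = 'n] by blast
  define F where "F = G * (1 + norm \<xi>) ^ m"
  have F: "F > 0" unfolding F_def using G(1) by (intro mult_pos_pos zero_less_power add_pos_nonneg) auto
  obtain b where b: "b > 0" "\<And>\<epsilon>. 0 < \<epsilon> \<Longrightarrow> \<epsilon> < b \<Longrightarrow> C * \<epsilon> powr real N \<le> tilde m (p \<epsilon>) \<xi>"
    using C(2) unfolding eventually_at_right[of 0 1, OF zero_less_one] by auto
  show ?thesis
  \<comment> \<open>Half of b, since the bound is known strictly below b whereas the interval for
    \<epsilon> includes its right end.\<close>
  proof (rule exI[of _ N], rule exI[of _ "C / F"], rule exI[of _ "min 1 (b / 2)"], intro conjI ballI)
    show "C / F > 0" using C F by simp
    show "min 1 (b / 2) \<in> {0<..1}" using b(1) by simp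
    fix \<epsilon> assume e: "\<epsilon> \<in> {0<..min 1 (b / 2)}"
    have "C * \<epsilon> powr real N \<le> tilde m (p \<epsilon>) \<xi>" using e b(1) by (intro b(2)) auto
    also have "\<dots> \<le> F * tilde m (p \<epsilon>) 0" unfolding F_def using G(2)[of "p \<epsilon>" 0 \<xi>] by simp
    finally show "C / F * \<epsilon> powr real N \<le> tilde m (p \<epsilon>) 0" using F by (simp add: field_simps)
  qed
qed

section \<open>Assembly of the fundamental solution from the kernels for each \<epsilon>\<close>

theorem theorem2p3:
  fixes m :: nat
  shows
    "(\<forall>c :: ('n::finite \<Rightarrow> nat) \<Rightarrow> complex gen.
        (\<exists>\<xi>0. gtilde m c \<xi>0 dvd 1) \<longrightarrow>
        (\<exists>E\<in>LGc_basic. fundamental_solution m c E)) \<and>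
     (\<forall>a::real. a > 0 \<longrightarrow> (\<exists>C0::real.
        \<forall>c :: ('n \<Rightarrow> nat) \<Rightarrow> complex gen.
          (\<exists>\<xi>0. gtilde m c \<xi>0 dvd 1) \<longrightarrow>
          (\<forall>p. poly_rep m p c \<longrightarrow>
            (\<exists>E E_net. fundamental_solution m c E \<and> given_by E E_net \<and>
               (\<forall>\<epsilon>\<in>{0<..1}. \<exists>w \<in> B_space \<infinity> (tilde m (p \<epsilon>)).
                  extends_dist w (mult_dist (\<lambda>x. 1 / cosh (a * norm x)) (E_net \<epsilon>)) \<and>
                  B_norm \<infinity> (tilde m (p \<epsilon>)) w \<le> ennreal C0)))))"
proof -
  let ?k = "m + 2 * CARD('n)"
  have part2: "\<exists>C0::real.
        \<forall>c :: ('n \<Rightarrow> nat) \<Rightarrow> complex gen.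
          (\<exists>\<xi>0. gtilde m c \<xi>0 dvd 1) \<longrightarrow>
          (\<forall>p. poly_rep m p c \<longrightarrow>
            (\<exists>E E_net. fundamental_solution m c E \<and> given_by E E_net \<and>
               (\<forall>\<epsilon>\<in>{0<..1}. \<exists>w \<in> B_space \<infinity> (tilde m (p \<epsilon>)).
                  extends_dist w (mult_dist (\<lambda>x. 1 / cosh (a * norm x)) (E_net \<epsilon>)) \<and>
                  B_norm \<infinity> (tilde m (p \<epsilon>)) w \<le> ennreal C0)))" if a: "a > 0" for a :: real
  proof -
    obtain C0 and CK :: "(real^'n) set \<Rightarrow> real" where "\<forall>p. \<exists>E w.
      linear_on_funs test_funs E \<and>
      (\<forall>K f. compact K \<longrightarrow> f \<in> test_on K \<longrightarrow> norm (E f) \<le> CK K / tilde m p 0 * seminorm_C K ?k f) \<and>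
      (tilde m p 0 > 0 \<longrightarrow> (\<forall>f\<in>test_funs. E (transpose_symbol m p f) = f 0)) \<and>
      w \<in> B_space \<infinity> (tilde m p) \<and> extends_dist w (mult_dist (\<lambda>x. 1 / cosh (a * norm x)) E) \<and>
      B_norm \<infinity> (tilde m p) w \<le> ennreal C0"
      using uniform_fundamental_kernel[OF a, of m, where 'n = 'n] by blast
    then obtain F W where F: "\<And>p. linear_on_funs test_funs (F p)"
      "\<And>p K f. compact K \<Longrightarrow> f \<in> test_on K \<Longrightarrow> norm (F p f) \<le> CK K / tilde m p 0 * seminorm_C K ?k f"
      "\<And>p f. tilde m p 0 > 0 \<Longrightarrow> f \<in> test_funs \<Longrightarrow> F p (transpose_symbol m p f) = f 0"
      "\<And>p. W p \<in> B_space \<infinity> (tilde m p)"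
      "\<And>p. extends_dist (W p) (mult_dist (\<lambda>x. 1 / cosh (a * norm x)) (F p))"
      "\<And>p. B_norm \<infinity> (tilde m p) (W p) \<le> ennreal C0"
      by metis
    show ?thesis
    proof (intro exI[of _ C0] allI impI)
      fix c :: "('n \<Rightarrow> nat) \<Rightarrow> complex gen" and p
      assume "\<exists>\<xi>0. gtilde m c \<xi>0 dvd 1" and p: "poly_rep m p c"
      then obtain N :: nat and C \<eta> where C: "C > 0" "\<eta> \<in> {0<..1}"
        "\<And>\<epsilon>. \<epsilon> \<in> {0<..\<eta>} \<Longrightarrow> C * \<epsilon> powr real N \<le> tilde m (p \<epsilon>) 0"
        using tilde_lower_bound_0[OF _ p] by blast
      define En where "En \<epsilon> = F (p \<epsilon>)" for \<epsilon>
      have basic: "basic_net En"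
        unfolding basic_net_def
      proof (intro conjI ballI allI impI)
        show "distribution (En \<epsilon>)" for \<epsilon>
          unfolding distribution_def En_def using F(1,2) by blast
        fix K :: "(real^'n) set" assume K: "compact K"
        \<comment> \<open>The absolute value and the summand 1 make B positive, since the sign of
          \<open>CK K\<close> is not known.\<close>
        define B where "B = (\<bar>CK K\<bar> + 1) / C"
        have B: "B > 0" unfolding B_def using C(1) by (intro divide_pos_pos) auto
        have "norm (En \<epsilon> f) \<le> B * \<epsilon> powr (- real N) * seminorm_C K ?k f"
          if f: "f \<in> test_on K" and e: "\<epsilon> \<in> {0<..\<eta>}" for f \<epsilon>
        proof -
          have pos: "0 < C * \<epsilon> powr real N" using C(1) e by simp
          have "CK K / tilde m (p \<epsilon>) 0 \<le> (\<bar>CK K\<bar> + 1) / tilde m (p \<epsilon>) 0"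
            by (intro divide_right_mono tilde_nonneg) simp
          also have "\<dots> \<le> (\<bar>CK K\<bar> + 1) / (C * \<epsilon> powr real N)"
            using C(3)[OF e] pos by (intro divide_left_mono) auto
          also have "\<dots> = B * \<epsilon> powr (- real N)" unfolding B_def by (simp add: powr_minus field_simps)
          finally show ?thesis
            unfolding En_def
            by (intro order_trans[OF F(2)[OF K f]] mult_right_mono seminorm_C_nonneg K test_on_smooth[OF f])
        qed
        then show "\<exists>(j::nat) (N::nat) c \<eta>. c > 0 \<and> \<eta> \<in> {0<..1} \<and>
            (\<forall>f\<in>test_on K. \<forall>\<epsilon>\<in>{0<..\<eta>}. norm (En \<epsilon> f) \<le> c * \<epsilon> powr (- real N) * seminorm_C K j f)"
          using B C(2) by blast
      qed
      have "fundamental_solution m c (functional_of En)"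
        unfolding fundamental_solution_def
      proof (intro conjI ballI)
        show "functional_of En \<in> LGc" by (rule functional_of_LGc[OF basic])
        fix u :: "'n colombeau" assume "u \<in> Gc"
        then have "\<exists>u_net. is_crep_c u_net u" unfolding Gc_iff_crep_c .
        then have s: "is_crep_c (SOME u_net. is_crep_c u_net u) u" by (rule someI_ex)
        \<comment> \<open>This is the very representative that \<open>iota_d\<close> evaluates, so
          both sides are compared on the same net.\<close>
        define U where "U = (SOME u_net. is_crep_c u_net u)"
        have s: "is_crep_c U u" unfolding U_def by (rule s)
        obtain K where K: "compact K" "\<And>\<epsilon>. \<epsilon> \<in> {0<..1} \<Longrightarrow> U \<epsilon> \<in> test_on K"
          using is_crep_c_test[OF s] by blast
        \<comment> \<open>For \<epsilon> above \<eta> the polynomial may be 0, and the identity may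
          then fail. Equality for small \<epsilon> is enough, because the class of a net depends
          only on its germ at 0.\<close>
        have "is_rep (\<lambda>\<epsilon>. dirac (U \<epsilon>)) (functional_of En (transpose_op m c u))"
        proof (rule is_rep_cong_ev[OF functional_of_rep[OF basic is_crep_c_transpose[OF p s]]])
          have "eventually (\<lambda>\<epsilon>::real. \<epsilon> \<in> {0<..\<eta>}) (at_right 0)"
            by (rule eventually_at_rightI[of 0 \<eta>]) (use C(2) in auto)
          then show "eventually (\<lambda>\<epsilon>. En \<epsilon> (transpose_symbol m (p \<epsilon>) (U \<epsilon>)) = dirac (U \<epsilon>)) (at_right 0)"
          proof eventually_elim
            case (elim \<epsilon>)
            have "0 < C * \<epsilon> powr real N" using C(1) elim by simp
            then have "tilde m (p \<epsilon>) 0 > 0" using C(3)[OF elim] by linarith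
            moreover have "U \<epsilon> \<in> test_funs" using K(1) K(2)[of \<epsilon>] elim C(2) by (intro test_on_test_funs) auto
            ultimately show ?case unfolding En_def dirac_def by (rule F(3))
          qed
        qed
        then show "apply_op m c (functional_of En) u = iota_d dirac u"
          unfolding apply_op_def iota_d_def U_def[symmetric] is_rep_def by simp
      qed
      moreover have "\<exists>w \<in> B_space \<infinity> (tilde m (p \<epsilon>)).
          extends_dist w (mult_dist (\<lambda>x. 1 / cosh (a * norm x)) (En \<epsilon>)) \<and>
          B_norm \<infinity> (tilde m (p \<epsilon>)) w \<le> ennreal C0" for \<epsilon>
        unfolding En_def using F(4-6) by blast
      ultimately show "\<exists>E E_net. fundamental_solution m c E \<and> given_by E E_net \<and>
          (\<forall>\<epsilon>\<in>{0<..1}. \<exists>w \<in> B_space \<infinity> (tilde m (p \<epsilon>)).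
            extends_dist w (mult_dist (\<lambda>x. 1 / cosh (a * norm x)) (E_net \<epsilon>)) \<and>
            B_norm \<infinity> (tilde m (p \<epsilon>)) w \<le> ennreal C0)"
        using functional_of_given_by[OF basic] by blast
    qed
  qed
  have part1: "\<exists>E\<in>LGc_basic. fundamental_solution m c E"
    if c: "\<exists>\<xi>0. gtilde m c \<xi>0 dvd 1" for c :: "('n \<Rightarrow> nat) \<Rightarrow> complex gen"
  proof -
    \<comment> \<open>The first assertion is the second one for an arbitrary representative and the
      growth parameter 1.\<close>
    have "poly_rep m (\<lambda>\<epsilon> \<alpha>. rep_gen (c \<alpha>) \<epsilon>) c" unfolding poly_rep_def using is_rep_rep_gen by blast
    with c part2[of 1] obtain E E_net where "fundamental_solution m c E" "given_by E E_net" by (metis zero_less_one)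
    then show ?thesis unfolding LGc_basic_def fundamental_solution_def by blast
  qed
  show ?thesis using part1 part2 by blast
qed

end
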